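(* Consider $N\geq 1$ information streams sharing a single server, with strict priorities: stream $1$ has the highest priority, stream $2$ the next, and so on. Packets of each stream arrive according to independent Poisson processes, each of rate $\lambda>0$, and each packet's transmission (service) time is exponentially distributed with rate $\mu>0$, independently of everything else. The service discipline is as follows: (i) an arriving packet of a higher-priority stream preempts the packet of a lower-priority stream currently in service; the preempted packet is not discarded but is stored in a single-packet waiting room dedicated to its own stream, and its service is resumed once all higher-priority packets in the system have been served; (ii) each stream has a single buffer space, and a new arrival of a stream replaces that stream's packet waiting in its buffer; (iii) a new arrival of the stream whose packet is currently in service preempts that packet, which is discarded, and the new packet takes its place in service. For stream $k$, let $U_k(t)$ be the generation time-stamp of the most recent packet of stream $k$ delivered to its monitor by time $t$, let $\Delta_k(t)=t-U_k(t)$, and let the average age be $\overline{\Delta}_k=\lim_{\tau\to\infty}\frac{1}{\tau}\int_0^\tau\Delta_k(t)\,dt$. Fix a stream having exactly $i$ streams of higher priority above it, $0\leq i\leq N-1$ (i.e. stream $i+1$). Define $S=\sum_{m=0}^{i}\frac{\lambda^m\, i!}{\mu^m\,(i-m)!}$, and define the real numbers $a_0,\ldots,a_i$ by: if $i\geq1$, $a_i=\lambda+\mu$, $a_h=(i-h+1)\lambda+\mu-\frac{(i-h)\lambda\mu}{a_{h+1}}$ for $1\leq h\leq i-1$, and $a_0=(i+1)\lambda-\frac{i\lambda\mu}{a_1}$; if $i=0$, $a_0=\lambda$. Define $$\overline{v}_{00}=\frac{1}{\mu}+\sum_{j=0}^{i}\frac{\lambda^j\, i!}{(i-j)!\;S\;\prod_{h=0}^{j}a_h},$$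 and recursively, for $1\leq k\leq i$, $$\overline{v}_{k0}=\frac{(i-k+1)\lambda}{\mu}\,\overline{v}_{(k-1)0}+\sum_{j=k}^{i}\frac{\lambda^j\, i!}{\mu^{j+1}\,(i-j)!\;S}.$$ Then the average age of this stream is $$\overline{\Delta}^{WQ}_i=\overline{v}_{00}+\sum_{k=1}^{i}\overline{v}_{k0}.$$
   Context: "WQ" ("with queues") indicates the setting in which each stream has its own single-packet waiting room in which preempted packets are stored for later resumption, as described in the claim. The total average age of the system is $\sum_{i=0}^{N-1}\overline{\Delta}^{WQ}_i$. *)

theory Defs
  imports "HOL-Probability.Probability"
begin

text \<open>Sample-path model. Streams are indexed 0,...,N-1 (index k has exactly k streams of
higher priority; index 0 is the highest priority). T k n is the arrival (= generation) time of
the n-th packet of stream k, X k n its service requirement (work). Each stream holds at most one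
packet (in service or in its waiting room); a new arrival of a stream replaces that stream's
packet; the server always works (at unit rate) on the packet of the highest-priority stream that
holds a packet, with preempt-resume (accumulated work is kept).\<close>

definition arrival_time :: "(nat \<Rightarrow> nat \<Rightarrow> real) \<Rightarrow> nat \<Rightarrow> nat \<Rightarrow> real" where
  "arrival_time A k n = (\<Sum>m\<le>n. A k m)"

text \<open>B s: some higher-priority stream holds a packet at time s (server blocked for stream k).
Work received by packet n of stream k up to time t.\<close>
definition served :: "(real \<Rightarrow> bool) \<Rightarrow> (nat \<Rightarrow> nat \<Rightarrow> real) \<Rightarrow> nat \<Rightarrow> nat \<Rightarrow> real \<Rightarrow> real" where
  "served B T k n t = measure lborel ({T k n..t} \<inter> {s. \<not> B s})"

definition done_by :: "(real \<Rightarrow> bool) \<Rightarrow> (nat \<Rightarrow> nat \<Rightarrow> real) \<Rightarrow> (nat \<Rightarrow> nat \<Rightarrow> real)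
    \<Rightarrow> nat \<Rightarrow> nat \<Rightarrow> real \<Rightarrow> bool" where
  "done_by B T X k n t \<longleftrightarrow> T k n \<le> t \<and> t < T k (Suc n) \<and> served B T k n t \<ge> X k n"

definition holds_packet :: "(real \<Rightarrow> bool) \<Rightarrow> (nat \<Rightarrow> nat \<Rightarrow> real) \<Rightarrow> (nat \<Rightarrow> nat \<Rightarrow> real)
    \<Rightarrow> nat \<Rightarrow> real \<Rightarrow> bool" where
  "holds_packet B T X k s \<longleftrightarrow> (\<exists>n. T k n \<le> s \<and> s < T k (Suc n) \<and> \<not> done_by B T X k n s)"

primrec higher_busy :: "(nat \<Rightarrow> nat \<Rightarrow> real) \<Rightarrow> (nat \<Rightarrow> nat \<Rightarrow> real) \<Rightarrow> nat \<Rightarrow> real \<Rightarrow> bool" where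
  "higher_busy T X 0 = (\<lambda>s. False)"
| "higher_busy T X (Suc k) = (\<lambda>s. higher_busy T X k s \<or> holds_packet (higher_busy T X k) T X k s)"

definition delivered_by :: "(nat \<Rightarrow> nat \<Rightarrow> real) \<Rightarrow> (nat \<Rightarrow> nat \<Rightarrow> real) \<Rightarrow> nat \<Rightarrow> nat \<Rightarrow> real \<Rightarrow> bool" where
  "delivered_by A X k n t \<longleftrightarrow>
     (\<exists>t'\<le>t. done_by (higher_busy (arrival_time A) X k) (arrival_time A) X k n t')"

definition latest_stamp :: "(nat \<Rightarrow> nat \<Rightarrow> real) \<Rightarrow> (nat \<Rightarrow> nat \<Rightarrow> real) \<Rightarrow> nat \<Rightarrow> real \<Rightarrow> real" where
  "latest_stamp A X k t =
     (let D = {arrival_time A k n | n. delivered_by A X k n t} in if D = {} then 0 else Sup D)"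

definition age :: "(nat \<Rightarrow> nat \<Rightarrow> real) \<Rightarrow> (nat \<Rightarrow> nat \<Rightarrow> real) \<Rightarrow> nat \<Rightarrow> real \<Rightarrow> real" where
  "age A X k t = t - latest_stamp A X k t"

primrec aux_a :: "real \<Rightarrow> real \<Rightarrow> nat \<Rightarrow> real" where
  "aux_a lam mu 0 = lam + mu"
| "aux_a lam mu (Suc d) = (real d + 2) * lam + mu - (real d + 1) * lam * mu / aux_a lam mu d"

definition coef_a :: "real \<Rightarrow> real \<Rightarrow> nat \<Rightarrow> nat \<Rightarrow> real" where
  "coef_a lam mu i h =
     (if h = 0 then (if i = 0 then lam
                     else (real i + 1) * lam - real i * lam * mu / aux_a lam mu (i - 1))
      else aux_a lam mu (i - h))"

definition S_const :: "real \<Rightarrow> real \<Rightarrow> nat \<Rightarrow> real" where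
  "S_const lam mu i = (\<Sum>m=0..i. lam ^ m * fact i / (mu ^ m * fact (i - m)))"

primrec v_bar :: "real \<Rightarrow> real \<Rightarrow> nat \<Rightarrow> nat \<Rightarrow> real" where
  "v_bar lam mu i 0 = 1 / mu +
     (\<Sum>j=0..i. lam ^ j * fact i / (fact (i - j) * S_const lam mu i * (\<Prod>h=0..j. coef_a lam mu i h)))"
| "v_bar lam mu i (Suc k) = (real (i - k) * lam / mu) * v_bar lam mu i k +
     (\<Sum>j=Suc k..i. lam ^ j * fact i / (mu ^ (j + 1) * fact (i - j) * S_const lam mu i))"

definition avg_age_WQ :: "real \<Rightarrow> real \<Rightarrow> nat \<Rightarrow> real" where
  "avg_age_WQ lam mu i = v_bar lam mu i 0 + (\<Sum>k=1..i. v_bar lam mu i k)"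

end

(*
The proof is a time-average version of the stochastic-hybrid-systems argument. Let Q be the number of higher-priority
streams holding a packet, delta the age and x the time since the last arrival of the observed stream. For a function F of
(Q, delta, x), the increment of F along the sample path minus the time integral of the generator applied to F is a sum of
compensated jumps, one family for every arrival and every service clock. Revealing the exponential variables one after the
other makes the compensated jumps orthogonal, so their second moment is bounded by the expected integral of the squared
jump sizes. An exponential Lyapunov function bounds the exponential moments of the age, and Borel-Cantelli along the times
n^2 shows that the time average of the generator of F tends to 0 almost surely whenever F grows at most linearly.
Choosing F affine in delta and x on each level of Q turns this into linear equations for the limiting averages, which
determine the average age; the continued fractions a_h cancel because the sum in the definition of v_00 equals 1/lambda.
*)

theory Submission
  imports Defs
begin

section \<open>The exponential distribution\<close>

text \<open>No filtration and no Markov process is set up: a path is a deterministic function of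
  countably many independent exponential variables. Independence is used through one operation,
  redrawing a single coordinate, and causality becomes invariance of a function under such a change.
  A service requirement is an amount of work, not a time, because service is interrupted by higher
  streams and cut off by replacement; compensators arise in units of work and are carried to real
  time by a change of variables. The triple (Q, delta, x) closes for two reasons. All rates are
  equal, so only the number of busy higher streams counts; and when the observed stream is empty its
  last packet was delivered, so delta = x and a fictitious completion changes nothing. Functions
  affine in delta and x with coefficients depending on Q are mapped by the generator to functions of
  the same kind, so the limiting averages solve a closed linear system. Streams from N on are
  supplied by independent extra variables, so that one canonical product space can be used.\<close>

abbreviation expm :: "real \<Rightarrow> real measure" where
  "expm r \<equiv> density lborel (\<lambda>x. ennreal (exponential_density r x))"

lemma expm_nn:
  assumes r: "r > 0" and [measurable]: "g \<in> borel_measurable borel"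
  shows "(\<integral>\<^sup>+a. g a \<partial>expm r) = (\<integral>\<^sup>+s. ennreal (r * exp (- s * r)) * g s * indicator {0<..} s \<partial>lborel)"
proof -
  have "(\<integral>\<^sup>+a. g a \<partial>expm r) = (\<integral>\<^sup>+s. ennreal (exponential_density r s) * g s \<partial>lborel)"
    by (subst nn_integral_density) auto
  also have "\<dots> = (\<integral>\<^sup>+s. ennreal (r * exp (- s * r)) * g s * indicator {0<..} s \<partial>lborel)"
    using AE_lborel_singleton[of "0::real"]
    by (intro nn_integral_cong_AE) (auto simp: exponential_density_def split: split_indicator)
  finally show ?thesis .
qed

lemma expm_tail:
  assumes r: "r > 0" and s: "s > 0"
  shows "(\<integral>\<^sup>+a. indicator {s..} a \<partial>expm r) = ennreal (exp (- s * r))"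
proof -
  have "(\<integral>\<^sup>+a. indicator {s..} a \<partial>expm r) = (\<integral>\<^sup>+a. ennreal (r * exp (- a * r)) * indicator {s..} a \<partial>lborel)"
    by (subst expm_nn[OF r]) (use s in \<open>auto intro!: nn_integral_cong split: split_indicator\<close>)
  also have "\<dots> = ennreal (0 - (- exp (- s * r)))"
  proof (rule nn_integral_FTC_atLeast)
    show "((\<lambda>a. - exp (- a * r)) \<longlongrightarrow> 0) at_top"
      using r by real_asymp
  qed (use r in \<open>auto intro!: derivative_eq_intros\<close>)
  finally show ?thesis by simp
qed

text \<open>The hazard rate is constant: after exchanging the integrals the weight at
  \<open>s\<close> is \<open>r\<close> times the tail probability \<open>exp (- s * r)\<close>,
  which is the density at \<open>s\<close>. Every compensator below comes from this
  identity.\<close>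

lemma expm_hazard_nn:
  assumes r: "r > 0" and [measurable]: "g \<in> borel_measurable borel"
  shows "(\<integral>\<^sup>+a. g a \<partial>expm r) = (\<integral>\<^sup>+a. (\<integral>\<^sup>+s. ennreal r * g s * indicator {0<..a} s \<partial>lborel) \<partial>expm r)"
proof -
  interpret prob_space "expm r" by (rule prob_space_exponential_density[OF r])
  interpret pair_sigma_finite "expm r" lborel ..
  have "(\<integral>\<^sup>+a. (\<integral>\<^sup>+s. ennreal r * g s * indicator {0<..a} s \<partial>lborel) \<partial>expm r) =
        (\<integral>\<^sup>+s. (\<integral>\<^sup>+a. ennreal r * g s * indicator {0<..a} s \<partial>expm r) \<partial>lborel)"
    by (rule Fubini'[symmetric]) (simp add: greaterThanAtMost_def greaterThan_def atMost_def indicator_def)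
  also have "\<dots> = (\<integral>\<^sup>+s. ennreal (r * exp (- s * r)) * g s * indicator {0<..} s \<partial>lborel)"
  proof (rule nn_integral_cong)
    fix s :: real
    have "(\<integral>\<^sup>+a. ennreal r * g s * indicator {0<..a} s \<partial>expm r)
        = (\<integral>\<^sup>+a. ennreal r * g s * indicator {0<..} s * indicator {s..} a \<partial>expm r)"
      by (intro nn_integral_cong) (auto split: split_indicator)
    also have "\<dots> = ennreal r * g s * indicator {0<..} s * (\<integral>\<^sup>+a. indicator {s..} a \<partial>expm r)"
      by (subst nn_integral_cmult) auto
    also have "\<dots> = ennreal (r * exp (- s * r)) * g s * indicator {0<..} s"
      using r expm_tail[OF r, of s] by (cases "s > 0") (auto simp: ennreal_mult mult_ac)
    finally show "(\<integral>\<^sup>+a. ennreal r * g s * indicator {0<..a} s \<partial>expm r) =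
      ennreal (r * exp (- s * r)) * g s * indicator {0<..} s" .
  qed
  also have "\<dots> = (\<integral>\<^sup>+a. g a \<partial>expm r)" by (rule expm_nn[symmetric, OF r]) simp
  finally show ?thesis by simp
qed

lemma AE_expm_pos: "r > 0 \<Longrightarrow> AE a in expm r. a > 0"
  by (subst AE_density) (use AE_lborel_singleton[of "0::real"] in \<open>auto simp: exponential_density_def\<close>)

lemma expm_moment: "r > 0 \<Longrightarrow> (\<integral>\<^sup>+a. ennreal (a ^ k) \<partial>expm r) < \<infinity>"
proof -
  assume r: "r > 0"
  have "(\<integral>\<^sup>+a. ennreal (a ^ k) \<partial>expm r) = (\<integral>\<^sup>+x. ennreal (exponential_density r x * x ^ k) \<partial>lborel)"
    using r by (subst nn_integral_density)
      (auto intro!: nn_integral_cong simp: ennreal_mult' exponential_density_nonneg)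
  also have "\<dots> = ennreal (fact (0 + k) / (fact 0 * r ^ k))"
    by (rule nn_integral_erlang_ith_moment[OF r])
  finally show ?thesis by (metis ennreal_less_top infinity_ennreal_def)
qed

lemma integrable_expm_growth:
  fixes f :: "real \<Rightarrow> real"
  assumes r: "r > 0" and [measurable]: "f \<in> borel_measurable borel"
    and f: "\<And>a. a > 0 \<Longrightarrow> \<bar>f a\<bar> \<le> K * (1 + a\<^sup>2)"
  shows "integrable (expm r) f"
proof (rule integrableI_bounded)
  have K: "0 \<le> K" using f[of 1] by auto
  have "(\<integral>\<^sup>+a. ennreal (norm (f a)) \<partial>expm r) \<le> (\<integral>\<^sup>+a. ennreal K * (ennreal (a ^ 0) + ennreal (a ^ 2)) \<partial>expm r)"
  proof (rule nn_integral_mono_AE)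
    show "AE a in expm r. ennreal (norm (f a)) \<le> ennreal K * (ennreal (a ^ 0) + ennreal (a ^ 2))"
      using AE_expm_pos[OF r]
    proof eventually_elim
      fix a :: real assume "0 < a"
      from f[OF this] K show "ennreal (norm (f a)) \<le> ennreal K * (ennreal (a ^ 0) + ennreal (a ^ 2))"
        by (subst ennreal_plus[symmetric]; (subst ennreal_mult[symmetric])?) (auto intro!: ennreal_leI)
    qed
  qed
  also have "\<dots> = ennreal K * ((\<integral>\<^sup>+a. ennreal (a ^ 0) \<partial>expm r) + (\<integral>\<^sup>+a. ennreal (a ^ 2) \<partial>expm r))"
    by (simp add: nn_integral_cmult nn_integral_add)
  also have "\<dots> < \<infinity>" using expm_moment[OF r, of 0] expm_moment[OF r, of 2]
    by (auto simp: ennreal_mult_less_top)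
  finally show "(\<integral>\<^sup>+a. ennreal (norm (f a)) \<partial>expm r) < \<infinity>" .
qed simp

lemma abs_interval_integral_le:
  fixes g :: "real \<Rightarrow> real"
  assumes [measurable]: "g \<in> borel_measurable borel" and a: "a \<ge> 0" and g: "\<And>s. 0 < s \<Longrightarrow> s \<le> a \<Longrightarrow> \<bar>g s\<bar> \<le> K"
    and K: "K \<ge> 0"
  shows "set_integrable lborel {0<..a} g" "\<bar>LINT s:{0<..a}|lborel. g s\<bar> \<le> K * a"
proof -
  have i: "set_integrable lborel {0<..a} (\<lambda>_. K)"
    using a by (auto simp: set_integrable_def intro!: integrable_mult_left integrable_real_indicator)
  show g1: "set_integrable lborel {0<..a} g"
    unfolding set_integrable_def
    by (rule Bochner_Integration.integrable_bound[OF i[unfolded set_integrable_def]])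
       (use g K in \<open>auto split: split_indicator\<close>)
  have "\<bar>LINT s:{0<..a}|lborel. g s\<bar> \<le> (LINT s:{0<..a}|lborel. K)"
    unfolding set_lebesgue_integral_def real_norm_def[symmetric]
    by (rule Bochner_Integration.integral_norm_bound_integral[OF g1[unfolded set_integrable_def] i[unfolded set_integrable_def]])
       (use g in \<open>auto split: split_indicator\<close>)
  also have "\<dots> = K * a" using a by (simp add: set_integral_const)
  finally show "\<bar>LINT s:{0<..a}|lborel. g s\<bar> \<le> K * a" .
qed

lemma borel_measurable_primitive [measurable]:
  fixes g :: "real \<Rightarrow> real"
  assumes [measurable]: "g \<in> borel_measurable borel"
  shows "(\<lambda>a. LINT s:{0<..a}|lborel. g s) \<in> borel_measurable borel"
proof -
  have "(\<lambda>a. \<integral>s. (if 0 < s \<and> s \<le> a then g s else 0) \<partial>lborel) \<in> borel_measurable borel"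
    by (intro lborel.borel_measurable_lebesgue_integral) measurable
  then show ?thesis
    unfolding set_lebesgue_integral_def by (rule back_subst[of "\<lambda>f. f \<in> _"])
      (auto intro!: ext Bochner_Integration.integral_cong split: split_indicator)
qed

text \<open>Signed form of the hazard identity. Linear growth is allowed because it is applied to a
  bounded function and also to the product of that function with its primitive.\<close>

lemma expm_hazard:
  fixes g :: "real \<Rightarrow> real"
  assumes r: "r > 0" and m[measurable]: "g \<in> borel_measurable borel"
    and g: "\<And>s. s > 0 \<Longrightarrow> \<bar>g s\<bar> \<le> K * (1 + s)"
  shows "(\<integral>a. g a \<partial>expm r) = (\<integral>a. r * (LINT s:{0<..a}|lborel. g s) \<partial>expm r)"
proof -
  have K: "K \<ge> 0" using g[of 1] by auto
  have lin: "1 + a \<le> 2 * (1 + a\<^sup>2)" for a :: real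
  proof -
    have "0 \<le> (a - 1)\<^sup>2 + 3 * a\<^sup>2" by simp
    then show ?thesis by (simp add: power2_diff)
  qed
  have gi: "integrable (expm r) g"
    by (rule integrable_expm_growth[OF r m, of "2 * K"])
    (rule order_trans[OF g], assumption, use mult_left_mono[OF lin K] in \<open>simp add: mult_ac\<close>)
  interpret prob_space "expm r" by (rule prob_space_exponential_density[OF r])
  interpret pair_sigma_finite "expm r" lborel ..
  let ?\<phi> = "\<lambda>a s. r * g s * indicator {0<..a} s"
  have [measurable]: "(\<lambda>x. r * g (snd x) * indicator {0<..fst x} (snd x)) \<in> borel_measurable (expm r \<Otimes>\<^sub>M lborel)"
    by (simp add: greaterThanAtMost_def greaterThan_def atMost_def indicator_def)
  have eq: "ennreal (norm (r * g s * indicator {0<..a} s)) = ennreal r * ennreal \<bar>g s\<bar> * indicator {0<..a} s" for a s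
    using r by (auto simp: abs_mult ennreal_mult split: split_indicator)
  have "integrable (expm r \<Otimes>\<^sub>M lborel) (\<lambda>x. r * g (snd x) * indicator {0<..fst x} (snd x))"
  proof (rule integrableI_bounded)
    have "(\<integral>\<^sup>+x. ennreal (norm (r * g (snd x) * indicator {0<..fst x} (snd x))) \<partial>(expm r \<Otimes>\<^sub>M lborel))
       = (\<integral>\<^sup>+a. \<integral>\<^sup>+s. ennreal r * ennreal \<bar>g s\<bar> * indicator {0<..a} s \<partial>lborel \<partial>expm r)"
      by (subst lborel.nn_integral_fst[symmetric]) (simp, simp only: fst_conv snd_conv eq)
    also have "\<dots> = (\<integral>\<^sup>+a. ennreal \<bar>g a\<bar> \<partial>expm r)"
      by (rule expm_hazard_nn[OF r, symmetric]) simp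
    also have "\<dots> < \<infinity>" using gi by (simp add: integrable_iff_bounded)
    finally show "(\<integral>\<^sup>+x. ennreal (norm (r * g (snd x) * indicator {0<..fst x} (snd x))) \<partial>(expm r \<Otimes>\<^sub>M lborel)) < \<infinity>" .
  qed simp
  then have "(\<integral>s. (\<integral>a. ?\<phi> a s \<partial>expm r) \<partial>lborel) = (\<integral>a. (\<integral>s. ?\<phi> a s \<partial>lborel) \<partial>expm r)"
    by (intro Fubini_integral) (simp add: case_prod_beta')
  moreover have "(\<integral>a. (\<integral>s. ?\<phi> a s \<partial>lborel) \<partial>expm r) = (\<integral>a. r * (LINT s:{0<..a}|lborel. g s) \<partial>expm r)"
    by (auto simp: set_lebesgue_integral_def mult_ac intro!: Bochner_Integration.integral_cong
        simp flip: Bochner_Integration.integral_mult_right_zero)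
  moreover have "(\<integral>s. (\<integral>a. ?\<phi> a s \<partial>expm r) \<partial>lborel) = (\<integral>s. exponential_density r s * g s \<partial>lborel)"
  proof (rule integral_cong_AE)
    \<comment> \<open>The point 0 has to be left out: there the density equals \<open>r\<close>,
      whereas the indicator of \<open>{0<..a}\<close> vanishes.\<close>
    have "(\<integral>a. ?\<phi> a s \<partial>expm r) = exponential_density r s * g s" if "s \<noteq> 0" for s
    proof (cases "s > 0")
      case True
      have "emeasure (expm r) {s..} = ennreal (exp (- s * r))"
        using expm_tail[OF r True] by simp
      then have "measure (expm r) {s..} = exp (- s * r)" by (simp add: measure_def)
      moreover have "(\<integral>a. ?\<phi> a s \<partial>expm r) = (\<integral>a. r * g s * indicator {s..} a \<partial>expm r)"
        using True by (intro Bochner_Integration.integral_cong) (auto split: split_indicator)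
      ultimately show ?thesis using True by (simp add: exponential_density_def)
    qed (use that in \<open>auto simp: exponential_density_def\<close>)
    then show "AE s in lborel. (\<integral>a. ?\<phi> a s \<partial>expm r) = exponential_density r s * g s"
      using AE_lborel_singleton[of "0::real"] by (auto elim!: eventually_mono)
    have "(\<lambda>s. (\<integral>a. (if 0 < s \<and> s \<le> a then r * g s else 0) \<partial>expm r)) \<in> borel_measurable lborel"
      by measurable
    then show "(\<lambda>s. (\<integral>a. ?\<phi> a s \<partial>expm r)) \<in> borel_measurable lborel"
      by (rule back_subst[of "\<lambda>f. f \<in> _"])
         (intro ext Bochner_Integration.integral_cong refl, auto split: split_indicator)
  qed measurable
  moreover have "(\<integral>s. exponential_density r s * g s \<partial>lborel) = (\<integral>a. g a \<partial>expm r)"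
    using r by (subst integral_real_density) (auto simp: exponential_density_nonneg)
  ultimately show ?thesis by simp
qed

text \<open>The square is a double integral symmetric in its variables, hence twice the integral
  over one side of the diagonal, which is null. It takes the place of differentiating a squared
  primitive, since \<open>f\<close> is merely integrable.\<close>

lemma square_of_integral:
  fixes f :: "real \<Rightarrow> real"
  assumes f: "integrable lborel f"
  shows "(\<integral>s. f s \<partial>lborel)\<^sup>2 = 2 * (\<integral>s. f s * (\<integral>t. f t * indicator {..s} t \<partial>lborel) \<partial>lborel)"
proof -
  have [measurable]: "f \<in> borel_measurable borel" using f by auto
  have ff: "integrable (lborel \<Otimes>\<^sub>M lborel) (\<lambda>(s, t). f s * f t)"
    using f by (intro lborel_pair.Fubini_integrable) (auto simp: abs_mult)
  let ?h = "\<lambda>s t. f s * f t * indicator {..s} t"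
  have i1: "integrable (lborel \<Otimes>\<^sub>M lborel) (\<lambda>(s, t). f s * f t * indicator {t. t \<le> s} t)"
    by (rule Bochner_Integration.integrable_bound[OF ff]) (auto split: split_indicator)
  have i2: "integrable (lborel \<Otimes>\<^sub>M lborel) (\<lambda>(s, t). f s * f t * indicator {t. s < t} t)"
    by (rule Bochner_Integration.integrable_bound[OF ff]) (auto split: split_indicator)
  have "(\<integral>s. f s \<partial>lborel)\<^sup>2 = (\<integral>s. (\<integral>t. f s * f t \<partial>lborel) \<partial>lborel)"
    by (simp add: power2_eq_square)
  also have "\<dots> = (\<integral>x. (case x of (s, t) \<Rightarrow> f s * f t) \<partial>(lborel \<Otimes>\<^sub>M lborel))"
    using lborel_pair.integral_fst'[OF ff] by simp
  also have "\<dots> = (\<integral>x. (case x of (s, t) \<Rightarrow> f s * f t * indicator {t. t \<le> s} t) + 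
                      (case x of (s, t) \<Rightarrow> f s * f t * indicator {t. s < t} t) \<partial>(lborel \<Otimes>\<^sub>M lborel))"
    by (rule Bochner_Integration.integral_cong) (auto split: split_indicator)
  also have "\<dots> = (\<integral>x. (case x of (s, t) \<Rightarrow> f s * f t * indicator {t. t \<le> s} t) \<partial>(lborel \<Otimes>\<^sub>M lborel)) + 
                 (\<integral>x. (case x of (s, t) \<Rightarrow> f s * f t * indicator {t. s < t} t) \<partial>(lborel \<Otimes>\<^sub>M lborel))"
    by (rule Bochner_Integration.integral_add[OF i1 i2])
  also have "(\<integral>x. (case x of (s, t) \<Rightarrow> f s * f t * indicator {t. t \<le> s} t) \<partial>(lborel \<Otimes>\<^sub>M lborel)) = 
      (\<integral>s. (\<integral>t. f s * f t * indicator {t. t \<le> s} t \<partial>lborel) \<partial>lborel)"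
    using lborel_pair.integral_fst'[OF i1] by simp
  also have "(\<integral>x. (case x of (s, t) \<Rightarrow> f s * f t * indicator {t. s < t} t) \<partial>(lborel \<Otimes>\<^sub>M lborel)) = 
      (\<integral>t. (\<integral>s. f s * f t * indicator {t. s < t} t \<partial>lborel) \<partial>lborel)"
    using lborel_pair.integral_snd[OF i2] by simp
  also have "(\<integral>t. (\<integral>s. f s * f t * indicator {t. s < t} t \<partial>lborel) \<partial>lborel) = 
     (\<integral>s. (\<integral>t. f s * f t * indicator {t. t \<le> s} t \<partial>lborel) \<partial>lborel)"
  proof (rule Bochner_Integration.integral_cong[OF refl])
    fix t :: real
    show "(\<integral>s. f s * f t * indicator {t. s < t} t \<partial>lborel) = (\<integral>s. f t * f s * indicator {s. s \<le> t} s \<partial>lborel)"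
      using AE_lborel_singleton[of t] by (intro integral_cong_AE) (auto split: split_indicator elim!: eventually_mono)
  qed
  also have "(\<lambda>s. (\<integral>t. f s * f t * indicator {t. t \<le> s} t \<partial>lborel)) = (\<lambda>s. f s * (\<integral>t. f t * indicator {..s} t \<partial>lborel))"
    by (simp add: mult.assoc atMost_def)
  finally show ?thesis by simp
qed

lemma square_of_primitive:
  fixes g :: "real \<Rightarrow> real"
  assumes g: "set_integrable lborel {0<..a} g"
  shows "(LINT s:{0<..a}|lborel. g s)\<^sup>2 = 2 * (LINT s:{0<..a}|lborel. g s * (LINT t:{0<..s}|lborel. g t))"
proof -
  have "(LINT t:{0<..s}|lborel. g t) = (\<integral>t. indicator {0<..a} t * g t * indicator {..s} t \<partial>lborel)" if "s \<in> {0<..a}" for s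
    using that by (auto simp: set_lebesgue_integral_def intro!: Bochner_Integration.integral_cong split: split_indicator)
  then show ?thesis
    using square_of_integral[OF g[unfolded set_integrable_def]]
    by (auto simp: set_lebesgue_integral_def intro!: Bochner_Integration.integral_cong split: split_indicator)
qed

lemma integral_square_nonneg_eq:
  assumes i: "integrable M (\<lambda>x. (f x)\<^sup>2 :: real)"
  shows "(\<integral>\<^sup>+x. ennreal ((f x)\<^sup>2) \<partial>M) = ennreal (\<integral>x. (f x)\<^sup>2 \<partial>M)"
  by (rule nn_integral_eq_integral[OF i]) simp

text \<open>Let \<open>I\<close> be the primitive of \<open>g\<close>. The hazard identity for
  \<open>g\<close> gives mean zero. For \<open>2 * (g a * I a)\<close>, whose primitive is the
  square of \<open>I\<close>, it shows that twice the mean of \<open>g a * I a\<close> is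
  \<open>r\<close> times the mean of the square of \<open>I\<close>; so in the second moment of
  \<open>D\<close> everything cancels except the mean of the square of \<open>g\<close>. The
  constant \<open>s\<close> will be the sum of the terms revealed before.\<close>

lemma expm_compensated:
  fixes g :: "real \<Rightarrow> real"
  assumes r: "r > 0" and m[measurable]: "g \<in> borel_measurable borel" and g: "\<And>s. \<bar>g s\<bar> \<le> B"
  defines "D \<equiv> \<lambda>a. g a - r * (LINT s:{0<..a}|lborel. g s)"
  shows "(\<integral>\<^sup>+a. ennreal ((s + D a)\<^sup>2) \<partial>expm r) = ennreal (s\<^sup>2) + (\<integral>\<^sup>+a. ennreal ((g a)\<^sup>2) \<partial>expm r)"
    and "(\<integral>a. D a \<partial>expm r) = 0"
    and "(\<integral>\<^sup>+a. ennreal \<bar>D a\<bar> \<partial>expm r) \<le> 2 * (\<integral>\<^sup>+a. ennreal \<bar>g a\<bar> \<partial>expm r)"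
proof -
  interpret prob_space "expm r" by (rule prob_space_exponential_density[OF r])
  define I where "I = (\<lambda>a. LINT s:{0<..a}|lborel. g s)"
  have [measurable]: "I \<in> borel_measurable borel" unfolding I_def by measurable
  have B: "0 \<le> B" using g[of 0] by auto
  have Ib: "\<bar>I a\<bar> \<le> B * a" if "a > 0" for a
    unfolding I_def by (rule abs_interval_integral_le[OF m]) (use that g B in auto)
  have gi: "set_integrable lborel {0<..a} g" if "a > 0" for a
    by (rule abs_interval_integral_le[OF m, of a B]) (use that g B in auto)
  have lin: "1 + a \<le> 2 * (1 + a\<^sup>2)" for a :: real
  proof -
    have "0 \<le> (a - 1)\<^sup>2 + 3 * a\<^sup>2" by simp
    then show ?thesis by (simp add: power2_diff)
  qed
  have i_g: "integrable (expm r) g"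
  proof (rule integrable_expm_growth[OF r m, of B])
    show "\<bar>g a\<bar> \<le> B * (1 + a\<^sup>2)" for a
      using g[of a] mult_nonneg_nonneg[OF B zero_le_power2[of a]] unfolding distrib_left mult_1_right by linarith
  qed
  have i_I: "integrable (expm r) I"
  proof (rule integrable_expm_growth[OF r, of _ "2 * B"])
    fix a :: real assume "a > 0"
    have "\<bar>I a\<bar> \<le> B * (1 + a)" using Ib[OF \<open>a > 0\<close>] B by (simp add: algebra_simps)
    also have "\<dots> \<le> B * (2 * (1 + a\<^sup>2))" by (intro mult_left_mono lin B)
    finally show "\<bar>I a\<bar> \<le> 2 * B * (1 + a\<^sup>2)" by (simp add: mult_ac)
  qed simp
  have i_g2: "integrable (expm r) (\<lambda>a. (g a)\<^sup>2)"
  proof (rule integrable_expm_growth[OF r, of _ "B\<^sup>2"])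
    fix a :: real assume "a > 0"
    have "(g a)\<^sup>2 \<le> B\<^sup>2" using g[of a] B by (metis abs_le_square_iff abs_of_nonneg)
    also have "\<dots> \<le> B\<^sup>2 * (1 + a\<^sup>2)" by (simp add: mult_le_cancel_left1)
    finally show "\<bar>(g a)\<^sup>2\<bar> \<le> B\<^sup>2 * (1 + a\<^sup>2)" by simp
  qed simp
  have i_gI: "integrable (expm r) (\<lambda>a. g a * I a)"
  proof (rule integrable_expm_growth[OF r, of _ "B\<^sup>2 * 2"])
    fix a :: real assume "a > 0"
    have "\<bar>g a * I a\<bar> \<le> B * (B * a)" unfolding abs_mult using g Ib \<open>a > 0\<close> B by (intro mult_mono) auto
    also have "\<dots> = B\<^sup>2 * a" by (simp add: power2_eq_square)
    also have "\<dots> \<le> B\<^sup>2 * (2 * (1 + a\<^sup>2))"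
      using lin[of a] \<open>a > 0\<close> by (intro mult_left_mono) auto
    finally show "\<bar>g a * I a\<bar> \<le> B\<^sup>2 * 2 * (1 + a\<^sup>2)" by (simp only: mult.assoc)
  qed simp
  have i_I2: "integrable (expm r) (\<lambda>a. (I a)\<^sup>2)"
  proof (rule integrable_expm_growth[OF r, of _ "B\<^sup>2"])
    fix a :: real assume "a > 0"
    have "(I a)\<^sup>2 \<le> (B * a)\<^sup>2" using Ib[OF \<open>a > 0\<close>] B \<open>a > 0\<close> by (metis abs_le_square_iff abs_of_nonneg mult_nonneg_nonneg less_imp_le)
    also have "\<dots> \<le> B\<^sup>2 * (1 + a\<^sup>2)" by (simp add: power_mult_distrib algebra_simps)
    finally show "\<bar>(I a)\<^sup>2\<bar> \<le> B\<^sup>2 * (1 + a\<^sup>2)" by simp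
  qed simp
  have Eg: "(\<integral>a. g a \<partial>expm r) = r * (\<integral>a. I a \<partial>expm r)"
  proof -
    have "\<bar>g s\<bar> \<le> B * (1 + s)" if "s > 0" for s
      using g[of s] B that by (simp add: algebra_simps) (smt (verit) mult_nonneg_nonneg)
    from expm_hazard[OF r m this] show ?thesis unfolding I_def by simp
  qed
  have "(\<integral>a. 2 * (g a * I a) \<partial>expm r) = (\<integral>a. r * (LINT s:{0<..a}|lborel. 2 * (g s * I s)) \<partial>expm r)"
  proof (rule expm_hazard[OF r, of _ "2 * B\<^sup>2"])
    fix a :: real assume "a > 0"
    have "\<bar>g a * I a\<bar> \<le> B * (B * a)" unfolding abs_mult using g Ib \<open>a > 0\<close> B by (intro mult_mono) auto
    then have "2 * \<bar>g a * I a\<bar> \<le> 2 * (B * B * a)" by (simp add: mult.assoc)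
    also have "\<dots> \<le> 2 * (B * B * (1 + a))" by (intro mult_left_mono) auto
    finally show "\<bar>2 * (g a * I a)\<bar> \<le> 2 * B\<^sup>2 * (1 + a)"
      by (simp only: power2_eq_square mult.assoc abs_mult abs_numeral)
  qed simp
  also have "\<dots> = (\<integral>a. r * (I a)\<^sup>2 \<partial>expm r)"
  proof (rule integral_cong_AE)
    show "AE a in expm r. r * (LINT s:{0<..a}|lborel. 2 * (g s * I s)) = r * (I a)\<^sup>2"
      using AE_expm_pos[OF r]
    proof eventually_elim
      fix a :: real assume "0 < a"
      from square_of_primitive[OF gi[OF this]]
      show "r * (LINT s:{0<..a}|lborel. 2 * (g s * I s)) = r * (I a)\<^sup>2"
        unfolding I_def by simp
    qed
  qed measurable
  finally have EgI: "2 * (\<integral>a. g a * I a \<partial>expm r) = r * (\<integral>a. (I a)\<^sup>2 \<partial>expm r)" by simp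
  have D: "D = (\<lambda>a. g a - r * I a)" unfolding D_def I_def ..
  show D0: "(\<integral>a. D a \<partial>expm r) = 0"
    unfolding D using i_g i_I Eg by simp
  have i_D: "integrable (expm r) D" unfolding D using i_g i_I by simp
  have D2: "(\<lambda>a. (D a)\<^sup>2) = (\<lambda>a. (g a)\<^sup>2 - 2 * r * (g a * I a) + r\<^sup>2 * (I a)\<^sup>2)"
    by (auto simp: D power2_eq_square algebra_simps)
  have i_D2: "integrable (expm r) (\<lambda>a. (D a)\<^sup>2)"
    unfolding D2 using i_g2 i_gI i_I2 by simp
  have "(\<integral>a. (D a)\<^sup>2 \<partial>expm r) = (\<integral>a. (g a)\<^sup>2 \<partial>expm r) - r * (2 * (\<integral>a. g a * I a \<partial>expm r)) + r\<^sup>2 * (\<integral>a. (I a)\<^sup>2 \<partial>expm r)"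
    unfolding D2 using i_g2 i_gI i_I2 by simp
  then have ED2: "(\<integral>a. (D a)\<^sup>2 \<partial>expm r) = (\<integral>a. (g a)\<^sup>2 \<partial>expm r)"
    unfolding EgI by (simp add: power2_eq_square)
  have s2: "(\<lambda>a. (s + D a)\<^sup>2) = (\<lambda>a. s\<^sup>2 + 2 * s * D a + (D a)\<^sup>2)"
    by (auto simp: power2_eq_square algebra_simps)
  have i_s: "integrable (expm r) (\<lambda>a. (s + D a)\<^sup>2)"
    unfolding s2 using i_D i_D2 by simp
  have "(\<integral>\<^sup>+a. ennreal ((s + D a)\<^sup>2) \<partial>expm r) = ennreal (\<integral>a. (s + D a)\<^sup>2 \<partial>expm r)"
    by (rule integral_square_nonneg_eq[OF i_s])
  also have "(\<integral>a. (s + D a)\<^sup>2 \<partial>expm r) = s\<^sup>2 + (\<integral>a. (g a)\<^sup>2 \<partial>expm r)"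
    unfolding s2 using i_D i_D2 D0 ED2 prob_space by (simp add: measure_def)
  also have "ennreal \<dots> = ennreal (s\<^sup>2) + ennreal (\<integral>a. (g a)\<^sup>2 \<partial>expm r)"
    by (rule ennreal_plus) auto
  also have "ennreal (\<integral>a. (g a)\<^sup>2 \<partial>expm r) = (\<integral>\<^sup>+a. ennreal ((g a)\<^sup>2) \<partial>expm r)"
    by (rule integral_square_nonneg_eq[OF i_g2, symmetric])
  finally show "(\<integral>\<^sup>+a. ennreal ((s + D a)\<^sup>2) \<partial>expm r) = ennreal (s\<^sup>2) + (\<integral>\<^sup>+a. ennreal ((g a)\<^sup>2) \<partial>expm r)" .
  have "(\<integral>\<^sup>+a. ennreal \<bar>D a\<bar> \<partial>expm r) \<le> 
     (\<integral>\<^sup>+a. ennreal \<bar>g a\<bar> + (\<integral>\<^sup>+s. ennreal r * ennreal \<bar>g s\<bar> * indicator {0<..a} s \<partial>lborel) \<partial>expm r)"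
  proof (rule nn_integral_mono_AE)
    show "AE a in expm r. ennreal \<bar>D a\<bar> \<le> ennreal \<bar>g a\<bar> + (\<integral>\<^sup>+s. ennreal r * ennreal \<bar>g s\<bar> * indicator {0<..a} s \<partial>lborel)"
      using AE_expm_pos[OF r]
    proof eventually_elim
      fix a :: real assume a: "0 < a"
      have "ennreal \<bar>I a\<bar> \<le> (\<integral>\<^sup>+s. ennreal (norm (indicator {0<..a} s *\<^sub>R g s)) \<partial>lborel)"
        using integral_norm_bound_ennreal[OF gi[OF a, unfolded set_integrable_def]]
        unfolding I_def set_lebesgue_integral_def by simp
      also have "\<dots> = (\<integral>\<^sup>+s. ennreal \<bar>g s\<bar> * indicator {0<..a} s \<partial>lborel)"
        by (intro nn_integral_cong) (auto split: split_indicator)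
      finally have "ennreal r * ennreal \<bar>I a\<bar> \<le> ennreal r * (\<integral>\<^sup>+s. ennreal \<bar>g s\<bar> * indicator {0<..a} s \<partial>lborel)"
        by (rule mult_left_mono) simp
      also have "\<dots> = (\<integral>\<^sup>+s. ennreal r * ennreal \<bar>g s\<bar> * indicator {0<..a} s \<partial>lborel)"
        by (subst nn_integral_cmult[symmetric]) (auto simp: mult_ac)
      finally have *: "ennreal (r * \<bar>I a\<bar>) \<le> (\<integral>\<^sup>+s. ennreal r * ennreal \<bar>g s\<bar> * indicator {0<..a} s \<partial>lborel)"
        using r by (simp add: ennreal_mult)
      have "ennreal \<bar>D a\<bar> \<le> ennreal (\<bar>g a\<bar> + r * \<bar>I a\<bar>)"
        using r abs_triangle_ineq4[of "g a" "r * I a"] by (intro ennreal_leI) (simp add: D abs_mult)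
      also have "\<dots> = ennreal \<bar>g a\<bar> + ennreal (r * \<bar>I a\<bar>)" using r by (intro ennreal_plus) auto
      also note add_left_mono[OF *]
      finally show "ennreal \<bar>D a\<bar> \<le> ennreal \<bar>g a\<bar> + (\<integral>\<^sup>+s. ennreal r * ennreal \<bar>g s\<bar> * indicator {0<..a} s \<partial>lborel)" .
    qed
  qed
  also have "\<dots> = (\<integral>\<^sup>+a. ennreal \<bar>g a\<bar> \<partial>expm r) + (\<integral>\<^sup>+a. (\<integral>\<^sup>+s. ennreal r * ennreal \<bar>g s\<bar> * indicator {0<..a} s \<partial>lborel) \<partial>expm r)"
    by (rule nn_integral_add) (simp_all add: greaterThanAtMost_def greaterThan_def atMost_def indicator_def)
  also have "\<dots> = 2 * (\<integral>\<^sup>+a. ennreal \<bar>g a\<bar> \<partial>expm r)"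
    by (subst expm_hazard_nn[OF r, symmetric]) (simp_all add: mult_2)
  finally show "(\<integral>\<^sup>+a. ennreal \<bar>D a\<bar> \<partial>expm r) \<le> 2 * (\<integral>\<^sup>+a. ennreal \<bar>g a\<bar> \<partial>expm r)" .
qed

section \<open>Compensated sums over independent exponential variables\<close>

locale exponential_family =
  fixes rate :: "'c \<Rightarrow> real"
  assumes rate_pos: "rate c > 0"
begin

definition P :: "('c \<Rightarrow> real) measure" where "P = PiM UNIV (\<lambda>c. expm (rate c))"

lemma prob_expm: "prob_space (expm (rate c))"
  by (rule prob_space_exponential_density[OF rate_pos])

lemma sigma_finite_expm: "sigma_finite_measure (expm (rate c))"
  by (rule prob_space_imp_sigma_finite[OF prob_expm])

sublocale expms: product_prob_space "\<lambda>c. expm (rate c)" UNIV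
  by (rule product_prob_spaceI[OF prob_expm])

sublocale P: prob_space P
  unfolding P_def by (rule prob_space_PiM) (rule prob_expm)

lemma space_P [simp]: "space P = UNIV"
  by (simp add: P_def space_PiM PiE_def)

lemma sets_P: "sets P = sets (PiM UNIV (\<lambda>_. borel))"
  unfolding P_def by (intro sets_PiM_cong) auto

lemma measurable_P_iff: "measurable P N = measurable (PiM UNIV (\<lambda>_. borel)) N"
  "measurable N P = measurable N (PiM UNIV (\<lambda>_. borel))"
  using sets_P sets_eq_imp_space_eq[OF sets_P] by (auto simp: measurable_def)

lemma measurable_coordinate [measurable]: "(\<lambda>w. w c) \<in> borel_measurable P"
  unfolding measurable_P_iff by measurable

lemma measurable_into_P: "(\<And>c. (\<lambda>x. f x c) \<in> borel_measurable N) \<Longrightarrow> f \<in> measurable N P"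
  unfolding measurable_P_iff by (rule measurable_PiM_single') (auto simp: space_PiM)

lemma measurable_resample [measurable]:
  assumes [measurable]: "f \<in> measurable N P" "h \<in> borel_measurable N"
  shows "(\<lambda>x. (f x)(c := h x)) \<in> measurable N P"
proof (rule measurable_into_P)
  fix c'
  have "(\<lambda>x. (\<lambda>w. w c') (f x)) \<in> borel_measurable N"
    by (rule measurable_compose[OF assms(1) measurable_coordinate])
  then show "(\<lambda>x. ((f x)(c := h x)) c') \<in> borel_measurable N"
    by (cases "c' = c") auto
qed

lemma sets_P_cylinder:
  fixes E :: "'c \<Rightarrow> real set"
  assumes "finite J" "\<And>j. j \<in> J \<Longrightarrow> E j \<in> sets borel"
  shows "{w. \<forall>j\<in>J. w j \<in> E j} \<in> sets P"
proof -
  have "Measurable.pred P (\<lambda>w. \<forall>j\<in>J. w j \<in> E j)"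
    using assms by (intro pred_intros_finite pred_sets2[OF _ measurable_coordinate])
  then show ?thesis by (simp add: pred_def)
qed

lemma emeasure_P_cylinder:
  assumes "finite J" "\<And>j. j \<in> J \<Longrightarrow> E j \<in> sets borel"
  shows "emeasure P {w. \<forall>j\<in>J. w j \<in> E j} = (\<Prod>j\<in>J. emeasure (expm (rate j)) (E j))"
proof -
  have "{w. \<forall>j\<in>J. w j \<in> E j} = prod_emb UNIV (\<lambda>c. expm (rate c)) J (Pi\<^sub>E J E)"
    by (auto simp: prod_emb_def space_PiM PiE_iff)
  then show ?thesis
    unfolding P_def using assms by (simp add: expms.emeasure_PiM_emb)
qed

lemma P_eqI:
  assumes "sets Q = sets P"
    and "\<And>J E. finite J \<Longrightarrow> (\<And>j. j \<in> J \<Longrightarrow> E j \<in> sets borel) \<Longrightarrow>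
      emeasure Q {w. \<forall>j\<in>J. w j \<in> E j} = (\<Prod>j\<in>J. emeasure (expm (rate j)) (E j))"
  shows "Q = P"
  unfolding P_def
proof (rule expms.PiM_eq)
  fix J E assume J: "finite J" "J \<subseteq> UNIV" "\<And>j. j \<in> J \<Longrightarrow> E j \<in> sets (expm (rate j))"
  have "prod_emb UNIV (\<lambda>c. expm (rate c)) J (Pi\<^sub>E J E) = {w. \<forall>j\<in>J. w j \<in> E j}"
    by (auto simp: prod_emb_def space_PiM PiE_iff)
  then show "emeasure Q (prod_emb UNIV (\<lambda>c. expm (rate c)) J (Pi\<^sub>E J E)) = (\<Prod>j\<in>J. emeasure (expm (rate j)) (E j))"
    using assms(2)[of J E] J by simp
qed (use assms(1) in \<open>simp add: P_def\<close>)

text \<open>On cylinders, overwriting coordinate \<open>c\<close> exchanges one factor for an equal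
  one. Together with Fubini this does the work of conditioning on all coordinates except
  \<open>c\<close>.\<close>

lemma resample: "distr (P \<Otimes>\<^sub>M expm (rate c)) P (\<lambda>(w, a). w(c := a)) = P" (is "?Q = P")
proof (rule P_eqI)
  fix J :: "'c set" and E :: "'c \<Rightarrow> real set" assume J: "finite J" and E: "\<And>j. j \<in> J \<Longrightarrow> E j \<in> sets borel"
  let ?f = "\<lambda>(w, a). w(c := a)"
  have f: "?f \<in> measurable (P \<Otimes>\<^sub>M expm (rate c)) P" by measurable
  have "emeasure ?Q {w. \<forall>j\<in>J. w j \<in> E j} =
      emeasure (P \<Otimes>\<^sub>M expm (rate c)) (?f -` {w. \<forall>j\<in>J. w j \<in> E j} \<inter> space (P \<Otimes>\<^sub>M expm (rate c)))"
    by (rule emeasure_distr[OF f sets_P_cylinder[OF J E]])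
  also have "?f -` {w. \<forall>j\<in>J. w j \<in> E j} \<inter> space (P \<Otimes>\<^sub>M expm (rate c)) =
     {w. \<forall>j\<in>J - {c}. w j \<in> E j} \<times> (if c \<in> J then E c else UNIV)"
    by (auto simp: space_pair_measure split: if_splits)
  also have "emeasure (P \<Otimes>\<^sub>M expm (rate c)) \<dots> = 
     emeasure P {w. \<forall>j\<in>J - {c}. w j \<in> E j} * emeasure (expm (rate c)) (if c \<in> J then E c else UNIV)"
    using J E by (intro sigma_finite_measure.emeasure_pair_measure_Times[OF sigma_finite_expm] sets_P_cylinder) auto
  also have "\<dots> = (\<Prod>j\<in>J - {c}. emeasure (expm (rate j)) (E j)) * emeasure (expm (rate c)) (if c \<in> J then E c else UNIV)"
    using J E by (subst emeasure_P_cylinder) auto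
  also have "\<dots> = (\<Prod>j\<in>J. emeasure (expm (rate j)) (E j))"
    using J prob_space.emeasure_space_1[OF prob_expm] by (auto simp: prod.remove[of J c] mult_ac)
  finally show "emeasure ?Q {w. \<forall>j\<in>J. w j \<in> E j} = (\<Prod>j\<in>J. emeasure (expm (rate j)) (E j))" .
qed simp

lemma nn_integral_resample:
  assumes [measurable]: "F \<in> borel_measurable P"
  shows "(\<integral>\<^sup>+w. F w \<partial>P) = (\<integral>\<^sup>+w. (\<integral>\<^sup>+a. F (w(c := a)) \<partial>expm (rate c)) \<partial>P)"
proof -
  interpret PR: pair_sigma_finite P "expm (rate c)" ..
  have "(\<integral>\<^sup>+w. F w \<partial>P) = (\<integral>\<^sup>+w. F w \<partial>distr (P \<Otimes>\<^sub>M expm (rate c)) P (\<lambda>(w, a). w(c := a)))"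
    by (simp only: resample)
  also have "\<dots> = (\<integral>\<^sup>+x. F ((fst x)(c := snd x)) \<partial>(P \<Otimes>\<^sub>M expm (rate c)))"
    by (subst nn_integral_distr) (auto simp: case_prod_beta)
  also have "\<dots> = (\<integral>\<^sup>+w. (\<integral>\<^sup>+a. F (w(c := a)) \<partial>expm (rate c)) \<partial>P)"
    by (subst sigma_finite_measure.nn_integral_fst[OF sigma_finite_expm, symmetric]) auto
  finally show ?thesis .
qed

lemma integral_resample:
  fixes F :: "_ \<Rightarrow> real"
  assumes F: "integrable P F"
  shows "(\<integral>w. F w \<partial>P) = (\<integral>w. (\<integral>a. F (w(c := a)) \<partial>expm (rate c)) \<partial>P)"
proof -
  interpret PR: pair_sigma_finite P "expm (rate c)" ..
  have [measurable]: "F \<in> borel_measurable P" using F by auto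
  have "integrable (distr (P \<Otimes>\<^sub>M expm (rate c)) P (\<lambda>(w, a). w(c := a))) F"
    by (simp only: resample F)
  then have i: "integrable (P \<Otimes>\<^sub>M expm (rate c)) (\<lambda>(w, a). F (w(c := a)))"
    by (subst (asm) integrable_distr_eq) (auto simp: case_prod_beta')
  have "(\<integral>w. F w \<partial>P) = (\<integral>w. F w \<partial>distr (P \<Otimes>\<^sub>M expm (rate c)) P (\<lambda>(w, a). w(c := a)))"
    by (simp only: resample)
  also have "\<dots> = (\<integral>x. (case x of (w, a) \<Rightarrow> F (w(c := a))) \<partial>(P \<Otimes>\<^sub>M expm (rate c)))"
    by (subst integral_distr) (auto simp: case_prod_beta')
  also have "\<dots> = (\<integral>w. (\<integral>a. F (w(c := a)) \<partial>expm (rate c)) \<partial>P)"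
    using PR.integral_fst'[OF i] by simp
  finally show ?thesis .
qed

text \<open>With all other coordinates frozen, an almost sure statement becomes one about a null set
  of reals. Coincidences between random times are excluded in this way.\<close>

lemma AE_resample:
  assumes [measurable]: "Measurable.pred P Q"
    and "\<And>w. AE a in expm (rate c). Q (w(c := a))"
  shows "AE w in P. Q w"
proof -
  have "(\<integral>\<^sup>+w. indicator {w. \<not> Q w} w \<partial>P) = (\<integral>\<^sup>+w. (\<integral>\<^sup>+a. indicator {w. \<not> Q w} (w(c := a)) \<partial>expm (rate c)) \<partial>P)"
    by (rule nn_integral_resample) simp
  also have "\<dots> = (\<integral>\<^sup>+w. 0 \<partial>P)"
    using assms(2) by (intro nn_integral_cong) (auto simp: nn_integral_0_iff_AE indicator_def elim!: eventually_mono)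
  finally have "AE w in P. indicator {w. \<not> Q w} w = (0::ennreal)"
    using nn_integral_0_iff_AE[of "indicator {w. \<not> Q w}" P] by simp
  then show ?thesis by eventually_elim (auto simp: indicator_def split: if_splits)
qed

definition Pos :: "('c \<Rightarrow> real) set" where "Pos = {w. \<forall>c. w c > 0}"

lemma AE_coordinate_pos: "AE w in P. w c > 0"
  by (rule AE_resample[of _ c]) (auto intro!: AE_expm_pos rate_pos)

end

text \<open>\<open>g n w s\<close> is the size of the jump that takes place if the variable
  \<open>c n\<close> has the value \<open>s\<close>; it must not react to changes of the coordinates
  \<open>c n\<close>, \<open>c (Suc n)\<close>, and so on. This is demanded only for positive
  values, because the queue is causal only for them; as \<open>S\<close> is countable, positivity on
  \<open>S\<close> is almost sure.\<close>

locale compensated_sums = exponential_family rate for rate :: "'c \<Rightarrow> real" +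
  fixes S :: "'c set" and c :: "nat \<Rightarrow> 'c" and r B :: real and g :: "nat \<Rightarrow> ('c \<Rightarrow> real) \<Rightarrow> real \<Rightarrow> real"
  assumes inj_c: "inj c" and rate_c: "rate (c n) = r" and c_S: "c n \<in> S" and S: "countable S"
    and g_meas: "(\<lambda>(w, s). g n w s) \<in> borel_measurable (P \<Otimes>\<^sub>M borel)"
    and g_bound: "\<bar>g n w s\<bar> \<le> B"
    and nonanticipating: "n \<le> m \<Longrightarrow> (\<And>c. c \<in> S \<Longrightarrow> w c > 0) \<Longrightarrow> a > 0 \<Longrightarrow> s > 0 \<Longrightarrow> g n (w(c m := a)) s = g n w s"
begin

definition D :: "nat \<Rightarrow> ('c \<Rightarrow> real) \<Rightarrow> real" where
  "D n w = g n w (w (c n)) - r * (LINT s:{0<..w (c n)}|lborel. g n w s)"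

lemma r_pos: "r > 0" using rate_pos[of "c 0"] rate_c by simp

lemma g_meas' [measurable]: "f \<in> measurable N P \<Longrightarrow> h \<in> borel_measurable N \<Longrightarrow> (\<lambda>x. g n (f x) (h x)) \<in> borel_measurable N"
  using measurable_compose[OF measurable_Pair[of f N P h borel] g_meas[of n]] by simp

lemma g_section [measurable]: "g n w \<in> borel_measurable borel"
  using g_meas'[of "\<lambda>_. w" borel "\<lambda>s. s"] by simp

lemma integral_g_meas [measurable]: "(\<lambda>w. LINT s:{0<..w (c n)}|lborel. g n w s) \<in> borel_measurable P"
proof -
  have "(\<lambda>w. \<integral>s. (if 0 < s \<and> s \<le> w (c n) then g n w s else 0) \<partial>lborel) \<in> borel_measurable P"
    by (intro lborel.borel_measurable_lebesgue_integral) measurable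
  then show ?thesis
    unfolding set_lebesgue_integral_def by (rule back_subst[of "\<lambda>f. f \<in> _"])
      (auto intro!: ext Bochner_Integration.integral_cong split: split_indicator)
qed

lemma D_meas [measurable]: "D n \<in> borel_measurable P"
  unfolding D_def[abs_def] by measurable

lemma AE_Pos: "AE w in P. \<forall>c\<in>S. w c > 0"
  using S AE_coordinate_pos by (simp add: AE_ball_countable)

lemma AE_pos: "AE a in expm r. a > 0" by (rule AE_expm_pos[OF r_pos])

lemma D_resample:
  assumes "\<forall>c\<in>S. w c > 0" "a > 0"
  shows "D n (w(c n := a)) = g n w a - r * (LINT s:{0<..a}|lborel. g n w s)"
proof -
  have "(LINT s:{0<..a}|lborel. g n (w(c n := a)) s) = (LINT s:{0<..a}|lborel. g n w s)"
    using assms by (intro set_lebesgue_integral_cong) (auto simp: nonanticipating)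
  then show ?thesis using assms by (simp add: D_def nonanticipating)
qed

lemma D_resample_later:
  assumes "\<forall>c\<in>S. w c > 0" "a > 0" "n < m"
  shows "D n (w(c m := a)) = D n w"
proof -
  have ne: "c n \<noteq> c m" using inj_c assms(3) by (auto dest: injD)
  have "(LINT s:{0<..w (c n)}|lborel. g n (w(c m := a)) s) = (LINT s:{0<..w (c n)}|lborel. g n w s)"
    using assms by (intro set_lebesgue_integral_cong) (auto simp: nonanticipating)
  then show ?thesis using assms ne c_S by (simp add: D_def nonanticipating)
qed

text \<open>The hazard identity in coordinate \<open>c n\<close>, with the others fixed. It brings
  the integral up to the actual value \<open>w (c n)\<close> into the moment bounds, and such
  integrals can later be rewritten over real time.\<close>

lemma g_resample:
  fixes f :: "real \<Rightarrow> ennreal"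
  assumes [measurable]: "f \<in> borel_measurable borel"
  shows "(\<integral>\<^sup>+w. (\<integral>\<^sup>+a. f (g n w a) \<partial>expm r) \<partial>P) = 
    (\<integral>\<^sup>+w. (\<integral>\<^sup>+s. ennreal r * f (g n w s) * indicator {0<..w (c n)} s \<partial>lborel) \<partial>P)"
proof -
  have m: "(\<lambda>w. \<integral>\<^sup>+s. (if 0 < s \<and> s \<le> w (c n) then ennreal r * f (g n w s) else 0) \<partial>lborel) \<in> borel_measurable P"
    by (intro lborel.borel_measurable_nn_integral) measurable
  have [measurable]: "(\<lambda>w. \<integral>\<^sup>+s. ennreal r * f (g n w s) * indicator {0<..w (c n)} s \<partial>lborel) \<in> borel_measurable P"
    by (rule back_subst[of "\<lambda>f. f \<in> _", OF m]) (auto intro!: ext nn_integral_cong split: split_indicator)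
  have "(\<integral>\<^sup>+w. (\<integral>\<^sup>+s. ennreal r * f (g n w s) * indicator {0<..w (c n)} s \<partial>lborel) \<partial>P) =
    (\<integral>\<^sup>+w. (\<integral>\<^sup>+a. (\<integral>\<^sup>+s. ennreal r * f (g n (w(c n := a)) s) * indicator {0<..a} s \<partial>lborel) \<partial>expm r) \<partial>P)"
    by (subst nn_integral_resample[of _ "c n"]) (simp_all add: rate_c)
  also have "\<dots> = (\<integral>\<^sup>+w. (\<integral>\<^sup>+a. (\<integral>\<^sup>+s. ennreal r * f (g n w s) * indicator {0<..a} s \<partial>lborel) \<partial>expm r) \<partial>P)"
    using AE_Pos by (intro nn_integral_cong_AE, eventually_elim)
      (intro nn_integral_cong_AE eventually_mono[OF AE_pos] nn_integral_cong,
       auto simp: nonanticipating split: split_indicator)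
  also have "\<dots> = (\<integral>\<^sup>+w. (\<integral>\<^sup>+a. f (g n w a) \<partial>expm r) \<partial>P)"
    by (intro nn_integral_cong expm_hazard_nn[OF r_pos, symmetric]) measurable
  finally show ?thesis by simp
qed

text \<open>Orthogonality of the terms. When coordinate \<open>c n\<close> is integrated out, the
  first \<open>n\<close> terms do not depend on it and play the role of the constant in
  \<open>expm_compensated\<close>.\<close>

lemma second_moment_sum:
  "(\<integral>\<^sup>+w. ennreal ((\<Sum>j<n. D j w)\<^sup>2) \<partial>P) =
   (\<Sum>j<n. \<integral>\<^sup>+w. (\<integral>\<^sup>+s. ennreal r * ennreal ((g j w s)\<^sup>2) * indicator {0<..w (c j)} s \<partial>lborel) \<partial>P)"
proof (induction n)
  case (Suc n)
  let ?S = "\<lambda>w. \<Sum>j<n. D j w"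
  have "(\<integral>\<^sup>+w. ennreal ((\<Sum>j<Suc n. D j w)\<^sup>2) \<partial>P) = 
    (\<integral>\<^sup>+w. (\<integral>\<^sup>+a. ennreal ((?S (w(c n := a)) + D n (w(c n := a)))\<^sup>2) \<partial>expm r) \<partial>P)"
    by (subst nn_integral_resample[of _ "c n"]) (simp_all add: rate_c)
  also have "\<dots> = (\<integral>\<^sup>+w. ennreal ((?S w)\<^sup>2) + (\<integral>\<^sup>+a. ennreal ((g n w a)\<^sup>2) \<partial>expm r) \<partial>P)"
  proof (intro nn_integral_cong_AE, use AE_Pos in eventually_elim)
    fix w :: "'c \<Rightarrow> real" assume w: "\<forall>c\<in>S. w c > 0"
    have "(\<integral>\<^sup>+a. ennreal ((?S (w(c n := a)) + D n (w(c n := a)))\<^sup>2) \<partial>expm r) =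
      (\<integral>\<^sup>+a. ennreal ((?S w + (g n w a - r * (LINT s:{0<..a}|lborel. g n w s)))\<^sup>2) \<partial>expm r)"
      using AE_pos by (intro nn_integral_cong_AE, eventually_elim) (simp add: D_resample[OF w] D_resample_later[OF w])
    also have "\<dots> = ennreal ((?S w)\<^sup>2) + (\<integral>\<^sup>+a. ennreal ((g n w a)\<^sup>2) \<partial>expm r)"
      by (rule expm_compensated(1)[OF r_pos g_section g_bound])
    finally show "(\<integral>\<^sup>+a. ennreal ((?S (w(c n := a)) + D n (w(c n := a)))\<^sup>2) \<partial>expm r) = 
       ennreal ((?S w)\<^sup>2) + (\<integral>\<^sup>+a. ennreal ((g n w a)\<^sup>2) \<partial>expm r)" .
  qed
  also have "\<dots> = (\<integral>\<^sup>+w. ennreal ((?S w)\<^sup>2) \<partial>P) + (\<integral>\<^sup>+w. (\<integral>\<^sup>+a. ennreal ((g n w a)\<^sup>2) \<partial>expm r) \<partial>P)"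
  proof (rule nn_integral_add)
    interpret R: prob_space "expm r" using prob_expm[of "c n"] by (simp add: rate_c)
    show "(\<lambda>w. \<integral>\<^sup>+a. ennreal ((g n w a)\<^sup>2) \<partial>expm r) \<in> borel_measurable P"
      by (intro R.borel_measurable_nn_integral) measurable
  qed measurable
  also have "(\<integral>\<^sup>+w. (\<integral>\<^sup>+a. ennreal ((g n w a)\<^sup>2) \<partial>expm r) \<partial>P) = 
     (\<integral>\<^sup>+w. (\<integral>\<^sup>+s. ennreal r * ennreal ((g n w s)\<^sup>2) * indicator {0<..w (c n)} s \<partial>lborel) \<partial>P)"
    by (rule g_resample) simp
  finally show ?case using Suc.IH by simp
qed simp

lemma first_moment_D:
  "(\<integral>\<^sup>+w. ennreal \<bar>D n w\<bar> \<partial>P) \<le> 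
   2 * (\<integral>\<^sup>+w. (\<integral>\<^sup>+s. ennreal r * ennreal \<bar>g n w s\<bar> * indicator {0<..w (c n)} s \<partial>lborel) \<partial>P)"
proof -
  interpret R: prob_space "expm r" using prob_expm[of "c n"] by (simp add: rate_c)
  have "(\<integral>\<^sup>+w. ennreal \<bar>D n w\<bar> \<partial>P) = (\<integral>\<^sup>+w. (\<integral>\<^sup>+a. ennreal \<bar>D n (w(c n := a))\<bar> \<partial>expm r) \<partial>P)"
    by (subst nn_integral_resample[of _ "c n"]) (simp_all add: rate_c)
  also have "\<dots> \<le> (\<integral>\<^sup>+w. 2 * (\<integral>\<^sup>+a. ennreal \<bar>g n w a\<bar> \<partial>expm r) \<partial>P)"
  proof (intro nn_integral_mono_AE, use AE_Pos in eventually_elim)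
    fix w :: "'c \<Rightarrow> real" assume w: "\<forall>c\<in>S. w c > 0"
    have "(\<integral>\<^sup>+a. ennreal \<bar>D n (w(c n := a))\<bar> \<partial>expm r) = 
        (\<integral>\<^sup>+a. ennreal \<bar>g n w a - r * (LINT s:{0<..a}|lborel. g n w s)\<bar> \<partial>expm r)"
      using AE_pos by (intro nn_integral_cong_AE, eventually_elim) (simp add: D_resample[OF w])
    also have "\<dots> \<le> 2 * (\<integral>\<^sup>+a. ennreal \<bar>g n w a\<bar> \<partial>expm r)"
      by (rule expm_compensated(3)[OF r_pos g_section g_bound])
    finally show "(\<integral>\<^sup>+a. ennreal \<bar>D n (w(c n := a))\<bar> \<partial>expm r) \<le> 2 * (\<integral>\<^sup>+a. ennreal \<bar>g n w a\<bar> \<partial>expm r)" .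
  qed
  also have "\<dots> = 2 * (\<integral>\<^sup>+w. (\<integral>\<^sup>+a. ennreal \<bar>g n w a\<bar> \<partial>expm r) \<partial>P)"
  proof (rule nn_integral_cmult)
    show "(\<lambda>w. \<integral>\<^sup>+a. ennreal \<bar>g n w a\<bar> \<partial>expm r) \<in> borel_measurable P"
      by (intro R.borel_measurable_nn_integral) measurable
  qed
  also have "(\<integral>\<^sup>+w. (\<integral>\<^sup>+a. ennreal \<bar>g n w a\<bar> \<partial>expm r) \<partial>P) = 
     (\<integral>\<^sup>+w. (\<integral>\<^sup>+s. ennreal r * ennreal \<bar>g n w s\<bar> * indicator {0<..w (c n)} s \<partial>lborel) \<partial>P)"
    by (rule g_resample) simp
  finally show ?thesis .
qed

lemma integral_D: "integrable P (D n) \<Longrightarrow> (\<integral>w. D n w \<partial>P) = 0"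
proof -
  assume i: "integrable P (D n)"
  interpret R: prob_space "expm r" using prob_expm[of "c n"] by (simp add: rate_c)
  have "(\<integral>w. D n w \<partial>P) = (\<integral>w. (\<integral>a. D n (w(c n := a)) \<partial>expm r) \<partial>P)"
    using integral_resample[OF i, of "c n"] by (simp add: rate_c)
  also have "\<dots> = (\<integral>w. 0 \<partial>P)"
  proof (intro integral_cong_AE)
    show "(\<lambda>w. \<integral>a. D n (w(c n := a)) \<partial>expm r) \<in> borel_measurable P"
      by (intro R.borel_measurable_lebesgue_integral) measurable
    show "AE w in P. (\<integral>a. D n (w(c n := a)) \<partial>expm r) = 0"
      using AE_Pos
    proof eventually_elim
      fix w :: "'c \<Rightarrow> real" assume w: "\<forall>c\<in>S. w c > 0"
      have "(\<integral>a. D n (w(c n := a)) \<partial>expm r) = (\<integral>a. g n w a - r * (LINT s:{0<..a}|lborel. g n w s) \<partial>expm r)"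
      proof (intro integral_cong_AE)
        show "AE a in expm r. D n (w(c n := a)) = g n w a - r * (LINT s:{0<..a}|lborel. g n w s)"
          using AE_pos by eventually_elim (simp add: D_resample[OF w])
        show "(\<lambda>a. D n (w(c n := a))) \<in> borel_measurable (expm r)"
          by (rule measurable_compose[OF _ D_meas]) (simp add: measurable_resample)
      qed simp
      also have "\<dots> = 0" by (rule expm_compensated(2)[OF r_pos g_section g_bound])
      finally show "(\<integral>a. D n (w(c n := a)) \<partial>expm r) = 0" .
    qed
  qed simp
  finally show ?thesis by simp
qed

text \<open>The deterministic bound \<open>H\<close> makes the first absolute moments of the terms
  summable, so the series may be integrated term by term; this gives integrability and mean zero.
  The second moment passes to the limit by Fatou, hence only as an inequality.\<close>

theorem compensated_limit:
  assumes M: "AE w in P. (\<lambda>n. D n w) sums M w" and [measurable]: "M \<in> borel_measurable P"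
    and V [measurable]: "V \<in> borel_measurable P"
    and V_le: "AE w in P. \<forall>n. (\<Sum>j<n. \<integral>\<^sup>+s. ennreal ((g j w s)\<^sup>2) * indicator {0<..w (c j)} s \<partial>lborel) \<le> V w"
    and H: "AE w in P. \<forall>n. (\<Sum>j<n. \<integral>\<^sup>+s. ennreal \<bar>g j w s\<bar> * indicator {0<..w (c j)} s \<partial>lborel) \<le> ennreal H"
  shows "integrable P M" "(\<integral>w. M w \<partial>P) = 0"
    "(\<integral>\<^sup>+w. ennreal ((M w)\<^sup>2) \<partial>P) \<le> ennreal r * (\<integral>\<^sup>+w. V w \<partial>P)"
proof -
  have gm: "(\<lambda>w. \<integral>\<^sup>+s. f (g n w s) * indicator {0<..w (c n)} s \<partial>lborel) \<in> borel_measurable P"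
    if [measurable]: "f \<in> borel_measurable borel" for f :: "real \<Rightarrow> ennreal" and n
  proof -
    have m: "(\<lambda>w. \<integral>\<^sup>+s. (if 0 < s \<and> s \<le> w (c n) then f (g n w s) else 0) \<partial>lborel) \<in> borel_measurable P"
      by (intro lborel.borel_measurable_nn_integral) measurable
    show ?thesis
      by (rule back_subst[of "\<lambda>f. f \<in> _", OF m]) (auto intro!: ext nn_integral_cong split: split_indicator)
  qed
  have r1: "(\<integral>\<^sup>+s. ennreal r * f (g n w s) * indicator {0<..w (c n)} s \<partial>lborel) =
     ennreal r * (\<integral>\<^sup>+s. f (g n w s) * indicator {0<..w (c n)} s \<partial>lborel)"
    if [measurable]: "f \<in> borel_measurable borel" for f :: "real \<Rightarrow> ennreal" and n w
    by (subst nn_integral_cmult[symmetric]) (auto simp: mult_ac)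
  \<comment> \<open>\<open>max 0 H\<close> because \<open>ennreal\<close> sends a negative
    \<open>H\<close> to 0; the factor 2 stems from \<open>first_moment_D\<close>.\<close>
  have Dsum: "(\<Sum>j<n. \<integral>\<^sup>+w. ennreal \<bar>D j w\<bar> \<partial>P) \<le> ennreal (2 * (r * max 0 H))" for n
  proof -
    have "(\<Sum>j<n. \<integral>\<^sup>+w. ennreal \<bar>D j w\<bar> \<partial>P) \<le> 
      (\<Sum>j<n. 2 * (\<integral>\<^sup>+w. ennreal r * (\<integral>\<^sup>+s. ennreal \<bar>g j w s\<bar> * indicator {0<..w (c j)} s \<partial>lborel) \<partial>P))"
      using first_moment_D by (intro sum_mono) (simp add: r1[of "\<lambda>x. ennreal \<bar>x\<bar>"])
    also have "\<dots> = 2 * (ennreal r * (\<integral>\<^sup>+w. (\<Sum>j<n. \<integral>\<^sup>+s. ennreal \<bar>g j w s\<bar> * indicator {0<..w (c j)} s \<partial>lborel) \<partial>P))"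
      using gm[of "\<lambda>x. ennreal \<bar>x\<bar>"] by (simp add: nn_integral_cmult nn_integral_sum sum_distrib_left)
    also have "\<dots> \<le> 2 * (ennreal r * (\<integral>\<^sup>+w. ennreal H \<partial>P))"
      using H by (intro mult_left_mono nn_integral_mono_AE) (auto elim: eventually_mono)
    also have "\<dots> = ennreal (2 * (r * max 0 H))"
      using r_pos P.emeasure_space_1 by (simp add: ennreal_mult' ennreal_mult max_def) (simp add: ennreal_neg)
    finally show ?thesis .
  qed
  have i_D: "integrable P (D n)" for n
  proof (rule integrableI_bounded)
    have "(\<integral>\<^sup>+w. ennreal \<bar>D n w\<bar> \<partial>P) \<le> (\<Sum>j<Suc n. \<integral>\<^sup>+w. ennreal \<bar>D j w\<bar> \<partial>P)"
      by (simp add: add_increasing)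
    also note Dsum
    finally show "(\<integral>\<^sup>+w. ennreal (norm (D n w)) \<partial>P) < \<infinity>"
      by (simp add: le_less_trans)
  qed simp
  have absD: "(\<integral>\<^sup>+w. ennreal \<bar>D j w\<bar> \<partial>P) = ennreal (\<integral>w. norm (D j w) \<partial>P)" for j
    by (subst nn_integral_eq_integral) (use i_D in auto)
  have sm: "summable (\<lambda>j. \<integral>w. norm (D j w) \<partial>P)"
  proof (rule summableI_nonneg_bounded)
    fix n
    have "ennreal (\<Sum>j<n. \<integral>w. norm (D j w) \<partial>P) \<le> ennreal (2 * (r * max 0 H))"
      using Dsum[of n] by (simp add: absD sum_ennreal)
    then show "(\<Sum>j<n. \<integral>w. norm (D j w) \<partial>P) \<le> 2 * (r * max 0 H)"
      using r_pos by (subst (asm) ennreal_le_iff) auto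
  qed simp
  have "(\<integral>\<^sup>+w. (\<Sum>j. ennreal \<bar>D j w\<bar>) \<partial>P) = (\<Sum>j. \<integral>\<^sup>+w. ennreal \<bar>D j w\<bar> \<partial>P)"
    by (rule nn_integral_suminf) simp
  also have "\<dots> \<le> ennreal (2 * (r * max 0 H))"
    by (intro suminf_le_const[OF summableI] Dsum)
  finally have "(\<integral>\<^sup>+w. (\<Sum>j. ennreal \<bar>D j w\<bar>) \<partial>P) \<noteq> \<infinity>"
    by (auto simp: top_unique)
  then have "AE w in P. (\<Sum>j. ennreal \<bar>D j w\<bar>) \<noteq> \<infinity>"
    by (rule nn_integral_PInf_AE[rotated]) simp
  then have smD: "AE w in P. summable (\<lambda>j. norm (D j w))"
    by eventually_elim (auto intro!: summable_suminf_not_top)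
  have MD: "AE w in P. M w = (\<Sum>j. D j w)" using M by eventually_elim (auto dest: sums_unique)
  have i2: "integrable P (\<lambda>w. \<Sum>j. D j w)" by (rule integrable_suminf[OF i_D smD sm])
  show "integrable P M" by (rule integrable_cong_AE_imp[OF i2]) (use MD in auto)
  have "(\<integral>w. M w \<partial>P) = (\<integral>w. (\<Sum>j. D j w) \<partial>P)"
    by (rule integral_cong_AE) (use i2 MD in auto)
  also have "\<dots> = 0" by (subst integral_suminf[OF i_D smD sm]) (simp add: integral_D i_D)
  finally show "(\<integral>w. M w \<partial>P) = 0" .
  have "(\<integral>\<^sup>+w. ennreal ((M w)\<^sup>2) \<partial>P) = (\<integral>\<^sup>+w. liminf (\<lambda>n. ennreal ((\<Sum>j<n. D j w)\<^sup>2)) \<partial>P)"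
  proof (intro nn_integral_cong_AE, use M in eventually_elim)
    fix w assume "(\<lambda>n. D n w) sums M w"
    then have "(\<lambda>n. ennreal ((\<Sum>j<n. D j w)\<^sup>2)) \<longlonglongrightarrow> ennreal ((M w)\<^sup>2)"
      unfolding sums_def by (intro tendsto_intros)
    then show "ennreal ((M w)\<^sup>2) = liminf (\<lambda>n. ennreal ((\<Sum>j<n. D j w)\<^sup>2))"
      using lim_imp_Liminf[of sequentially] by (metis trivial_limit_sequentially)
  qed
  also have "\<dots> \<le> liminf (\<lambda>n. \<integral>\<^sup>+w. ennreal ((\<Sum>j<n. D j w)\<^sup>2) \<partial>P)"
    by (rule nn_integral_liminf) simp
  also have "\<dots> \<le> limsup (\<lambda>n. \<integral>\<^sup>+w. ennreal ((\<Sum>j<n. D j w)\<^sup>2) \<partial>P)"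
    by (rule Liminf_le_Limsup) simp
  also have "\<dots> \<le> ennreal r * (\<integral>\<^sup>+w. V w \<partial>P)"
  proof (rule Limsup_bounded, rule always_eventually, rule allI)
    fix n
    have "(\<integral>\<^sup>+w. ennreal ((\<Sum>j<n. D j w)\<^sup>2) \<partial>P) =
     ennreal r * (\<integral>\<^sup>+w. (\<Sum>j<n. (\<integral>\<^sup>+s. ennreal ((g j w s)\<^sup>2) * indicator {0<..w (c j)} s \<partial>lborel)) \<partial>P)"
      using gm[of "\<lambda>x. ennreal (x\<^sup>2)"]
      by (simp add: second_moment_sum r1[of "\<lambda>x. ennreal (x\<^sup>2)"] nn_integral_cmult nn_integral_sum sum_distrib_left)
    also have "\<dots> \<le> ennreal r * (\<integral>\<^sup>+w. V w \<partial>P)"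
      using V_le by (intro mult_left_mono nn_integral_mono_AE) (auto elim: eventually_mono)
    finally show "(\<integral>\<^sup>+w. ennreal ((\<Sum>j<n. D j w)\<^sup>2) \<partial>P) \<le> ennreal r * (\<integral>\<^sup>+w. V w \<partial>P)" .
  qed
  finally show "(\<integral>\<^sup>+w. ennreal ((M w)\<^sup>2) \<partial>P) \<le> ennreal r * (\<integral>\<^sup>+w. V w \<partial>P)" .
qed

end

section \<open>Clocks that run on a set of times\<close>

definition work :: "real set \<Rightarrow> real \<Rightarrow> real \<Rightarrow> real" where
  "work I a t = measure lborel ({a..t} \<inter> I)"

text \<open>Generalized inverse of the clock reading \<open>work I a\<close>: the first time at
  which a clock started at \<open>a\<close>, running only on \<open>I\<close>, shows
  \<open>s\<close>. It is meaningful when that reading is reached at all.\<close>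

definition finish :: "real set \<Rightarrow> real \<Rightarrow> real \<Rightarrow> real" where
  "finish I a s = Inf {t. a \<le> t \<and> s \<le> work I a t}"

lemma work_nonneg: "0 \<le> work I a t"
  by (simp add: work_def)

lemma work_before: "t \<le> a \<Longrightarrow> work I a t = 0"
proof -
  assume "t \<le> a"
  then have "{a..t} \<inter> I = {} \<or> {a..t} \<inter> I = {a}" by (cases "t = a"; cases "a \<in> I") auto
  then show ?thesis by (auto simp: work_def)
qed

context
  fixes I :: "real set"
  assumes I [measurable]: "I \<in> sets borel"
begin

lemma emeasure_work: "emeasure lborel ({a..t} \<inter> I) = ennreal (work I a t)"
proof -
  have "emeasure lborel ({a..t} \<inter> I) \<le> emeasure lborel {a..t}"
    by (rule emeasure_mono) auto
  also have "\<dots> < \<infinity>" by (simp add: emeasure_lborel_Icc_eq)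
  finally show ?thesis unfolding work_def by (subst emeasure_eq_ennreal_measure) auto
qed

lemma emeasure_work_increment:
  assumes "a \<le> s" "s \<le> t"
  shows "emeasure lborel ({s<..t} \<inter> I) = ennreal (work I a t - work I a s)"
proof -
  have "{a..t} \<inter> I = ({a..s} \<inter> I) \<union> ({s<..t} \<inter> I)" using assms by auto
  then have "emeasure lborel ({a..t} \<inter> I) = emeasure lborel ({a..s} \<inter> I) + emeasure lborel ({s<..t} \<inter> I)"
    by (simp only:) (rule plus_emeasure[symmetric], auto)
  then have "ennreal (work I a t) = ennreal (work I a s) + emeasure lborel ({s<..t} \<inter> I)"
    by (simp only: emeasure_work)
  then show ?thesis
    by (subst ennreal_minus[symmetric, OF work_nonneg]) simp
qed

lemma work_mono: "s \<le> t \<Longrightarrow> work I a s \<le> work I a t"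
proof -
  assume "s \<le> t"
  then have "emeasure lborel ({a..s} \<inter> I) \<le> emeasure lborel ({a..t} \<inter> I)"
    by (intro emeasure_mono) auto
  then show ?thesis by (simp add: emeasure_work work_nonneg)
qed

lemma work_le: assumes "s \<le> t" shows "work I a t \<le> work I a s + (t - s)"
proof (cases "a \<le> s")
  case True
  have "ennreal (work I a t - work I a s) = emeasure lborel ({s<..t} \<inter> I)"
    by (rule emeasure_work_increment[OF True assms, symmetric])
  also have "\<dots> \<le> emeasure lborel {s<..t}" by (rule emeasure_mono) auto
  also have "\<dots> = ennreal (t - s)" using assms by simp
  finally show ?thesis using assms by (subst (asm) ennreal_le_iff) auto
next
  case False
  show ?thesis
  proof (cases "a \<le> t")
    case True
    have "ennreal (work I a t) \<le> emeasure lborel {a..t}"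
      unfolding emeasure_work[symmetric] by (rule emeasure_mono) auto
    then have "work I a t \<le> t - a" using True by simp
    then show ?thesis using False work_nonneg[of I a s] by simp
  qed (use False assms in \<open>simp add: work_before\<close>)
qed

lemma work_lipschitz: "\<bar>work I a t - work I a s\<bar> \<le> \<bar>t - s\<bar>"
  using work_le[of s t a] work_le[of t s a] work_mono[of s t a] work_mono[of t s a] by (cases "s \<le> t") auto

lemma continuous_work: "continuous_on UNIV (work I a)"
proof -
  have "1-lipschitz_on UNIV (work I a)"
    by (rule lipschitz_onI) (use work_lipschitz in \<open>auto simp: dist_real_def\<close>)
  then show ?thesis by (rule lipschitz_on_continuous_on)
qed

context
  fixes a u s :: real
  assumes s: "0 < s" "s \<le> work I a u"
begin

text \<open>The reading is nondecreasing and 1-Lipschitz, so the set of times at which it is at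
  least \<open>s\<close> is closed and the infimum is attained. The equivalence is the Galois
  connection between the reading and its inverse; measurability and the change of variables rest on
  it.\<close>

lemma finish_le_iff: "finish I a s \<le> v \<longleftrightarrow> s \<le> work I a v"
  and work_finish: "work I a (finish I a s) = s"
  and finish_le: "finish I a s \<le> u"
  and finish_gt: "a < finish I a s"
proof -
  let ?A = "{t. a \<le> t \<and> s \<le> work I a t}"
  have au: "a < u" using s work_before[of u a I] by (cases "u \<le> a") auto
  have cl: "closed ?A"
    by (intro closed_Collect_conj closed_Collect_le continuous_intros continuous_work)
  have bd: "bdd_below ?A" by (auto intro: bdd_belowI)
  have ne: "u \<in> ?A" using au s by auto
  have inA: "finish I a s \<in> ?A"
    unfolding finish_def by (rule closed_contains_Inf[OF _ bd cl]) (use ne in blast)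
  show "finish I a s \<le> u"
    unfolding finish_def by (rule cInf_lower[OF ne bd])
  show gt: "a < finish I a s" using inA s work_before[of a a I] by (cases "a = finish I a s") auto
  show iff: "finish I a s \<le> v \<longleftrightarrow> s \<le> work I a v" for v
  proof
    assume "finish I a s \<le> v"
    with work_mono[OF this, of a] inA show "s \<le> work I a v" by auto
  next
    assume v: "s \<le> work I a v"
    then have "a \<le> v" using work_before[of v a I] s by (cases "v \<le> a") auto
    then have "v \<in> ?A" using v by simp
    then show "finish I a s \<le> v" unfolding finish_def by (rule cInf_lower[OF _ bd])
  qed
  show "work I a (finish I a s) = s"
  proof (rule antisym)
    show "s \<le> work I a (finish I a s)" using inA by simp
    show "work I a (finish I a s) \<le> s"
    proof (rule ccontr)
      assume "\<not> ?thesis"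
      then have *: "s < work I a (finish I a s)" by simp
      \<comment> \<open>Half of the supposed overshoot. Going back in time by \<open>e\<close> loses
        at most \<open>e\<close> of work, so the reading \<open>s\<close> would have been reached
        before its first time.\<close>
      define e where "e = (work I a (finish I a s) - s) / 2"
      have "e > 0" using * by (simp add: e_def)
      have "work I a (finish I a s) \<le> work I a (finish I a s - e) + e"
        using work_le[of "finish I a s - e" "finish I a s" a] \<open>e > 0\<close> by simp
      then have "s \<le> work I a (finish I a s - e)" unfolding e_def using * by (simp add: field_simps)
      then have "finish I a s \<le> finish I a s - e" using iff by blast
      then show False using \<open>e > 0\<close> by simp
    qed
  qed
qed

lemma work_less_before_finish: "v < finish I a s \<longleftrightarrow> work I a v < s"
  using finish_le_iff[of v] by auto

end

text \<open>Both measures give the half-line beyond \<open>v\<close> the mass by which the reading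
  grows from \<open>v\<close> to \<open>u\<close> (0 if it does not grow), and finite values on
  half-lines determine a measure. Outside the readings attained by time \<open>u\<close>,
  \<open>C\<close> takes the value \<open>u\<close>, so that it is a total measurable
  function.\<close>

lemma time_change:
  defines "C \<equiv> \<lambda>u a s. if 0 < s \<and> s \<le> work I a u then finish I a s else u"
  shows "distr (density lborel (indicator {0<..work I a u})) borel (C u a) = density lborel (indicator ({a<..u} \<inter> I))"
    and "C u a \<in> borel_measurable borel"
proof -
  show C [measurable]: "C u a \<in> borel_measurable borel"
  proof (rule borel_measurableI_le)
    fix v
    have "{s \<in> space borel. C u a s \<le> v} = 
       ({0<..work I a u} \<inter> {..work I a v}) \<union> (if u \<le> v then - {0<..work I a u} else {})"
      by (auto simp: C_def finish_le_iff split: if_splits)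
    also have "\<dots> \<in> sets borel" by (auto intro!: sets.Un)
    finally show "{s \<in> space borel. C u a s \<le> v} \<in> sets borel" .
  qed
  have less: "emeasure (density lborel (indicator A)) B = emeasure lborel (A \<inter> B)" 
    if "A \<in> sets borel" "B \<in> sets borel" for A B :: "real set"
    using that by (subst emeasure_density) (auto simp flip: indicator_inter_arith)
  show "distr (density lborel (indicator {0<..work I a u})) borel (C u a) = density lborel (indicator ({a<..u} \<inter> I))"
  proof (rule measure_eqI_lessThan)
    fix v :: real
    have "emeasure (distr (density lborel (indicator {0<..work I a u})) borel (C u a)) {v<..} =
        emeasure (density lborel (indicator {0<..work I a u})) (C u a -` {v<..})"
      by (subst emeasure_distr) auto
    also have "\<dots> = emeasure lborel ({0<..work I a u} \<inter> C u a -` {v<..})"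
      using measurable_sets[OF C, of "{v<..}"] by (intro less) auto
    also have "{0<..work I a u} \<inter> C u a -` {v<..} = {s. 0 < s \<and> s \<le> work I a u \<and> work I a v < s}"
      by (auto simp: C_def work_less_before_finish)
    also have "\<dots> = {work I a v<..work I a u}" using work_nonneg[of I a v] by auto
    finally have 1: "emeasure (distr (density lborel (indicator {0<..work I a u})) borel (C u a)) {v<..} = emeasure lborel {work I a v<..work I a u}" .
    have "emeasure (density lborel (indicator ({a<..u} \<inter> I))) {v<..} = emeasure lborel ({a<..u} \<inter> I \<inter> {v<..})"
      by (rule less) auto
    also have "{a<..u} \<inter> I \<inter> {v<..} = {max a v<..u} \<inter> I" by auto
    also have "emeasure lborel \<dots> = emeasure lborel {work I a v<..work I a u}"
    proof (cases "max a v \<le> u")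
      case True
      have "work I a (max a v) = work I a v" by (auto simp: max_def work_before)
      then show ?thesis using emeasure_work_increment[OF _ True, of a] work_mono[of "max a v" u a] True by simp
    next
      case False
      then consider "u < a" | "u < v" by linarith
      then have "work I a u \<le> work I a v"
        by cases (auto simp: work_before work_nonneg work_mono)
      moreover have "{max a v<..u} = {}" using False by auto
      ultimately show ?thesis by (simp only: Int_empty_left greaterThanAtMost_empty)
    qed
    finally have 2: "emeasure (density lborel (indicator ({a<..u} \<inter> I))) {v<..} = emeasure lborel {work I a v<..work I a u}" .
    show "emeasure (distr (density lborel (indicator {0<..work I a u})) borel (C u a)) {v<..} = emeasure (density lborel (indicator ({a<..u} \<inter> I))) {v<..}"
      using 1 2 by simp
    show "emeasure (distr (density lborel (indicator {0<..work I a u})) borel (C u a)) {v<..} < \<infinity>"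
      unfolding 1 by (cases "work I a v \<le> work I a u") auto
  qed simp_all
qed

lemma time_change_nn_integral:
  assumes [measurable]: "f \<in> borel_measurable borel"
  shows "(\<integral>\<^sup>+s. f (finish I a s) * indicator {0<..work I a u} s \<partial>lborel) = (\<integral>\<^sup>+t. f t * indicator ({a<..u} \<inter> I) t \<partial>lborel)"
proof -
  let ?C = "\<lambda>s. if 0 < s \<and> s \<le> work I a u then finish I a s else u"
  have [measurable]: "?C \<in> borel_measurable borel" by (rule time_change(2))
  have "(\<integral>\<^sup>+t. f t * indicator ({a<..u} \<inter> I) t \<partial>lborel) = (\<integral>\<^sup>+t. f t \<partial>density lborel (indicator ({a<..u} \<inter> I)))"
    by (subst nn_integral_density) (auto simp: mult.commute)
  also have "\<dots> = (\<integral>\<^sup>+s. f (?C s) \<partial>density lborel (indicator {0<..work I a u}))"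
    unfolding time_change(1)[symmetric] by (subst nn_integral_distr) auto
  also have "\<dots> = (\<integral>\<^sup>+s. f (finish I a s) * indicator {0<..work I a u} s \<partial>lborel)"
    by (subst nn_integral_density) (auto intro!: nn_integral_cong split: split_indicator)
  finally show ?thesis by simp
qed

lemma time_change_integral:
  fixes f :: "real \<Rightarrow> real"
  assumes [measurable]: "f \<in> borel_measurable borel"
  shows "(LINT s:{0<..work I a u}|lborel. f (finish I a s)) = (LINT t:{a<..u} \<inter> I|lborel. f t)"
proof -
  let ?C = "\<lambda>s. if 0 < s \<and> s \<le> work I a u then finish I a s else u"
  have [measurable]: "?C \<in> borel_measurable borel" by (rule time_change(2))
  have ind: "density lborel (indicator A) = density lborel (\<lambda>x. ennreal (indicator A x))" for A :: "real set"
    by (simp add: ennreal_indicator)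
  have "(LINT t:{a<..u} \<inter> I|lborel. f t) = (\<integral>t. f t \<partial>density lborel (indicator ({a<..u} \<inter> I)))"
    unfolding ind by (subst integral_density) (auto simp: set_lebesgue_integral_def)
  also have "\<dots> = (\<integral>s. f (?C s) \<partial>density lborel (indicator {0<..work I a u}))"
    unfolding time_change(1)[symmetric] by (subst integral_distr) auto
  also have "\<dots> = (LINT s:{0<..work I a u}|lborel. f (finish I a s))"
    unfolding ind by (subst integral_density)
      (auto simp: set_lebesgue_integral_def intro!: Bochner_Integration.integral_cong split: split_indicator)
  finally show ?thesis by simp
qed

end

text \<open>A left limit made total: sampled along a sequence and clipped to the interval from
  \<open>- B\<close> to \<open>B\<close>. It is bounded and measurable by construction and depends
  only on values strictly before \<open>t\<close>, even where no left limit exists.\<close>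

definition left_lim :: "real \<Rightarrow> (real \<Rightarrow> real) \<Rightarrow> real \<Rightarrow> real" where
  "left_lim B y t = max (- B) (min B (lim (\<lambda>m. y (t - 1 / Suc m))))"

lemma left_lim_cong: "(\<And>s. s < t \<Longrightarrow> y s = z s) \<Longrightarrow> left_lim B y t = left_lim B z t"
  by (simp add: left_lim_def)

lemma abs_left_lim: "B \<ge> 0 \<Longrightarrow> \<bar>left_lim B y t\<bar> \<le> B"
  by (auto simp: left_lim_def)

lemma left_lim_eq:
  assumes "(y \<longlongrightarrow> l) (at_left t)" and "\<bar>l\<bar> \<le> B"
  shows "left_lim B y t = l"
proof -
  have "filterlim (\<lambda>m. t - 1 / Suc m) (at_left t) sequentially"
  proof -
    have "(\<lambda>m. t - 1 / Suc m) \<longlonglongrightarrow> t - 0"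
      by (intro tendsto_diff tendsto_const) (use LIMSEQ_inverse_real_of_nat in \<open>simp only: inverse_eq_divide\<close>)
    then show ?thesis unfolding filterlim_at by simp
  qed
  from filterlim_compose[OF assms(1) this] have "lim (\<lambda>m. y (t - 1 / Suc m)) = l"
    by (rule limI)
  then show ?thesis using assms(2) by (simp add: left_lim_def)
qed

lemma measurable_left_lim [measurable]:
  assumes "(\<lambda>(w, t). Y w t) \<in> borel_measurable (N \<Otimes>\<^sub>M borel)"
  assumes [measurable]: "f \<in> measurable L N" "h \<in> borel_measurable L"
  shows "(\<lambda>x. left_lim B (Y (f x)) (h x)) \<in> borel_measurable L"
proof -
  have Y: "(\<lambda>x. Y (f x) (h x)) \<in> borel_measurable L" if "h \<in> borel_measurable L" for h
    using measurable_compose[OF measurable_Pair[OF assms(2) that] assms(1)] by simp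
  have "(\<lambda>x. lim (\<lambda>m. Y (f x) (h x - 1 / Suc m))) \<in> borel_measurable L"
    by (rule borel_measurable_lim_metric, rule Y) simp
  then show ?thesis
    unfolding left_lim_def by (intro borel_measurable_max borel_measurable_min borel_measurable_const)
qed

section \<open>The compensated process of completions of a clock\<close>

text \<open>Clock number \<open>n\<close> starts at time \<open>\<sigma> n\<close>, advances at unit speed on the set of times \<open>Run\<close>, and rings
  when it shows the exponential variable \<open>c n\<close>, unless the deadline \<open>d n\<close> comes first. Arrivals and service
  completions are both of this kind. The process \<open>Y\<close> observed just before ringing must not anticipate
  the variable that causes the ringing.\<close>

locale clocks = exponential_family rate for rate :: "'c \<Rightarrow> real" +
  fixes S :: "'c set" and c :: "nat \<Rightarrow> 'c" and r B \<tau> :: real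
    and \<sigma> d :: "nat \<Rightarrow> ('c \<Rightarrow> real) \<Rightarrow> real" and Run :: "('c \<Rightarrow> real) \<Rightarrow> real set" and Y :: "('c \<Rightarrow> real) \<Rightarrow> real \<Rightarrow> real"
  assumes inj_c: "inj c" and rate_c: "\<And>n. rate (c n) = r" and c_S: "\<And>n. c n \<in> S" and S: "countable S"
    and \<sigma>_meas [measurable]: "\<And>n. \<sigma> n \<in> borel_measurable P" and d_meas [measurable]: "\<And>n. d n \<in> borel_measurable P"
    and d_le: "\<And>n w. d n w \<le> \<tau>" and \<sigma>_nonneg: "\<And>n w. (\<And>c. c \<in> S \<Longrightarrow> w c > 0) \<Longrightarrow> \<sigma> n w \<ge> 0" and \<tau>: "\<tau> \<ge> 0"
    and Run_meas: "Measurable.pred (P \<Otimes>\<^sub>M borel) (\<lambda>(w, t). t \<in> Run w)"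
    and Y_meas: "(\<lambda>(w, t). Y w t) \<in> borel_measurable (P \<Otimes>\<^sub>M borel)" and B: "B \<ge> 0"
    and \<sigma>_upd: "\<And>n m w a. n \<le> m \<Longrightarrow> \<sigma> n (w(c m := a)) = \<sigma> n w" and d_upd: "\<And>n m w a. n \<le> m \<Longrightarrow> d n (w(c m := a)) = d n w"
    and Run_upd: "\<And>n w a. Run (w(c n := a)) = Run w"
    and Y_upd_start: "\<And>n w a t. (\<And>c. c \<in> S \<Longrightarrow> w c > 0) \<Longrightarrow> a > 0 \<Longrightarrow> t < \<tau> \<Longrightarrow> t < \<sigma> n w \<Longrightarrow> Y (w(c n := a)) t = Y w t"
    and Y_upd_run: "\<And>n w a t. (\<And>c. c \<in> S \<Longrightarrow> w c > 0) \<Longrightarrow> a > 0 \<Longrightarrow> t < d n w \<Longrightarrow>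
          work (Run w) (\<sigma> n w) t < w (c n) \<Longrightarrow> work (Run w) (\<sigma> n w) t < a \<Longrightarrow> Y (w(c n := a)) t = Y w t"
    and successive: "\<And>n m w. n < m \<Longrightarrow> (\<And>c. c \<in> S \<Longrightarrow> w c > 0) \<Longrightarrow> w (c n) \<le> work (Run w) (\<sigma> n w) (d n w) \<Longrightarrow>
          finish (Run w) (\<sigma> n w) (w (c n)) \<le> \<sigma> m w"
begin

definition W :: "nat \<Rightarrow> ('c \<Rightarrow> real) \<Rightarrow> real \<Rightarrow> real" where "W n w t = work (Run w) (\<sigma> n w) t"

definition ring :: "nat \<Rightarrow> ('c \<Rightarrow> real) \<Rightarrow> real" where "ring n w = finish (Run w) (\<sigma> n w) (w (c n))"

definition rings :: "('c \<Rightarrow> real) \<Rightarrow> nat \<Rightarrow> bool" where "rings w n \<longleftrightarrow> w (c n) \<le> W n w (d n w)"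

definition active :: "nat \<Rightarrow> ('c \<Rightarrow> real) \<Rightarrow> real set" where
  "active n w = {\<sigma> n w<..(if rings w n then ring n w else d n w)} \<inter> Run w"

text \<open>Coordinate \<open>c n\<close> is overwritten by the argument, so the actual value of
  \<open>w (c n)\<close> is not seen: this is \<open>Y\<close> just before the ringing, had the
  clock been set to \<open>s\<close>. Readings that the clock does not attain by its deadline cause
  no ringing and get 0.\<close>

definition g :: "nat \<Rightarrow> ('c \<Rightarrow> real) \<Rightarrow> real \<Rightarrow> real" where
  "g n w s = (if 0 < s \<and> s \<le> W n w (d n w) then left_lim B (Y (w(c n := s))) (finish (Run w) (\<sigma> n w) s) else 0)"

lemma Run_borel [measurable]: "Run w \<in> sets borel"
proof -
  have "Measurable.pred borel (\<lambda>t. (\<lambda>(w, t). t \<in> Run w) (w, t))"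
    by (rule measurable_compose[OF _ Run_meas]) simp
  then show ?thesis by (simp add: pred_def)
qed

lemma W_meas [measurable]:
  assumes [measurable]: "f \<in> measurable N P" "h \<in> borel_measurable N"
  shows "(\<lambda>x. W n (f x) (h x)) \<in> borel_measurable N"
proof -
  have [measurable]: "Measurable.pred (N \<Otimes>\<^sub>M lborel) (\<lambda>y. snd y \<in> Run (f (fst y)))"
  proof -
    have "Measurable.pred (N \<Otimes>\<^sub>M lborel) (\<lambda>y. (\<lambda>(w, t). t \<in> Run w) (f (fst y), snd y))"
      by (rule measurable_compose[OF _ Run_meas]) measurable
    then show ?thesis by simp
  qed
  have [measurable]: "(\<lambda>x. \<sigma> n (f x)) \<in> borel_measurable N"
    by (rule measurable_compose[OF assms(1) \<sigma>_meas])
  have "(\<lambda>x. \<integral>\<^sup>+s. (if \<sigma> n (f x) \<le> s \<and> s \<le> h x \<and> s \<in> Run (f x) then 1 else 0) \<partial>lborel) \<in> borel_measurable N"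
    by (intro lborel.borel_measurable_nn_integral) measurable
  then have "(\<lambda>x. enn2real (\<integral>\<^sup>+s. (if \<sigma> n (f x) \<le> s \<and> s \<le> h x \<and> s \<in> Run (f x) then 1 else 0) \<partial>lborel)) \<in> borel_measurable N"
    by simp
  also have "(\<lambda>x. enn2real (\<integral>\<^sup>+s. (if \<sigma> n (f x) \<le> s \<and> s \<le> h x \<and> s \<in> Run (f x) then 1 else 0) \<partial>lborel)) = (\<lambda>x. W n (f x) (h x))"
  proof
    fix x
    have "(\<integral>\<^sup>+s. (if \<sigma> n (f x) \<le> s \<and> s \<le> h x \<and> s \<in> Run (f x) then 1 else 0) \<partial>lborel) = 
        (\<integral>\<^sup>+s. indicator ({\<sigma> n (f x)..h x} \<inter> Run (f x)) s \<partial>lborel)"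
      by (intro nn_integral_cong) (auto split: split_indicator)
    also have "\<dots> = emeasure lborel ({\<sigma> n (f x)..h x} \<inter> Run (f x))" by simp
    finally show "enn2real (\<integral>\<^sup>+s. (if \<sigma> n (f x) \<le> s \<and> s \<le> h x \<and> s \<in> Run (f x) then 1 else 0) \<partial>lborel) = W n (f x) (h x)"
      by (simp add: W_def work_def measure_def)
  qed
  finally show ?thesis .
qed

text \<open>By \<open>finish_le_iff\<close> the sublevel sets are comparisons between
  \<open>s\<close> and the jointly measurable reading at \<open>v\<close>; where the reading
  \<open>s\<close> is not attained the value 0 is inserted.\<close>

lemma finish_meas:
  "(\<lambda>x. if 0 < snd x \<and> snd x \<le> W n (fst x) (d n (fst x)) then finish (Run (fst x)) (\<sigma> n (fst x)) (snd x) else 0)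
     \<in> borel_measurable (P \<Otimes>\<^sub>M borel)" (is "?f \<in> _")
proof (rule borel_measurableI_le)
  fix v
  have V: "Measurable.pred (P \<Otimes>\<^sub>M borel) (\<lambda>x. 0 < snd x \<and> snd x \<le> W n (fst x) (d n (fst x)))" (is "Measurable.pred _ ?V")
    by measurable
  have W: "Measurable.pred (P \<Otimes>\<^sub>M borel) (\<lambda>x. snd x \<le> W n (fst x) v)" (is "Measurable.pred _ ?W")
    by measurable
  have "?f x \<le> v \<longleftrightarrow> ?V x \<and> ?W x \<or> \<not> ?V x \<and> 0 \<le> v" for x
  proof (cases "?V x")
    case True
    then have "0 < snd x" "snd x \<le> work (Run (fst x)) (\<sigma> n (fst x)) (d n (fst x))" by (auto simp: W_def)
    from finish_le_iff[OF Run_borel this, of v] True show ?thesis by (simp add: W_def)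
  next
    case False
    then have "?f x = 0" by (simp only: if_not_P if_False)
    with False show ?thesis by argo
  qed
  then have "{x \<in> space (P \<Otimes>\<^sub>M borel). ?f x \<le> v} = 
     {x \<in> space (P \<Otimes>\<^sub>M borel). ?V x} \<inter> {x \<in> space (P \<Otimes>\<^sub>M borel). ?W x} \<union>
     (if 0 \<le> v then space (P \<Otimes>\<^sub>M borel) - {x \<in> space (P \<Otimes>\<^sub>M borel). ?V x} else {})"
    by auto
  also have "\<dots> \<in> sets (P \<Otimes>\<^sub>M borel)"
    using V W unfolding pred_def by (intro sets.Un sets.Int) (auto intro: sets.Diff)
  finally show "{x \<in> space (P \<Otimes>\<^sub>M borel). ?f x \<le> v} \<in> sets (P \<Otimes>\<^sub>M borel)" .
qed

lemma g_meas: "(\<lambda>(w, s). g n w s) \<in> borel_measurable (P \<Otimes>\<^sub>M borel)"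
proof -
  have [measurable]: "(\<lambda>x. d n (fst x)) \<in> borel_measurable (P \<Otimes>\<^sub>M borel)"
    by (rule measurable_compose[OF measurable_fst d_meas])
  have [measurable]: "(\<lambda>x. if 0 < snd x \<and> snd x \<le> W n (fst x) (d n (fst x)) then finish (Run (fst x)) (\<sigma> n (fst x)) (snd x) else 0) \<in> borel_measurable (P \<Otimes>\<^sub>M borel)"
    by (rule finish_meas)
  have "(\<lambda>x. if 0 < snd x \<and> snd x \<le> W n (fst x) (d n (fst x)) then 
     left_lim B (Y ((fst x)(c n := snd x))) (if 0 < snd x \<and> snd x \<le> W n (fst x) (d n (fst x)) then finish (Run (fst x)) (\<sigma> n (fst x)) (snd x) else 0)
     else 0) \<in> borel_measurable (P \<Otimes>\<^sub>M borel)"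
    by (rule measurable_If[OF measurable_left_lim[OF Y_meas _ finish_meas]]) measurable
  then show ?thesis
    by (rule back_subst[of "\<lambda>f. f \<in> _"]) (auto simp: g_def fun_eq_iff)
qed

text \<open>For \<open>n = m\<close> the changed coordinate is overwritten anyway. For
  \<open>n < m\<close>, clock \<open>m\<close> starts only after clock \<open>n\<close> has rung, so
  the path strictly before that ringing has not yet seen the variable \<open>c m\<close>.\<close>

lemma g_upd:
  assumes nm: "n \<le> m" and w: "\<And>c. c \<in> S \<Longrightarrow> w c > 0" and a: "a > 0" and s: "s > 0"
  shows "g n (w(c m := a)) s = g n w s"
proof (cases "n = m")
  case True
  then show ?thesis by (simp add: g_def W_def \<sigma>_upd d_upd Run_upd)
next
  case False
  then have nm': "n < m" using nm by simp
  then have ne: "c n \<noteq> c m" using inj_c by (auto dest: injD)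
  have "left_lim B (Y (w(c m := a, c n := s))) (finish (Run w) (\<sigma> n w) s) = left_lim B (Y (w(c n := s))) (finish (Run w) (\<sigma> n w) s)"
    if s': "s \<le> W n w (d n w)"
  proof (rule left_lim_cong)
    fix t assume t: "t < finish (Run w) (\<sigma> n w) s"
    let ?w = "w(c n := s)"
    have pos: "\<And>c. c \<in> S \<Longrightarrow> ?w c > 0" using w s by auto
    have "finish (Run w) (\<sigma> n w) s \<le> d n w"
      using finish_le[OF Run_borel s s'[unfolded W_def]] .
    then have "t < \<tau>" using t d_le[of n w] by simp
    have "finish (Run ?w) (\<sigma> n ?w) (?w (c n)) \<le> \<sigma> m ?w"
      using s' by (intro successive[OF nm', of ?w] pos) (simp_all add: \<sigma>_upd d_upd Run_upd W_def)
    then have "t < \<sigma> m ?w" using t by (simp add: \<sigma>_upd Run_upd)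
    then have "Y (?w(c m := a)) t = Y ?w t"
      by (intro Y_upd_start) (use pos a \<open>t < \<tau>\<close> in auto)
    then show "Y (w(c m := a, c n := s)) t = Y (w(c n := s)) t"
      using ne by (simp add: fun_upd_twist)
  qed
  then show ?thesis using nm by (auto simp: g_def W_def \<sigma>_upd d_upd Run_upd)
qed

sublocale compensated_sums rate S c r B g
proof (unfold_locales, goal_cases)
  case (6 n w s) then show ?case using B by (simp add: g_def abs_left_lim)
next
  case (7 n m w a s) then show ?case by (intro g_upd)
qed (use inj_c rate_c c_S S g_meas in auto)

lemma left_lim_section [measurable]: "left_lim B (Y w) \<in> borel_measurable borel"
  using measurable_left_lim[OF Y_meas, of "\<lambda>_. w" borel "\<lambda>t. t" B] by simp

context
  fixes w :: "'c \<Rightarrow> real"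
  assumes w: "\<forall>c\<in>S. w c > 0"
begin

lemma w_c: "w (c n) > 0" using w c_S by auto

text \<open>Until the clock shows \<open>s\<close>, with \<open>s\<close> at most
  \<open>w (c n)\<close>, it has not rung, be it set to \<open>s\<close> or to
  \<open>w (c n)\<close>. Up to the actual setting the hypothetical path can thus be replaced by the
  real one.\<close>

lemma g_path:
  assumes s: "0 < s" "s \<le> w (c n)"
  shows "g n w s = (if s \<le> W n w (d n w) then left_lim B (Y w) (finish (Run w) (\<sigma> n w) s) else 0)"
proof -
  have "left_lim B (Y (w(c n := s))) (finish (Run w) (\<sigma> n w) s) = left_lim B (Y w) (finish (Run w) (\<sigma> n w) s)"
    if s': "s \<le> W n w (d n w)"
  proof (rule left_lim_cong)
    fix t assume t: "t < finish (Run w) (\<sigma> n w) s"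
    have "finish (Run w) (\<sigma> n w) s \<le> d n w"
      using finish_le[OF Run_borel s(1) s'[unfolded W_def]] .
    moreover have "work (Run w) (\<sigma> n w) t < s"
      using t work_less_before_finish[OF Run_borel s(1) s'[unfolded W_def]] by simp
    ultimately show "Y (w(c n := s)) t = Y w t"
      using t s w by (intro Y_upd_run) auto
  qed
  then show ?thesis using s by (simp add: g_def)
qed

lemma work_active: "work (Run w) (\<sigma> n w) (if rings w n then ring n w else d n w) = min (w (c n)) (W n w (d n w))"
  using work_finish[OF Run_borel w_c, of n] by (auto simp: rings_def ring_def W_def)

lemma g_nn_integral:
  assumes [measurable]: "f \<in> borel_measurable borel" and "f 0 = (0::ennreal)"
  shows "(\<integral>\<^sup>+s. f (g n w s) * indicator {0<..w (c n)} s \<partial>lborel) = (\<integral>\<^sup>+t. f (left_lim B (Y w) t) * indicator (active n w) t \<partial>lborel)"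
proof -
  have "(\<integral>\<^sup>+s. f (g n w s) * indicator {0<..w (c n)} s \<partial>lborel) = 
    (\<integral>\<^sup>+s. f (left_lim B (Y w) (finish (Run w) (\<sigma> n w) s)) * indicator {0<..work (Run w) (\<sigma> n w) (if rings w n then ring n w else d n w)} s \<partial>lborel)"
    unfolding work_active using assms(2) by (intro nn_integral_cong) (auto simp: g_path split: split_indicator)
  also have "\<dots> = (\<integral>\<^sup>+t. f (left_lim B (Y w) t) * indicator (active n w) t \<partial>lborel)"
    unfolding active_def by (rule time_change_nn_integral) measurable
  finally show ?thesis .
qed

lemma g_integral: "(LINT s:{0<..w (c n)}|lborel. g n w s) = (LINT t:active n w|lborel. left_lim B (Y w) t)"
proof -
  have "(LINT s:{0<..w (c n)}|lborel. g n w s) = 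
    (LINT s:{0<..work (Run w) (\<sigma> n w) (if rings w n then ring n w else d n w)}|lborel. left_lim B (Y w) (finish (Run w) (\<sigma> n w) s))"
    unfolding work_active set_lebesgue_integral_def
    by (intro Bochner_Integration.integral_cong) (auto simp: g_path split: split_indicator)
  also have "\<dots> = (LINT t:active n w|lborel. left_lim B (Y w) t)"
    unfolding active_def by (rule time_change_integral) measurable
  finally show ?thesis .
qed

text \<open>The change of variables carried out: an integral over clock readings turns into an
  integral over the real times at which the clock is active.\<close>

lemma D_path: "D n w = (if rings w n then left_lim B (Y w) (ring n w) else 0) - r * (LINT t:active n w|lborel. left_lim B (Y w) t)"
  unfolding D_def g_integral using g_path[OF w_c, of n] by (auto simp: rings_def ring_def)

lemma active_subset: "active n w \<subseteq> {0..\<tau>}"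
proof -
  have "ring n w \<le> d n w" if "rings w n"
  proof -
    from that have "w (c n) \<le> work (Run w) (\<sigma> n w) (d n w)" by (simp add: rings_def W_def)
    from finish_le[OF Run_borel w_c this] show ?thesis by (simp add: ring_def)
  qed
  then show ?thesis using d_le[of n w] \<sigma>_nonneg[of w n] w by (auto simp: active_def split: if_splits)
qed

lemma active_sets [measurable]: "active n w \<in> sets borel" unfolding active_def by simp

end

definition Mart :: "('c \<Rightarrow> real) \<Rightarrow> real" where "Mart w = (\<Sum>n. D n w)"

text \<open>Clocks that start after \<open>\<tau>\<close> contribute nothing, so along each path the
  series is a finite sum. The active periods are disjoint parts of \<open>{0..\<tau>}\<close>; hence
  the compensators join into a single integral, and the variances are dominated by one integral of
  the square of \<open>Y\<close>.\<close>

theorem compensated_rings: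
  assumes disj: "AE w in P. disjoint_family (\<lambda>n. active n w)"
    and fin: "AE w in P. \<exists>n0. \<forall>n\<ge>n0. \<tau> < \<sigma> n w"
    and reg: "AE w in P. AE t in lborel. 0 \<le> t \<longrightarrow> t \<le> \<tau> \<longrightarrow> left_lim B (Y w) t = Y w t"
  shows "Mart \<in> borel_measurable P"
    and "AE w in P. Mart w = (\<Sum>n | rings w n. left_lim B (Y w) (ring n w)) - r * (LINT t:(\<Union>n. active n w)|lborel. Y w t)"
    and "integrable P Mart" "(\<integral>w. Mart w \<partial>P) = 0"
    and "(\<integral>\<^sup>+w. ennreal ((Mart w)\<^sup>2) \<partial>P) \<le> ennreal r * (\<integral>\<^sup>+w. (\<integral>\<^sup>+t. ennreal ((Y w t)\<^sup>2) * indicator {0..\<tau>} t \<partial>lborel) \<partial>P)"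
proof -
  show M [measurable]: "Mart \<in> borel_measurable P"
    unfolding Mart_def[abs_def] by measurable
  have Y_sec [measurable]: "Y w \<in> borel_measurable borel" for w
  proof -
    have "(\<lambda>t. (\<lambda>(w, t). Y w t) (w, t)) \<in> borel_measurable borel"
      by (rule measurable_compose[OF _ Y_meas]) simp
    then show ?thesis by simp
  qed
  have key: "AE w in P. (\<lambda>n. D n w) sums ((\<Sum>n | rings w n. left_lim B (Y w) (ring n w)) - r * (LINT t:(\<Union>n. active n w)|lborel. Y w t))"
    using AE_Pos disj fin reg
  proof eventually_elim
    fix w assume w: "\<forall>c\<in>S. w c > 0" and disj: "disjoint_family (\<lambda>n. active n w)"
      and "\<exists>n0. \<forall>n\<ge>n0. \<tau> < \<sigma> n w" and reg: "AE t in lborel. 0 \<le> t \<longrightarrow> t \<le> \<tau> \<longrightarrow> left_lim B (Y w) t = Y w t"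
    then obtain n0 where n0: "\<And>n. n \<ge> n0 \<Longrightarrow> \<tau> < \<sigma> n w" by auto
    have W0: "W n w (d n w) = 0" if "n \<ge> n0" for n
      unfolding W_def by (rule work_before) (use n0[OF that] d_le[of n w] in simp)
    have nr: "\<not> rings w n" if "n \<ge> n0" for n
      using W0[OF that] w_c[OF w, of n] by (simp add: rings_def)
    have emp: "active n w = {}" if "n \<ge> n0" for n
      using nr[OF that] n0[OF that] d_le[of n w] by (auto simp: active_def)
    have "D n w = 0" if "n \<ge> n0" for n
      using nr[OF that] emp[OF that] by (simp add: D_path[OF w] set_lebesgue_integral_def)
    then have "(\<lambda>n. D n w) sums (\<Sum>n<n0. D n w)"
      by (intro sums_finite) auto
    moreover have "(\<Sum>n<n0. D n w) = (\<Sum>n | rings w n. left_lim B (Y w) (ring n w)) - r * (LINT t:(\<Union>n. active n w)|lborel. Y w t)"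
    proof -
      have sub: "{n. rings w n} \<subseteq> {..<n0}" using nr not_le_imp_less by blast
      have 1: "(\<Sum>n<n0. if rings w n then left_lim B (Y w) (ring n w) else 0) = (\<Sum>n | rings w n. left_lim B (Y w) (ring n w))"
        using sub by (simp add: sum.inter_filter[symmetric]) (intro sum.cong, auto)
      have si: "set_integrable lborel (active n w) (left_lim B (Y w))" for n
        unfolding set_integrable_def
      proof (rule Bochner_Integration.integrable_bound)
        show "integrable lborel (\<lambda>t. B * indicator {0..\<tau>} t)" using \<tau> by (auto intro!: integrable_mult_right)
        show "(\<lambda>t. indicator (active n w) t *\<^sub>R left_lim B (Y w) t) \<in> borel_measurable lborel"
          using left_lim_section active_sets[OF w] by (intro borel_measurable_scaleR borel_measurable_indicator) simp_all
        have "norm (indicator (active n w) t *\<^sub>R left_lim B (Y w) t) \<le> norm (B * indicator {0..\<tau>} t)" for t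
        proof (cases "t \<in> active n w")
          case True
          then have "t \<in> {0..\<tau>}" using active_subset[OF w] by blast
          with True show ?thesis using abs_left_lim[OF B, of "Y w" t] B by simp
        qed simp
        then show "AE t in lborel. norm (indicator (active n w) t *\<^sub>R left_lim B (Y w) t) \<le> norm (B * indicator {0..\<tau>} t)"
          by (intro AE_I2)
      qed
      have "(\<Sum>n<n0. LINT t:active n w|lborel. left_lim B (Y w) t) = (LINT t:(\<Union>n\<in>{..<n0}. active n w)|lborel. left_lim B (Y w) t)"
        using disj si active_sets[OF w] by (intro set_integral_finite_Union[symmetric]) (simp_all add: disjoint_family_on_def)
      also have "(\<Union>n\<in>{..<n0}. active n w) = (\<Union>n. active n w)"
        using emp not_le_imp_less by blast
      also have "(LINT t:(\<Union>n. active n w)|lborel. left_lim B (Y w) t) = (LINT t:(\<Union>n. active n w)|lborel. Y w t)"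
        unfolding set_lebesgue_integral_def
      proof (rule integral_cong_AE)
        show "AE t in lborel. indicator (\<Union>n. active n w) t *\<^sub>R left_lim B (Y w) t = indicator (\<Union>n. active n w) t *\<^sub>R Y w t"
          using reg
        proof eventually_elim
          fix t assume t: "0 \<le> t \<longrightarrow> t \<le> \<tau> \<longrightarrow> left_lim B (Y w) t = Y w t"
          show "indicator (\<Union>n. active n w) t *\<^sub>R left_lim B (Y w) t = indicator (\<Union>n. active n w) t *\<^sub>R Y w t"
          proof (cases "t \<in> (\<Union>n. active n w)")
            case True
            then have "t \<in> {0..\<tau>}" using active_subset[OF w] by blast
            with t show ?thesis by simp
          qed simp
        qed
        have "(\<Union>n. active n w) \<in> sets lborel" using active_sets[OF w] by (intro sets.countable_UN) auto
        then show "(\<lambda>t. indicator (\<Union>n. active n w) t *\<^sub>R left_lim B (Y w) t) \<in> borel_measurable lborel"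
          and "(\<lambda>t. indicator (\<Union>n. active n w) t *\<^sub>R Y w t) \<in> borel_measurable lborel"
          using left_lim_section Y_sec by (intro borel_measurable_scaleR borel_measurable_indicator; simp)+
      qed
      finally have 2: "(\<Sum>n<n0. LINT t:active n w|lborel. left_lim B (Y w) t) = (LINT t:(\<Union>n. active n w)|lborel. Y w t)" .
      show ?thesis unfolding D_path[OF w] sum_subtractf sum_distrib_left[symmetric] 1 2 ..
    qed
    ultimately show "(\<lambda>n. D n w) sums ((\<Sum>n | rings w n. left_lim B (Y w) (ring n w)) - r * (LINT t:(\<Union>n. active n w)|lborel. Y w t))"
      by simp
  qed
  show "AE w in P. Mart w = (\<Sum>n | rings w n. left_lim B (Y w) (ring n w)) - r * (LINT t:(\<Union>n. active n w)|lborel. Y w t)"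
    using key by eventually_elim (simp add: Mart_def sums_iff)
  have sumsM: "AE w in P. (\<lambda>n. D n w) sums Mart w"
    using key by eventually_elim (simp add: Mart_def sums_iff)
  let ?V = "\<lambda>w. \<integral>\<^sup>+t. ennreal ((Y w t)\<^sup>2) * indicator {0..\<tau>} t \<partial>lborel"
  have V: "?V \<in> borel_measurable P"
  proof -
    have "(\<lambda>(w, t). ennreal ((Y w t)\<^sup>2) * indicator {0..\<tau>} t) \<in> borel_measurable (P \<Otimes>\<^sub>M lborel)"
    proof -
      have [measurable]: "(\<lambda>x. Y (fst x) (snd x)) \<in> borel_measurable (P \<Otimes>\<^sub>M lborel)"
        using Y_meas by (simp add: case_prod_beta')
      show ?thesis by (simp add: case_prod_beta')
    qed
    then show ?thesis by (intro lborel.borel_measurable_nn_integral) simp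
  qed
  have sum_le: "(\<Sum>j<n. \<integral>\<^sup>+s. f (g j w s) * indicator {0<..w (c j)} s \<partial>lborel) \<le> (\<integral>\<^sup>+t. f (Y w t) * indicator {0..\<tau>} t \<partial>lborel)"
    if w: "\<forall>c\<in>S. w c > 0" and disj: "disjoint_family (\<lambda>n. active n w)" 
      and reg: "AE t in lborel. 0 \<le> t \<longrightarrow> t \<le> \<tau> \<longrightarrow> left_lim B (Y w) t = Y w t"
      and "f \<in> borel_measurable borel" and f0: "f 0 = (0::ennreal)" for f n w
  proof -
    have m: "(\<lambda>t. f (left_lim B (Y w) t) * indicator (active j w) t) \<in> borel_measurable lborel" for j
      using active_sets[OF w] measurable_compose[OF left_lim_section \<open>f \<in> borel_measurable borel\<close>]
      by (intro borel_measurable_times_ennreal borel_measurable_indicator) simp_all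
    have gn: "(\<integral>\<^sup>+s. f (g j w s) * indicator {0<..w (c j)} s \<partial>lborel) = (\<integral>\<^sup>+t. f (left_lim B (Y w) t) * indicator (active j w) t \<partial>lborel)" for j
      by (rule g_nn_integral[of w f j]) (use w f0 \<open>f \<in> borel_measurable borel\<close> in simp_all)
    have "(\<Sum>j<n. \<integral>\<^sup>+s. f (g j w s) * indicator {0<..w (c j)} s \<partial>lborel) = 
       (\<integral>\<^sup>+t. (\<Sum>j<n. f (left_lim B (Y w) t) * indicator (active j w) t) \<partial>lborel)"
      unfolding gn by (rule nn_integral_sum[symmetric]) (rule m)
    also have "\<dots> \<le> (\<integral>\<^sup>+t. f (Y w t) * indicator {0..\<tau>} t \<partial>lborel)"
    proof (rule nn_integral_mono_AE, use reg in eventually_elim)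
      fix t assume t: "0 \<le> t \<longrightarrow> t \<le> \<tau> \<longrightarrow> left_lim B (Y w) t = Y w t"
      have "(\<Sum>j<n. f (left_lim B (Y w) t) * indicator (active j w) t) = f (left_lim B (Y w) t) * (\<Sum>j<n. indicator (active j w) t)"
        by (simp add: sum_distrib_left)
      also have "(\<Sum>j<n. indicator (active j w) t :: ennreal) = indicator (\<Union>j\<in>{..<n}. active j w) t"
        by (rule indicator_UN_disjoint[symmetric]) (use disj in \<open>auto simp: disjoint_family_on_def\<close>)
      also have "f (left_lim B (Y w) t) * indicator (\<Union>j\<in>{..<n}. active j w) t \<le> f (Y w t) * indicator {0..\<tau>} t"
      proof (cases "t \<in> (\<Union>j\<in>{..<n}. active j w)")
        case True
        then have t': "t \<in> {0..\<tau>}" using active_subset[OF w] by blast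
        with t have "left_lim B (Y w) t = Y w t" by simp
        with True t' show ?thesis by (simp only: indicator_simps mult_1_right order_refl)
      qed simp
      finally show "(\<Sum>j<n. f (left_lim B (Y w) t) * indicator (active j w) t) \<le> f (Y w t) * indicator {0..\<tau>} t" .
    qed
    finally show ?thesis .
  qed
  have V_le: "AE w in P. \<forall>n. (\<Sum>j<n. \<integral>\<^sup>+s. ennreal ((g j w s)\<^sup>2) * indicator {0<..w (c j)} s \<partial>lborel) \<le> ?V w"
    using AE_Pos disj reg by eventually_elim (rule allI, rule sum_le, auto)
  \<comment> \<open>The deterministic bound: almost everywhere on the interval \<open>Y\<close>
    equals its clipped left limit and is therefore at most \<open>B\<close> in absolute
    value.\<close>
  have H: "AE w in P. \<forall>n. (\<Sum>j<n. \<integral>\<^sup>+s. ennreal \<bar>g j w s\<bar> * indicator {0<..w (c j)} s \<partial>lborel) \<le> ennreal (B * \<tau>)"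
    using AE_Pos disj reg
  proof eventually_elim
    fix w assume w: "\<forall>c\<in>S. w c > 0" "disjoint_family (\<lambda>n. active n w)"
      and reg: "AE t in lborel. 0 \<le> t \<longrightarrow> t \<le> \<tau> \<longrightarrow> left_lim B (Y w) t = Y w t"
    show "\<forall>n. (\<Sum>j<n. \<integral>\<^sup>+s. ennreal \<bar>g j w s\<bar> * indicator {0<..w (c j)} s \<partial>lborel) \<le> ennreal (B * \<tau>)"
    proof
      fix n
      have "(\<Sum>j<n. \<integral>\<^sup>+s. ennreal \<bar>g j w s\<bar> * indicator {0<..w (c j)} s \<partial>lborel) \<le> (\<integral>\<^sup>+t. ennreal \<bar>Y w t\<bar> * indicator {0..\<tau>} t \<partial>lborel)"
        by (rule sum_le[OF w reg]) auto
      also have "\<dots> \<le> (\<integral>\<^sup>+t. ennreal B * indicator {0..\<tau>} t \<partial>lborel)"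
        using reg by (intro nn_integral_mono_AE, elim eventually_mono)
          (use abs_left_lim[OF B, of "Y w"] in \<open>auto split: split_indicator intro!: ennreal_leI, metis\<close>)
      also have "\<dots> = ennreal (B * \<tau>)" using B \<tau> by (simp add: nn_integral_cmult ennreal_mult)
      finally show "(\<Sum>j<n. \<integral>\<^sup>+s. ennreal \<bar>g j w s\<bar> * indicator {0<..w (c j)} s \<partial>lborel) \<le> ennreal (B * \<tau>)" .
    qed
  qed
  from compensated_limit[OF sumsM M V V_le H]
  show "integrable P Mart" "(\<integral>w. Mart w \<partial>P) = 0"
    "(\<integral>\<^sup>+w. ennreal ((Mart w)\<^sup>2) \<partial>P) \<le> ennreal r * (\<integral>\<^sup>+w. ?V w \<partial>P)" by auto
qed

end

section \<open>Sample paths of the queue\<close>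

text \<open>Capping the time at the next arrival freezes the work of a replaced packet. The
  condition needs no witness time as in \<open>delivered_by\<close>, and its measurability is
  immediate.\<close>

definition delivered_work :: "(nat \<Rightarrow> nat \<Rightarrow> real) \<Rightarrow> (nat \<Rightarrow> nat \<Rightarrow> real) \<Rightarrow> nat \<Rightarrow> nat \<Rightarrow> real \<Rightarrow> bool" where
  "delivered_work T X k n t \<longleftrightarrow> T k n \<le> t \<and> X k n \<le> served (higher_busy T X k) T k n (min t (T k (Suc n)))"

text \<open>A countable supremum in \<open>ennreal\<close> is measurable without a case distinction
  on the path, and it is 0 before the first arrival. \<open>stamp\<close> has the same form.\<close>

definition last_arrival :: "(nat \<Rightarrow> nat \<Rightarrow> real) \<Rightarrow> nat \<Rightarrow> real \<Rightarrow> real" where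
  "last_arrival T k t = enn2real (SUP n. if T k n \<le> t then ennreal (T k n) else 0)"

definition stamp :: "(nat \<Rightarrow> nat \<Rightarrow> real) \<Rightarrow> (nat \<Rightarrow> nat \<Rightarrow> real) \<Rightarrow> nat \<Rightarrow> real \<Rightarrow> real" where
  "stamp T X k t = enn2real (SUP n. if delivered_work T X k n t then ennreal (T k n) else 0)"

lemma served_eq_work: "served B T k n t = work {s. \<not> B s} (T k n) t"
  by (simp add: served_def work_def)

lemma higher_busy_iff: "higher_busy T X k s \<longleftrightarrow> (\<exists>l<k. holds_packet (higher_busy T X l) T X l s)"
  by (induction k) (auto simp: less_Suc_eq)

lemma enn2real_SUP_attained:
  assumes "P m" "\<And>n. P n \<Longrightarrow> f n \<le> f m" "0 \<le> f m"
  shows "enn2real (SUP n. if P n then ennreal (f n) else 0) = f m"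
proof -
  have "(SUP n. if P n then ennreal (f n) else 0) = ennreal (f m)"
  proof (rule antisym)
    show "(SUP n. if P n then ennreal (f n) else 0) \<le> ennreal (f m)"
      by (intro SUP_least) (use assms in \<open>auto intro: ennreal_leI\<close>)
    show "ennreal (f m) \<le> (SUP n. if P n then ennreal (f n) else 0)"
      using assms(1) by (intro SUP_upper2[of m]) auto
  qed
  then show ?thesis using assms(3) by simp
qed

lemma enn2real_SUP_none: "(\<And>n. \<not> P n) \<Longrightarrow> enn2real (SUP n. if P n then ennreal (f n) else 0) = 0"
  by simp

lemma eventually_at_right_below: "t < (c::real) \<Longrightarrow> \<forall>\<^sub>F s in at_right t. t < s \<and> s < c"
  by (rule eventually_at_rightI[of t c]) auto

lemma eventually_at_left_above: "c < (t::real) \<Longrightarrow> \<forall>\<^sub>F s in at_left t. c < s \<and> s < t"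
  by (rule eventually_at_leftI[of c t]) auto

type_synonym event = "nat \<times> nat + nat \<times> nat"

text \<open>Properties shared by almost all sample paths. \<open>no_tie\<close> says that at no
  arrival epoch has a packet received exactly its requirement; so no completion coincides with an
  arrival, in particular not with the arrival that would replace the packet.\<close>

locale path =
  fixes T X :: "nat \<Rightarrow> nat \<Rightarrow> real" and i :: nat
  assumes T_first: "k \<le> i \<Longrightarrow> 0 < T k 0" and T_step: "k \<le> i \<Longrightarrow> T k n < T k (Suc n)"
    and T_lim: "k \<le> i \<Longrightarrow> filterlim (T k) at_top sequentially"
    and X_pos: "k \<le> i \<Longrightarrow> 0 < X k n"
    and holds_borel: "k \<le> i \<Longrightarrow> {s. holds_packet (higher_busy T X k) T X k s} \<in> sets borel"
    and arrivals_distinct: "k \<le> i \<Longrightarrow> m \<le> i \<Longrightarrow> k \<noteq> m \<Longrightarrow> T k n \<noteq> T m l"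
    and no_tie: "k \<le> i \<Longrightarrow> m \<le> i \<Longrightarrow> served (higher_busy T X k) T k n (T m l) \<noteq> X k n"
begin

abbreviation hb :: "nat \<Rightarrow> real \<Rightarrow> bool" where "hb \<equiv> higher_busy T X"
abbreviation hp :: "nat \<Rightarrow> real \<Rightarrow> bool" where "hp k \<equiv> holds_packet (hb k) T X k"
abbreviation srv :: "nat \<Rightarrow> nat \<Rightarrow> real \<Rightarrow> real" where "srv \<equiv> \<lambda>k n t. served (hb k) T k n t"

definition idle :: "nat \<Rightarrow> real set" where "idle k = {s. \<not> hb k s}"

definition completes :: "nat \<Rightarrow> nat \<Rightarrow> bool" where "completes k n \<longleftrightarrow> X k n \<le> srv k n (T k (Suc n))"

definition ctime :: "nat \<Rightarrow> nat \<Rightarrow> real" where "ctime k n = finish (idle k) (T k n) (X k n)"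

lemma srv_work: "srv k n t = work (idle k) (T k n) t"
  by (simp add: served_eq_work idle_def)

lemma idle_borel: "k \<le> i \<Longrightarrow> idle k \<in> sets borel"
proof -
  assume "k \<le> i"
  then have "(\<Union>l\<in>{..<k}. {s. hp l s}) \<in> sets borel" by (intro sets.finite_UN) (auto intro!: holds_borel)
  moreover have "idle k = - (\<Union>l\<in>{..<k}. {s. hp l s})" by (auto simp: idle_def higher_busy_iff)
  ultimately show ?thesis by (simp only: borel_comp)
qed

lemma T_strict_mono: "k \<le> i \<Longrightarrow> strict_mono (T k)"
  by (rule strict_monoI_Suc) (rule T_step)

lemma T_less_iff: "k \<le> i \<Longrightarrow> T k n < T k m \<longleftrightarrow> n < m"
  using T_strict_mono by (simp add: strict_mono_less)

lemma T_le_iff: "k \<le> i \<Longrightarrow> T k n \<le> T k m \<longleftrightarrow> n \<le> m"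
  using T_strict_mono by (simp add: strict_mono_less_eq)

lemma T_pos: "k \<le> i \<Longrightarrow> 0 < T k n"
  using T_first[of k] T_le_iff[of k 0 n] by (meson bot_nat_0.extremum less_le_trans)

lemma eventually_T_gt: "k \<le> i \<Longrightarrow> \<exists>n0. \<forall>n\<ge>n0. t < T k n"
  using T_lim[of k] by (auto simp: filterlim_at_top_dense eventually_sequentially)

lemma locate:
  assumes k: "k \<le> i"
  obtains "t < T k 0" | n where "T k n \<le> t" "t < T k (Suc n)"
proof (cases "t < T k 0")
  case False
  define n where "n = (LEAST n. t < T k n)"
  have ex: "\<exists>n. t < T k n" using eventually_T_gt[OF k] by blast
  have n: "t < T k n" unfolding n_def by (rule LeastI_ex[OF ex])
  with False obtain m where m: "n = Suc m" by (cases n) auto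
  have "\<not> t < T k m" using not_less_Least[of m "\<lambda>n. t < T k n"] m unfolding n_def by auto
  with n m show thesis by (intro that(2)[of m]) auto
qed (use that in blast)

lemma locate_left:
  assumes k: "k \<le> i"
  obtains "t \<le> T k 0" | n where "T k n < t" "t \<le> T k (Suc n)"
proof (rule locate[OF k, of t])
  fix n assume n: "T k n \<le> t" "t < T k (Suc n)"
  show thesis
  proof (cases "T k n = t")
    case True
    show thesis
    proof (cases n)
      case 0 then show thesis using True that(1) by simp
    next
      case (Suc m) then show thesis using True that(2)[of m] T_step[OF k, of m] by simp
    qed
  next
    case False then show thesis using that(2)[of n] n by simp
  qed
next
  assume "t < T k 0" then show thesis using that(1) by simp
qed

lemma same_interval:
  assumes "k \<le> i" "T k n \<le> t" "t < T k (Suc n)" "T k m \<le> t" "t < T k (Suc m)"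
  shows "m = n"
  using T_less_iff[OF assms(1), of n "Suc m"] T_less_iff[OF assms(1), of m "Suc n"] assms by simp

lemma same_left_interval:
  assumes "k \<le> i" "T k n < t" "t \<le> T k (Suc n)" "T k m < t" "t \<le> T k (Suc m)"
  shows "m = n"
  using T_less_iff[OF assms(1), of n "Suc m"] T_less_iff[OF assms(1), of m "Suc n"] assms by simp

context
  fixes k n :: nat
  assumes k: "k \<le> i"
begin

lemma srv_less_X: "\<not> completes k n \<Longrightarrow> t \<le> T k (Suc n) \<Longrightarrow> srv k n t < X k n"
  using work_mono[OF idle_borel[OF k], of t "T k (Suc n)" "T k n"] by (simp add: completes_def srv_work)

context
  assumes c: "completes k n"
begin

lemma ctime_iff: "ctime k n \<le> v \<longleftrightarrow> X k n \<le> srv k n v"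
  and ctime_gt: "T k n < ctime k n"
  and srv_ctime: "srv k n (ctime k n) = X k n"
proof -
  have 1: "X k n \<le> work (idle k) (T k n) (T k (Suc n))" using c by (simp add: completes_def srv_work)
  note f = X_pos[OF k, of n] 1
  show "ctime k n \<le> v \<longleftrightarrow> X k n \<le> srv k n v" unfolding srv_work ctime_def by (rule finish_le_iff[OF idle_borel[OF k] f])
  show "T k n < ctime k n" unfolding ctime_def by (rule finish_gt[OF idle_borel[OF k] f])
  show "srv k n (ctime k n) = X k n" unfolding srv_work ctime_def by (rule work_finish[OF idle_borel[OF k] f])
qed

lemma ctime_less: "ctime k n < T k (Suc n)"
  using c ctime_iff[of "T k (Suc n)"] srv_ctime no_tie[OF k k, of n "Suc n"] 
  by (auto simp: completes_def less_le)

lemma ctime_less_iff: "v < ctime k n \<longleftrightarrow> srv k n v < X k n"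
  using ctime_iff[of v] by auto

end

lemma hp_iff:
  assumes "T k n \<le> t" "t < T k (Suc n)"
  shows "hp k t \<longleftrightarrow> \<not> (completes k n \<and> ctime k n \<le> t)"
proof -
  have "hp k t \<longleftrightarrow> \<not> X k n \<le> srv k n t"
  proof -
    have "hp k t \<longleftrightarrow> \<not> done_by (hb k) T X k n t"
      unfolding holds_packet_def using same_interval[OF k assms] assms by blast
    then show ?thesis using assms by (simp add: done_by_def)
  qed
  then show ?thesis using ctime_iff[of t] srv_less_X[of t] assms by force
qed

end

lemma T_first_le: "k \<le> i \<Longrightarrow> T k 0 \<le> T k n"
  by (simp add: T_le_iff)

lemma hp_before: "k \<le> i \<Longrightarrow> t < T k 0 \<Longrightarrow> \<not> hp k t"
  unfolding holds_packet_def using T_first_le by (meson not_less order_trans)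

text \<open>The left limit of \<open>hp\<close>: the intervals between arrivals are closed on the
  right, and a completion counts only strictly after its time.\<close>

definition hpl :: "nat \<Rightarrow> real \<Rightarrow> bool" where
  "hpl k t \<longleftrightarrow> (\<exists>n. T k n < t \<and> t \<le> T k (Suc n) \<and> \<not> (completes k n \<and> ctime k n < t))"

lemma hpl_iff:
  assumes "k \<le> i" "T k n < t" "t \<le> T k (Suc n)"
  shows "hpl k t \<longleftrightarrow> \<not> (completes k n \<and> ctime k n < t)"
  unfolding hpl_def using same_left_interval[OF assms] assms by blast

lemma hpl_before: "k \<le> i \<Longrightarrow> t \<le> T k 0 \<Longrightarrow> \<not> hpl k t"
  unfolding hpl_def using T_first_le by (meson not_less order_trans)

lemma hp_right: assumes k: "k \<le> i" shows "\<forall>\<^sub>F s in at_right t. hp k s = hp k t"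
proof (rule locate[OF k, of t])
  assume t: "t < T k 0"
  show ?thesis using eventually_at_right_below[OF t] by eventually_elim (use t hp_before[OF k] in auto)
next
  fix n assume n: "T k n \<le> t" "t < T k (Suc n)"
  define c where "c = (if completes k n \<and> t < ctime k n then min (ctime k n) (T k (Suc n)) else T k (Suc n))"
  have "t < c" using n by (auto simp: c_def)
  from eventually_at_right_below[OF this] show ?thesis
  proof eventually_elim
    fix s assume "t < s \<and> s < c"
    then show "hp k s = hp k t"
      using n hp_iff[OF k, of n s] hp_iff[OF k, of n t] by (auto simp: c_def split: if_splits)
  qed
qed

lemma hp_left: assumes k: "k \<le> i" shows "\<forall>\<^sub>F s in at_left t. hp k s = hpl k t"
proof (rule locate_left[OF k, of t])
  assume t: "t \<le> T k 0"
  have "\<forall>\<^sub>F s in at_left t. t - 1 < s \<and> s < t" by (rule eventually_at_left_above) simp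
  then show ?thesis by eventually_elim (use t hp_before[OF k] hpl_before[OF k] in auto)
next
  fix n assume n: "T k n < t" "t \<le> T k (Suc n)"
  define c where "c = (if completes k n \<and> ctime k n < t then max (ctime k n) (T k n) else T k n)"
  have "c < t" using n by (auto simp: c_def)
  from eventually_at_left_above[OF this] show ?thesis
  proof eventually_elim
    fix s assume "c < s \<and> s < t"
    then show "hp k s = hpl k t"
      using n hp_iff[OF k, of n s] hpl_iff[OF k n] by (auto simp: c_def split: if_splits)
  qed
qed

lemma hp_arrival: "k \<le> i \<Longrightarrow> hp k (T k n)"
  using hp_iff[of k n "T k n"] T_step[of k n] ctime_gt[of k n] by auto

lemma hp_completion: "k \<le> i \<Longrightarrow> completes k n \<Longrightarrow> hpl k (ctime k n) \<and> \<not> hp k (ctime k n)"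
  using hp_iff[of k n "ctime k n"] hpl_iff[of k n "ctime k n"] ctime_gt[of k n] ctime_less[of k n] by auto

lemma hp_no_event:
  assumes k: "k \<le> i" and "\<And>n. t \<noteq> T k n" "\<And>n. completes k n \<Longrightarrow> t \<noteq> ctime k n"
  shows "hpl k t = hp k t"
proof (rule locate[OF k, of t])
  assume t: "t < T k 0"
  then show ?thesis using hp_before[OF k] hpl_before[OF k] by auto
next
  fix n assume n: "T k n \<le> t" "t < T k (Suc n)"
  then have "T k n < t" "t \<le> T k (Suc n)" using assms(2)[of n] by auto
  from hpl_iff[OF k this] hp_iff[OF k n] assms(3)[of n] show ?thesis by auto
qed

definition hbl :: "nat \<Rightarrow> real \<Rightarrow> bool" where "hbl k t \<longleftrightarrow> (\<exists>l<k. hpl l t)"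

lemma hb_left: assumes "k \<le> Suc i" shows "\<forall>\<^sub>F s in at_left t. hb k s = hbl k t"
proof -
  have "\<forall>\<^sub>F s in at_left t. \<forall>l\<in>{..<k}. hp l s = hpl l t"
    using assms by (intro eventually_ball_finite) (auto intro!: hp_left)
  then show ?thesis by eventually_elim (auto simp: higher_busy_iff hbl_def)
qed

text \<open>If the server were blocked on a left neighbourhood of the completion, the packet would
  receive no work there and would have met its requirement earlier.\<close>

lemma idle_before_completion:
  assumes k: "k \<le> i" and c: "completes k n"
  shows "\<not> hbl k (ctime k n)"
proof
  let ?t = "ctime k n"
  assume "hbl k ?t"
  then have "\<forall>\<^sub>F s in at_left ?t. hb k s" using hb_left[of k ?t] k by auto
  moreover have "\<forall>\<^sub>F s in at_left ?t. T k n < s \<and> s < ?t"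
    by (rule eventually_at_left_above) (rule ctime_gt[OF k c])
  ultimately have "\<forall>\<^sub>F s in at_left ?t. hb k s \<and> T k n < s \<and> s < ?t" by eventually_elim auto
  then obtain b where b: "b < ?t" "\<And>s. b < s \<Longrightarrow> s < ?t \<Longrightarrow> hb k s \<and> T k n < s"
    by (auto simp: eventually_at_left_field)
  define s where "s = (b + ?t) / 2"
  have s: "b < s" "s < ?t" using b(1) by (auto simp: s_def)
  have "ennreal (work (idle k) (T k n) ?t - work (idle k) (T k n) s) = emeasure lborel ({s<..?t} \<inter> idle k)"
    by (rule emeasure_work_increment[OF idle_borel[OF k], symmetric]) (use s b(2)[OF s] in auto)
  also have "\<dots> \<le> emeasure lborel {?t}"
  proof (rule emeasure_mono)
    have sub: "x = ?t" if "s < x" "x \<le> ?t" "x \<in> idle k" for x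
    proof (rule ccontr)
      assume "x \<noteq> ?t"
      then have "hb k x" using b(2)[of x] s that by simp
      then show False using that by (simp add: idle_def)
    qed
    show "{s<..?t} \<inter> idle k \<subseteq> {?t}"
    proof
      fix x assume "x \<in> {s<..?t} \<inter> idle k"
      then show "x \<in> {?t}" using sub[of x] by simp
    qed
  qed simp
  finally have "srv k n ?t \<le> srv k n s" by (simp add: srv_work ennreal_eq_0_iff)
  moreover have "srv k n s < X k n" using ctime_less_iff[OF k c] s by auto
  ultimately show False using srv_ctime[OF k c] by simp
qed

definition events :: "event set" where
  "events = {Inl (k, n) |k n. k \<le> i} \<union> {Inr (k, n) |k n. k \<le> i \<and> completes k n}"

definition etime :: "event \<Rightarrow> real" where
  "etime e = (case e of Inl (k, n) \<Rightarrow> T k n | Inr (k, n) \<Rightarrow> ctime k n)"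

lemma etime_simps [simp]: "etime (Inl (k, n)) = T k n" "etime (Inr (k, n)) = ctime k n"
  by (auto simp: etime_def)

lemma events_simps [simp]: "Inl (k, n) \<in> events \<longleftrightarrow> k \<le> i" "Inr (k, n) \<in> events \<longleftrightarrow> k \<le> i \<and> completes k n"
  by (auto simp: events_def)

lemma arrival_not_completion:
  assumes "k \<le> i" "m \<le> i" "completes m l"
  shows "T k n \<noteq> ctime m l"
  using no_tie[OF assms(2,1), of l n] srv_ctime[OF assms(2,3)] by auto

text \<open>For two streams the argument is deterministic: just before the common time the stream of
  higher priority still holds its packet, so it blocks the other one, against
  \<open>idle_before_completion\<close>.\<close>

lemma completions_distinct:
  assumes "k \<le> i" "m \<le> i" "completes k n" "completes m l" "ctime k n = ctime m l"
  shows "k = m" "n = l"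
proof -
  show km: "k = m"
  proof (rule ccontr)
    assume "k \<noteq> m"
    then consider "k < m" | "m < k" by linarith
    then show False
    proof cases
      case 1
      then show False using idle_before_completion[OF assms(2,4)] hp_completion[OF assms(1,3)] assms(5) by (auto simp: hbl_def)
    next
      case 2
      then show False using idle_before_completion[OF assms(1,3)] hp_completion[OF assms(2,4)] assms(5) by (auto simp: hbl_def)
    qed
  qed
  show "n = l"
    by (rule same_interval[OF assms(2), of l "ctime m l"])
       (use assms km ctime_gt[OF assms(1,3)] ctime_less[OF assms(1,3)] ctime_gt[OF assms(2,4)] ctime_less[OF assms(2,4)] in auto)
qed

lemma inj_etime: "inj_on etime events"
proof (rule inj_onI)
  fix e f assume "e \<in> events" "f \<in> events" "etime e = etime f"
  then show "e = f"
  proof (cases e; cases f)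
    fix p q assume ef: "e = Inl p" "f = Inl q"
    obtain k n m l where pq: "p = (k, n)" "q = (m, l)" by (cases p; cases q)
    with ef \<open>e \<in> events\<close> \<open>f \<in> events\<close> \<open>etime e = etime f\<close> have "k \<le> i" "m \<le> i" "T k n = T m l" by auto
    moreover from this have "k = m" using arrivals_distinct by blast
    ultimately have "n = l" using T_strict_mono strict_mono_eq by blast
    with ef pq \<open>k = m\<close> show "e = f" by simp
  next
    fix p q assume ef: "e = Inr p" "f = Inr q"
    obtain k n m l where pq: "p = (k, n)" "q = (m, l)" by (cases p; cases q)
    with ef \<open>e \<in> events\<close> \<open>f \<in> events\<close> \<open>etime e = etime f\<close> 
    have "k \<le> i" "m \<le> i" "completes k n" "completes m l" "ctime k n = ctime m l" by auto
    from completions_distinct[OF this] ef pq show "e = f" by simp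
  next
    fix p q assume ef: "e = Inl p" "f = Inr q"
    obtain k n m l where pq: "p = (k, n)" "q = (m, l)" by (cases p; cases q)
    with ef \<open>e \<in> events\<close> \<open>f \<in> events\<close> \<open>etime e = etime f\<close> 
    have "k \<le> i" "m \<le> i" "completes m l" "T k n = ctime m l" by auto
    with arrival_not_completion show "e = f" by blast
  next
    fix p q assume ef: "e = Inr q" "f = Inl p"
    obtain k n m l where pq: "p = (k, n)" "q = (m, l)" by (cases p; cases q)
    with ef \<open>e \<in> events\<close> \<open>f \<in> events\<close> \<open>etime e = etime f\<close> 
    have "k \<le> i" "m \<le> i" "completes m l" "T k n = ctime m l" by auto
    with arrival_not_completion show "e = f" by blast
  qed
qed

lemma etime_pos: "e \<in> events \<Longrightarrow> 0 < etime e"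
proof (cases e)
  case (Inr p)
  obtain k n where "p = (k, n)" by (cases p)
  then show "e \<in> events \<Longrightarrow> 0 < etime e" using Inr T_pos[of k n] ctime_gt[of k n] by auto
qed (use T_pos in \<open>auto simp: events_def\<close>)

lemma finite_events: "finite {e \<in> events. etime e \<le> t}"
proof -
  have fin: "finite {n. T k n \<le> t}" if k: "k \<le> i" for k
  proof -
    obtain n0 where n0: "\<And>n. n \<ge> n0 \<Longrightarrow> t < T k n" using eventually_T_gt[OF k, of t] by auto
    have "n < n0" if "T k n \<le> t" for n
      using n0[of n] that by (cases "n0 \<le> n") auto
    then have "{n. T k n \<le> t} \<subseteq> {..<n0}" by auto
    then show ?thesis by (rule finite_subset) simp
  qed
  let ?A = "SIGMA k:{..i}. {n. T k n \<le> t}"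
  have "finite ?A" using fin by (intro finite_SigmaI) auto
  have "{e \<in> events. etime e \<le> t} \<subseteq> Inl ` ?A \<union> Inr ` ?A"
  proof
    fix e assume e: "e \<in> {e \<in> events. etime e \<le> t}"
    show "e \<in> Inl ` ?A \<union> Inr ` ?A"
    proof (cases e)
      case (Inr p)
      obtain k n where p: "p = (k, n)" by (cases p)
      then have "k \<le> i" "completes k n" "ctime k n \<le> t" using e Inr by auto
      then have "T k n \<le> t" using ctime_gt[of k n] by auto
      then show ?thesis using p Inr \<open>k \<le> i\<close> by auto
    qed (use e in \<open>auto simp: events_def\<close>)
  qed
  then show ?thesis by (rule finite_subset) (use \<open>finite ?A\<close> in auto)
qed

end

section \<open>The state (Q, delta, x) along a path and its change-of-variables formula\<close>

definition busy_count :: "(nat \<Rightarrow> nat \<Rightarrow> real) \<Rightarrow> (nat \<Rightarrow> nat \<Rightarrow> real) \<Rightarrow> nat \<Rightarrow> real \<Rightarrow> nat" where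
  "busy_count T X i t = card {k. k < i \<and> holds_packet (higher_busy T X k) T X k t}"

text \<open>Effect of an arrival, respectively a completion, in stream \<open>k\<close> on a function \<open>F\<close> of the number \<open>q\<close> of
  higher-priority streams holding a packet, the age \<open>\<delta>\<close> of stream \<open>i\<close> and the time \<open>x\<close> since its last arrival.\<close>

definition arrival_jump :: "(nat \<Rightarrow> real \<Rightarrow> real \<Rightarrow> real) \<Rightarrow> nat \<Rightarrow> nat \<Rightarrow> bool \<Rightarrow> nat \<Rightarrow> real \<Rightarrow> real \<Rightarrow> real" where
  "arrival_jump F i k h q \<delta> x = (if k = i then F q \<delta> 0 - F q \<delta> x else if h then 0 else F (Suc q) \<delta> x - F q \<delta> x)"

definition completion_jump :: "(nat \<Rightarrow> real \<Rightarrow> real \<Rightarrow> real) \<Rightarrow> nat \<Rightarrow> nat \<Rightarrow> nat \<Rightarrow> real \<Rightarrow> real \<Rightarrow> real" where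
  "completion_jump F i k q \<delta> x = (if k = i then F q x x - F q \<delta> x else F (q - 1) \<delta> x - F q \<delta> x)"

text \<open>\<open>F'\<close> is the derivative in the direction (1, 1), since between events the
  age and the time since the last arrival both grow at unit speed. Continuity serves measurability,
  local boundedness and left limits.\<close>

definition smooth_pair :: "(nat \<Rightarrow> real \<Rightarrow> real \<Rightarrow> real) \<Rightarrow> (nat \<Rightarrow> real \<Rightarrow> real \<Rightarrow> real) \<Rightarrow> bool" where
  "smooth_pair F F' \<longleftrightarrow> (\<forall>q. continuous_on UNIV (\<lambda>(\<delta>, x). F q \<delta> x)) \<and> (\<forall>q. continuous_on UNIV (\<lambda>(\<delta>, x). F' q \<delta> x)) \<and>
     (\<forall>q \<delta> x. ((\<lambda>s. F q (\<delta> + s) (x + s)) has_real_derivative F' q \<delta> x) (at 0))"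

lemma continuous_compose2:
  fixes f :: "real \<Rightarrow> real \<Rightarrow> real" and g h :: "real \<Rightarrow> real"
  assumes "continuous_on UNIV (\<lambda>(\<delta>, x). f \<delta> x)" "isCont g t" "isCont h t"
  shows "isCont (\<lambda>s. f (g s) (h s)) t"
proof -
  have "isCont (\<lambda>(\<delta>, x). f \<delta> x) (g t, h t)"
    using assms(1) by (simp add: continuous_on_eq_continuous_at)
  then have "isCont (\<lambda>s. (\<lambda>(\<delta>, x). f \<delta> x) (g s, h s)) t"
    by (rule isCont_o2[OF isCont_Pair[OF assms(2,3)]])
  then show ?thesis by simp
qed

lemma continuous_bounded2:
  fixes F :: "nat \<Rightarrow> real \<Rightarrow> real \<Rightarrow> real"
  assumes "\<And>q. continuous_on UNIV (\<lambda>(\<delta>, x). F q \<delta> x)"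
  obtains B where "0 \<le> B" "\<And>q \<delta> x. q \<le> m \<Longrightarrow> 0 \<le> \<delta> \<Longrightarrow> \<delta> \<le> \<tau> \<Longrightarrow> 0 \<le> x \<Longrightarrow> x \<le> \<tau> \<Longrightarrow> \<bar>F q \<delta> x\<bar> \<le> B"
proof -
  have "\<exists>b. \<forall>p\<in>{0..\<tau>} \<times> {0..\<tau>}. \<bar>case p of (\<delta>, x) \<Rightarrow> F q \<delta> x\<bar> \<le> b" for q
  proof -
    have "compact ((\<lambda>(\<delta>, x). F q \<delta> x) ` ({0..\<tau>} \<times> {0..\<tau>}))"
      by (intro compact_continuous_image continuous_on_subset[OF assms[of q]] compact_Times) auto
    then have "bounded ((\<lambda>(\<delta>, x). F q \<delta> x) ` ({0..\<tau>} \<times> {0..\<tau>}))" by (rule compact_imp_bounded)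
    then obtain b where "\<forall>y\<in>(\<lambda>(\<delta>, x). F q \<delta> x) ` ({0..\<tau>} \<times> {0..\<tau>}). norm y \<le> b" unfolding bounded_iff ..
    then show ?thesis by (intro exI[of _ b]) auto
  qed
  then obtain b where b: "\<And>q p. p \<in> {0..\<tau>} \<times> {0..\<tau>} \<Longrightarrow> \<bar>case p of (\<delta>, x) \<Rightarrow> F q \<delta> x\<bar> \<le> b q" by metis
  show thesis
  proof (rule that[of "\<Sum>q\<le>m. \<bar>b q\<bar>"])
    fix q \<delta> x assume q: "q \<le> m" "0 \<le> \<delta>" "\<delta> \<le> \<tau>" "0 \<le> x" "x \<le> \<tau>"
    then have "\<bar>F q \<delta> x\<bar> \<le> \<bar>b q\<bar>" using b[of "(\<delta>, x)" q] by auto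
    also have "\<dots> \<le> (\<Sum>q\<le>m. \<bar>b q\<bar>)" using q by (intro member_le_sum) auto
    finally show "\<bar>F q \<delta> x\<bar> \<le> (\<Sum>q\<le>m. \<bar>b q\<bar>)" .
  qed (simp add: sum_nonneg)
qed

context path
begin

abbreviation la :: "real \<Rightarrow> real" where "la \<equiv> last_arrival T i"
abbreviation st :: "real \<Rightarrow> real" where "st \<equiv> stamp T X i"
abbreviation Q :: "real \<Rightarrow> nat" where "Q \<equiv> busy_count T X i"

definition lal :: "real \<Rightarrow> real" where
  "lal t = enn2real (SUP n. if T i n < t then ennreal (T i n) else 0)"
definition stl :: "real \<Rightarrow> real" where
  "stl t = enn2real (SUP n. if completes i n \<and> ctime i n < t then ennreal (T i n) else 0)"
definition Ql :: "real \<Rightarrow> nat" where "Ql t = card {k. k < i \<and> hpl k t}"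

lemma delivered_work_iff:
  assumes k: "k \<le> i"
  shows "delivered_work T X k n t \<longleftrightarrow> completes k n \<and> ctime k n \<le> t"
proof (cases "completes k n")
  case True
  have "delivered_work T X k n t \<longleftrightarrow> T k n \<le> t \<and> ctime k n \<le> min t (T k (Suc n))"
    unfolding delivered_work_def ctime_iff[OF k True] ..
  then show ?thesis using True ctime_gt[OF k True] ctime_less[OF k True] by auto
next
  case False
  then show ?thesis using srv_less_X[OF k False, of "min t (T k (Suc n))"] by (auto simp: delivered_work_def)
qed

lemma st_alt: "st t = enn2real (SUP n. if completes i n \<and> ctime i n \<le> t then ennreal (T i n) else 0)"
  by (simp add: stamp_def delivered_work_iff)

lemma events_right: "\<forall>\<^sub>F s in at_right t. \<forall>e\<in>events. etime e \<le> s \<longleftrightarrow> etime e \<le> t"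
proof -
  have "\<forall>\<^sub>F s in at_right t. \<forall>e\<in>{e\<in>events. etime e \<le> t + 1}. etime e \<le> s \<longleftrightarrow> etime e \<le> t"
  proof (intro eventually_ball_finite finite_events ballI)
    fix e
    show "\<forall>\<^sub>F s in at_right t. etime e \<le> s \<longleftrightarrow> etime e \<le> t"
    proof (cases "etime e \<le> t")
      case True
      have "\<forall>\<^sub>F s in at_right t. t < s \<and> s < t + 1" by (rule eventually_at_right_below) simp
      then show ?thesis by eventually_elim (use True in auto)
    next
      case False
      then have "\<forall>\<^sub>F s in at_right t. t < s \<and> s < etime e" by (intro eventually_at_right_below) simp
      then show ?thesis by eventually_elim (use False in auto)
    qed
  qed
  moreover have "\<forall>\<^sub>F s in at_right t. t < s \<and> s < t + 1" by (rule eventually_at_right_below) simp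
  ultimately show ?thesis by eventually_elim force
qed

lemma events_left: "\<forall>\<^sub>F s in at_left t. \<forall>e\<in>events. etime e \<le> s \<longleftrightarrow> etime e < t"
proof -
  have "\<forall>\<^sub>F s in at_left t. \<forall>e\<in>{e\<in>events. etime e \<le> t}. etime e \<le> s \<longleftrightarrow> etime e < t"
  proof (intro eventually_ball_finite finite_events ballI)
    fix e
    show "\<forall>\<^sub>F s in at_left t. etime e \<le> s \<longleftrightarrow> etime e < t"
    proof (cases "etime e < t")
      case False
      have "\<forall>\<^sub>F s in at_left t. t - 1 < s \<and> s < t" by (rule eventually_at_left_above) simp
      then show ?thesis by eventually_elim (use False in auto)
    next
      case True
      then have "\<forall>\<^sub>F s in at_left t. etime e < s \<and> s < t" by (intro eventually_at_left_above) simp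
      then show ?thesis by eventually_elim (use True in auto)
    qed
  qed
  moreover have "\<forall>\<^sub>F s in at_left t. t - 1 < s \<and> s < t" by (rule eventually_at_left_above) simp
  ultimately show ?thesis by eventually_elim force
qed

lemma la_cong: "\<forall>e\<in>events. etime e \<le> s \<longleftrightarrow> etime e \<le> t \<Longrightarrow> la s = la t"
proof -
  assume *: "\<forall>e\<in>events. etime e \<le> s \<longleftrightarrow> etime e \<le> t"
  have "T i n \<le> s \<longleftrightarrow> T i n \<le> t" for n using *[rule_format, of "Inl (i, n)"] by simp
  then show ?thesis by (simp add: last_arrival_def)
qed

lemma la_lal: "\<forall>e\<in>events. etime e \<le> s \<longleftrightarrow> etime e < t \<Longrightarrow> la s = lal t"
proof -
  assume *: "\<forall>e\<in>events. etime e \<le> s \<longleftrightarrow> etime e < t"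
  have "T i n \<le> s \<longleftrightarrow> T i n < t" for n using *[rule_format, of "Inl (i, n)"] by simp
  then show ?thesis by (simp add: last_arrival_def lal_def)
qed

lemma st_cong: "\<forall>e\<in>events. etime e \<le> s \<longleftrightarrow> etime e \<le> t \<Longrightarrow> st s = st t"
proof -
  assume *: "\<forall>e\<in>events. etime e \<le> s \<longleftrightarrow> etime e \<le> t"
  have "completes i n \<and> ctime i n \<le> s \<longleftrightarrow> completes i n \<and> ctime i n \<le> t" for n
    using *[rule_format, of "Inr (i, n)"] by auto
  then show ?thesis by (simp only: st_alt)
qed

lemma st_stl: "\<forall>e\<in>events. etime e \<le> s \<longleftrightarrow> etime e < t \<Longrightarrow> st s = stl t"
proof -
  assume *: "\<forall>e\<in>events. etime e \<le> s \<longleftrightarrow> etime e < t"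
  have "completes i n \<and> ctime i n \<le> s \<longleftrightarrow> completes i n \<and> ctime i n < t" for n
    using *[rule_format, of "Inr (i, n)"] by auto
  then show ?thesis by (simp only: st_alt stl_def)
qed

lemma right_state: "\<forall>\<^sub>F s in at_right t. Q s = Q t \<and> st s = st t \<and> la s = la t \<and> (\<forall>k\<le>i. hp k s = hp k t)"
proof -
  have "\<forall>\<^sub>F s in at_right t. \<forall>k\<in>{..i}. hp k s = hp k t"
    by (intro eventually_ball_finite) (auto intro!: hp_right)
  with events_right[of t] show ?thesis
  proof eventually_elim
    case (elim s)
    have "{k. k < i \<and> hp k s} = {k. k < i \<and> hp k t}" using elim(2) by auto
    then show ?case using elim la_cong[of s t] st_cong[of s t] by (simp add: busy_count_def)
  qed
qed

lemma left_state: "\<forall>\<^sub>F s in at_left t. Q s = Ql t \<and> st s = stl t \<and> la s = lal t \<and> (\<forall>k\<le>i. hp k s = hpl k t)"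
proof -
  have "\<forall>\<^sub>F s in at_left t. \<forall>k\<in>{..i}. hp k s = hpl k t"
    by (intro eventually_ball_finite) (auto intro!: hp_left)
  with events_left[of t] show ?thesis
  proof eventually_elim
    case (elim s)
    have "{k. k < i \<and> hp k s} = {k. k < i \<and> hpl k t}" using elim(2) by auto
    then show ?case using elim la_lal[of s t] st_stl[of s t] by (simp add: busy_count_def Ql_def)
  qed
qed

lemma la_le: "0 \<le> t \<Longrightarrow> la t \<le> t"
proof -
  assume "0 \<le> t"
  have "(SUP n. if T i n \<le> t then ennreal (T i n) else 0) \<le> ennreal t"
    by (intro SUP_least) (auto intro: ennreal_leI)
  then show ?thesis unfolding last_arrival_def using \<open>0 \<le> t\<close> by (simp add: enn2real_leI)
qed

lemma st_le_la: "st t \<le> la t"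
proof -
  have "(SUP n. if T i n \<le> t then ennreal (T i n) else 0) \<le> ennreal (max 0 t)"
    by (intro SUP_least) (auto intro!: ennreal_leI)
  also have "\<dots> < top" by simp
  finally have fin: "(SUP n. if T i n \<le> t then ennreal (T i n) else 0) < top" .
  have "(SUP n. if completes i n \<and> ctime i n \<le> t then ennreal (T i n) else 0) \<le> (SUP n. if T i n \<le> t then ennreal (T i n) else 0)"
  proof (rule SUP_mono)
    fix n
    show "\<exists>m\<in>UNIV. (if completes i n \<and> ctime i n \<le> t then ennreal (T i n) else 0) \<le> (if T i m \<le> t then ennreal (T i m) else 0)"
      using ctime_gt[of i n] by (intro bexI[of _ n]) auto
  qed
  then show ?thesis unfolding st_alt last_arrival_def using fin by (rule enn2real_mono)
qed

lemma st_nonneg: "0 \<le> st t" and la_nonneg: "0 \<le> la t"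
  by (simp_all add: stamp_def last_arrival_def)

text \<open>An empty stream has delivered its last arrival, or has had none, and then both
  quantities are 0. This identity allows the state to ignore whether the observed stream holds a
  packet.\<close>

lemma st_eq_la: "\<not> hp i t \<Longrightarrow> st t = la t"
proof (rule locate[OF order_refl, of t])
  assume t: "t < T i 0"
  have nT: "\<not> T i n \<le> t" for n using T_first_le[OF order_refl, of n] t by auto
  moreover have "\<not> (completes i n \<and> ctime i n \<le> t)" for n
    using nT[of n] ctime_gt[OF order_refl, of n] by auto
  ultimately have "st t = 0" "la t = 0"
    unfolding st_alt last_arrival_def by (intro enn2real_SUP_none; blast)+
  then show ?thesis by simp
next
  fix n assume h: "\<not> hp i t" and n: "T i n \<le> t" "t < T i (Suc n)"
  have c: "completes i n \<and> ctime i n \<le> t" using hp_iff[OF order_refl n] h by simp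
  have le: "T i m \<le> T i n" if "T i m \<le> t" for m
    using that n(2) T_le_iff[of i "Suc n" m] T_le_iff[of i m n] by (cases "m \<le> n") auto
  have "la t = T i n"
    unfolding last_arrival_def by (rule enn2real_SUP_attained) (use n le T_pos[of i n] in auto)
  moreover have "st t = T i n"
    unfolding st_alt
  proof (rule enn2real_SUP_attained)
    fix m assume "completes i m \<and> ctime i m \<le> t"
    then show "T i m \<le> T i n" using ctime_gt[of i m] by (intro le) auto
  qed (use c T_pos[of i n] in auto)
  ultimately show ?thesis by simp
qed

lemma la_arrival: "la (T i n) = T i n"
  unfolding last_arrival_def by (rule enn2real_SUP_attained) (use T_pos[of i n] in auto)

lemma event_unique: "e \<in> events \<Longrightarrow> f \<in> events \<Longrightarrow> etime e = etime f \<Longrightarrow> e = f"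
  using inj_etime by (rule inj_onD)

lemma hp_other_event:
  assumes k: "k \<le> i" and e: "e \<in> events" "etime e = t" and ne: "\<And>n. e \<noteq> Inl (k, n)" "\<And>n. e \<noteq> Inr (k, n)"
  shows "hpl k t = hp k t"
proof (rule hp_no_event[OF k])
  show "t \<noteq> T k n" for n using event_unique[OF e(1), of "Inl (k, n)"] e(2) ne k by auto
  show "t \<noteq> ctime k n" if "completes k n" for n using event_unique[OF e(1), of "Inr (k, n)"] e(2) ne k that by auto
qed

lemma la_other_event:
  assumes e: "e \<in> events" "etime e = t" and ne: "\<And>n. e \<noteq> Inl (i, n)"
  shows "lal t = la t"
proof -
  have "T i n \<noteq> t" for n using event_unique[OF e(1), of "Inl (i, n)"] e(2) ne by auto
  then have "T i n < t \<longleftrightarrow> T i n \<le> t" for n by (simp add: less_le)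
  then show ?thesis by (simp add: lal_def last_arrival_def)
qed

lemma st_other_event:
  assumes e: "e \<in> events" "etime e = t" and ne: "\<And>n. e \<noteq> Inr (i, n)"
  shows "stl t = st t"
proof -
  have "completes i n \<and> ctime i n < t \<longleftrightarrow> completes i n \<and> ctime i n \<le> t" for n
    using event_unique[OF e(1), of "Inr (i, n)"] e(2) ne by (auto simp: less_le)
  then show ?thesis by (simp only: stl_def st_alt)
qed

lemma no_event_state:
  assumes "\<And>e. e \<in> events \<Longrightarrow> etime e \<noteq> t"
  shows "Ql t = Q t" "stl t = st t" "lal t = la t" "k \<le> i \<Longrightarrow> hpl k t = hp k t"
proof -
  have h: "hpl k t = hp k t" if "k \<le> i" for k
    using assms[of "Inl (k, _)"] assms[of "Inr (k, _)"] that by (intro hp_no_event) auto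
  show "k \<le> i \<Longrightarrow> hpl k t = hp k t" by (rule h)
  have "{k. k < i \<and> hpl k t} = {k. k < i \<and> hp k t}" using h by auto
  then show "Ql t = Q t" by (simp add: Ql_def busy_count_def)
  have "completes i n \<and> ctime i n < t \<longleftrightarrow> completes i n \<and> ctime i n \<le> t" for n
    using assms[of "Inr (i, n)"] by (auto simp: less_le)
  then show "stl t = st t" by (simp only: stl_def st_alt)
  have "T i n < t \<longleftrightarrow> T i n \<le> t" for n using assms[of "Inl (i, n)"] by (auto simp: less_le)
  then show "lal t = la t" by (simp add: lal_def last_arrival_def)
qed

definition jump :: "(nat \<Rightarrow> real \<Rightarrow> real \<Rightarrow> real) \<Rightarrow> event \<Rightarrow> real" where
  "jump F e = (case e of
     Inl (k, n) \<Rightarrow> arrival_jump F i k (hpl k (T k n)) (Ql (T k n)) (T k n - stl (T k n)) (T k n - lal (T k n))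
   | Inr (k, n) \<Rightarrow> completion_jump F i k (Ql (ctime k n)) (ctime k n - stl (ctime k n)) (ctime k n - lal (ctime k n)))"

text \<open>Distinct events have distinct times, so only the component that belongs to
  \<open>e\<close> changes. A completion in stream \<open>i\<close> leaves that stream empty, and
  \<open>st_eq_la\<close> then turns the age into the time since the last arrival.\<close>

lemma state_jump:
  assumes e: "e \<in> events"
  defines "t \<equiv> etime e"
  shows "F (Q t) (t - st t) (t - la t) = F (Ql t) (t - stl t) (t - lal t) + jump F e"
proof -
  have et: "etime e = t" by (simp add: t_def)
  show ?thesis
  proof (cases e)
    case (Inl p)
    obtain k n where p: "p = (k, n)" by (cases p)
    have k: "k \<le> i" and tT: "t = T k n" using e Inl p et by auto
    have st: "stl t = st t" by (rule st_other_event[OF e et]) (simp add: Inl)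
    have oth: "hpl l t = hp l t" if "l \<le> i" "l \<noteq> k" for l
      by (rule hp_other_event[OF that(1) e et]) (use that Inl p in auto)
    show ?thesis
    proof (cases "k = i")
      case True
      have "{l. l < i \<and> hpl l t} = {l. l < i \<and> hp l t}" using oth True by auto
      then have "Ql t = Q t" by (simp add: Ql_def busy_count_def)
      then show ?thesis using st True la_arrival[of n] by (simp add: jump_def Inl p arrival_jump_def tT)
    next
      case False
      have la: "lal t = la t" by (rule la_other_event[OF e et]) (use Inl p False in auto)
      have "l \<in> {l. l < i \<and> hp l t} \<longleftrightarrow> l \<in> insert k {l. l < i \<and> hpl l t}" for l
        using oth[of l] False k hp_arrival[OF k, of n] tT by (cases "l = k") auto
      then have "{l. l < i \<and> hp l t} = insert k {l. l < i \<and> hpl l t}" by blast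
      then have "Q t = (if hpl k t then Ql t else Suc (Ql t))" using False k by (simp add: Ql_def busy_count_def card_insert_if)
      then show ?thesis using st la False by (simp add: jump_def Inl p arrival_jump_def tT)
    qed
  next
    case (Inr p)
    obtain k n where p: "p = (k, n)" by (cases p)
    have k: "k \<le> i" and c: "completes k n" and tc: "t = ctime k n" using e Inr p et by auto
    have la: "lal t = la t" by (rule la_other_event[OF e et]) (simp add: Inr)
    have oth: "hpl l t = hp l t" if "l \<le> i" "l \<noteq> k" for l
      by (rule hp_other_event[OF that(1) e et]) (use that Inr p in auto)
    show ?thesis
    proof (cases "k = i")
      case True
      have "{l. l < i \<and> hpl l t} = {l. l < i \<and> hp l t}" using oth True by auto
      then have "Ql t = Q t" by (simp add: Ql_def busy_count_def)
      moreover have "st t = la t" using hp_completion[OF k c] True tc by (intro st_eq_la) auto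
      ultimately show ?thesis using la True by (simp add: jump_def Inr p completion_jump_def tc)
    next
      case False
      have st: "stl t = st t" by (rule st_other_event[OF e et]) (use Inr p False in auto)
      have "l \<in> {l. l < i \<and> hpl l t} \<longleftrightarrow> l \<in> insert k {l. l < i \<and> hp l t}" for l
        using oth[of l] False k hp_completion[OF k c] tc by (cases "l = k") auto
      then have "{l. l < i \<and> hpl l t} = insert k {l. l < i \<and> hp l t}" by blast
      moreover have "k \<notin> {l. l < i \<and> hp l t}" using hp_completion[OF k c] tc by simp
      ultimately have "Ql t = Suc (Q t)" by (simp add: Ql_def busy_count_def)
      then show ?thesis using st la False by (simp add: jump_def Inr p completion_jump_def tc)
    qed
  qed
qed

lemma Q_le: "Q t \<le> i" 
proof -
  have "Q t \<le> card {..<i}" unfolding busy_count_def by (intro card_mono) auto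
  then show ?thesis by simp
qed

lemma measurable_Q [measurable]: "Q \<in> measurable borel (count_space UNIV)"
proof -
  have [measurable]: "k < i \<Longrightarrow> Measurable.pred borel (hp k)" for k using holds_borel[of k] by (simp add: pred_def)
  have "Q t = (\<Sum>k<i. if hp k t then 1 else 0)" for t
    by (simp add: busy_count_def sum.If_cases Int_def)
  then have "Q = (\<lambda>t. \<Sum>k\<in>{..<i}. if hp k t then 1 else 0)" by auto
  moreover have "(\<lambda>t. \<Sum>k\<in>{..<i}. if hp k t then 1 else (0::nat)) \<in> measurable borel (count_space UNIV)"
    by measurable
  ultimately show ?thesis by simp
qed

lemma measurable_la [measurable]: "la \<in> borel_measurable borel"
  unfolding last_arrival_def[abs_def] by measurable

lemma measurable_st [measurable]: "st \<in> borel_measurable borel"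
  unfolding st_alt[abs_def] by measurable

lemma measurable_state:
  assumes "\<And>q. continuous_on UNIV (\<lambda>(\<delta>, x). F q \<delta> x)"
  shows "(\<lambda>t. F (Q t) (t - st t) (t - la t) :: real) \<in> borel_measurable borel"
proof (rule measurable_compose_countable[OF _ measurable_Q])
  fix q
  have "(\<lambda>(\<delta>, x). F q \<delta> x) \<in> borel_measurable borel" using assms by (rule borel_measurable_continuous_onI)
  then have *: "(\<lambda>(\<delta>, x). F q \<delta> x) \<in> borel_measurable (borel \<Otimes>\<^sub>M borel)" by (simp only: borel_prod)
  have "(\<lambda>t. (t - st t, t - la t)) \<in> measurable borel (borel \<Otimes>\<^sub>M borel)" by measurable
  from measurable_compose[OF this *] show "(\<lambda>t. F q (t - st t) (t - la t)) \<in> borel_measurable borel" by simp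
qed

lemma state_range: "0 \<le> t \<Longrightarrow> 0 \<le> t - la t \<and> t - la t \<le> t - st t \<and> t - st t \<le> t"
  using la_le[of t] st_le_la[of t] st_nonneg[of t] by simp

text \<open>With the jumps so far subtracted, the process is continuous, and it is differentiable
  except at the finitely many event times; the fundamental theorem of calculus tolerates these
  exceptions.\<close>

theorem jump_formula:
  assumes F: "smooth_pair F F'" and \<tau>: "0 \<le> \<tau>"
  shows "F (Q \<tau>) (\<tau> - st \<tau>) (\<tau> - la \<tau>) - F (Q 0) 0 0 =
    (LINT t:{0..\<tau>}|lborel. F' (Q t) (t - st t) (t - la t)) + (\<Sum>e | e \<in> events \<and> etime e \<le> \<tau>. jump F e)"
proof -
  have cF: "\<And>q. continuous_on UNIV (\<lambda>(\<delta>, x). F q \<delta> x)" and cF': "\<And>q. continuous_on UNIV (\<lambda>(\<delta>, x). F' q \<delta> x)"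
    and dF: "\<And>q \<delta> x. ((\<lambda>s. F q (\<delta> + s) (x + s)) has_real_derivative F' q \<delta> x) (at 0)"
    using F by (auto simp: smooth_pair_def)
  define \<Phi> where "\<Phi> t = F (Q t) (t - st t) (t - la t)" for t
  define \<phi> where "\<phi> t = F' (Q t) (t - st t) (t - la t)" for t
  define N where "N t = (\<Sum>e | e \<in> events \<and> etime e \<le> t. jump F e)" for t
  define G where "G t = \<Phi> t - N t" for t
  have right: "\<forall>\<^sub>F s in at_right t. G s = F (Q t) (s - st t) (s - la t) - N t" for t
    using right_state[of t] events_right[of t]
  proof eventually_elim
    case (elim s)
    then have "{e. e \<in> events \<and> etime e \<le> s} = {e. e \<in> events \<and> etime e \<le> t}" by auto
    with elim show ?case by (simp add: G_def \<Phi>_def N_def)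
  qed
  define Nl where "Nl t = (\<Sum>e | e \<in> events \<and> etime e < t. jump F e)" for t
  have left: "\<forall>\<^sub>F s in at_left t. G s = F (Ql t) (s - stl t) (s - lal t) - Nl t" for t
    using left_state[of t] events_left[of t]
  proof eventually_elim
    case (elim s)
    then have "{e. e \<in> events \<and> etime e \<le> s} = {e. e \<in> events \<and> etime e < t}" by auto
    with elim show ?case by (simp add: G_def \<Phi>_def N_def Nl_def)
  qed
  \<comment> \<open>The value at \<open>t\<close> agrees with the expression for the left limit,
    because the new summand of \<open>N\<close> is exactly the jump of \<open>F\<close>.\<close>
  have Gt: "G t = F (Ql t) (t - stl t) (t - lal t) - Nl t" for t
  proof (cases "\<exists>e\<in>events. etime e = t")
    case True
    then obtain e where e: "e \<in> events" "etime e = t" by auto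
    have "{f. f \<in> events \<and> etime f \<le> t} = insert e {f. f \<in> events \<and> etime f < t}"
      using e event_unique by (auto simp: less_le)
    moreover have "finite {f. f \<in> events \<and> etime f < t}"
      by (rule finite_subset[OF _ finite_events[of t]]) auto
    ultimately have "N t = Nl t + jump F e" using e by (simp add: N_def Nl_def)
    then show ?thesis using state_jump[OF e(1), of F] e(2) by (simp add: G_def \<Phi>_def)
  next
    case False
    then have ne: "\<And>e. e \<in> events \<Longrightarrow> etime e \<noteq> t" by auto
    then have "{f. f \<in> events \<and> etime f \<le> t} = {f. f \<in> events \<and> etime f < t}" by (auto simp: less_le)
    then show ?thesis using no_event_state[OF ne] by (simp add: G_def \<Phi>_def N_def Nl_def)
  qed
  have contF: "isCont (\<lambda>s. F q (s - a) (s - b) - c) t" for q a b c t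
    by (intro continuous_intros continuous_compose2[OF cF])
  have contG: "isCont G t" for t
    unfolding isCont_def
  proof (rule filterlim_split_at)
    have "((\<lambda>s. F (Ql t) (s - stl t) (s - lal t) - Nl t) \<longlongrightarrow> G t) (at_left t)"
      unfolding Gt by (rule filterlim_mono[OF contF[unfolded isCont_def] order_refl at_le]) simp
    then show "(G \<longlongrightarrow> G t) (at_left t)"
      by (rule Lim_transform_eventually) (rule eventually_mono[OF left[of t]], simp)
    have "((\<lambda>s. F (Q t) (s - st t) (s - la t) - N t) \<longlongrightarrow> F (Q t) (t - st t) (t - la t) - N t) (at_right t)"
      by (rule filterlim_mono[OF contF[unfolded isCont_def] order_refl at_le]) simp
    then show "(G \<longlongrightarrow> G t) (at_right t)"
      unfolding G_def[of t] \<Phi>_def[of t] by (rule Lim_transform_eventually) (rule eventually_mono[OF right[of t]], simp)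
  qed
  have derivG: "(G has_vector_derivative \<phi> t) (at t)" if ne: "\<And>e. e \<in> events \<Longrightarrow> etime e \<noteq> t" for t
  proof -
    have "{f. f \<in> events \<and> etime f \<le> t} = {f. f \<in> events \<and> etime f < t}" using ne by (auto simp: less_le)
    then have "N t = Nl t" by (simp add: N_def Nl_def)
    then have "\<forall>\<^sub>F s in at_left t. G s = F (Q t) (s - st t) (s - la t) - N t"
      using left[of t] no_event_state[OF ne] by simp
    with right[of t] have "\<forall>\<^sub>F s in at t. G s = F (Q t) (s - st t) (s - la t) - N t"
      by (simp add: eventually_at_split)
    then have "\<forall>\<^sub>F s in nhds t. G s = F (Q t) (s - st t) (s - la t) - N t"
      by (simp add: eventually_nhds_conv_at G_def \<Phi>_def)
    moreover have "((\<lambda>s. F (Q t) (s - st t) (s - la t) - N t) has_real_derivative \<phi> t) (at t)"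
    proof -
      have "((\<lambda>s. F (Q t) (t - st t + s) (t - la t + s)) has_real_derivative \<phi> t) (at (t + - t))"
        using dF[of "Q t" "t - st t" "t - la t"] by (simp add: \<phi>_def)
      then have "((\<lambda>s. F (Q t) (t - st t + (s + - t)) (t - la t + (s + - t))) has_real_derivative \<phi> t) (at t)"
        unfolding DERIV_shift .
      then have "((\<lambda>s. F (Q t) (s - st t) (s - la t)) has_real_derivative \<phi> t) (at t)" by (simp add: algebra_simps)
      then show ?thesis by (auto intro!: derivative_eq_intros)
    qed
    ultimately have "(G has_real_derivative \<phi> t) (at t)"
      using DERIV_cong_ev[OF refl, of G "\<lambda>s. F (Q t) (s - st t) (s - la t) - N t" t "\<phi> t" "\<phi> t"] by simp
    then show ?thesis by (simp add: has_real_derivative_iff_has_vector_derivative)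
  qed
  have hi: "(\<phi> has_integral (G \<tau> - G 0)) {0..\<tau>}"
  proof (rule fundamental_theorem_of_calculus_strong[of "etime ` {e \<in> events. etime e \<le> \<tau>}"])
    show "finite (etime ` {e \<in> events. etime e \<le> \<tau>})" using finite_events by simp
    show "continuous_on {0..\<tau>} G" using contG by (simp add: continuous_at_imp_continuous_on)
    fix t assume "t \<in> {0..\<tau>} - etime ` {e \<in> events. etime e \<le> \<tau>}"
    then show "(G has_vector_derivative \<phi> t) (at t)" by (intro derivG) auto
  qed (rule \<tau>)
  obtain B where B: "0 \<le> B" "\<And>q \<delta> x. q \<le> i \<Longrightarrow> 0 \<le> \<delta> \<Longrightarrow> \<delta> \<le> \<tau> \<Longrightarrow> 0 \<le> x \<Longrightarrow> x \<le> \<tau> \<Longrightarrow> \<bar>F' q \<delta> x\<bar> \<le> B"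
    using continuous_bounded2[of F' i \<tau>] cF' by metis
  have "set_integrable lborel {0..\<tau>} \<phi>"
    unfolding set_integrable_def
  proof (rule Bochner_Integration.integrable_bound)
    show "integrable lborel (\<lambda>t. B * indicator {0..\<tau>} t)" using \<tau> by (auto intro!: integrable_mult_right)
    show "(\<lambda>t. indicator {0..\<tau>} t *\<^sub>R \<phi> t) \<in> borel_measurable lborel"
      using measurable_state[OF cF'] by (simp add: \<phi>_def)
    have "norm (indicator {0..\<tau>} t *\<^sub>R \<phi> t) \<le> norm (B * indicator {0..\<tau>} t)" for t
    proof (cases "t \<in> {0..\<tau>}")
      case True
      then have "\<bar>\<phi> t\<bar> \<le> B" unfolding \<phi>_def using state_range[of t] Q_le[of t] by (intro B(2)) auto
      then show ?thesis using True B(1) by simp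
    qed simp
    then show "AE t in lborel. norm (indicator {0..\<tau>} t *\<^sub>R \<phi> t) \<le> norm (B * indicator {0..\<tau>} t)"
      by (intro AE_I2)
  qed
  from set_borel_integral_eq_integral(2)[OF this] have "(LINT t:{0..\<tau>}|lborel. \<phi> t) = G \<tau> - G 0"
    using hi by (simp add: integral_unique)
  moreover have "N 0 = 0"
  proof -
    have "{e. e \<in> events \<and> etime e \<le> 0} = {}" using etime_pos by (auto simp: not_le)
    then show ?thesis by (simp only: N_def sum.empty)
  qed
  moreover have "st 0 = 0" "la 0 = 0" using st_le_la[of 0] la_le[of 0] st_nonneg[of 0] la_nonneg[of 0] by auto
  ultimately show ?thesis by (simp add: G_def \<Phi>_def N_def \<phi>_def)
qed

lemma arrival_jump_left_limit:
  assumes cF: "\<And>q. continuous_on UNIV (\<lambda>(\<delta>, x). F q \<delta> x)" and k: "k \<le> i"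
  shows "((\<lambda>s. arrival_jump F i k (hp k s) (Q s) (s - st s) (s - la s)) \<longlongrightarrow>
     arrival_jump F i k (hpl k t) (Ql t) (t - stl t) (t - lal t)) (at_left t)"
proof -
  have "isCont (\<lambda>s. arrival_jump F i k h q (s - a) (s - b)) t" for h q a b
    unfolding arrival_jump_def by (cases "k = i"; cases h) (auto intro!: continuous_intros continuous_compose2[OF cF])
  then have "((\<lambda>s. arrival_jump F i k (hpl k t) (Ql t) (s - stl t) (s - lal t)) \<longlongrightarrow>
     arrival_jump F i k (hpl k t) (Ql t) (t - stl t) (t - lal t)) (at_left t)"
    unfolding isCont_def by (rule filterlim_mono[OF _ order_refl at_le]) simp
  then show ?thesis
    by (rule Lim_transform_eventually) (rule eventually_mono[OF left_state[of t]], use k in auto)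
qed

lemma completion_jump_left_limit:
  assumes cF: "\<And>q. continuous_on UNIV (\<lambda>(\<delta>, x). F q \<delta> x)"
  shows "((\<lambda>s. completion_jump F i k (Q s) (s - st s) (s - la s)) \<longlongrightarrow>
     completion_jump F i k (Ql t) (t - stl t) (t - lal t)) (at_left t)"
proof -
  have "isCont (\<lambda>s. completion_jump F i k q (s - a) (s - b)) t" for q a b
    unfolding completion_jump_def by (cases "k = i") (auto intro!: continuous_intros continuous_compose2[OF cF])
  then have "((\<lambda>s. completion_jump F i k (Ql t) (s - stl t) (s - lal t)) \<longlongrightarrow>
     completion_jump F i k (Ql t) (t - stl t) (t - lal t)) (at_left t)"
    unfolding isCont_def by (rule filterlim_mono[OF _ order_refl at_le]) simp
  then show ?thesis
    by (rule Lim_transform_eventually) (rule eventually_mono[OF left_state[of t]], auto)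
qed

lemma countable_event_times: "countable (etime ` events)"
proof -
  have "countable (UNIV :: event set)" by simp
  then have "countable events" by (rule countable_subset[OF subset_UNIV])
  then show ?thesis by simp
qed

lemma AE_no_event: "AE t in lborel. \<forall>e\<in>events. etime e \<noteq> t"
proof -
  have "etime ` events \<in> null_sets lborel" by (rule countable_imp_null_set_lborel[OF countable_event_times])
  then have "AE t in lborel. t \<notin> etime ` events" by (rule AE_not_in)
  then show ?thesis by eventually_elim auto
qed

end

section \<open>The queue on the canonical probability space\<close>

lemma measurable_work_param:
  assumes I: "Measurable.pred (N \<Otimes>\<^sub>M borel) (\<lambda>(x, s). s \<in> I x)"
    and [measurable]: "a \<in> borel_measurable N" "b \<in> borel_measurable N"
  shows "(\<lambda>x. work (I x) (a x) (b x)) \<in> borel_measurable N"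
proof -
  have [measurable]: "Measurable.pred (N \<Otimes>\<^sub>M lborel) (\<lambda>y. snd y \<in> I (fst y))"
    using I by (simp add: case_prod_beta' pred_def space_pair_measure cong: measurable_cong_sets)
  have m: "(\<lambda>x. enn2real (\<integral>\<^sup>+s. (if a x \<le> s \<and> s \<le> b x \<and> s \<in> I x then 1 else 0) \<partial>lborel)) \<in> borel_measurable N"
    by (intro borel_measurable_enn2real lborel.borel_measurable_nn_integral) measurable
  have e: "enn2real (\<integral>\<^sup>+s. (if a x \<le> s \<and> s \<le> b x \<and> s \<in> I x then 1 else 0) \<partial>lborel) = work (I x) (a x) (b x)"
    if x: "x \<in> space N" for x
  proof -
    have "(\<lambda>s. (x, s)) \<in> measurable borel (N \<Otimes>\<^sub>M borel)" using x by simp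
    from measurable_compose[OF this I] have [measurable]: "I x \<in> sets borel" by (simp add: pred_def)
    have "(\<integral>\<^sup>+s. (if a x \<le> s \<and> s \<le> b x \<and> s \<in> I x then 1 else 0) \<partial>lborel) = (\<integral>\<^sup>+s. indicator ({a x..b x} \<inter> I x) s \<partial>lborel)"
      by (intro nn_integral_cong) (auto split: split_indicator)
    also have "\<dots> = emeasure lborel ({a x..b x} \<inter> I x)" by simp
    finally show ?thesis by (simp add: work_def measure_def)
  qed
  show ?thesis using measurable_cong[THEN iffD1, OF e m] .
qed

text \<open>\<open>Inl (k, n)\<close> is the coordinate of the interarrival time that ends with
  packet \<open>n\<close> of stream \<open>k\<close>, and \<open>Inr (k, n)\<close> that of its
  service requirement. Every natural number \<open>k\<close> gets its coordinates.\<close>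

definition clock_rate :: "real \<Rightarrow> real \<Rightarrow> event \<Rightarrow> real" where
  "clock_rate lam mu c = (case c of Inl _ \<Rightarrow> lam | Inr _ \<Rightarrow> mu)"

locale queue =
  fixes lam mu :: real and i :: nat
  assumes lam_pos: "lam > 0" and mu_pos: "mu > 0"
begin

sublocale exponential_family "clock_rate lam mu"
  by unfold_locales (auto simp: clock_rate_def lam_pos mu_pos split: sum.splits)

definition T :: "(event \<Rightarrow> real) \<Rightarrow> nat \<Rightarrow> nat \<Rightarrow> real" where
  "T w = arrival_time (\<lambda>k n. w (Inl (k, n)))"
definition X :: "(event \<Rightarrow> real) \<Rightarrow> nat \<Rightarrow> nat \<Rightarrow> real" where
  "X w = (\<lambda>k n. w (Inr (k, n)))"

abbreviation busy where "busy w \<equiv> higher_busy (T w) (X w)"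
abbreviation holds where "holds w k \<equiv> holds_packet (busy w k) (T w) (X w) k"

lemma measurable_T [measurable]: "(\<lambda>w. T w k n) \<in> borel_measurable P"
  unfolding T_def arrival_time_def by measurable

lemma measurable_X [measurable]: "(\<lambda>w. X w k n) \<in> borel_measurable P"
  unfolding X_def by measurable

lemma measurable_srv:
  assumes "Measurable.pred (P \<Otimes>\<^sub>M borel) (\<lambda>(w, t). busy w k t)"
    and f: "f \<in> measurable N P" and h: "h \<in> borel_measurable N"
  shows "(\<lambda>x. served (busy (f x) k) (T (f x)) k n (h x)) \<in> borel_measurable N"
  unfolding served_eq_work
proof (rule measurable_work_param)
  have "(\<lambda>y. (f (fst y), snd y)) \<in> measurable (N \<Otimes>\<^sub>M borel) (P \<Otimes>\<^sub>M borel)"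
    using f by measurable
  from measurable_compose[OF this assms(1)]
  show "Measurable.pred (N \<Otimes>\<^sub>M borel) (\<lambda>(x, s). s \<in> {s. \<not> busy (f x) k s})" by (simp add: case_prod_beta')
  show "(\<lambda>x. T (f x) k n) \<in> borel_measurable N" by (rule measurable_compose[OF f measurable_T])
qed (rule h)

lemma measurable_hp_step:
  assumes busy: "Measurable.pred (P \<Otimes>\<^sub>M borel) (\<lambda>(w, t). busy w k t)"
  shows "Measurable.pred (P \<Otimes>\<^sub>M borel) (\<lambda>(w, t). holds w k t)"
proof -
  have [measurable]: "(\<lambda>x. served (busy (fst x) k) (T (fst x)) k n (snd x)) \<in> borel_measurable (P \<Otimes>\<^sub>M borel)" for n
    by (rule measurable_srv[OF busy]) measurable
  have [measurable]: "(\<lambda>x. T (fst x) k n) \<in> borel_measurable (P \<Otimes>\<^sub>M borel)" "(\<lambda>x. X (fst x) k n) \<in> borel_measurable (P \<Otimes>\<^sub>M borel)" for n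
    by (rule measurable_compose[OF measurable_fst measurable_T] measurable_compose[OF measurable_fst measurable_X])+
  show ?thesis
    unfolding holds_packet_def done_by_def case_prod_beta' by measurable
qed

lemma measurable_hb: "Measurable.pred (P \<Otimes>\<^sub>M borel) (\<lambda>(w, t). busy w k t)"
proof (induction k)
  case (Suc k)
  note Suc[measurable] measurable_hp_step[OF Suc, measurable]
  from pred_intros_logic(5)[OF Suc measurable_hp_step[OF Suc]]
  show ?case by (simp add: case_prod_beta')
qed simp

lemma measurable_hp: "Measurable.pred (P \<Otimes>\<^sub>M borel) (\<lambda>(w, t). holds w k t)"
  by (rule measurable_hp_step[OF measurable_hb])

lemma hp_borel: "{s. holds w k s} \<in> sets borel" and hb_borel: "{s. \<not> busy w k s} \<in> sets borel"
proof -
  have sec: "(\<lambda>t. (w, t)) \<in> measurable borel (P \<Otimes>\<^sub>M borel)" by simp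
  from measurable_compose[OF sec measurable_hp[of k]] show "{s. holds w k s} \<in> sets borel" by (simp add: pred_def)
  from measurable_compose[OF sec measurable_hb[of k]] have "{s. busy w k s} \<in> sets borel" by (simp add: pred_def)
  then have "- {s. busy w k s} \<in> sets borel" by (rule borel_comp)
  then show "{s. \<not> busy w k s} \<in> sets borel" by (simp add: Collect_neg_eq)
qed

lemma measurable_busy_count: "(\<lambda>x. busy_count (T (fst x)) (X (fst x)) i (snd x)) \<in> measurable (P \<Otimes>\<^sub>M borel) (count_space UNIV)"
proof -
  have [measurable]: "Measurable.pred (P \<Otimes>\<^sub>M borel) (\<lambda>x. holds (fst x) k (snd x))" for k
    using measurable_hp[of k] by (simp add: case_prod_beta')
  have "(\<lambda>x. busy_count (T (fst x)) (X (fst x)) i (snd x)) = (\<lambda>x. \<Sum>k\<in>{..<i}. if holds (fst x) k (snd x) then 1 else 0)"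
    by (auto simp: busy_count_def sum.If_cases Int_def)
  moreover have "(\<lambda>x. \<Sum>k\<in>{..<i}. if holds (fst x) k (snd x) then 1 else (0::nat)) \<in> measurable (P \<Otimes>\<^sub>M borel) (count_space UNIV)"
    by measurable
  ultimately show ?thesis by simp
qed

lemma measurable_last_arrival [measurable]: "(\<lambda>x. last_arrival (T (fst x)) i (snd x)) \<in> borel_measurable (P \<Otimes>\<^sub>M borel)"
proof -
  have [measurable]: "(\<lambda>x. T (fst x) k n) \<in> borel_measurable (P \<Otimes>\<^sub>M borel)" for k n
    by (rule measurable_compose[OF measurable_fst measurable_T])
  show ?thesis unfolding last_arrival_def by measurable
qed

lemma measurable_stamp [measurable]: "(\<lambda>x. stamp (T (fst x)) (X (fst x)) i (snd x)) \<in> borel_measurable (P \<Otimes>\<^sub>M borel)"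
proof -
  have [measurable]: "(\<lambda>x. T (fst x) k n) \<in> borel_measurable (P \<Otimes>\<^sub>M borel)" "(\<lambda>x. X (fst x) k n) \<in> borel_measurable (P \<Otimes>\<^sub>M borel)" for k n
    by (rule measurable_compose[OF measurable_fst measurable_T] measurable_compose[OF measurable_fst measurable_X])+
  have [measurable]: "(\<lambda>x. served (busy (fst x) k) (T (fst x)) k n (min (snd x) (T (fst x) k (Suc n)))) \<in> borel_measurable (P \<Otimes>\<^sub>M borel)" for k n
    by (rule measurable_srv[OF measurable_hb]) measurable
  show ?thesis unfolding stamp_def delivered_work_def by measurable
qed

section \<open>Almost every sample path is regular\<close>

lemma T_upd_other: "k \<noteq> m \<Longrightarrow> T (w(Inl (k, n) := a)) m = T w m"
  by (auto simp: T_def arrival_time_def fun_eq_iff)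

lemma T_upd_service: "T (w(Inr c := a)) = T w"
  by (auto simp: T_def arrival_time_def fun_eq_iff)

lemma X_upd_arrival: "X (w(Inl c := a)) = X w"
  by (auto simp: X_def fun_eq_iff)

lemma X_upd_other: "(k, n) \<noteq> (m, l) \<Longrightarrow> X (w(Inr (k, n) := a)) m l = X w m l"
  by (auto simp: X_def)

lemma X_upd_same [simp]: "X (w(Inr (k, n) := a)) k n = a"
  by (simp add: X_def)

lemma T_Suc: "T w k (Suc n) = T w k n + w (Inl (k, Suc n))"
  by (simp add: T_def arrival_time_def)

lemma T_upd_before: "m < n \<Longrightarrow> T (w(Inl (k, n) := a)) k m = T w k m"
  by (auto simp: T_def arrival_time_def intro!: sum.cong)

lemma T_upd_same: "T (w(Inl (k, n) := a)) k n = (\<Sum>m<n. w (Inl (k, m))) + a"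
  unfolding T_def arrival_time_def lessThan_Suc_atMost[symmetric] sum.lessThan_Suc
  by (auto intro!: sum.cong)

lemma higher_busy_cong:
  assumes "\<And>l. l < k \<Longrightarrow> S l = S' l \<and> Z l = Z' l"
  shows "higher_busy S Z k = higher_busy S' Z' k"
  using assms
proof (induction k)
  case (Suc k)
  then have "higher_busy S Z k = higher_busy S' Z' k" "S k = S' k" "Z k = Z' k" by auto
  then show ?case by (auto simp: holds_packet_def done_by_def served_def fun_eq_iff)
qed simp

lemma hb_upd_service: "k \<le> m \<Longrightarrow> busy (w(Inr (m, n) := a)) k = busy w k"
  by (rule higher_busy_cong) (auto simp: T_upd_service X_upd_other fun_eq_iff)

lemma AE_expm_neq: "AE a in expm r. a \<noteq> b" for b :: real
  by (subst AE_density) (use AE_lborel_singleton[of b] in auto)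

text \<open>Redrawing the last interarrival time shifts \<open>T w k n\<close> and does not move
  stream \<open>m\<close>; a coincidence then needs one particular value.\<close>

lemma AE_arrivals_distinct:
  assumes "k \<noteq> m" shows "AE w in P. T w k n \<noteq> T w m l"
proof (rule AE_resample[of _ "Inl (k, n)"])
  fix w
  have "AE a in expm (clock_rate lam mu (Inl (k, n))). a \<noteq> T w m l - (\<Sum>j<n. w (Inl (k, j)))" by (rule AE_expm_neq)
  then show "AE a in expm (clock_rate lam mu (Inl (k, n))). T (w(Inl (k, n) := a)) k n \<noteq> T (w(Inl (k, n) := a)) m l"
    by eventually_elim (auto simp: T_upd_same T_upd_other[OF assms])
next
  show "Measurable.pred P (\<lambda>w. T w k n \<noteq> T w m l)"
    unfolding pred_def by (rule borel_measurable_neq) (rule measurable_T)+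
qed

text \<open>The work received depends on arrivals and on the services of higher-priority streams,
  not on the packet's own requirement. Redrawing that requirement hits the given value with
  probability zero.\<close>

lemma AE_no_tie: "AE w in P. served (busy w k) (T w) k n (T w m l) \<noteq> X w k n"
proof (rule AE_resample[of _ "Inr (k, n)"])
  have [measurable]: "(\<lambda>w. served (busy w k) (T w) k n (T w m l)) \<in> borel_measurable P"
    by (rule measurable_srv[OF measurable_hb, of "\<lambda>w. w"]) measurable
  show "Measurable.pred P (\<lambda>w. served (busy w k) (T w) k n (T w m l) \<noteq> X w k n)"
    unfolding pred_def by (rule borel_measurable_neq) measurable
  fix w
  have "AE a in expm (clock_rate lam mu (Inr (k, n))). a \<noteq> served (busy w k) (T w) k n (T w m l)" by (rule AE_expm_neq)
  then show "AE a in expm (clock_rate lam mu (Inr (k, n))). served (busy (w(Inr (k, n) := a)) k) (T (w(Inr (k, n) := a))) k n (T (w(Inr (k, n) := a)) m l) \<noteq> X (w(Inr (k, n) := a)) k n"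
    unfolding hb_upd_service[OF order_refl] unfolding T_upd_service X_upd_same by eventually_elim auto
qed

lemma expm_laplace: "r > 0 \<Longrightarrow> (\<integral>\<^sup>+a. ennreal (exp (- a)) \<partial>expm r) = ennreal (r / (r + 1))"
proof -
  assume r: "r > 0"
  have "(\<integral>\<^sup>+a. ennreal (exp (- a)) \<partial>expm r) = (\<integral>\<^sup>+s. ennreal (r / (r + 1)) * (ennreal ((r + 1) * exp (- s * (r + 1))) * 1 * indicator {0<..} s) \<partial>lborel)"
  proof (subst expm_nn[OF r], simp, rule nn_integral_cong)
    fix s :: real
    have "exp (- s * r) * exp (- s) = exp (- s * (r + 1))"
      by (simp add: exp_add[symmetric] algebra_simps)
    then have "r * exp (- s * r) * exp (- s) = r / (r + 1) * ((r + 1) * exp (- s * (r + 1)))"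
      using r by (simp add: mult.assoc)
    then show "ennreal (r * exp (- s * r)) * ennreal (exp (- s)) * indicator {0<..} s = 
       ennreal (r / (r + 1)) * (ennreal ((r + 1) * exp (- s * (r + 1))) * 1 * indicator {0<..} s)"
      using r by (auto simp flip: ennreal_mult split: split_indicator)
  qed
  also have "\<dots> = ennreal (r / (r + 1)) * (\<integral>\<^sup>+a. 1 \<partial>expm (r + 1))"
    using r by (subst expm_nn[of "r + 1"]) (auto simp: nn_integral_cmult)
  also have "(\<integral>\<^sup>+a. 1 \<partial>expm (r + 1)) = 1"
    using prob_space.emeasure_space_1[OF prob_space_exponential_density[of "r + 1"]] r by simp
  finally show ?thesis by simp
qed

lemma laplace_T: "(\<integral>\<^sup>+w. ennreal (exp (- T w k n)) \<partial>P) = ennreal ((lam / (lam + 1)) ^ Suc n)"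
proof (induction n)
  case 0
  have "(\<integral>\<^sup>+w. ennreal (exp (- T w k 0)) \<partial>P) = (\<integral>\<^sup>+w. (\<integral>\<^sup>+a. ennreal (exp (- a)) \<partial>expm lam) \<partial>P)"
    by (subst nn_integral_resample[of _ "Inl (k, 0)"]) (simp_all add: T_upd_same clock_rate_def)
  also have "\<dots> = ennreal (lam / (lam + 1))"
    by (simp add: expm_laplace lam_pos P.emeasure_space_1[simplified])
  finally show ?case by simp
next
  case (Suc n)
  let ?q = "lam / (lam + 1)"
  have "(\<integral>\<^sup>+w. ennreal (exp (- T w k (Suc n))) \<partial>P) = (\<integral>\<^sup>+w. (\<integral>\<^sup>+a. ennreal (exp (- T w k n)) * ennreal (exp (- a)) \<partial>expm lam) \<partial>P)"
    by (subst nn_integral_resample[of _ "Inl (k, Suc n)"])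
       (simp_all add: T_Suc T_upd_before clock_rate_def exp_add[symmetric] flip: ennreal_mult)
  also have "\<dots> = (\<integral>\<^sup>+w. ennreal (exp (- T w k n)) * ennreal ?q \<partial>P)"
    by (simp add: nn_integral_cmult expm_laplace lam_pos)
  also have "\<dots> = ennreal (?q ^ Suc n) * ennreal ?q"
    by (simp add: nn_integral_multc Suc.IH)
  also have "\<dots> = ennreal (?q ^ Suc (Suc n))"
    using lam_pos by (subst ennreal_mult[symmetric]) (auto simp: mult_ac)
  finally show ?case .
qed

text \<open>The Laplace transforms of the arrival times at 1 form a convergent geometric series.
  Hence the sum of \<open>exp (- T w k n)\<close> over \<open>n\<close> is almost surely finite and
  its terms tend to 0.\<close>

lemma AE_T_lim: "AE w in P. filterlim (T w k) at_top sequentially"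
proof -
  let ?q = "lam / (lam + 1)"
  have q: "0 \<le> ?q" "?q < 1" using lam_pos by auto
  have "(\<integral>\<^sup>+w. (\<Sum>n. ennreal (exp (- T w k n))) \<partial>P) = (\<Sum>n. ennreal (?q ^ Suc n))"
    by (subst nn_integral_suminf) (simp_all add: laplace_T)
  also have "\<dots> = ennreal (\<Sum>n. ?q ^ Suc n)"
  proof (rule suminf_ennreal2)
    show "0 \<le> ?q ^ Suc n" for n by (rule zero_le_power) (rule q)
    have "norm ?q < 1" using q by (simp only: real_norm_def abs_of_nonneg)
    then have "summable (\<lambda>n. ?q ^ n)" by (rule summable_geometric)
    then show "summable (\<lambda>n. ?q ^ Suc n)" unfolding summable_Suc_iff .
  qed
  finally have "AE w in P. (\<Sum>n. ennreal (exp (- T w k n))) \<noteq> \<infinity>"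
    by (intro nn_integral_PInf_AE) auto
  then show ?thesis
  proof eventually_elim
    fix w assume "(\<Sum>n. ennreal (exp (- T w k n))) \<noteq> \<infinity>"
    then have "summable (\<lambda>n. exp (- T w k n))" by (intro summable_suminf_not_top) auto
    then have "(\<lambda>n. exp (- T w k n)) \<longlonglongrightarrow> 0" by (rule summable_LIMSEQ_zero)
    then have "filterlim (\<lambda>n. exp (- T w k n)) (at_right 0) sequentially" by (simp add: filterlim_at)
    then have "filterlim (\<lambda>n. ln (exp (- T w k n))) at_bot sequentially" by (rule filterlim_compose[OF ln_at_0])
    then show "filterlim (T w k) at_top sequentially" by (simp add: filterlim_uminus_at_top)
  qed
qed

definition good :: "(event \<Rightarrow> real) \<Rightarrow> bool" where
  "good w \<longleftrightarrow> path (T w) (X w) i \<and> (\<forall>c. w c > 0)"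

lemma AE_good: "AE w in P. good w"
proof -
  have pos: "AE w in P. \<forall>c. w c > 0" using AE_coordinate_pos by (simp add: AE_all_countable)
  have lim: "AE w in P. \<forall>k. filterlim (T w k) at_top sequentially" using AE_T_lim by (simp add: AE_all_countable)
  have tie: "AE w in P. \<forall>k n m l. served (busy w k) (T w) k n (T w m l) \<noteq> X w k n"
    using AE_no_tie by (simp add: AE_all_countable)
  have dist: "AE w in P. \<forall>k m n l. k \<noteq> m \<longrightarrow> T w k n \<noteq> T w m l"
    using AE_arrivals_distinct by (auto simp: AE_all_countable)
  show ?thesis
    using pos lim tie dist
  proof eventually_elim
    case (elim w)
    have "path (T w) (X w) i"
    proof (unfold_locales, goal_cases)
      case (1 k) then show ?case using elim(1) by (simp add: T_def arrival_time_def)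
    next
      case (2 k n) then show ?case using elim(1) by (simp add: T_Suc)
    next
      case (4 k n) then show ?case using elim(1) by (simp add: X_def)
    next
      case (5 k) show ?case by (rule hp_borel)
    qed (use elim in auto)
    then show "good w" using elim(1) by (simp add: good_def)
  qed
qed

section \<open>Causality\<close>

text \<open>All the information at time \<open>t\<close> that the jump sizes may use. Causality of a
  process is stated as being a function of it.\<close>

definition same_obs :: "(event \<Rightarrow> real) \<Rightarrow> (event \<Rightarrow> real) \<Rightarrow> real \<Rightarrow> bool" where
  "same_obs w w' t \<longleftrightarrow> (\<forall>k\<le>i. holds w k t = holds w' k t) \<and> stamp (T w) (X w) i t = stamp (T w') (X w') i t \<and>
      last_arrival (T w) i t = last_arrival (T w') i t"

text \<open>Two inputs of stream \<open>k\<close> that cannot yet be told apart at time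
  \<open>t\<close>: arrivals that differ lie beyond \<open>t\<close> under both inputs, and a
  requirement that differs has been reached under neither, up to \<open>t\<close> or up to the
  replacement of the packet.\<close>

definition agree :: "(event \<Rightarrow> real) \<Rightarrow> (event \<Rightarrow> real) \<Rightarrow> real \<Rightarrow> nat \<Rightarrow> bool" where
  "agree w w' t k \<longleftrightarrow> (\<forall>n. T w k n = T w' k n \<or> t < T w k n \<and> t < T w' k n) \<and>
    (\<forall>n. X w k n = X w' k n \<or> (\<forall>s\<le>min t (T w k (Suc n)). served (busy w k) (T w) k n s < X w k n \<and> served (busy w k) (T w) k n s < X w' k n))"

lemma served_agree:
  assumes "\<And>s. s \<le> t \<Longrightarrow> B s = B' s" "S k n = S' k n" "s \<le> t"
  shows "served B S k n s = served B' S' k n s"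
proof -
  have "{S k n..s} \<inter> {s. \<not> B s} = {S' k n..s} \<inter> {s. \<not> B' s}" using assms by auto
  then show ?thesis by (simp add: served_def)
qed

lemma done_agree:
  assumes a: "agree w w' t k" and busy: "\<And>s. s \<le> t \<Longrightarrow> busy w k s = busy w' k s" and s: "s \<le> t"
    and T: "T w k n \<le> t" "s \<le> T w k (Suc n)"
  shows "X w k n \<le> served (busy w k) (T w) k n s \<longleftrightarrow> X w' k n \<le> served (busy w' k) (T w') k n s"
proof -
  have "T w k n = T w' k n" using a T by (auto simp: agree_def)
  then have e: "served (busy w k) (T w) k n s = served (busy w' k) (T w') k n s"
    using busy s by (intro served_agree[where t=t]) auto
  consider "X w k n = X w' k n" | "served (busy w k) (T w) k n s < X w k n \<and> served (busy w k) (T w) k n s < X w' k n"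
    using a s T(2) unfolding agree_def by (meson min.boundedI)
  then show ?thesis using e by cases auto
qed

lemma hp_agree:
  assumes a: "agree w w' t k" and busy: "\<And>s. s \<le> t \<Longrightarrow> busy w k s = busy w' k s" and s: "s \<le> t"
  shows "holds w k s = holds w' k s"
proof -
  have le: "T w k n \<le> s \<longleftrightarrow> T w' k n \<le> s" and less: "s < T w k n \<longleftrightarrow> s < T w' k n" for n
  proof -
    have "T w k n = T w' k n \<or> t < T w k n \<and> t < T w' k n" using a unfolding agree_def by blast
    then show "T w k n \<le> s \<longleftrightarrow> T w' k n \<le> s" "s < T w k n \<longleftrightarrow> s < T w' k n" using s by auto
  qed
  have "T w k n \<le> s \<and> s < T w k (Suc n) \<and> \<not> done_by (busy w k) (T w) (X w) k n s \<longleftrightarrow>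
    T w' k n \<le> s \<and> s < T w' k (Suc n) \<and> \<not> done_by (busy w' k) (T w') (X w') k n s" for n
    using done_agree[OF a busy s, of n] le[of n] less[of "Suc n"] s by (auto simp: done_by_def)
  then show ?thesis unfolding holds_packet_def by blast
qed

text \<open>Induction over the priorities: equal blocking by the streams above gives equal work,
  hence equal occupancy of the next stream, hence equal blocking one level below.\<close>

lemma agree_state:
  assumes a: "\<And>k. k \<le> i \<Longrightarrow> agree w w' t k"
  shows "same_obs w w' t"
proof -
  have busy: "busy w k s = busy w' k s" if "k \<le> Suc i" "s \<le> t" for k s
    using that
  proof (induction k arbitrary: s)
    case (Suc k)
    then have "holds w k s = holds w' k s" by (intro hp_agree[OF a]) auto
    then show ?case using Suc by simp
  qed simp
  have holds: "holds w k t = holds w' k t" if "k \<le> i" for k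
    using that busy by (intro hp_agree[OF a]) auto
  have T: "T w i n \<le> t \<longleftrightarrow> T w' i n \<le> t" "T w i n \<le> t \<Longrightarrow> T w i n = T w' i n" for n
  proof -
    have "T w i n = T w' i n \<or> t < T w i n \<and> t < T w' i n" using a[OF order_refl] unfolding agree_def by blast
    then show "T w i n \<le> t \<longleftrightarrow> T w' i n \<le> t" "T w i n \<le> t \<Longrightarrow> T w i n = T w' i n" by auto
  qed
  have "last_arrival (T w) i t = last_arrival (T w') i t"
    unfolding last_arrival_def by (intro arg_cong[of _ _ enn2real] SUP_cong) (use T in auto)
  moreover have "stamp (T w) (X w) i t = stamp (T w') (X w') i t"
  proof -
    have "delivered_work (T w) (X w) i n t \<longleftrightarrow> delivered_work (T w') (X w') i n t" for n
    proof (cases "T w i n \<le> t")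
      case True
      have m: "min t (T w i (Suc n)) = min t (T w' i (Suc n))"
      proof -
        have "T w i (Suc n) = T w' i (Suc n) \<or> t < T w i (Suc n) \<and> t < T w' i (Suc n)"
          using a[OF order_refl] unfolding agree_def by blast
        then show ?thesis by (elim disjE) simp_all
      qed
      have "X w i n \<le> served (busy w i) (T w) i n (min t (T w i (Suc n))) \<longleftrightarrow> X w' i n \<le> served (busy w' i) (T w') i n (min t (T w i (Suc n)))"
        using busy True by (intro done_agree[OF a]) auto
      then show ?thesis using T[of n] True m by (simp add: delivered_work_def)
    qed (use T[of n] in \<open>auto simp: delivered_work_def\<close>)
    then show ?thesis
      unfolding stamp_def by (intro arg_cong[of _ _ enn2real] SUP_cong) (use T in \<open>auto simp: delivered_work_def\<close>)
  qed
  ultimately show ?thesis using holds by (simp add: same_obs_def)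
qed

lemma agree_refl: "T w k = T w' k \<Longrightarrow> X w k = X w' k \<Longrightarrow> agree w w' t k"
  by (simp add: agree_def)

lemma T_later:
  assumes "\<And>k n. k \<le> i \<Longrightarrow> w (Inl (k, n)) > 0" "k \<le> i" "n \<le> m"
  shows "T w k n \<le> T w k m"
  using assms unfolding T_def arrival_time_def by (intro sum_mono2) (auto intro: less_imp_le)

text \<open>The change moves arrival \<open>n\<close> and all later arrivals of stream
  \<open>k\<close>, and under both inputs these lie after \<open>t\<close>.\<close>

lemma same_obs_arrival:
  assumes pos: "\<And>k n. k \<le> i \<Longrightarrow> w (Inl (k, n)) > 0" and a: "a > 0" and k: "k \<le> i"
    and t: "t < T w k n" "t < T (w(Inl (k, n) := a)) k n"
  shows "same_obs (w(Inl (k, n) := a)) w t"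
proof (rule agree_state)
  fix l assume l: "l \<le> i"
  let ?w = "w(Inl (k, n) := a)"
  have pos': "\<And>k n. k \<le> i \<Longrightarrow> ?w (Inl (k, n)) > 0" using pos a by auto
  show "agree ?w w t l"
  proof (cases "l = k")
    case True
    have "T ?w k m = T w k m \<or> t < T ?w k m \<and> t < T w k m" for m
    proof (cases "m < n")
      case False
      then show ?thesis using T_later[of w k n m] T_later[of ?w k n m] pos pos' k t by force
    qed (simp add: T_upd_before)
    then show ?thesis using True by (simp add: agree_def X_upd_arrival)
  qed (auto intro!: agree_refl simp: T_upd_other X_upd_arrival)
qed

text \<open>The work received by a packet does not depend on its own requirement, so until it
  reaches one of the two requirements, or before the packet arrives, both inputs produce the same
  path.\<close>

lemma same_obs_service:
  assumes X: "X w k n > 0" "a > 0" and k: "k \<le> i"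
    and t: "t < T w k n \<or> t \<le> T w k (Suc n) \<and> served (busy w k) (T w) k n t < X w k n \<and> served (busy w k) (T w) k n t < a"
  shows "same_obs (w(Inr (k, n) := a)) w t"
proof (rule agree_state)
  fix l assume l: "l \<le> i"
  let ?w = "w(Inr (k, n) := a)"
  show "agree ?w w t l"
  proof (cases "l = k")
    case True
    have less: "served (busy w k) (T w) k n s < X w k n \<and> served (busy w k) (T w) k n s < a" if "s \<le> t" for s
    proof -
      have "served (busy w k) (T w) k n s \<le> served (busy w k) (T w) k n t"
        unfolding served_eq_work by (rule work_mono[OF hb_borel that])
      moreover have "t < T w k n \<Longrightarrow> served (busy w k) (T w) k n t = 0" by (simp add: served_eq_work work_before)
      ultimately show ?thesis using t X by auto
    qed
    have srv: "served (busy ?w k) (T ?w) k m s = served (busy w k) (T w) k m s" for m s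
      unfolding hb_upd_service[OF order_refl] unfolding T_upd_service ..
    have "X ?w k m = X w k m \<or> (\<forall>s\<le>min t (T ?w k (Suc m)). served (busy w k) (T w) k m s < X ?w k m \<and> served (busy w k) (T w) k m s < X w k m)" for m
      using less X_upd_other[of k n k m w a] by (cases "m = n") auto
    then show ?thesis unfolding True agree_def srv by (simp add: T_upd_service)
  qed (auto intro!: agree_refl simp: T_upd_service X_upd_other fun_eq_iff)
qed

end

section \<open>Arrivals and service completions as families of clocks\<close>

lemma work_UNIV: "a \<le> t \<Longrightarrow> work UNIV a t = t - a"
  by (simp add: work_def)

lemma finish_UNIV: "0 < s \<Longrightarrow> finish UNIV a s = a + s"
proof -
  assume s: "0 < s"
  have u: "s \<le> work UNIV a (a + s)" using s by (simp add: work_UNIV)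
  have "a < finish UNIV a s" by (rule finish_gt[OF _ s u]) simp
  moreover have "work UNIV a (finish UNIV a s) = s" by (rule work_finish[OF _ s u]) simp
  ultimately show ?thesis by (simp add: work_UNIV)
qed

lemma disjoint_family_lessI:
  assumes "\<And>n m :: nat. n < m \<Longrightarrow> A n \<inter> A m = {}"
  shows "disjoint_family A"
  unfolding disjoint_family_on_def
proof (intro ballI impI)
  fix n m :: nat assume "n \<noteq> m"
  then consider "n < m" | "m < n" by linarith
  then show "A n \<inter> A m = {}" using assms[of n m] assms[of m n] by cases auto
qed

context queue
begin

lemma T_eq_sum: "T w k n = (\<Sum>m<n. w (Inl (k, m))) + w (Inl (k, n))"
  unfolding T_def arrival_time_def lessThan_Suc_atMost[symmetric] sum.lessThan_Suc ..

lemma sum_less_eq_T: "(\<Sum>m<Suc n. w (Inl (k, m))) = T w k n"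
  by (simp add: T_eq_sum)

lemma good_path: "good w \<Longrightarrow> path (T w) (X w) i"
  by (simp add: good_def)

text \<open>The clock of an arrival starts at the previous arrival, written as a sum over
  \<open>m < n\<close> so that the very first clock starts at 0. It never pauses, and its deadline
  is the horizon.\<close>

lemma arrival_clocks:
  assumes k: "k \<le> i" and \<tau>: "0 \<le> \<tau>" and B: "0 \<le> B"
    and Y: "(\<lambda>(w, t). Y w t) \<in> borel_measurable (P \<Otimes>\<^sub>M borel)"
    and causal: "\<And>w w' t. same_obs w w' t \<Longrightarrow> Y w t = Y w' t"
  shows "clocks (clock_rate lam mu) UNIV (\<lambda>n. Inl (k, n)) lam B \<tau> (\<lambda>n w. \<Sum>m<n. w (Inl (k, m))) (\<lambda>_ _. \<tau>) (\<lambda>_. UNIV) Y"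
proof (unfold_locales, goal_cases)
  case 1 show ?case by (simp add: inj_on_def)
next
  case (2 n) show ?case by (simp add: clock_rate_def)
next
  case 4 show ?case by simp
next
  case (8 n w) then show ?case by (intro sum_nonneg) (simp add: less_imp_le)
next
  case (13 n m w a) then show ?case by (auto intro!: sum.cong)
next
  \<comment> \<open>The goals come in the order of the assumptions of \<open>clocks\<close>: 16 and
    17 are invariance of \<open>Y\<close> before the start and during the run, and 18 says that
    clocks follow one another.\<close>
  case (16 n w a t)
  have "t < T w k n" "t < T (w(Inl (k, n) := a)) k n"
    using 16(1)[of "Inl (k, n)"] 16(2,4) by (auto simp: T_eq_sum[of w] T_upd_same)
  with 16(1,2) k show ?case by (intro causal same_obs_arrival) auto
next
  case (17 n w a t)
  define \<sigma> where "\<sigma> = (\<Sum>m<n. w (Inl (k, m)))"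
  have "t < \<sigma> + w (Inl (k, n)) \<and> t < \<sigma> + a"
  proof (cases "\<sigma> \<le> t")
    case True
    then show ?thesis using 17(4,5) by (simp add: work_UNIV flip: \<sigma>_def)
  next
    case False
    then show ?thesis using 17(1)[of "Inl (k, n)"] 17(2) by simp
  qed
  then have "same_obs (w(Inl (k, n) := a)) w t"
    using 17(1,2) k by (intro same_obs_arrival) (auto simp: T_upd_same T_eq_sum \<sigma>_def)
  then show ?case by (rule causal)
next
  case (18 n m w)
  have "finish UNIV (\<Sum>m<n. w (Inl (k, m))) (w (Inl (k, n))) = (\<Sum>m<Suc n. w (Inl (k, m)))"
    using 18(2)[of "Inl (k, n)"] by (simp add: finish_UNIV)
  also have "\<dots> \<le> (\<Sum>m<m. w (Inl (k, m)))"
    using 18(1,2) by (intro sum_mono2) (auto intro: less_imp_le)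
  finally show ?case .
qed (use \<tau> B Y in auto)

text \<open>The intervals between arrivals tile \<open>{0<..\<tau>}\<close>, so the compensator is
  an integral over the whole interval.\<close>

lemma arrival_martingale:
  assumes k: "k \<le> i" and \<tau>: "0 \<le> \<tau>" and B: "0 \<le> B"
    and Y: "(\<lambda>(w, t). Y w t) \<in> borel_measurable (P \<Otimes>\<^sub>M borel)"
    and causal: "\<And>w w' t. same_obs w w' t \<Longrightarrow> Y w t = Y w' t"
    and reg: "AE w in P. AE t in lborel. 0 \<le> t \<longrightarrow> t \<le> \<tau> \<longrightarrow> left_lim B (Y w) t = Y w t"
  obtains M where "integrable P M" "(\<integral>w. M w \<partial>P) = 0"
    "(\<integral>\<^sup>+w. ennreal ((M w)\<^sup>2) \<partial>P) \<le> ennreal lam * (\<integral>\<^sup>+w. (\<integral>\<^sup>+t. ennreal ((Y w t)\<^sup>2) * indicator {0..\<tau>} t \<partial>lborel) \<partial>P)"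
    "AE w in P. M w = (\<Sum>n | T w k n \<le> \<tau>. left_lim B (Y w) (T w k n)) - lam * (LINT t:{0<..\<tau>}|lborel. Y w t)"
proof -
  interpret C: clocks "clock_rate lam mu" UNIV "\<lambda>n. Inl (k, n)" lam B \<tau> "\<lambda>n w. \<Sum>m<n. w (Inl (k, m))" "\<lambda>_ _. \<tau>" "\<lambda>_. UNIV" Y
    by (rule arrival_clocks[OF k \<tau> B Y causal])
  have ring: "C.ring n w = T w k n" if "good w" for n w
    using that by (simp add: C.ring_def good_def finish_UNIV T_eq_sum)
  have rings: "C.rings w n \<longleftrightarrow> T w k n \<le> \<tau>" if "good w" for n w
  proof (cases "(\<Sum>m<n. w (Inl (k, m))) \<le> \<tau>")
    case True
    then show ?thesis by (auto simp: C.rings_def C.W_def work_UNIV T_eq_sum)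
  next
    case False
    have "w (Inl (k, n)) > 0" using that by (simp add: good_def)
    then show ?thesis using False by (auto simp: C.rings_def C.W_def work_before T_eq_sum)
  qed
  have active: "C.active n w = {(\<Sum>m<n. w (Inl (k, m)))<..min (T w k n) \<tau>}" if "good w" for n w
    unfolding C.active_def rings[OF that] ring[OF that] by auto
  have disj: "disjoint_family (\<lambda>n. C.active n w)" if g: "good w" for w
  proof -
    have "T w k n \<le> (\<Sum>m<m. w (Inl (k, m)))" if "n < m" for n m
      using that g unfolding sum_less_eq_T[symmetric] good_def by (intro sum_mono2) (auto intro: less_imp_le)
    then have "C.active n w \<inter> C.active m w = {}" if "n < m" for n m
      unfolding active[OF g] using that by fastforce
    then show ?thesis by (rule disjoint_family_lessI)
  qed
  have un: "(\<Union>n. C.active n w) = {0<..\<tau>}" if g: "good w" for w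
  proof -
    interpret path "T w" "X w" i by (rule good_path[OF g])
    have nn: "0 \<le> (\<Sum>m<n. w (Inl (k, m)))" for n using g by (intro sum_nonneg) (auto simp: good_def intro: less_imp_le)
    have "C.active n w \<subseteq> {0<..\<tau>}" for n
    proof
      fix t assume "t \<in> C.active n w"
      then show "t \<in> {0<..\<tau>}" using nn[of n] by (simp add: active[OF g])
    qed
    then have "(\<Union>n. C.active n w) \<subseteq> {0<..\<tau>}" by blast
    moreover have "t \<in> (\<Union>n. C.active n w)" if t: "t \<in> {0<..\<tau>}" for t
    proof (rule locate_left[OF k, of t])
      assume "t \<le> T w k 0"
      then show ?thesis using t by (intro UN_I[of 0]) (auto simp: active[OF g])
    next
      fix n assume "T w k n < t" "t \<le> T w k (Suc n)"
      then show ?thesis using t by (intro UN_I[of "Suc n"]) (auto simp: active[OF g] sum_less_eq_T simp del: sum.lessThan_Suc)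
    qed
    ultimately show ?thesis by blast
  qed
  have fin: "\<exists>n0. \<forall>n\<ge>n0. \<tau> < (\<Sum>m<n. w (Inl (k, m)))" if g: "good w" for w
  proof -
    interpret path "T w" "X w" i by (rule good_path[OF g])
    obtain n0 where n0: "\<And>n. n \<ge> n0 \<Longrightarrow> \<tau> < T w k n" using eventually_T_gt[OF k] by metis
    show ?thesis
    proof (intro exI allI impI)
      fix n assume "Suc n0 \<le> n"
      then obtain m where "n = Suc m" "n0 \<le> m" by (cases n) auto
      then show "\<tau> < (\<Sum>m<n. w (Inl (k, m)))" using n0[of m] by (simp only: sum_less_eq_T)
    qed
  qed
  have ae: "AE w in P. disjoint_family (\<lambda>n. C.active n w)" "AE w in P. \<exists>n0. \<forall>n\<ge>n0. \<tau> < (\<Sum>m<n. w (Inl (k, m)))"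
    using AE_good disj fin by (auto elim!: eventually_mono)
  note R = C.compensated_rings[OF ae reg]
  show thesis
  proof (rule that[of C.Mart])
    show "AE w in P. C.Mart w = (\<Sum>n | T w k n \<le> \<tau>. left_lim B (Y w) (T w k n)) - lam * (LINT t:{0<..\<tau>}|lborel. Y w t)"
      using R(2) AE_good by eventually_elim (simp add: ring rings un)
  qed (rule R)+
qed

text \<open>The service clock of a packet starts at its arrival and has the next arrival of the
  stream as deadline, which models the discarding of a replaced packet. Higher streams merely pause
  it, and the set of running times does not involve the services of stream \<open>k\<close> itself,
  so redrawing them leaves it fixed.\<close>

lemma completion_clocks:
  assumes k: "k \<le> i" and \<tau>: "0 \<le> \<tau>" and B: "0 \<le> B"
    and Y: "(\<lambda>(w, t). Y w t) \<in> borel_measurable (P \<Otimes>\<^sub>M borel)"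
    and causal: "\<And>w w' t. same_obs w w' t \<Longrightarrow> Y w t = Y w' t"
  shows "clocks (clock_rate lam mu) UNIV (\<lambda>n. Inr (k, n)) mu B \<tau> (\<lambda>n w. T w k n) (\<lambda>n w. min (T w k (Suc n)) \<tau>) (\<lambda>w. {s. \<not> busy w k s}) Y"
proof (unfold_locales, goal_cases)
  case 1 show ?case by (simp add: inj_on_def)
next
  case (2 n) show ?case by (simp add: clock_rate_def)
next
  case 4 show ?case by simp
next
  case (8 n w) then show ?case unfolding T_def arrival_time_def by (intro sum_nonneg) (simp add: less_imp_le)
next
  case 10
  have "Measurable.pred (P \<Otimes>\<^sub>M borel) (\<lambda>x. busy (fst x) k (snd x))" using measurable_hb[of k] by (simp add: case_prod_beta')
  then show ?case by (simp add: case_prod_beta')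
next
  case (13 n m w a) then show ?case by (simp add: T_upd_service)
next
  case (14 n m w a) then show ?case by (simp add: T_upd_service)
next
  case (15 n w a) then show ?case by (simp only: hb_upd_service[OF order_refl])
next
  case (16 n w a t)
  then show ?case using k by (intro causal same_obs_service) (auto simp: X_def)
next
  case (17 n w a t)
  then show ?case using k by (intro causal same_obs_service) (auto simp: X_def served_eq_work)
next
  case (18 n m w)
  have "finish {s. \<not> busy w k s} (T w k n) (w (Inr (k, n))) \<le> min (T w k (Suc n)) \<tau>"
    by (rule finish_le[OF hb_borel]) (use 18 in auto)
  also have "\<dots> \<le> T w k m"
    using T_later[of w k "Suc n" m] 18(1,2) k by (intro min.coboundedI1) auto
  finally show ?case .
qed (use \<tau> B Y in auto)

text \<open>Up to a null set the active periods make up the times in \<open>{0..\<tau>}\<close> at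
  which stream \<open>k\<close> holds a packet and is not blocked, that is, at which it is in
  service.\<close>

lemma completion_martingale:
  assumes k: "k \<le> i" and \<tau>: "0 \<le> \<tau>" and B: "0 \<le> B"
    and Y: "(\<lambda>(w, t). Y w t) \<in> borel_measurable (P \<Otimes>\<^sub>M borel)"
    and causal: "\<And>w w' t. same_obs w w' t \<Longrightarrow> Y w t = Y w' t"
    and reg: "AE w in P. AE t in lborel. 0 \<le> t \<longrightarrow> t \<le> \<tau> \<longrightarrow> left_lim B (Y w) t = Y w t"
  obtains M where "integrable P M" "(\<integral>w. M w \<partial>P) = 0"
    "(\<integral>\<^sup>+w. ennreal ((M w)\<^sup>2) \<partial>P) \<le> ennreal mu * (\<integral>\<^sup>+w. (\<integral>\<^sup>+t. ennreal ((Y w t)\<^sup>2) * indicator {0..\<tau>} t \<partial>lborel) \<partial>P)"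
    "AE w in P. M w = (\<Sum>n | path.completes (T w) (X w) k n \<and> path.ctime (T w) (X w) k n \<le> \<tau>. left_lim B (Y w) (path.ctime (T w) (X w) k n))
       - mu * (LINT t:{0..\<tau>}|lborel. of_bool (holds w k t \<and> \<not> busy w k t) * Y w t)"
proof -
  interpret C: clocks "clock_rate lam mu" UNIV "\<lambda>n. Inr (k, n)" mu B \<tau> "\<lambda>n w. T w k n" "\<lambda>n w. min (T w k (Suc n)) \<tau>" "\<lambda>w. {s. \<not> busy w k s}" Y
    by (rule completion_clocks[OF k \<tau> B Y causal])
  have ring: "C.ring n w = path.ctime (T w) (X w) k n" if g: "good w" for n w
  proof -
    interpret path "T w" "X w" i by (rule good_path[OF g])
    show ?thesis by (simp add: C.ring_def ctime_def idle_def) (simp add: X_def)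
  qed
  have rings: "C.rings w n \<longleftrightarrow> path.completes (T w) (X w) k n \<and> path.ctime (T w) (X w) k n \<le> \<tau>" if g: "good w" for n w
  proof -
    interpret path "T w" "X w" i by (rule good_path[OF g])
    have "C.rings w n \<longleftrightarrow> X w k n \<le> srv k n (min (T w k (Suc n)) \<tau>)"
      by (simp add: C.rings_def C.W_def served_eq_work) (simp add: X_def)
    also have "\<dots> \<longleftrightarrow> completes k n \<and> ctime k n \<le> \<tau>"
    proof (cases "completes k n")
      case True
      show ?thesis unfolding ctime_iff[OF k True, symmetric] using True ctime_less[OF k True] by auto
    next
      case False
      then show ?thesis using srv_less_X[OF k False, of "min (T w k (Suc n)) \<tau>"] by auto
    qed
    finally show ?thesis .
  qed
  have active: "C.active n w = {T w k n<..(if C.rings w n then path.ctime (T w) (X w) k n else min (T w k (Suc n)) \<tau>)} \<inter> {s. \<not> busy w k s}"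
    if "good w" for n w
    unfolding C.active_def ring[OF that] ..
  have active_le: "C.active n w \<subseteq> {T w k n<..min (T w k (Suc n)) \<tau>}" if g: "good w" for n w
  proof -
    interpret path "T w" "X w" i by (rule good_path[OF g])
    show ?thesis unfolding active[OF g] rings[OF g] using ctime_less[OF k, of n] by auto
  qed
  have disj: "disjoint_family (\<lambda>n. C.active n w)" if g: "good w" for w
  proof -
    interpret path "T w" "X w" i by (rule good_path[OF g])
    have "C.active n w \<inter> C.active m w = {}" if "n < m" for n m
    proof -
      have "T w k (Suc n) \<le> T w k m" using T_le_iff[OF k, of "Suc n" m] that by simp
      then show ?thesis using active_le[OF g, of n] active_le[OF g, of m] by fastforce
    qed
    then show ?thesis by (rule disjoint_family_lessI)
  qed
  have un: "AE t in lborel. t \<in> (\<Union>n. C.active n w) \<longleftrightarrow> t \<in> {0..\<tau>} \<and> holds w k t \<and> \<not> busy w k t" if g: "good w" for w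
  proof -
    interpret path "T w" "X w" i by (rule good_path[OF g])
    \<comment> \<open>Active periods are closed on the right whereas \<open>holds\<close> is
      right-continuous; the two can disagree only at event times, which form a null set.\<close>
    show ?thesis using AE_no_event
    proof eventually_elim
      fix t assume ne: "\<forall>e\<in>events. etime e \<noteq> t"
      have neT: "T w k n \<noteq> t" for n using ne[rule_format, of "Inl (k, n)"] k by simp
      have nec: "ctime k n \<noteq> t" if "completes k n" for n using ne[rule_format, of "Inr (k, n)"] k that by simp
      show "t \<in> (\<Union>n. C.active n w) \<longleftrightarrow> t \<in> {0..\<tau>} \<and> holds w k t \<and> \<not> busy w k t"
      proof
        assume "t \<in> (\<Union>n. C.active n w)"
        then obtain n where n: "t \<in> C.active n w" by auto
        then have T: "T w k n < t" "t \<le> T w k (Suc n)" "t \<le> \<tau>" using active_le[OF g, of n] by auto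
        then have "t < T w k (Suc n)" using neT[of "Suc n"] by auto
        then have "holds w k t \<longleftrightarrow> \<not> (completes k n \<and> ctime k n \<le> t)" using T by (intro hp_iff[OF k]) auto
        moreover have "\<not> (completes k n \<and> ctime k n \<le> t)"
          using n nec[of n] T(3) by (auto simp: active[OF g] rings[OF g] split: if_splits)
        ultimately show "t \<in> {0..\<tau>} \<and> holds w k t \<and> \<not> busy w k t"
          using n T T_pos[OF k, of n] by (auto simp: active[OF g])
      next
        assume t: "t \<in> {0..\<tau>} \<and> holds w k t \<and> \<not> busy w k t"
        then obtain n where n: "T w k n \<le> t" "t < T w k (Suc n)" using hp_before[OF k] locate[OF k, of t] by metis
        then have "\<not> (completes k n \<and> ctime k n \<le> t)" using hp_iff[OF k n] t by simp
        then have "t \<in> C.active n w" using n neT[of n] t rings[OF g, of n] by (auto simp: active[OF g] less_le)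
        then show "t \<in> (\<Union>n. C.active n w)" by blast
      qed
    qed
  qed
  have fin: "\<exists>n0. \<forall>n\<ge>n0. \<tau> < T w k n" if g: "good w" for w
  proof -
    interpret path "T w" "X w" i by (rule good_path[OF g])
    show ?thesis by (rule eventually_T_gt[OF k])
  qed
  have ae: "AE w in P. disjoint_family (\<lambda>n. C.active n w)" "AE w in P. \<exists>n0. \<forall>n\<ge>n0. \<tau> < T w k n"
    using AE_good disj fin by (auto elim!: eventually_mono)
  note R = C.compensated_rings[OF ae reg]
  have Ysec: "Y w \<in> borel_measurable borel" for w
  proof -
    have "(\<lambda>t. (w, t)) \<in> measurable borel (P \<Otimes>\<^sub>M borel)" by simp
    from measurable_compose[OF this Y] show ?thesis by simp
  qed
  have int: "(LINT t:(\<Union>n. C.active n w)|lborel. Y w t) = (LINT t:{0..\<tau>}|lborel. of_bool (holds w k t \<and> \<not> busy w k t) * Y w t)"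
    if g: "good w" for w
    unfolding set_lebesgue_integral_def
  proof (rule integral_cong_AE)
    show "AE t in lborel. indicator (\<Union>n. C.active n w) t *\<^sub>R Y w t = indicator {0..\<tau>} t *\<^sub>R (of_bool (holds w k t \<and> \<not> busy w k t) * Y w t)"
      using un[OF g]
    proof eventually_elim
      fix t assume "t \<in> (\<Union>n. C.active n w) \<longleftrightarrow> t \<in> {0..\<tau>} \<and> holds w k t \<and> \<not> busy w k t"
      then show "indicator (\<Union>n. C.active n w) t *\<^sub>R Y w t = indicator {0..\<tau>} t *\<^sub>R (of_bool (holds w k t \<and> \<not> busy w k t) * Y w t)"
        by (cases "t \<in> (\<Union>n. C.active n w)") (simp_all only: indicator_simps, auto simp: indicator_def)
    qed
    have "(\<Union>n. C.active n w) \<in> sets lborel" using g by (intro sets.countable_UN) (auto intro!: C.active_sets simp: good_def)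
    then show "(\<lambda>t. indicator (\<Union>n. C.active n w) t *\<^sub>R Y w t) \<in> borel_measurable lborel"
      using Ysec[of w] by (intro borel_measurable_scaleR borel_measurable_indicator; simp)
    have "{s. holds w k s} \<inter> {s. \<not> busy w k s} \<in> sets lborel"
      using hp_borel[of w k] hb_borel[of w k] by (intro sets.Int) simp_all
    then have "(\<lambda>t. indicator ({s. holds w k s} \<inter> {s. \<not> busy w k s}) t :: real) \<in> borel_measurable lborel"
      by (rule borel_measurable_indicator)
    also have "(\<lambda>t. indicator ({s. holds w k s} \<inter> {s. \<not> busy w k s}) t) = (\<lambda>t. of_bool (holds w k t \<and> \<not> busy w k t) :: real)"
      by (auto simp: fun_eq_iff)
    finally have "(\<lambda>t. of_bool (holds w k t \<and> \<not> busy w k t) :: real) \<in> borel_measurable lborel" .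
    then show "(\<lambda>t. indicator {0..\<tau>} t *\<^sub>R (of_bool (holds w k t \<and> \<not> busy w k t) * Y w t)) \<in> borel_measurable lborel"
      using Ysec[of w] by (intro borel_measurable_scaleR borel_measurable_times borel_measurable_indicator) simp_all
  qed
  show thesis
  proof (rule that[of C.Mart])
    show "AE w in P. C.Mart w = (\<Sum>n | path.completes (T w) (X w) k n \<and> path.ctime (T w) (X w) k n \<le> \<tau>. left_lim B (Y w) (path.ctime (T w) (X w) k n))
       - mu * (LINT t:{0..\<tau>}|lborel. of_bool (holds w k t \<and> \<not> busy w k t) * Y w t)"
      using R(2) AE_good by eventually_elim (simp only: ring rings int)
  qed (rule R)+
qed

end

section \<open>The generator of the state process and its compensated process\<close>

lemma continuous_on_compose2':
  fixes f :: "real \<Rightarrow> real \<Rightarrow> real" and g h :: "'a :: topological_space \<Rightarrow> real"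
  assumes "continuous_on UNIV (\<lambda>(\<delta>, x). f \<delta> x)" "continuous_on S g" "continuous_on S h"
  shows "continuous_on S (\<lambda>p. f (g p) (h p))"
proof -
  have "continuous_on S (\<lambda>p. (\<lambda>(\<delta>, x). f \<delta> x) (g p, h p))"
    by (rule continuous_on_compose2[OF assms(1)]) (auto intro!: continuous_on_Pair assms(2,3))
  then show ?thesis by simp
qed

context path
begin

lemma sum_events:
  "(\<Sum>e | e \<in> events \<and> etime e \<le> \<tau>. f e) =
   (\<Sum>k\<le>i. (\<Sum>n | T k n \<le> \<tau>. f (Inl (k, n))) + (\<Sum>n | completes k n \<and> ctime k n \<le> \<tau>. f (Inr (k, n))))"
  for f :: "event \<Rightarrow> real"
proof -
  let ?E = "{e \<in> events. etime e \<le> \<tau>}"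
  let ?A = "\<lambda>k. {n. T k n \<le> \<tau>}" and ?C = "\<lambda>k. {n. completes k n \<and> ctime k n \<le> \<tau>}"
  have fA: "finite (?A k)" and fC: "finite (?C k)" if "k \<le> i" for k
  proof -
    have "finite ((\<lambda>n. Inl (k, n)) -` ?E)" "finite ((\<lambda>n. Inr (k, n)) -` ?E)"
      by (intro finite_vimageI finite_events; simp add: inj_on_def)+
    moreover have "(\<lambda>n. Inl (k, n)) -` ?E = ?A k" "(\<lambda>n. Inr (k, n)) -` ?E = ?C k" using that by auto
    ultimately show "finite (?A k)" "finite (?C k)" by simp_all
  qed
  have E: "?E = Inl ` Sigma {..i} ?A \<union> Inr ` Sigma {..i} ?C"
    by (auto simp: events_def)
  have fin: "finite (Sigma {..i} ?A)" "finite (Sigma {..i} ?C)"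
    using fA fC by (auto intro!: finite_SigmaI)
  have "sum f ?E = sum f (Inl ` Sigma {..i} ?A) + sum f (Inr ` Sigma {..i} ?C)"
    unfolding E using fin by (intro sum.union_disjoint) auto
  also have "sum f (Inl ` Sigma {..i} ?A) = (\<Sum>k\<le>i. \<Sum>n\<in>?A k. f (Inl (k, n)))"
    by (subst sum.reindex) (use fA in \<open>auto simp: sum.Sigma inj_on_def case_prod_beta\<close>)
  also have "sum f (Inr ` Sigma {..i} ?C) = (\<Sum>k\<le>i. \<Sum>n\<in>?C k. f (Inr (k, n)))"
    by (subst sum.reindex) (use fC in \<open>auto simp: sum.Sigma inj_on_def case_prod_beta\<close>)
  finally show ?thesis by (simp add: sum.distrib)
qed

lemma Q_zero_iff: "Q t = 0 \<longleftrightarrow> \<not> hb i t"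
proof -
  have "finite {k. k < i \<and> hp k t}" by simp
  then have "Q t = 0 \<longleftrightarrow> {k. k < i \<and> hp k t} = {}" unfolding busy_count_def by simp
  then show ?thesis by (auto simp: higher_busy_iff)
qed

lemma Q_initial: "Q 0 = 0"
proof -
  have "{k. k < i \<and> hp k 0} = {}" using hp_before T_first by auto
  then show ?thesis by (simp only: busy_count_def card.empty)
qed

lemma sum_not_holding: "(\<Sum>k<i. if hp k t then 0 else c) = real (i - Q t) * c"
proof -
  have "(\<Sum>k<i. if hp k t then 0 else c) = (\<Sum>k\<in>{k. k < i \<and> \<not> hp k t}. c)"
    by (simp add: sum.If_cases Int_def)
  also have "{k. k < i \<and> \<not> hp k t} = {..<i} - {k. k < i \<and> hp k t}" by auto
  also have "(\<Sum>k\<in>{..<i} - {k. k < i \<and> hp k t}. c) = real (card ({..<i} - {k. k < i \<and> hp k t})) * c"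
    by simp
  also have "card ({..<i} - {k. k < i \<and> hp k t}) = i - Q t"
    unfolding busy_count_def by (subst card_Diff_subset) auto
  finally show ?thesis .
qed

text \<open>Among the busy higher streams precisely the one with the least index is unblocked. So
  the total service rate of the higher streams is the same at every positive level.\<close>

lemma sum_in_service: "(\<Sum>k<i. of_bool (hp k t \<and> \<not> hb k t) * c) = (if Q t = 0 then 0 else c :: real)"
proof (cases "Q t = 0")
  case True
  then have "\<not> hp k t" if "k < i" for k using that by (auto simp: Q_zero_iff higher_busy_iff)
  then show ?thesis using True by simp
next
  case False
  define m where "m = (LEAST k. hp k t)"
  obtain l where l: "l < i" "hp l t" using False by (auto simp: Q_zero_iff higher_busy_iff)
  have m: "hp m t" "m \<le> l" unfolding m_def by (rule LeastI[of "\<lambda>k. hp k t" l], rule l) (rule Least_le[of "\<lambda>k. hp k t" l], rule l)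
  have "\<not> hp j t" if "j < m" for j
    using that not_less_Least[of j "\<lambda>k. hp k t"] by (simp add: m_def)
  then have nb: "\<not> hb m t" by (auto simp: higher_busy_iff)
  have "hp k t \<and> \<not> hb k t \<longleftrightarrow> k = m" for k
  proof
    assume k: "hp k t \<and> \<not> hb k t"
    then have "m \<le> k" unfolding m_def by (intro Least_le) auto
    moreover have "\<not> m < k" using k m by (auto simp: higher_busy_iff)
    ultimately show "k = m" by simp
  qed (use m nb in auto)
  then have "(\<Sum>k<i. of_bool (hp k t \<and> \<not> hb k t) * c) = (\<Sum>k<i. if k = m then c else 0)"
    by (intro sum.cong) auto
  also have "\<dots> = c" using m l by simp
  finally show ?thesis using False by simp
qed

end

text \<open>Only the \<open>i - q\<close> empty higher streams raise the level, as an arrival to a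
  busy one just replaces a packet. At level 0 the service rate is charged even when the observed
  stream is empty: along a path one then has \<open>\<delta> = x\<close>, and the term
  vanishes.\<close>

definition generator :: "real \<Rightarrow> real \<Rightarrow> nat \<Rightarrow> (nat \<Rightarrow> real \<Rightarrow> real \<Rightarrow> real) \<Rightarrow> (nat \<Rightarrow> real \<Rightarrow> real \<Rightarrow> real) \<Rightarrow> nat \<Rightarrow> real \<Rightarrow> real \<Rightarrow> real" where
  "generator lam mu i F F' q \<delta> x = F' q \<delta> x + lam * (real (i - q) * (F (Suc q) \<delta> x - F q \<delta> x)) + lam * (F q \<delta> 0 - F q \<delta> x)
     + mu * (if q = 0 then F 0 x x - F 0 \<delta> x else F (q - 1) \<delta> x - F q \<delta> x)"

lemma continuous_arrival_jump:
  assumes "\<And>q. continuous_on UNIV (\<lambda>(\<delta>, x). F q \<delta> x)"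
  shows "continuous_on UNIV (\<lambda>(\<delta>, x). arrival_jump F i k h q \<delta> x)"
proof -
  have "continuous_on UNIV (\<lambda>p. arrival_jump F i k h q (fst p) (snd p))"
    unfolding arrival_jump_def
    by (cases "k = i"; cases h) (auto intro!: continuous_intros continuous_on_compose2'[OF assms])
  then show ?thesis by (simp add: case_prod_beta')
qed

lemma continuous_completion_jump:
  assumes "\<And>q. continuous_on UNIV (\<lambda>(\<delta>, x). F q \<delta> x)"
  shows "continuous_on UNIV (\<lambda>(\<delta>, x). completion_jump F i k q \<delta> x)"
proof -
  have "continuous_on UNIV (\<lambda>p. completion_jump F i k q (fst p) (snd p))"
    unfolding completion_jump_def
    by (cases "k = i") (auto intro!: continuous_intros continuous_on_compose2'[OF assms])
  then show ?thesis by (simp add: case_prod_beta')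
qed

lemma continuous_generator:
  assumes "smooth_pair F F'"
  shows "continuous_on UNIV (\<lambda>(\<delta>, x). generator lam mu i F F' q \<delta> x)"
proof -
  note c = assms[unfolded smooth_pair_def, THEN conjunct1, rule_format] assms[unfolded smooth_pair_def, THEN conjunct2, THEN conjunct1, rule_format]
  have "continuous_on UNIV (\<lambda>p. generator lam mu i F F' q (fst p) (snd p))"
    unfolding generator_def
    by (cases "q = 0") (auto intro!: continuous_intros continuous_on_compose2'[OF c(1)] continuous_on_compose2'[OF c(2)])
  then show ?thesis by (simp add: case_prod_beta')
qed

context queue
begin

definition Qw :: "(event \<Rightarrow> real) \<Rightarrow> real \<Rightarrow> nat" where "Qw w t = busy_count (T w) (X w) i t"
definition dl :: "(event \<Rightarrow> real) \<Rightarrow> real \<Rightarrow> real" where "dl w t = t - stamp (T w) (X w) i t"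
definition xl :: "(event \<Rightarrow> real) \<Rightarrow> real \<Rightarrow> real" where "xl w t = t - last_arrival (T w) i t"

lemma measurable_obs:
  assumes "\<And>q. continuous_on UNIV (\<lambda>(\<delta>, x). F q \<delta> x)"
  shows "(\<lambda>x. F (Qw (fst x) (snd x)) (dl (fst x) (snd x)) (xl (fst x) (snd x)) :: real) \<in> borel_measurable (P \<Otimes>\<^sub>M borel)"
proof (rule measurable_compose_countable[where f="\<lambda>q x. F q (dl (fst x) (snd x)) (xl (fst x) (snd x))" and g="\<lambda>x. Qw (fst x) (snd x)"])
  show "(\<lambda>x. Qw (fst x) (snd x)) \<in> measurable (P \<Otimes>\<^sub>M borel) (count_space UNIV)"
    unfolding Qw_def by (rule measurable_busy_count)
  fix q
  have "(\<lambda>(\<delta>, x). F q \<delta> x) \<in> borel_measurable borel" using assms by (rule borel_measurable_continuous_onI)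
  then have *: "(\<lambda>(\<delta>, x). F q \<delta> x) \<in> borel_measurable (borel \<Otimes>\<^sub>M borel)" by (simp only: borel_prod)
  have "(\<lambda>x. (dl (fst x) (snd x), xl (fst x) (snd x))) \<in> measurable (P \<Otimes>\<^sub>M borel) (borel \<Otimes>\<^sub>M borel)"
    unfolding dl_def xl_def by measurable
  from measurable_compose[OF this *]
  show "(\<lambda>x. F q (dl (fst x) (snd x)) (xl (fst x) (snd x))) \<in> borel_measurable (P \<Otimes>\<^sub>M borel)" by simp
qed

lemma obs_section:
  assumes "\<And>q. continuous_on UNIV (\<lambda>(\<delta>, x). F q \<delta> x)"
  shows "(\<lambda>t. F (Qw w t) (dl w t) (xl w t) :: real) \<in> borel_measurable borel"
proof -
  have "(\<lambda>t. (w, t)) \<in> measurable borel (P \<Otimes>\<^sub>M borel)" by simp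
  from measurable_compose[OF this measurable_obs[OF assms]] show ?thesis by simp
qed

lemma obs_at_time:
  assumes "\<And>q. continuous_on UNIV (\<lambda>(\<delta>, x). F q \<delta> x)"
  shows "(\<lambda>w. F (Qw w t) (dl w t) (xl w t) :: real) \<in> borel_measurable P"
proof -
  have "(\<lambda>w. (w, t)) \<in> measurable P (P \<Otimes>\<^sub>M borel)" by simp
  from measurable_compose[OF this measurable_obs[OF assms]] show ?thesis by simp
qed

text \<open>The jump that an arrival, and in \<open>CJ\<close> a completion, in stream
  \<open>k\<close> would cause at time \<open>t\<close>. The actual jumps are left limits of these
  processes at event times.\<close>

definition AJ where "AJ F k w t = arrival_jump F i k (holds w k t) (Qw w t) (dl w t) (xl w t)"
definition CJ where "CJ F k w t = completion_jump F i k (Qw w t) (dl w t) (xl w t)"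

lemma measurable_AJ:
  assumes "\<And>q. continuous_on UNIV (\<lambda>(\<delta>, x). F q \<delta> x)"
  shows "(\<lambda>(w, t). AJ F k w t) \<in> borel_measurable (P \<Otimes>\<^sub>M borel)"
proof -
  have h: "Measurable.pred (P \<Otimes>\<^sub>M borel) (\<lambda>x. holds (fst x) k (snd x))"
    using measurable_hp[of k] by (simp add: case_prod_beta')
  have m: "(\<lambda>x. arrival_jump F i k b (Qw (fst x) (snd x)) (dl (fst x) (snd x)) (xl (fst x) (snd x))) \<in> borel_measurable (P \<Otimes>\<^sub>M borel)" for b
    by (rule measurable_obs[OF continuous_arrival_jump[OF assms]])
  have "(\<lambda>x. if holds (fst x) k (snd x) then arrival_jump F i k True (Qw (fst x) (snd x)) (dl (fst x) (snd x)) (xl (fst x) (snd x))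
     else arrival_jump F i k False (Qw (fst x) (snd x)) (dl (fst x) (snd x)) (xl (fst x) (snd x))) \<in> borel_measurable (P \<Otimes>\<^sub>M borel)"
    using h by (intro measurable_If m) (simp add: pred_def)
  then show ?thesis
    by (rule back_subst[of "\<lambda>f. f \<in> _"]) (auto simp: AJ_def fun_eq_iff)
qed

lemma measurable_CJ:
  assumes "\<And>q. continuous_on UNIV (\<lambda>(\<delta>, x). F q \<delta> x)"
  shows "(\<lambda>(w, t). CJ F k w t) \<in> borel_measurable (P \<Otimes>\<^sub>M borel)"
  using measurable_obs[OF continuous_completion_jump[OF assms]] by (simp add: CJ_def case_prod_beta')

lemma same_obs_state: "same_obs w w' t \<Longrightarrow> Qw w t = Qw w' t \<and> dl w t = dl w' t \<and> xl w t = xl w' t"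
proof -
  assume s: "same_obs w w' t"
  then have "{k. k < i \<and> holds w k t} = {k. k < i \<and> holds w' k t}" by (auto simp: same_obs_def)
  then show ?thesis using s by (simp add: same_obs_def Qw_def dl_def xl_def busy_count_def)
qed

lemma obs_range: "good w \<Longrightarrow> 0 \<le> t \<Longrightarrow> 0 \<le> xl w t \<and> xl w t \<le> dl w t \<and> dl w t \<le> t \<and> Qw w t \<le> i"
  using path.state_range[OF good_path] path.Q_le[OF good_path] by (simp add: Qw_def dl_def xl_def)

lemma set_integrable_obs:
  assumes c: "\<And>q. continuous_on UNIV (\<lambda>(\<delta>, x). F q \<delta> x :: real)" and g: "good w" and \<tau>: "0 \<le> s"
  shows "set_integrable lborel {s..\<tau>} (\<lambda>t. F (Qw w t) (dl w t) (xl w t))"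
proof -
  obtain B where B: "0 \<le> B" "\<And>q \<delta> x. q \<le> i \<Longrightarrow> 0 \<le> \<delta> \<Longrightarrow> \<delta> \<le> \<tau> \<Longrightarrow> 0 \<le> x \<Longrightarrow> x \<le> \<tau> \<Longrightarrow> \<bar>F q \<delta> x\<bar> \<le> B"
    using continuous_bounded2[of F i \<tau>] c by metis
  show ?thesis
    unfolding set_integrable_def
  proof (rule Bochner_Integration.integrable_bound)
    show "integrable lborel (\<lambda>t. B * indicator {s..\<tau>} t)"
      by (intro integrable_mult_right integrable_real_indicator) (auto simp: emeasure_lborel_Icc_eq)
    show "(\<lambda>t. indicator {s..\<tau>} t *\<^sub>R F (Qw w t) (dl w t) (xl w t)) \<in> borel_measurable lborel"
      using obs_section[OF c, where w=w] by simp
    have "norm (indicator {s..\<tau>} t *\<^sub>R F (Qw w t) (dl w t) (xl w t)) \<le> norm (B * indicator {s..\<tau>} t)" for t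
    proof (cases "t \<in> {s..\<tau>}")
      case True
      then have "\<bar>F (Qw w t) (dl w t) (xl w t)\<bar> \<le> B"
        using obs_range[OF g, of t] \<tau> by (intro B(2)) auto
      then show ?thesis using True B(1) by simp
    qed simp
    then show "AE t in lborel. norm (indicator {s..\<tau>} t *\<^sub>R F (Qw w t) (dl w t) (xl w t)) \<le> norm (B * indicator {s..\<tau>} t)"
      by (intro AE_I2)
  qed
qed

text \<open>The process of Dynkin's formula; at time 0 no higher stream is busy and the age is 0,
  whence the subtracted \<open>F 0 0 0\<close>.\<close>

definition compensated :: "(nat \<Rightarrow> real \<Rightarrow> real \<Rightarrow> real) \<Rightarrow> (nat \<Rightarrow> real \<Rightarrow> real \<Rightarrow> real) \<Rightarrow> real \<Rightarrow> (event \<Rightarrow> real) \<Rightarrow> real" where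
  "compensated F F' \<tau> w = F (Qw w \<tau>) (dl w \<tau>) (xl w \<tau>) - F 0 0 0
     - (LINT t:{0..\<tau>}|lborel. generator lam mu i F F' (Qw w t) (dl w t) (xl w t))"

text \<open>Equal rates let the sum over the clocks depend on the occupancies only through their
  number. The term of the observed stream is the same whether it is empty or not, by
  \<open>st_eq_la\<close>.\<close>

lemma generator_pointwise:
  assumes g: "good w" and t: "0 \<le> t"
  shows "generator lam mu i F F' (Qw w t) (dl w t) (xl w t) = F' (Qw w t) (dl w t) (xl w t) +
    (\<Sum>k\<le>i. lam * AJ F k w t + mu * (of_bool (holds w k t \<and> \<not> busy w k t) * CJ F k w t))"
proof -
  interpret path "T w" "X w" i by (rule good_path[OF g])
  let ?q = "Qw w t" and ?d = "dl w t" and ?x = "xl w t"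
  have "(\<Sum>k\<le>i. lam * AJ F k w t + mu * (of_bool (holds w k t \<and> \<not> busy w k t) * CJ F k w t)) =
     (\<Sum>k<i. lam * AJ F k w t + mu * (of_bool (holds w k t \<and> \<not> busy w k t) * CJ F k w t)) + 
      lam * AJ F i w t + mu * (of_bool (holds w i t \<and> \<not> busy w i t) * CJ F i w t)"
    unfolding lessThan_Suc_atMost[symmetric] by simp
  also have "(\<Sum>k<i. lam * AJ F k w t + mu * (of_bool (holds w k t \<and> \<not> busy w k t) * CJ F k w t)) =
     lam * (\<Sum>k<i. if holds w k t then 0 else F (Suc ?q) ?d ?x - F ?q ?d ?x) +
     mu * (\<Sum>k<i. of_bool (holds w k t \<and> \<not> busy w k t) * (F (?q - 1) ?d ?x - F ?q ?d ?x))"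
    unfolding sum_distrib_left sum.distrib[symmetric]
    by (intro sum.cong) (auto simp: AJ_def CJ_def arrival_jump_def completion_jump_def)
  also have "(\<Sum>k<i. if holds w k t then 0 else F (Suc ?q) ?d ?x - F ?q ?d ?x) = real (i - ?q) * (F (Suc ?q) ?d ?x - F ?q ?d ?x)"
    unfolding Qw_def by (rule sum_not_holding)
  also have "(\<Sum>k<i. of_bool (holds w k t \<and> \<not> busy w k t) * (F (?q - 1) ?d ?x - F ?q ?d ?x)) = (if ?q = 0 then 0 else F (?q - 1) ?d ?x - F ?q ?d ?x)"
    unfolding Qw_def by (rule sum_in_service)
  also have "of_bool (holds w i t \<and> \<not> busy w i t) * CJ F i w t = (if ?q = 0 then F 0 ?x ?x - F 0 ?d ?x else 0)"
  proof (cases "holds w i t")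
    case True
    then show ?thesis using Q_zero_iff[of t] by (auto simp: CJ_def completion_jump_def Qw_def)
  next
    case False
    then have "?d = ?x" using st_eq_la by (simp add: dl_def xl_def)
    then show ?thesis using False by simp
  qed
  also have "AJ F i w t = F ?q ?d 0 - F ?q ?d ?x" by (simp add: AJ_def arrival_jump_def)
  finally show ?thesis by (simp add: generator_def algebra_simps)
qed

text \<open>\<open>jump_formula\<close> writes the process as a sum of \<open>2 * (i + 1)\<close>
  compensated families. Cauchy-Schwarz gives a factor \<open>2 * (i + 1)\<close>, and adding the
  individual variance bounds gives \<open>(i + 1) * (lam + mu)\<close>. The majorant
  \<open>H\<close> is left open so that an exponential of the age can be inserted.\<close>

theorem generator_martingale:
  assumes F: "smooth_pair F F'" and \<tau>: "0 \<le> \<tau>"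
  shows "integrable P (compensated F F' \<tau>)" "(\<integral>w. compensated F F' \<tau> w \<partial>P) = 0"
    and "\<And>H. (\<And>w t k. good w \<Longrightarrow> 0 \<le> t \<Longrightarrow> t \<le> \<tau> \<Longrightarrow> k \<le> i \<Longrightarrow> ennreal ((AJ F k w t)\<^sup>2) \<le> H w t \<and> ennreal ((CJ F k w t)\<^sup>2) \<le> H w t) \<Longrightarrow>
      (\<integral>\<^sup>+w. ennreal ((compensated F F' \<tau> w)\<^sup>2) \<partial>P) \<le> ennreal (2 * (real i + 1)\<^sup>2 * (lam + mu)) * (\<integral>\<^sup>+w. (\<integral>\<^sup>+t. H w t * indicator {0..\<tau>} t \<partial>lborel) \<partial>P)"
proof -
  have cF: "\<And>q. continuous_on UNIV (\<lambda>(\<delta>, x). F q \<delta> x)" and cF': "\<And>q. continuous_on UNIV (\<lambda>(\<delta>, x). F' q \<delta> x)"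
    using F by (auto simp: smooth_pair_def)
  \<comment> \<open>Levels up to \<open>Suc i\<close> are covered since an arrival evaluates
    \<open>F\<close> one level higher. A jump is a difference of two values, hence the factor 2 in
    \<open>B\<close>.\<close>
  obtain B0 where B0: "0 \<le> B0" "\<And>q \<delta> x. q \<le> Suc i \<Longrightarrow> 0 \<le> \<delta> \<Longrightarrow> \<delta> \<le> \<tau> \<Longrightarrow> 0 \<le> x \<Longrightarrow> x \<le> \<tau> \<Longrightarrow> \<bar>F q \<delta> x\<bar> \<le> B0"
    using continuous_bounded2[of F "Suc i" \<tau>] cF by metis
  define B where "B = 2 * B0"
  have B: "0 \<le> B" using B0(1) by (simp add: B_def)
  have bnd: "\<bar>AJ F k w t\<bar> \<le> B" "\<bar>CJ F k w t\<bar> \<le> B" if g: "good w" and t: "0 \<le> t" "t \<le> \<tau>" for k w t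
  proof -
    note o = obs_range[OF g t(1)]
    have f: "\<bar>F q \<delta> x - F q' \<delta>' x'\<bar> \<le> B" if "q \<le> Suc i" "q' \<le> Suc i" "0 \<le> \<delta>" "\<delta> \<le> \<tau>" "0 \<le> x" "x \<le> \<tau>" "0 \<le> \<delta>'" "\<delta>' \<le> \<tau>" "0 \<le> x'" "x' \<le> \<tau>" for q q' \<delta> x \<delta>' x'
      using B0(2)[of q \<delta> x] B0(2)[of q' \<delta>' x'] that unfolding B_def by linarith
    show "\<bar>AJ F k w t\<bar> \<le> B" unfolding AJ_def arrival_jump_def using o t B by (auto intro!: f)
    show "\<bar>CJ F k w t\<bar> \<le> B" unfolding CJ_def completion_jump_def using o t B by (auto intro!: f)
  qed
  have left: "left_lim B (AJ F k w) t = arrival_jump F i k (path.hpl (T w) (X w) k t) (path.Ql (T w) (X w) i t) (t - path.stl (T w) (X w) i t) (t - path.lal (T w) i t)"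
      (is "_ = ?a") and leftC: "left_lim B (CJ F k w) t = completion_jump F i k (path.Ql (T w) (X w) i t) (t - path.stl (T w) (X w) i t) (t - path.lal (T w) i t)"
      (is "_ = ?c") if g: "good w" and t: "0 < t" "t \<le> \<tau>" and k: "k \<le> i" for w t k
  proof -
    interpret path "T w" "X w" i by (rule good_path[OF g])
    have "\<forall>\<^sub>F s in at_left t. 0 < s \<and> s < t" by (rule eventually_at_left_above) (rule t)
    then have ev: "\<forall>\<^sub>F s in at_left t. \<bar>AJ F k w s\<bar> \<le> B" "\<forall>\<^sub>F s in at_left t. \<bar>CJ F k w s\<bar> \<le> B"
      using bnd[OF g] t(2) by (auto elim!: eventually_mono)
    have lA: "(AJ F k w \<longlongrightarrow> ?a) (at_left t)"
      using arrival_jump_left_limit[OF cF k, where t=t] by (simp add: AJ_def[abs_def] Qw_def dl_def xl_def)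
    have lC: "(CJ F k w \<longlongrightarrow> ?c) (at_left t)"
      using completion_jump_left_limit[OF cF, where k=k and t=t] by (simp add: CJ_def[abs_def] Qw_def dl_def xl_def)
    have "\<bar>?a\<bar> \<le> B" by (rule tendsto_upperbound[OF tendsto_rabs[OF lA] ev(1)]) simp
    with lA show "left_lim B (AJ F k w) t = ?a" by (rule left_lim_eq)
    have "\<bar>?c\<bar> \<le> B" by (rule tendsto_upperbound[OF tendsto_rabs[OF lC] ev(2)]) simp
    with lC show "left_lim B (CJ F k w) t = ?c" by (rule left_lim_eq)
  qed
  have reg: "AE w in P. AE t in lborel. 0 \<le> t \<longrightarrow> t \<le> \<tau> \<longrightarrow> left_lim B (AJ F k w) t = AJ F k w t"
    and regC: "AE w in P. AE t in lborel. 0 \<le> t \<longrightarrow> t \<le> \<tau> \<longrightarrow> left_lim B (CJ F k w) t = CJ F k w t" if k: "k \<le> i" for k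
  proof -
    have *: "AE t in lborel. (0 \<le> t \<longrightarrow> t \<le> \<tau> \<longrightarrow> left_lim B (AJ F k w) t = AJ F k w t) \<and> (0 \<le> t \<longrightarrow> t \<le> \<tau> \<longrightarrow> left_lim B (CJ F k w) t = CJ F k w t)"
      if g: "good w" for w
    proof -
      interpret path "T w" "X w" i by (rule good_path[OF g])
      show ?thesis using AE_no_event AE_lborel_singleton[of "0::real"]
      proof eventually_elim
        fix t :: real assume ne: "\<forall>e\<in>events. etime e \<noteq> t" and t0: "t \<noteq> 0"
        have ne': "\<And>e. e \<in> events \<Longrightarrow> etime e \<noteq> t" using ne by blast
        note s = no_event_state[OF ne']
        show "(0 \<le> t \<longrightarrow> t \<le> \<tau> \<longrightarrow> left_lim B (AJ F k w) t = AJ F k w t) \<and> (0 \<le> t \<longrightarrow> t \<le> \<tau> \<longrightarrow> left_lim B (CJ F k w) t = CJ F k w t)"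
        proof (intro conjI impI)
          assume t: "0 \<le> t" "t \<le> \<tau>"
          then have t': "0 < t" using t0 by simp
          show "left_lim B (AJ F k w) t = AJ F k w t"
            using left[OF g t' t(2) k] s(1-3) s(4)[OF _ k] by (simp add: AJ_def Qw_def dl_def xl_def)
        next
          assume t: "0 \<le> t" "t \<le> \<tau>"
          then have t': "0 < t" using t0 by simp
          show "left_lim B (CJ F k w) t = CJ F k w t"
            using leftC[OF g t' t(2) k] s(1-3) by (simp add: CJ_def Qw_def dl_def xl_def)
        qed
      qed
    qed
    show "AE w in P. AE t in lborel. 0 \<le> t \<longrightarrow> t \<le> \<tau> \<longrightarrow> left_lim B (AJ F k w) t = AJ F k w t"
      "AE w in P. AE t in lborel. 0 \<le> t \<longrightarrow> t \<le> \<tau> \<longrightarrow> left_lim B (CJ F k w) t = CJ F k w t"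
      using AE_good by (auto elim!: eventually_mono dest!: *)
  qed
  have causalA: "same_obs w w' t \<Longrightarrow> AJ F k w t = AJ F k w' t" if "k \<le> i" for w w' t k
    using same_obs_state[of w w' t] that by (simp add: AJ_def same_obs_def)
  have causalC: "same_obs w w' t \<Longrightarrow> CJ F k w t = CJ F k w' t" for w w' t k
    using same_obs_state[of w w' t] by (simp add: CJ_def)
  let ?V = "\<lambda>Y. \<integral>\<^sup>+w. (\<integral>\<^sup>+t. ennreal ((Y w t)\<^sup>2) * indicator {0..\<tau>} t \<partial>lborel) \<partial>P"
  have "\<forall>k\<in>{..i}. \<exists>M. integrable P M \<and> (\<integral>w. M w \<partial>P) = 0 \<and> (\<integral>\<^sup>+w. ennreal ((M w)\<^sup>2) \<partial>P) \<le> ennreal lam * ?V (AJ F k) \<and>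
    (AE w in P. M w = (\<Sum>n | T w k n \<le> \<tau>. left_lim B (AJ F k w) (T w k n)) - lam * (LINT t:{0<..\<tau>}|lborel. AJ F k w t))"
  proof
    fix k assume "k \<in> {..i}"
    then have k: "k \<le> i" by simp
    show "\<exists>M. integrable P M \<and> (\<integral>w. M w \<partial>P) = 0 \<and> (\<integral>\<^sup>+w. ennreal ((M w)\<^sup>2) \<partial>P) \<le> ennreal lam * ?V (AJ F k) \<and>
      (AE w in P. M w = (\<Sum>n | T w k n \<le> \<tau>. left_lim B (AJ F k w) (T w k n)) - lam * (LINT t:{0<..\<tau>}|lborel. AJ F k w t))"
      by (rule arrival_martingale[OF k \<tau> B measurable_AJ[OF cF] causalA[OF k] reg[OF k]]) blast+
  qed
  then obtain MA where MA: "\<forall>k\<in>{..i}. integrable P (MA k) \<and> (\<integral>w. MA k w \<partial>P) = 0 \<and> (\<integral>\<^sup>+w. ennreal ((MA k w)\<^sup>2) \<partial>P) \<le> ennreal lam * ?V (AJ F k) \<and>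
    (AE w in P. MA k w = (\<Sum>n | T w k n \<le> \<tau>. left_lim B (AJ F k w) (T w k n)) - lam * (LINT t:{0<..\<tau>}|lborel. AJ F k w t))"
    by (rule bchoice[THEN exE])
  have "\<forall>k\<in>{..i}. \<exists>M. integrable P M \<and> (\<integral>w. M w \<partial>P) = 0 \<and> (\<integral>\<^sup>+w. ennreal ((M w)\<^sup>2) \<partial>P) \<le> ennreal mu * ?V (CJ F k) \<and>
    (AE w in P. M w = (\<Sum>n | path.completes (T w) (X w) k n \<and> path.ctime (T w) (X w) k n \<le> \<tau>. left_lim B (CJ F k w) (path.ctime (T w) (X w) k n))
      - mu * (LINT t:{0..\<tau>}|lborel. of_bool (holds w k t \<and> \<not> busy w k t) * CJ F k w t))"
  proof
    fix k assume "k \<in> {..i}"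
    then have k: "k \<le> i" by simp
    show "\<exists>M. integrable P M \<and> (\<integral>w. M w \<partial>P) = 0 \<and> (\<integral>\<^sup>+w. ennreal ((M w)\<^sup>2) \<partial>P) \<le> ennreal mu * ?V (CJ F k) \<and>
      (AE w in P. M w = (\<Sum>n | path.completes (T w) (X w) k n \<and> path.ctime (T w) (X w) k n \<le> \<tau>. left_lim B (CJ F k w) (path.ctime (T w) (X w) k n))
      - mu * (LINT t:{0..\<tau>}|lborel. of_bool (holds w k t \<and> \<not> busy w k t) * CJ F k w t))"
      by (rule completion_martingale[OF k \<tau> B measurable_CJ[OF cF] causalC regC[OF k]]) blast+
  qed
  then obtain MC where MC: "\<forall>k\<in>{..i}. integrable P (MC k) \<and> (\<integral>w. MC k w \<partial>P) = 0 \<and> (\<integral>\<^sup>+w. ennreal ((MC k w)\<^sup>2) \<partial>P) \<le> ennreal mu * ?V (CJ F k) \<and>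
    (AE w in P. MC k w = (\<Sum>n | path.completes (T w) (X w) k n \<and> path.ctime (T w) (X w) k n \<le> \<tau>. left_lim B (CJ F k w) (path.ctime (T w) (X w) k n))
      - mu * (LINT t:{0..\<tau>}|lborel. of_bool (holds w k t \<and> \<not> busy w k t) * CJ F k w t))"
    by (rule bchoice[THEN exE])
  define M where "M w = (\<Sum>k\<le>i. MA k w + MC k w)" for w
  have eqA: "AE w in P. \<forall>k\<in>{..i}. MA k w = (\<Sum>n | T w k n \<le> \<tau>. left_lim B (AJ F k w) (T w k n)) - lam * (LINT t:{0<..\<tau>}|lborel. AJ F k w t)"
    using MA by (intro AE_finite_allI) auto
  have eqC: "AE w in P. \<forall>k\<in>{..i}. MC k w = (\<Sum>n | path.completes (T w) (X w) k n \<and> path.ctime (T w) (X w) k n \<le> \<tau>. left_lim B (CJ F k w) (path.ctime (T w) (X w) k n))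
      - mu * (LINT t:{0..\<tau>}|lborel. of_bool (holds w k t \<and> \<not> busy w k t) * CJ F k w t)"
    using MC by (intro AE_finite_allI) auto
  have eq: "AE w in P. M w = compensated F F' \<tau> w"
    using AE_good eqA eqC
  proof eventually_elim
    fix w assume g: "good w"
      and A: "\<forall>k\<in>{..i}. MA k w = (\<Sum>n | T w k n \<le> \<tau>. left_lim B (AJ F k w) (T w k n)) - lam * (LINT t:{0<..\<tau>}|lborel. AJ F k w t)"
      and C: "\<forall>k\<in>{..i}. MC k w = (\<Sum>n | path.completes (T w) (X w) k n \<and> path.ctime (T w) (X w) k n \<le> \<tau>. left_lim B (CJ F k w) (path.ctime (T w) (X w) k n))
      - mu * (LINT t:{0..\<tau>}|lborel. of_bool (holds w k t \<and> \<not> busy w k t) * CJ F k w t)"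
    interpret path "T w" "X w" i by (rule good_path[OF g])
    have jA: "left_lim B (AJ F k w) (T w k n) = jump F (Inl (k, n))" if "k \<le> i" "T w k n \<le> \<tau>" for k n
      using left[OF g T_pos[OF that(1)] that(2,1)] by (simp add: jump_def)
    have jC: "left_lim B (CJ F k w) (ctime k n) = jump F (Inr (k, n))" if "k \<le> i" "completes k n" "ctime k n \<le> \<tau>" for k n
      using leftC[OF g _ that(3,1)] etime_pos[of "Inr (k, n)"] that by (simp add: jump_def)
    have secA: "(\<lambda>t. AJ F k w t) \<in> borel_measurable borel" and secC: "(\<lambda>t. CJ F k w t) \<in> borel_measurable borel" for k
    proof -
      have "(\<lambda>t. (w, t)) \<in> measurable borel (P \<Otimes>\<^sub>M borel)" by simp
      from measurable_compose[OF this measurable_AJ[OF cF]] measurable_compose[OF this measurable_CJ[OF cF]]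
      show "(\<lambda>t. AJ F k w t) \<in> borel_measurable borel" "(\<lambda>t. CJ F k w t) \<in> borel_measurable borel" by simp_all
    qed
    have secB: "(\<lambda>t. of_bool (holds w k t \<and> \<not> busy w k t) :: real) \<in> borel_measurable borel" for k
    proof -
      have "(\<lambda>t. indicator ({s. holds w k s} \<inter> {s. \<not> busy w k s}) t :: real) \<in> borel_measurable borel"
        using hp_borel[of w k] hb_borel[of w k] by (intro borel_measurable_indicator sets.Int)
      also have "(\<lambda>t. indicator ({s. holds w k s} \<inter> {s. \<not> busy w k s}) t) = (\<lambda>t. of_bool (holds w k t \<and> \<not> busy w k t) :: real)"
        by (auto simp: fun_eq_iff)
      finally show ?thesis .
    qed
    have si: "set_integrable lborel {0..\<tau>} f" if m: "f \<in> borel_measurable borel" and b: "\<And>t. 0 \<le> t \<Longrightarrow> t \<le> \<tau> \<Longrightarrow> \<bar>f t\<bar> \<le> B" for f :: "real \<Rightarrow> real"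
      unfolding set_integrable_def
    proof (rule Bochner_Integration.integrable_bound)
      show "integrable lborel (\<lambda>t. B * indicator {0..\<tau>} t)"
        by (intro integrable_mult_right integrable_real_indicator) (auto simp: emeasure_lborel_Icc_eq)
      have "norm (indicator {0..\<tau>} t *\<^sub>R f t) \<le> norm (B * indicator {0..\<tau>} t)" for t
        using b[of t] B by (cases "t \<in> {0..\<tau>}") auto
      then show "AE t in lborel. norm (indicator {0..\<tau>} t *\<^sub>R f t) \<le> norm (B * indicator {0..\<tau>} t)" by (intro AE_I2)
    qed (use m in simp)
    have siA: "set_integrable lborel {0..\<tau>} (\<lambda>t. AJ F k w t)" for k by (rule si[OF secA bnd(1)[OF g]])
    have siC: "set_integrable lborel {0..\<tau>} (\<lambda>t. of_bool (holds w k t \<and> \<not> busy w k t) * CJ F k w t)" for k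
      by (rule si[OF borel_measurable_times[OF secB secC]]) (use bnd(2)[OF g] B in auto)
    have io: "(LINT t:{0<..\<tau>}|lborel. AJ F k w t) = (LINT t:{0..\<tau>}|lborel. AJ F k w t)" for k
      unfolding set_lebesgue_integral_def
    proof (rule integral_cong_AE)
      show "AE t in lborel. indicator {0<..\<tau>} t *\<^sub>R AJ F k w t = indicator {0..\<tau>} t *\<^sub>R AJ F k w t"
        using AE_lborel_singleton[of "0::real"] by eventually_elim (auto simp: indicator_def)
    qed (use secA in simp_all)
    have "(LINT t:{0..\<tau>}|lborel. generator lam mu i F F' (Qw w t) (dl w t) (xl w t)) =
       (LINT t:{0..\<tau>}|lborel. F' (Qw w t) (dl w t) (xl w t) + (\<Sum>k\<le>i. lam * AJ F k w t + mu * (of_bool (holds w k t \<and> \<not> busy w k t) * CJ F k w t)))"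
      by (rule set_lebesgue_integral_cong) (auto simp: generator_pointwise[OF g])
    also have "\<dots> = (LINT t:{0..\<tau>}|lborel. F' (Qw w t) (dl w t) (xl w t)) + 
       (\<Sum>k\<le>i. lam * (LINT t:{0..\<tau>}|lborel. AJ F k w t) + mu * (LINT t:{0..\<tau>}|lborel. of_bool (holds w k t \<and> \<not> busy w k t) * CJ F k w t))"
    proof -
      have s: "set_integrable lborel {0..\<tau>} (\<lambda>t. lam * AJ F k w t + mu * (of_bool (holds w k t \<and> \<not> busy w k t) * CJ F k w t))" for k
        using siA siC by (intro set_integral_add set_integrable_mult_right) auto
      have s2: "set_integrable lborel {0..\<tau>} (\<lambda>t. \<Sum>k\<le>i. lam * AJ F k w t + mu * (of_bool (holds w k t \<and> \<not> busy w k t) * CJ F k w t))"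
        using s unfolding set_integrable_def by (simp only: scaleR_sum_right) (rule Bochner_Integration.integrable_sum)
      have "(LINT t:{0..\<tau>}|lborel. (\<Sum>k\<le>i. lam * AJ F k w t + mu * (of_bool (holds w k t \<and> \<not> busy w k t) * CJ F k w t))) =
        (\<Sum>k\<le>i. LINT t:{0..\<tau>}|lborel. lam * AJ F k w t + mu * (of_bool (holds w k t \<and> \<not> busy w k t) * CJ F k w t))"
        unfolding set_lebesgue_integral_def scaleR_sum_right using s unfolding set_integrable_def by (rule Bochner_Integration.integral_sum)
      also have "\<dots> = (\<Sum>k\<le>i. lam * (LINT t:{0..\<tau>}|lborel. AJ F k w t) + mu * (LINT t:{0..\<tau>}|lborel. of_bool (holds w k t \<and> \<not> busy w k t) * CJ F k w t))"
      proof (rule sum.cong[OF refl])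
        fix k
        have "set_integrable lborel {0..\<tau>} (\<lambda>t. lam * AJ F k w t)" "set_integrable lborel {0..\<tau>} (\<lambda>t. mu * (of_bool (holds w k t \<and> \<not> busy w k t) * CJ F k w t))"
          by (intro set_integrable_mult_right impI siA siC)+
        from set_integral_add(2)[OF this]
        show "(LINT t:{0..\<tau>}|lborel. lam * AJ F k w t + mu * (of_bool (holds w k t \<and> \<not> busy w k t) * CJ F k w t)) = 
          lam * (LINT t:{0..\<tau>}|lborel. AJ F k w t) + mu * (LINT t:{0..\<tau>}|lborel. of_bool (holds w k t \<and> \<not> busy w k t) * CJ F k w t)"
          by (simp only: set_integral_mult_right)
      qed
      finally show ?thesis
        using set_integral_add(2)[OF set_integrable_obs[OF cF' g order_refl, of \<tau>] s2] by simp
    qed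
    finally have gen: "(LINT t:{0..\<tau>}|lborel. generator lam mu i F F' (Qw w t) (dl w t) (xl w t)) = 
       (LINT t:{0..\<tau>}|lborel. F' (Qw w t) (dl w t) (xl w t)) + 
       (\<Sum>k\<le>i. lam * (LINT t:{0..\<tau>}|lborel. AJ F k w t) + mu * (LINT t:{0..\<tau>}|lborel. of_bool (holds w k t \<and> \<not> busy w k t) * CJ F k w t))" .
    have "M w = (\<Sum>k\<le>i. (\<Sum>n | T w k n \<le> \<tau>. jump F (Inl (k, n))) + (\<Sum>n | completes k n \<and> ctime k n \<le> \<tau>. jump F (Inr (k, n)))) - 
       (\<Sum>k\<le>i. lam * (LINT t:{0..\<tau>}|lborel. AJ F k w t) + mu * (LINT t:{0..\<tau>}|lborel. of_bool (holds w k t \<and> \<not> busy w k t) * CJ F k w t))"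
      unfolding M_def sum_subtractf[symmetric]
    proof (rule sum.cong[OF refl])
      fix k assume k: "k \<in> {..i}"
      have "MA k w = (\<Sum>n | T w k n \<le> \<tau>. jump F (Inl (k, n))) - lam * (LINT t:{0..\<tau>}|lborel. AJ F k w t)"
        using A k jA by (simp add: io)
      moreover have "MC k w = (\<Sum>n | completes k n \<and> ctime k n \<le> \<tau>. jump F (Inr (k, n))) - mu * (LINT t:{0..\<tau>}|lborel. of_bool (holds w k t \<and> \<not> busy w k t) * CJ F k w t)"
        using C k jC by simp
      ultimately show "MA k w + MC k w = (\<Sum>n | T w k n \<le> \<tau>. jump F (Inl (k, n))) + (\<Sum>n | completes k n \<and> ctime k n \<le> \<tau>. jump F (Inr (k, n))) - 
       (lam * (LINT t:{0..\<tau>}|lborel. AJ F k w t) + mu * (LINT t:{0..\<tau>}|lborel. of_bool (holds w k t \<and> \<not> busy w k t) * CJ F k w t))"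
        by linarith
    qed
    moreover have "F (Qw w \<tau>) (dl w \<tau>) (xl w \<tau>) - F 0 0 0 = (LINT t:{0..\<tau>}|lborel. F' (Qw w t) (dl w t) (xl w t)) + 
       (\<Sum>k\<le>i. (\<Sum>n | T w k n \<le> \<tau>. jump F (Inl (k, n))) + (\<Sum>n | completes k n \<and> ctime k n \<le> \<tau>. jump F (Inr (k, n))))"
      using jump_formula[OF F \<tau>] unfolding sum_events by (simp add: Q_initial Qw_def dl_def xl_def)
    ultimately show "M w = compensated F F' \<tau> w" unfolding compensated_def gen by linarith
  qed
  have iM: "integrable P M" unfolding M_def[abs_def] using MA MC by auto
  have M0: "(\<integral>w. M w \<partial>P) = 0"
    unfolding M_def using MA MC by (subst Bochner_Integration.integral_sum) auto
  have cm: "compensated F F' \<tau> \<in> borel_measurable P"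
  proof -
    note c = continuous_generator[OF F, of lam mu i]
    have "(\<lambda>w. \<integral>t. indicator {0..\<tau>} t *\<^sub>R generator lam mu i F F' (Qw w t) (dl w t) (xl w t) \<partial>lborel) \<in> borel_measurable P"
    proof (rule lborel.borel_measurable_lebesgue_integral)
      have "(\<lambda>x. indicator {0..\<tau>} (snd x) *\<^sub>R generator lam mu i F F' (Qw (fst x) (snd x)) (dl (fst x) (snd x)) (xl (fst x) (snd x))) \<in> borel_measurable (P \<Otimes>\<^sub>M borel)"
        by (intro borel_measurable_scaleR measurable_obs[OF c]) measurable
      then show "(\<lambda>(w, t). indicator {0..\<tau>} t *\<^sub>R generator lam mu i F F' (Qw w t) (dl w t) (xl w t)) \<in> borel_measurable (P \<Otimes>\<^sub>M lborel)"
        by (simp add: case_prod_beta' cong: measurable_cong_sets)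
    qed
    then show ?thesis
      unfolding compensated_def[abs_def] set_lebesgue_integral_def
      by (intro borel_measurable_diff obs_at_time[OF cF] borel_measurable_const)
  qed
  show "integrable P (compensated F F' \<tau>)" by (rule integrable_cong_AE_imp[OF iM cm]) (use eq in auto)
  show "(\<integral>w. compensated F F' \<tau> w \<partial>P) = 0"
    using integral_cong_AE[of M P "compensated F F' \<tau>"] iM cm eq M0 by auto
  fix H assume H: "\<And>w t k. good w \<Longrightarrow> 0 \<le> t \<Longrightarrow> t \<le> \<tau> \<Longrightarrow> k \<le> i \<Longrightarrow> ennreal ((AJ F k w t)\<^sup>2) \<le> H w t \<and> ennreal ((CJ F k w t)\<^sup>2) \<le> H w t"
  let ?H = "\<integral>\<^sup>+w. (\<integral>\<^sup>+t. H w t * indicator {0..\<tau>} t \<partial>lborel) \<partial>P"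
  have VA: "?V (AJ F k) \<le> ?H" and VC: "?V (CJ F k) \<le> ?H" if "k \<le> i" for k
  proof -
    have V_le: "?V Y \<le> ?H" if b: "\<And>w t. good w \<Longrightarrow> 0 \<le> t \<Longrightarrow> t \<le> \<tau> \<Longrightarrow> ennreal ((Y w t)\<^sup>2) \<le> H w t" for Y
    proof (rule nn_integral_mono_AE, use AE_good in eventually_elim)
      fix w assume g: "good w"
      show "(\<integral>\<^sup>+t. ennreal ((Y w t)\<^sup>2) * indicator {0..\<tau>} t \<partial>lborel) \<le> (\<integral>\<^sup>+t. H w t * indicator {0..\<tau>} t \<partial>lborel)"
        by (intro nn_integral_mono) (auto simp: indicator_def intro: b[OF g])
    qed
    show "?V (AJ F k) \<le> ?H" "?V (CJ F k) \<le> ?H" using H[OF _ _ _ that] by (auto intro!: V_le)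
  qed
  have mA: "(\<lambda>w. ennreal ((MA k w)\<^sup>2)) \<in> borel_measurable P" and mC: "(\<lambda>w. ennreal ((MC k w)\<^sup>2)) \<in> borel_measurable P" if "k \<le> i" for k
  proof -
    have "MA k \<in> borel_measurable P" "MC k \<in> borel_measurable P" using MA MC that by auto
    then show "(\<lambda>w. ennreal ((MA k w)\<^sup>2)) \<in> borel_measurable P" "(\<lambda>w. ennreal ((MC k w)\<^sup>2)) \<in> borel_measurable P" by measurable
  qed
  have sq: "(M w)\<^sup>2 \<le> (real i + 1) * 2 * (\<Sum>k\<le>i. (MA k w)\<^sup>2 + (MC k w)\<^sup>2)" for w
  proof -
    have "(M w)\<^sup>2 \<le> (\<Sum>k\<le>i. (MA k w + MC k w)\<^sup>2) * real (card {..i})"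
      unfolding M_def by (rule sum_squared_le_sum_of_squares)
    also have "\<dots> \<le> (\<Sum>k\<le>i. 2 * ((MA k w)\<^sup>2 + (MC k w)\<^sup>2)) * real (card {..i})"
    proof (intro mult_right_mono sum_mono)
      fix k show "(MA k w + MC k w)\<^sup>2 \<le> 2 * ((MA k w)\<^sup>2 + (MC k w)\<^sup>2)"
        using zero_le_power2[of "MA k w - MC k w"] by (simp add: power2_eq_square algebra_simps)
    qed simp
    also have "\<dots> = (real i + 1) * 2 * (\<Sum>k\<le>i. (MA k w)\<^sup>2 + (MC k w)\<^sup>2)"
      by (simp add: sum_distrib_left algebra_simps)
    finally show ?thesis .
  qed
  have "(\<integral>\<^sup>+w. ennreal ((compensated F F' \<tau> w)\<^sup>2) \<partial>P) = (\<integral>\<^sup>+w. ennreal ((M w)\<^sup>2) \<partial>P)"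
    using eq by (intro nn_integral_cong_AE) (auto elim!: eventually_mono)
  also have "\<dots> \<le> (\<integral>\<^sup>+w. ennreal ((real i + 1) * 2) * (\<Sum>k\<le>i. ennreal ((MA k w)\<^sup>2) + ennreal ((MC k w)\<^sup>2)) \<partial>P)"
  proof (rule nn_integral_mono)
    fix w
    have "ennreal ((M w)\<^sup>2) \<le> ennreal ((real i + 1) * 2 * (\<Sum>k\<le>i. (MA k w)\<^sup>2 + (MC k w)\<^sup>2))" by (rule ennreal_leI[OF sq])
    also have "\<dots> = ennreal ((real i + 1) * 2) * (\<Sum>k\<le>i. ennreal ((MA k w)\<^sup>2) + ennreal ((MC k w)\<^sup>2))"
      by (subst ennreal_mult) (auto intro!: sum_nonneg simp flip: sum_ennreal ennreal_plus)
    finally show "ennreal ((M w)\<^sup>2) \<le> \<dots>" .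
  qed
  also have "\<dots> = ennreal ((real i + 1) * 2) * (\<Sum>k\<le>i. (\<integral>\<^sup>+w. ennreal ((MA k w)\<^sup>2) \<partial>P) + (\<integral>\<^sup>+w. ennreal ((MC k w)\<^sup>2) \<partial>P))"
  proof -
    have ms: "(\<lambda>w. ennreal ((MA k w)\<^sup>2) + ennreal ((MC k w)\<^sup>2)) \<in> borel_measurable P" if "k \<in> {..i}" for k
      using that by (intro borel_measurable_add mA mC) auto
    have "(\<integral>\<^sup>+w. ennreal ((real i + 1) * 2) * (\<Sum>k\<le>i. ennreal ((MA k w)\<^sup>2) + ennreal ((MC k w)\<^sup>2)) \<partial>P) = 
        ennreal ((real i + 1) * 2) * (\<integral>\<^sup>+w. (\<Sum>k\<le>i. ennreal ((MA k w)\<^sup>2) + ennreal ((MC k w)\<^sup>2)) \<partial>P)"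
      by (intro nn_integral_cmult borel_measurable_sum ms)
    also have "(\<integral>\<^sup>+w. (\<Sum>k\<le>i. ennreal ((MA k w)\<^sup>2) + ennreal ((MC k w)\<^sup>2)) \<partial>P) = 
        (\<Sum>k\<le>i. \<integral>\<^sup>+w. ennreal ((MA k w)\<^sup>2) + ennreal ((MC k w)\<^sup>2) \<partial>P)"
      by (intro nn_integral_sum ms)
    also have "\<dots> = (\<Sum>k\<le>i. (\<integral>\<^sup>+w. ennreal ((MA k w)\<^sup>2) \<partial>P) + (\<integral>\<^sup>+w. ennreal ((MC k w)\<^sup>2) \<partial>P))"
      by (intro sum.cong refl nn_integral_add mA mC) auto
    finally show ?thesis .
  qed
  also have "\<dots> \<le> ennreal ((real i + 1) * 2) * (\<Sum>k\<le>i. ennreal lam * ?H + ennreal mu * ?H)"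
  proof (intro mult_left_mono sum_mono add_mono)
    fix k assume k: "k \<in> {..i}"
    have "(\<integral>\<^sup>+w. ennreal ((MA k w)\<^sup>2) \<partial>P) \<le> ennreal lam * ?V (AJ F k)" using MA k by blast
    also have "\<dots> \<le> ennreal lam * ?H" using VA k by (intro mult_left_mono) auto
    finally show "(\<integral>\<^sup>+w. ennreal ((MA k w)\<^sup>2) \<partial>P) \<le> ennreal lam * ?H" .
    have "(\<integral>\<^sup>+w. ennreal ((MC k w)\<^sup>2) \<partial>P) \<le> ennreal mu * ?V (CJ F k)" using MC k by blast
    also have "\<dots> \<le> ennreal mu * ?H" using VC k by (intro mult_left_mono) auto
    finally show "(\<integral>\<^sup>+w. ennreal ((MC k w)\<^sup>2) \<partial>P) \<le> ennreal mu * ?H" .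
  qed simp
  also have "\<dots> = ennreal (2 * (real i + 1)\<^sup>2 * (lam + mu)) * ?H"
  proof -
    have c: "ennreal lam * ?H + ennreal mu * ?H = ennreal (lam + mu) * ?H"
      using lam_pos mu_pos by (subst ennreal_plus) (auto simp: distrib_right)
    have n: "of_nat (Suc i) = ennreal (real i + 1)"
      by (simp only: ennreal_of_nat_eq_real_of_nat of_nat_Suc add.commute)
    have "(\<Sum>k\<le>i. ennreal lam * ?H + ennreal mu * ?H) = ennreal (real i + 1) * (ennreal (lam + mu) * ?H)"
      unfolding c n[symmetric] by simp
    then have "ennreal ((real i + 1) * 2) * (\<Sum>k\<le>i. ennreal lam * ?H + ennreal mu * ?H) =
        ennreal ((real i + 1) * 2) * ennreal (real i + 1) * ennreal (lam + mu) * ?H" by (simp only: mult.assoc)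
    also have "ennreal ((real i + 1) * 2) * ennreal (real i + 1) * ennreal (lam + mu) = ennreal ((real i + 1) * 2 * (real i + 1) * (lam + mu))"
      using lam_pos mu_pos by (subst ennreal_mult[symmetric], simp, simp)+ simp
    also have "(real i + 1) * 2 * (real i + 1) * (lam + mu) = 2 * (real i + 1)\<^sup>2 * (lam + mu)"
      by (simp add: power2_eq_square)
    finally show ?thesis .
  qed
  finally show "(\<integral>\<^sup>+w. ennreal ((compensated F F' \<tau> w)\<^sup>2) \<partial>P) \<le> ennreal (2 * (real i + 1)\<^sup>2 * (lam + mu)) * ?H" .
qed

end

section \<open>Exponential moments of the age\<close>

text \<open>Mean first-passage times of the birth-death chain Q: with \<open>m\<close> empty higher
  streams, the mean time to go down one level. First-step analysis gives the recursion. With all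
  \<open>i\<close> higher streams empty, going down means a service at level 0.\<close>

primrec lyap_step :: "real \<Rightarrow> real \<Rightarrow> nat \<Rightarrow> real" where
  "lyap_step lam mu 0 = 1 / mu"
| "lyap_step lam mu (Suc m) = (1 + lam * (real m + 1) * lyap_step lam mu m) / mu"

lemma (in path) st_mono: assumes "s \<le> t" shows "st s \<le> st t"
proof -
  have "(SUP n. if completes i n \<and> ctime i n \<le> t then ennreal (T i n) else 0) \<le> ennreal (max 0 t)"
  proof (rule SUP_least)
    fix n
    show "(if completes i n \<and> ctime i n \<le> t then ennreal (T i n) else 0) \<le> ennreal (max 0 t)"
    proof (cases "completes i n \<and> ctime i n \<le> t")
      case True
      then have "T i n \<le> max 0 t" using ctime_gt[OF order_refl, of n] by linarith
      then have "ennreal (T i n) \<le> ennreal (max 0 t)" by (rule ennreal_leI)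
      then show ?thesis using True by simp
    next
      case False
      show ?thesis unfolding if_not_P[OF False] by (rule zero_le)
    qed
  qed
  also have "\<dots> < top" by simp
  finally have fin: "(SUP n. if completes i n \<and> ctime i n \<le> t then ennreal (T i n) else 0) < top" .
  have "(SUP n. if completes i n \<and> ctime i n \<le> s then ennreal (T i n) else 0) \<le> (SUP n. if completes i n \<and> ctime i n \<le> t then ennreal (T i n) else 0)"
  proof (rule SUP_subset_mono[OF subset_refl])
    fix n
    show "(if completes i n \<and> ctime i n \<le> s then ennreal (T i n) else 0) \<le> (if completes i n \<and> ctime i n \<le> t then ennreal (T i n) else 0)"
    proof (cases "completes i n \<and> ctime i n \<le> s")
      case True
      then have t: "completes i n \<and> ctime i n \<le> t" using assms by linarith
      show ?thesis unfolding if_P[OF True] if_P[OF t] by (rule order_refl)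
    next
      case False
      show ?thesis unfolding if_not_P[OF False] by (rule zero_le)
    qed
  qed
  then show ?thesis unfolding st_alt using fin by (rule enn2real_mono)
qed

lemma exp_dominates_linear: "0 < a \<Longrightarrow> 0 \<le> y \<Longrightarrow> min 1 a * (1 + y) \<le> exp (a * y)" for a y :: real
proof -
  assume "0 < a" "0 \<le> y"
  have "min 1 a * (1 + y) = min 1 a + min 1 a * y" by (simp add: algebra_simps)
  also have "\<dots> \<le> 1 + a * y" using \<open>0 \<le> y\<close> by (intro add_mono mult_right_mono) auto
  also have "\<dots> \<le> exp (a * y)" by (rule exp_ge_add_one_self)
  finally show ?thesis .
qed

lemma exp_dominates_power:
  assumes "0 < \<theta>" obtains c :: real where "0 < c" "\<And>y. 0 \<le> y \<Longrightarrow> (1 + y) ^ m \<le> c * exp (\<theta> * y)"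
proof
  let ?a = "\<theta> / real (Suc m)"
  let ?b = "min 1 ?a"
  have b: "0 < ?b" using assms by simp
  show "0 < (1 / ?b) ^ m" using b by (intro zero_less_power) simp
  fix y :: real assume y: "0 \<le> y"
  have "(?b * (1 + y)) ^ m \<le> exp (?a * y) ^ m"
    using y b assms by (intro power_mono exp_dominates_linear mult_nonneg_nonneg) auto
  also have "\<dots> = exp (real m * (?a * y))" by (simp only: exp_of_nat_mult)
  also have "\<dots> \<le> exp (\<theta> * y)"
  proof -
    have "real m * (?a * y) = (real m / real (Suc m)) * (\<theta> * y)" by simp
    also have "\<dots> \<le> 1 * (\<theta> * y)" using assms y by (intro mult_right_mono) auto
    finally show ?thesis by simp
  qed
  finally have "?b ^ m * (1 + y) ^ m \<le> exp (\<theta> * y)" by (simp only: power_mult_distrib)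
  then have "(1 / ?b) ^ m * (?b ^ m * (1 + y) ^ m) \<le> (1 / ?b) ^ m * exp (\<theta> * y)"
    using b by (intro mult_left_mono) auto
  moreover have "(1 / ?b) ^ m * (?b ^ m * (1 + y) ^ m) = (1 + y) ^ m"
  proof -
    have "(1 / ?b) ^ m * ?b ^ m = (1 / ?b * ?b) ^ m" by (simp only: power_mult_distrib)
    also have "\<dots> = 1" using b by simp
    finally show ?thesis by (metis mult.assoc mult_1)
  qed
  ultimately show "(1 + y) ^ m \<le> (1 / ?b) ^ m * exp (\<theta> * y)" by (simp only:)
qed

context queue
begin

abbreviation dd :: "nat \<Rightarrow> real" where "dd \<equiv> lyap_step lam mu"

text \<open>The mean time from level \<open>q\<close> until a service is completed at level 0,
  composed of the descents through the levels.\<close>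

definition wt :: "nat \<Rightarrow> real" where "wt q = (\<Sum>j\<le>q. dd (i - j))"

lemma dd_pos: "0 < dd m"
proof (induction m)
  case (Suc m)
  then have "0 < lam * (real m + 1) * dd m" using lam_pos by simp
  then show ?case using mu_pos by (simp add: divide_pos_pos add_pos_pos)
qed (use mu_pos in simp)

lemma wt_Suc: "wt (Suc q) = wt q + dd (i - Suc q)" by (simp add: wt_def)

lemma wt_mono: "q \<le> q' \<Longrightarrow> wt q \<le> wt q'"
  unfolding wt_def by (intro sum_mono2) (auto intro: less_imp_le dd_pos)

lemma wt_pos: "0 < wt q"
  using dd_pos[of i] wt_mono[of 0 q] by (simp add: wt_def)

text \<open>The generator of Q, killed by a service at level 0, maps the mean absorption time
  \<open>wt\<close> to -1.\<close>

lemma dd_balance: "q \<le> i \<Longrightarrow> lam * (real (i - q) * dd (i - Suc q)) - mu * dd (i - q) = - 1"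
proof (cases "i - q")
  case (Suc m)
  then have m: "i - Suc q = m" by simp
  have "mu * dd (Suc m) = 1 + lam * (real m + 1) * dd m" using mu_pos by simp
  then show ?thesis unfolding Suc m by (simp only: of_nat_Suc) (simp add: algebra_simps)
qed (use mu_pos in simp)

text \<open>The weights give \<open>exp (\<theta> * \<delta>)\<close> the drift -1, of which at most
  half is lost to the growth of the age because \<open>\<theta> * wt i\<close> is at most 1/2. A
  delivery at level 0 creates \<open>mu * wt 0 * exp (\<theta> * x)\<close>. The second term of
  \<open>F\<close> pays for it: \<open>x\<close> is reset at rate \<open>lam\<close>, which leaves
  the drift at most \<open>- (lam / 2) * K * exp (\<theta> * x)\<close> up to a constant, and
  \<open>K\<close> makes the two equal.\<close>

lemma lyapunov:
  fixes \<theta> :: real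
  defines "K \<equiv> 2 * mu * wt 0 / lam"
  defines "F \<equiv> \<lambda>q \<delta> x. wt q * exp (\<theta> * \<delta>) + K * exp (\<theta> * x)"
  assumes \<theta>: "0 < \<theta>" "\<theta> * wt i \<le> 1 / 2" "\<theta> \<le> lam / 2" and q: "q \<le> i"
  shows "generator lam mu i F (\<lambda>q \<delta> x. \<theta> * F q \<delta> x) q \<delta> x \<le> K * lam - exp (\<theta> * \<delta>) / 2"
proof -
  let ?E = "exp (\<theta> * \<delta>)" and ?e = "exp (\<theta> * x)"
  have K: "0 < K" unfolding K_def using mu_pos wt_pos lam_pos by simp
  define b where "b = (if q = 0 then mu * wt 0 * ?e else 0)"
  have service: "mu * (if q = 0 then F 0 x x - F 0 \<delta> x else F (q - 1) \<delta> x - F q \<delta> x) = b - mu * dd (i - q) * ?E"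
  proof (cases q)
    case 0
    then show ?thesis by (simp add: F_def b_def wt_def algebra_simps)
  next
    case (Suc m)
    then show ?thesis by (simp add: F_def b_def wt_Suc algebra_simps)
  qed
  have "generator lam mu i F (\<lambda>q \<delta> x. \<theta> * F q \<delta> x) q \<delta> x =
     \<theta> * (wt q * ?E + K * ?e) + lam * (real (i - q) * dd (i - Suc q)) * ?E + lam * (K - K * ?e) + (b - mu * dd (i - q) * ?E)"
    unfolding generator_def service by (simp add: F_def wt_Suc algebra_simps)
  also have "\<dots> = \<theta> * wt q * ?E + (lam * (real (i - q) * dd (i - Suc q)) - mu * dd (i - q)) * ?E + (\<theta> - lam) * (K * ?e) + lam * K + b"
    by (simp add: algebra_simps)
  also have "\<dots> = \<theta> * wt q * ?E - ?E + (\<theta> - lam) * (K * ?e) + lam * K + b"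
    unfolding dd_balance[OF q] by simp
  also have "\<dots> \<le> 1 / 2 * ?E - ?E + (- (lam / 2)) * (K * ?e) + lam * K + mu * wt 0 * ?e"
  proof -
    have "\<theta> * wt q \<le> \<theta> * wt i" using \<theta>(1) by (intro mult_left_mono wt_mono q) simp
    then have "\<theta> * wt q \<le> 1 / 2" using \<theta>(2) by linarith
    then have "\<theta> * wt q * ?E \<le> 1 / 2 * ?E" by (rule mult_right_mono) simp
    moreover have "(\<theta> - lam) * (K * ?e) \<le> (- (lam / 2)) * (K * ?e)" using \<theta> K by (intro mult_right_mono) auto
    moreover have "b \<le> mu * wt 0 * ?e" unfolding b_def using mu_pos wt_pos[of 0] by (auto intro!: mult_nonneg_nonneg less_imp_le)
    ultimately show ?thesis by linarith
  qed
  also have "(- (lam / 2)) * (K * ?e) = - (mu * wt 0 * ?e)" unfolding K_def using lam_pos by simp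
  finally show ?thesis by (simp add: mult.commute)
qed

text \<open>The compensated process of the Lyapunov function has mean zero, so the drift inequality
  can be integrated. Bounds that grow linearly in \<open>\<tau>\<close> suffice, as later divisions
  by powers of the time absorb them.\<close>

lemma exp_moments:
  obtains \<theta> C :: real where "0 < \<theta>" "0 < C"
    "\<And>\<tau>. 0 \<le> \<tau> \<Longrightarrow> (\<integral>\<^sup>+w. ennreal (exp (\<theta> * dl w \<tau>)) \<partial>P) \<le> ennreal (C * (1 + \<tau>))"
    "\<And>\<tau>. 0 \<le> \<tau> \<Longrightarrow> (\<integral>\<^sup>+w. (\<integral>\<^sup>+t. ennreal (exp (\<theta> * dl w t)) * indicator {0..\<tau>} t \<partial>lborel) \<partial>P) \<le> ennreal (C * (1 + \<tau>))"
proof -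
  define \<theta> where "\<theta> = min (1 / (2 * wt i)) (lam / 2)"
  have \<theta>: "0 < \<theta>" "\<theta> \<le> lam / 2" using wt_pos[of i] lam_pos by (auto simp: \<theta>_def)
  have "\<theta> * wt i \<le> 1 / (2 * wt i) * wt i" using wt_pos[of i] by (intro mult_right_mono) (auto simp: \<theta>_def)
  then have \<theta>w: "\<theta> * wt i \<le> 1 / 2" using wt_pos[of i] by simp
  define K where "K = 2 * mu * wt 0 / lam"
  have K: "0 < K" unfolding K_def using mu_pos wt_pos lam_pos by simp
  define F where "F = (\<lambda>q \<delta> x. wt q * exp (\<theta> * \<delta>) + K * exp (\<theta> * x))"
  let ?F' = "\<lambda>q \<delta> x. \<theta> * F q \<delta> x"
  have sp: "smooth_pair F ?F'"
    unfolding smooth_pair_def F_def case_prod_beta'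
    by (auto intro!: continuous_intros derivative_eq_intros simp: algebra_simps)
  have gen: "generator lam mu i F ?F' q \<delta> x \<le> K * lam - exp (\<theta> * \<delta>) / 2" if "q \<le> i" for q \<delta> x
    unfolding F_def K_def by (rule lyapunov[OF \<theta>(1) \<theta>w \<theta>(2) that])
  have cE: "\<And>q::nat. continuous_on UNIV (\<lambda>(\<delta>, x::real). exp (\<theta> * \<delta>))"
    unfolding case_prod_beta' by (intro continuous_intros)
  define c0 where "c0 \<tau> = wt 0 + K + K * lam * \<tau>" for \<tau>
  let ?I = "\<lambda>w \<tau>. LINT t:{0..\<tau>}|lborel. exp (\<theta> * dl w t)"
  have key: "(\<integral>\<^sup>+w. ennreal (wt 0 * exp (\<theta> * dl w \<tau>) + ?I w \<tau> / 2) \<partial>P) \<le> ennreal (c0 \<tau>)" if \<tau>: "0 \<le> \<tau>" for \<tau>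
  proof -
    let ?G = "compensated F ?F' \<tau>"
    have le: "wt 0 * exp (\<theta> * dl w \<tau>) + ?I w \<tau> / 2 \<le> ?G w + c0 \<tau>" and nn: "0 \<le> wt 0 * exp (\<theta> * dl w \<tau>) + ?I w \<tau> / 2" if g: "good w" for w
    proof -
      have sE: "set_integrable lborel {0..\<tau>} (\<lambda>t. exp (\<theta> * dl w t))"
        by (rule set_integrable_obs[OF cE g order_refl])
      have sc: "set_integrable lborel {0..\<tau>} (\<lambda>t. K * lam)"
        unfolding set_integrable_def by (auto simp: emeasure_lborel_Icc_eq intro!: integrable_mult_left)
      have sd: "set_integrable lborel {0..\<tau>} (\<lambda>t. K * lam - exp (\<theta> * dl w t) / 2)"
        using sE sc by (intro set_integral_diff set_integrable_divide) auto
      have "(LINT t:{0..\<tau>}|lborel. generator lam mu i F ?F' (Qw w t) (dl w t) (xl w t)) \<le> (LINT t:{0..\<tau>}|lborel. K * lam - exp (\<theta> * dl w t) / 2)"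
        by (intro set_integral_mono set_integrable_obs[OF continuous_generator[OF sp] g order_refl] sd gen) (use obs_range[OF g] in auto)
      also have "\<dots> = (LINT t:{0..\<tau>}|lborel. K * lam) - (LINT t:{0..\<tau>}|lborel. exp (\<theta> * dl w t) / 2)"
        using sE sc by (intro set_integral_diff set_integrable_divide) auto
      also have "(LINT t:{0..\<tau>}|lborel. K * lam) = K * lam * \<tau>" using \<tau> by (simp add: set_integral_const)
      also have "(LINT t:{0..\<tau>}|lborel. exp (\<theta> * dl w t) / 2) = ?I w \<tau> / 2" by simp
      finally have 1: "(LINT t:{0..\<tau>}|lborel. generator lam mu i F ?F' (Qw w t) (dl w t) (xl w t)) \<le> K * lam * \<tau> - ?I w \<tau> / 2" .
      have "wt 0 * exp (\<theta> * dl w \<tau>) \<le> wt (Qw w \<tau>) * exp (\<theta> * dl w \<tau>)" by (intro mult_right_mono wt_mono) auto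
      also have "\<dots> \<le> F (Qw w \<tau>) (dl w \<tau>) (xl w \<tau>)" using K by (simp add: F_def)
      finally show "wt 0 * exp (\<theta> * dl w \<tau>) + ?I w \<tau> / 2 \<le> ?G w + c0 \<tau>"
        using 1 by (simp add: compensated_def c0_def F_def)
      have "0 \<le> ?I w \<tau>" unfolding set_lebesgue_integral_def by (intro integral_nonneg_AE AE_I2) (simp add: indicator_def)
      then show "0 \<le> wt 0 * exp (\<theta> * dl w \<tau>) + ?I w \<tau> / 2" using wt_pos[of 0] by simp
    qed
    note iG = generator_martingale(1)[OF sp \<tau>] and EG = generator_martingale(2)[OF sp \<tau>]
    have "(\<integral>\<^sup>+w. ennreal (wt 0 * exp (\<theta> * dl w \<tau>) + ?I w \<tau> / 2) \<partial>P) \<le> (\<integral>\<^sup>+w. ennreal (?G w + c0 \<tau>) \<partial>P)"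
      by (intro nn_integral_mono_AE eventually_mono[OF AE_good] ennreal_leI le)
    also have "\<dots> = ennreal (\<integral>w. ?G w + c0 \<tau> \<partial>P)"
    proof (rule nn_integral_eq_integral)
      show "integrable P (\<lambda>w. ?G w + c0 \<tau>)" using iG by simp
      show "AE w in P. 0 \<le> ?G w + c0 \<tau>" by (rule eventually_mono[OF AE_good]) (rule order_trans[OF nn le])
    qed
    also have "(\<integral>w. ?G w + c0 \<tau> \<partial>P) = c0 \<tau>" using iG EG by (simp add: P.prob_space[simplified])
    finally show ?thesis .
  qed
  \<comment> \<open>\<open>1 / wt 0\<close> extracts the exponential from the bound in
    \<open>key\<close>, and 2 extracts its time integral; their sum serves for both.\<close>
  define C where "C = (wt 0 + K + K * lam) * (1 / wt 0 + 2)"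
  have Cpos: "0 < C" unfolding C_def using wt_pos[of 0] K lam_pos by (intro mult_pos_pos add_pos_pos) auto
  have c0: "c0 \<tau> \<le> (wt 0 + K + K * lam) * (1 + \<tau>)" if "0 \<le> \<tau>" for \<tau>
    using that wt_pos[of 0] K lam_pos by (simp add: c0_def algebra_simps)
  have scale: "(\<integral>\<^sup>+w. f w \<partial>P) \<le> ennreal (C * (1 + \<tau>))"
    if \<tau>: "0 \<le> \<tau>" and a: "0 < a" "a \<le> 1 / wt 0 + 2" and f: "\<And>w. good w \<Longrightarrow> f w \<le> ennreal a * ennreal (wt 0 * exp (\<theta> * dl w \<tau>) + ?I w \<tau> / 2)"
    for a f \<tau>
  proof -
    have Em: "(\<lambda>w. exp (\<theta> * dl w \<tau>)) \<in> borel_measurable P" by (rule obs_at_time[OF cE])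
    have Im: "(\<lambda>w. ?I w \<tau>) \<in> borel_measurable P"
      unfolding set_lebesgue_integral_def
    proof (rule lborel.borel_measurable_lebesgue_integral)
      have "(\<lambda>x. indicator {0..\<tau>} (snd x) *\<^sub>R exp (\<theta> * dl (fst x) (snd x))) \<in> borel_measurable (P \<Otimes>\<^sub>M borel)"
        by (intro borel_measurable_scaleR measurable_obs[OF cE]) measurable
      then show "(\<lambda>(w, t). indicator {0..\<tau>} t *\<^sub>R exp (\<theta> * dl w t)) \<in> borel_measurable (P \<Otimes>\<^sub>M lborel)"
        by (simp add: case_prod_beta' cong: measurable_cong_sets)
    qed
    have m: "(\<lambda>w. ennreal (wt 0 * exp (\<theta> * dl w \<tau>) + ?I w \<tau> / 2)) \<in> borel_measurable P"
      using Em Im by measurable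
    have "(\<integral>\<^sup>+w. f w \<partial>P) \<le> (\<integral>\<^sup>+w. ennreal a * ennreal (wt 0 * exp (\<theta> * dl w \<tau>) + ?I w \<tau> / 2) \<partial>P)"
      by (intro nn_integral_mono_AE eventually_mono[OF AE_good] f)
    also have "\<dots> = ennreal a * (\<integral>\<^sup>+w. ennreal (wt 0 * exp (\<theta> * dl w \<tau>) + ?I w \<tau> / 2) \<partial>P)"
      by (rule nn_integral_cmult[OF m])
    also have "\<dots> \<le> ennreal a * ennreal (c0 \<tau>)" by (intro mult_left_mono key \<tau>) simp
    also have "\<dots> = ennreal (a * c0 \<tau>)" using a by (simp add: ennreal_mult')
    also have "\<dots> \<le> ennreal (C * (1 + \<tau>))"
    proof (rule ennreal_leI)
      have "a * c0 \<tau> \<le> (1 / wt 0 + 2) * ((wt 0 + K + K * lam) * (1 + \<tau>))"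
        using a c0[OF \<tau>] \<tau> wt_pos[of 0] K lam_pos by (intro mult_mono) (auto simp: c0_def)
      then show "a * c0 \<tau> \<le> C * (1 + \<tau>)" by (simp add: C_def mult_ac)
    qed
    finally show ?thesis .
  qed
  have Inn: "0 \<le> ?I w \<tau>" for w \<tau>
    unfolding set_lebesgue_integral_def by (intro integral_nonneg_AE AE_I2) (simp add: indicator_def)
  show thesis
  proof (rule that[OF \<theta>(1) Cpos])
    fix \<tau> :: real assume \<tau>: "0 \<le> \<tau>"
    show "(\<integral>\<^sup>+w. ennreal (exp (\<theta> * dl w \<tau>)) \<partial>P) \<le> ennreal (C * (1 + \<tau>))"
    proof (rule scale[OF \<tau>, of "1 / wt 0"])
      fix w
      have "exp (\<theta> * dl w \<tau>) \<le> 1 / wt 0 * (wt 0 * exp (\<theta> * dl w \<tau>) + ?I w \<tau> / 2)"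
        using wt_pos[of 0] Inn[of \<tau> w] by (simp add: field_simps)
      then have "ennreal (exp (\<theta> * dl w \<tau>)) \<le> ennreal (1 / wt 0 * (wt 0 * exp (\<theta> * dl w \<tau>) + ?I w \<tau> / 2))" by (rule ennreal_leI)
      also have "\<dots> = ennreal (1 / wt 0) * ennreal (wt 0 * exp (\<theta> * dl w \<tau>) + ?I w \<tau> / 2)"
        using wt_pos[of 0] by (intro ennreal_mult') simp
      finally show "ennreal (exp (\<theta> * dl w \<tau>)) \<le> ennreal (1 / wt 0) * ennreal (wt 0 * exp (\<theta> * dl w \<tau>) + ?I w \<tau> / 2)" .
    qed (use wt_pos[of 0] in auto)
    show "(\<integral>\<^sup>+w. (\<integral>\<^sup>+t. ennreal (exp (\<theta> * dl w t)) * indicator {0..\<tau>} t \<partial>lborel) \<partial>P) \<le> ennreal (C * (1 + \<tau>))"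
    proof (rule scale[OF \<tau>, of 2])
      fix w assume g: "good w"
      have "(\<integral>\<^sup>+t. ennreal (exp (\<theta> * dl w t)) * indicator {0..\<tau>} t \<partial>lborel) = (\<integral>\<^sup>+t. ennreal (indicator {0..\<tau>} t *\<^sub>R exp (\<theta> * dl w t)) \<partial>lborel)"
        by (intro nn_integral_cong) (auto split: split_indicator)
      also have "\<dots> = ennreal (?I w \<tau>)"
        unfolding set_lebesgue_integral_def
        by (rule nn_integral_eq_integral[OF set_integrable_obs[OF cE g order_refl, of \<tau>, unfolded set_integrable_def]]) (simp add: indicator_def)
      also have "\<dots> \<le> ennreal (2 * (wt 0 * exp (\<theta> * dl w \<tau>) + ?I w \<tau> / 2))"
        using wt_pos[of 0] by (intro ennreal_leI) simp
      also have "\<dots> = ennreal 2 * ennreal (wt 0 * exp (\<theta> * dl w \<tau>) + ?I w \<tau> / 2)" by (rule ennreal_mult') simp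
      finally show "(\<integral>\<^sup>+t. ennreal (exp (\<theta> * dl w t)) * indicator {0..\<tau>} t \<partial>lborel) \<le> ennreal 2 * ennreal (wt 0 * exp (\<theta> * dl w \<tau>) + ?I w \<tau> / 2)" .
    qed (use wt_pos[of 0] in auto)
  qed
qed

end

section \<open>A law of large numbers for the generator\<close>

text \<open>From the last square before \<open>\<tau>\<close> the remaining interval has length of
  order \<open>sqrt \<tau>\<close>. There \<open>f\<close> is at most a constant plus a small
  multiple of \<open>sqrt \<tau>\<close>, because \<open>growth\<close> says that \<open>d\<close>
  is of smaller order than the root at integer times and \<open>dstep\<close> carries this to real
  times.\<close>

lemma time_average_zero:
  fixes f d :: "real \<Rightarrow> real"
  assumes d0: "\<And>t. 0 \<le> t \<Longrightarrow> 0 \<le> d t" and dstep: "\<And>s t. 0 \<le> s \<Longrightarrow> s \<le> t \<Longrightarrow> d t \<le> d s + (t - s)"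
    and int: "\<And>s t. 0 \<le> s \<Longrightarrow> set_integrable lborel {s..t} f"
    and f: "\<And>t. 0 \<le> t \<Longrightarrow> \<bar>f t\<bar> \<le> C * (1 + d t)" and C: "0 \<le> C"
    and growth: "(\<lambda>m. d (real (Suc m)) ^ 6 / real (Suc m) ^ 3) \<longlonglongrightarrow> 0"
    and squares: "(\<lambda>n. (LINT t:{0..(real (Suc n))\<^sup>2}|lborel. f t) / (real (Suc n))\<^sup>2) \<longlonglongrightarrow> 0"
  shows "((\<lambda>\<tau>. (LINT t:{0..\<tau>}|lborel. f t) / \<tau>) \<longlongrightarrow> 0) at_top"
proof (rule tendstoI)
  fix e :: real assume e: "0 < e"
  \<comment> \<open>The remaining interval has length at most \<open>3 * s\<close> with
    \<open>s = sqrt \<tau>\<close>, so the error contains \<open>3 * C * \<eta>\<close>, which this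
    choice keeps below \<open>e / 3\<close>.\<close>
  define \<eta> where "\<eta> = e / (9 * (C + 1))"
  have \<eta>: "0 < \<eta>" using e C by (simp add: \<eta>_def)
  have C\<eta>: "3 * C * \<eta> \<le> e / 3"
    using e C by (simp add: \<eta>_def field_simps)
  let ?A = "\<lambda>\<tau>. LINT t:{0..\<tau>}|lborel. f t"
  have "0 < \<eta> ^ 6" using \<eta> by simp
  from order_tendstoD(2)[OF growth this] obtain N1 where N1: "\<And>m. m \<ge> N1 \<Longrightarrow> d (real (Suc m)) ^ 6 / real (Suc m) ^ 3 < \<eta> ^ 6"
    by (auto simp: eventually_sequentially)
  have dm: "d (real (Suc m)) \<le> \<eta> * sqrt (real (Suc m))" if "m \<ge> N1" for m
  proof (rule power_le_imp_le_base[of _ 5])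
    have "sqrt (real (Suc m)) ^ 6 = (sqrt (real (Suc m)) ^ 2) ^ 3" by (simp only: power_mult[symmetric]) simp
    also have "\<dots> = real (Suc m) ^ 3" by (subst real_sqrt_pow2) auto
    finally have s6: "sqrt (real (Suc m)) ^ 6 = real (Suc m) ^ 3" .
    have "d (real (Suc m)) ^ 6 \<le> \<eta> ^ 6 * real (Suc m) ^ 3"
      using N1[OF that] by (simp add: divide_less_eq del: of_nat_Suc)
    also have "\<dots> = (\<eta> * sqrt (real (Suc m))) ^ 6" by (simp only: power_mult_distrib s6)
    finally show "d (real (Suc m)) ^ Suc 5 \<le> (\<eta> * sqrt (real (Suc m))) ^ Suc 5" by simp
    show "0 \<le> \<eta> * sqrt (real (Suc m))" using \<eta> by simp
  qed
  have dt: "d t \<le> \<eta> * sqrt t + 1" if t: "real N1 + 2 \<le> t" for t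
  proof -
    \<comment> \<open>\<open>Suc m\<close> is the integer part of \<open>t\<close>. Since
      \<open>d\<close> grows at most at unit speed, passing from there to \<open>t\<close> costs at
      most 1.\<close>
    define m where "m = nat \<lfloor>t\<rfloor> - 1"
    have fl: "real_of_int \<lfloor>t\<rfloor> \<le> t" "t < real_of_int \<lfloor>t\<rfloor> + 1" by linarith+
    have pos: "int N1 + 2 \<le> \<lfloor>t\<rfloor>" using t by linarith
    then have m: "real (Suc m) = real_of_int \<lfloor>t\<rfloor>" "m \<ge> N1" by (auto simp: m_def)
    have "d t \<le> d (real (Suc m)) + (t - real (Suc m))" using m(1) fl t by (intro dstep) linarith+
    also have "\<dots> \<le> \<eta> * sqrt (real (Suc m)) + 1" using dm[OF m(2)] m fl by linarith
    also have "\<dots> \<le> \<eta> * sqrt t + 1"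
    proof -
      have "real (Suc m) \<le> t" unfolding m(1) by (rule fl(1))
      then have "sqrt (real (Suc m)) \<le> sqrt t" by (rule real_sqrt_le_mono)
      then have "\<eta> * sqrt (real (Suc m)) \<le> \<eta> * sqrt t" using \<eta> by (intro mult_left_mono) linarith+
      then show ?thesis by linarith
    qed
    finally show ?thesis .
  qed
  have "0 < e / 3" using e by simp
  with squares obtain N2 where N2: "\<And>n. n \<ge> N2 \<Longrightarrow> \<bar>?A ((real (Suc n))\<^sup>2) / (real (Suc n))\<^sup>2\<bar> < e / 3"
    using tendstoD[OF squares, of "e / 3"] by (auto simp: eventually_sequentially dist_real_def)
  \<comment> \<open>Beyond the square of \<open>R\<close> the estimates at integers and at squares
    are available, and \<open>18 * C / e\<close> makes the error term \<open>6 * C / s\<close> at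
    most \<open>e / 3\<close>.\<close>
  define R where "R = max (max (real N1 + 3) (real N2 + 3)) (18 * C / e + 1)"
  show "\<forall>\<^sub>F \<tau> in at_top. dist (?A \<tau> / \<tau>) 0 < e"
    using eventually_ge_at_top[of "R\<^sup>2"]
  proof eventually_elim
    fix \<tau> :: real assume \<tau>: "R\<^sup>2 \<le> \<tau>"
    have Rge: "R \<ge> real N1 + 3" "R \<ge> real N2 + 3" "R > 18 * C / e" by (auto simp: R_def)
    have R: "R \<ge> 3" using Rge(1) by simp
    define s where "s = sqrt \<tau>"
    have s: "R \<le> s" unfolding s_def using \<tau> by (rule real_le_rsqrt)
    have s2: "s\<^sup>2 = \<tau>" unfolding s_def using \<tau> by (simp add: order_trans[OF zero_le_power2])
    \<comment> \<open>\<open>Suc n\<close> is the integer part of the root of \<open>\<tau>\<close>,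
      so that \<open>u\<close> below is the largest perfect square not exceeding
      \<open>\<tau>\<close>.\<close>
    define n where "n = nat \<lfloor>s\<rfloor> - 1"
    have fl: "real_of_int \<lfloor>s\<rfloor> \<le> s" "s < real_of_int \<lfloor>s\<rfloor> + 1" by linarith+
    have "int N2 + 2 \<le> \<lfloor>s\<rfloor>" "2 \<le> \<lfloor>s\<rfloor>" using s Rge R by linarith+
    then have n: "real (Suc n) = real_of_int \<lfloor>s\<rfloor>" "n \<ge> N2" by (auto simp: n_def)
    define u where "u = (real (Suc n))\<^sup>2"
    have n2: "real (Suc n) \<ge> real N1 + 2" "real (Suc n) \<ge> 2" using n fl s Rge R by linarith+
    have u1: "u \<le> \<tau>" unfolding u_def s2[symmetric] using n(1) fl by (intro power_mono) (simp_all only: of_nat_0_le_iff)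
    have "real N1 + 2 \<le> real (Suc n) * 1" using n2 by simp
    also have "\<dots> \<le> real (Suc n) * real (Suc n)" using n2 by (intro mult_left_mono) auto
    finally have u2: "real N1 + 2 \<le> u" by (simp add: u_def power2_eq_square)
    have u0: "0 < u" using u2 by linarith
    have "\<tau> \<le> (real (Suc n) + 1)\<^sup>2" unfolding s2[symmetric] using n fl s R by (intro power_mono) auto
    then have "\<tau> - u \<le> 2 * real (Suc n) + 1" by (simp add: u_def power2_eq_square algebra_simps)
    also have "\<dots> \<le> 3 * s"
    proof -
      have "2 * y + 1 \<le> 3 * s" if "y \<le> s" "2 \<le> y" for y using that by linarith
      moreover have "real (Suc n) \<le> s" unfolding n(1) by (rule fl(1))
      ultimately show ?thesis using n2(2) by blast
    qed
    finally have gap: "\<tau> - u \<le> 3 * s" .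
    have un: "{0..\<tau>} = {0..u} \<union> {u<..\<tau>}" using u1 u0 by auto
    have i2: "set_integrable lborel {u<..\<tau>} f"
      by (rule set_integrable_subset[OF int[OF less_imp_le[OF u0]]]) auto
    have split: "?A \<tau> = ?A u + (LINT t:{u<..\<tau>}|lborel. f t)"
      unfolding un by (rule set_integral_Un) (use int[of 0 u] i2 in auto)
    define b where "b = C * (2 + \<eta> * s)"
    have b: "0 \<le> b" using C \<eta> s R by (simp add: b_def)
    have "\<bar>LINT t:{u<..\<tau>}|lborel. f t\<bar> \<le> (LINT t:{u<..\<tau>}|lborel. b)"
      unfolding set_lebesgue_integral_def real_norm_def[symmetric]
    proof (rule Bochner_Integration.integral_norm_bound_integral)
      show "integrable lborel (\<lambda>t. indicator {u<..\<tau>} t *\<^sub>R f t)" using i2 by (simp add: set_integrable_def)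
      show "integrable lborel (\<lambda>t. indicator {u<..\<tau>} t *\<^sub>R b)"
        using u1 by (auto intro!: integrable_mult_left integrable_real_indicator)
      fix t
      show "norm (indicator {u<..\<tau>} t *\<^sub>R f t) \<le> indicator {u<..\<tau>} t *\<^sub>R b"
      proof (cases "t \<in> {u<..\<tau>}")
        case True
        have "\<bar>f t\<bar> \<le> C * (1 + d t)" using True u0 by (intro f) auto
        also have "\<dots> \<le> C * (1 + (\<eta> * sqrt t + 1))" using True u2 C by (intro mult_left_mono add_left_mono dt) auto
        also have "\<dots> \<le> b" unfolding b_def s_def using True C \<eta> by (intro mult_left_mono) auto
        finally show ?thesis using True by simp
      qed simp
    qed
    also have "\<dots> = b * (\<tau> - u)" using u1 by (simp add: set_integral_const)
    also have "\<dots> \<le> b * (3 * s)" using b gap by (rule mult_left_mono[rotated])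
    finally have g: "\<bar>LINT t:{u<..\<tau>}|lborel. f t\<bar> \<le> b * (3 * s)" .
    have sp: "0 < s" using s R by simp
    have "\<bar>?A \<tau> / \<tau>\<bar> = \<bar>?A \<tau>\<bar> / \<tau>" using u1 u0 by (simp add: abs_divide)
    also have "\<dots> \<le> (\<bar>?A u\<bar> + b * (3 * s)) / \<tau>"
      unfolding split using g u0 u1 by (intro divide_right_mono) auto
    also have "\<dots> = \<bar>?A u\<bar> / \<tau> + b * (3 * s) / \<tau>" by (rule add_divide_distrib)
    finally have total: "\<bar>?A \<tau> / \<tau>\<bar> \<le> \<bar>?A u\<bar> / \<tau> + b * (3 * s) / \<tau>" .
    have "\<bar>?A u\<bar> / \<tau> \<le> \<bar>?A u\<bar> / u" using u0 u1 by (intro divide_left_mono) auto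
    also have "\<dots> = \<bar>?A u / u\<bar>" using u0 by (simp add: abs_divide)
    also have "\<dots> < e / 3" unfolding u_def by (rule N2[OF n(2)])
    finally have first: "\<bar>?A u\<bar> / \<tau> < e / 3" .
    have second: "b * (3 * s) / \<tau> = 6 * C / s + 3 * C * \<eta>"
      unfolding b_def s2[symmetric] using sp by (simp add: power2_eq_square field_simps)
    have "18 * C / e \<le> s" using s Rge(3) by linarith
    then have "18 * C \<le> s * e" using e by (simp add: field_simps)
    then have "6 * C / s \<le> e / 3" using sp by (simp add: field_simps)
    then have "\<bar>?A \<tau> / \<tau>\<bar> < e / 3 + (e / 3 + 3 * C * \<eta>)" using total first second by linarith
    then show "dist (?A \<tau> / \<tau>) 0 < e" using C\<eta> by (simp add: dist_real_def)
  qed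
qed

context queue
begin

text \<open>A Borel-Cantelli argument: summable expectations make the series of the variables finite
  almost surely, so its terms vanish in the limit.\<close>

lemma AE_tendsto_zero:
  fixes f :: "nat \<Rightarrow> (event \<Rightarrow> real) \<Rightarrow> real"
  assumes m: "\<And>n. f n \<in> borel_measurable P" and f0: "\<And>n w. good w \<Longrightarrow> 0 \<le> f n w"
    and le: "\<And>n. (\<integral>\<^sup>+w. ennreal (f n w) \<partial>P) \<le> ennreal (a n)" and a: "\<And>n. 0 \<le> a n" "summable a"
  shows "AE w in P. (\<lambda>n. f n w) \<longlonglongrightarrow> 0"
proof -
  have "(\<integral>\<^sup>+w. (\<Sum>n. ennreal (f n w)) \<partial>P) = (\<Sum>n. \<integral>\<^sup>+w. ennreal (f n w) \<partial>P)"
    by (rule nn_integral_suminf) (use m in measurable)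
  also have "\<dots> \<le> (\<Sum>n. ennreal (a n))" by (intro suminf_le le) auto
  also have "\<dots> = ennreal (\<Sum>n. a n)" by (rule suminf_ennreal2[OF a])
  finally have "(\<integral>\<^sup>+w. (\<Sum>n. ennreal (f n w)) \<partial>P) \<noteq> \<infinity>" by (auto simp: top_unique)
  then have "AE w in P. (\<Sum>n. ennreal (f n w)) \<noteq> \<infinity>"
    by (rule nn_integral_PInf_AE[rotated]) (use m in measurable)
  with AE_good show ?thesis
  proof eventually_elim
    fix w assume g: "good w" and "(\<Sum>n. ennreal (f n w)) \<noteq> \<infinity>"
    then have "summable (\<lambda>n. f n w)" using f0[OF g] by (intro summable_suminf_not_top) auto
    then show "(\<lambda>n. f n w) \<longlonglongrightarrow> 0" by (rule summable_LIMSEQ_zero)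
  qed
qed

lemma summable_inverse_Suc_square: "summable (\<lambda>n. c / (real (Suc n))\<^sup>2)" for c :: real
proof -
  have "summable (\<lambda>n. 1 / real n ^ 2)" using inverse_power_summable[of 2, where 'a=real] by (simp add: inverse_eq_divide)
  then have "summable (\<lambda>n. 1 / (real (Suc n))\<^sup>2)" by (subst summable_Suc_iff)
  then have "summable (\<lambda>n. c * (1 / (real (Suc n))\<^sup>2))" by (rule summable_mult)
  then show ?thesis by simp
qed

lemma cont_dl: "\<And>q::nat. continuous_on UNIV (\<lambda>(\<delta>::real, x::real). \<delta>)"
  unfolding case_prod_beta' by (intro continuous_intros)

text \<open>The mean of the quotient is of order 1 / m squared, since the sixth moment is bounded by
  a multiple of \<open>1 + m\<close>; this is summable. The outcome is that the age at time m is of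
  smaller order than the root of m, just what interpolation between squares demands.\<close>

lemma AE_growth: "AE w in P. (\<lambda>m. dl w (real (Suc m)) ^ 6 / real (Suc m) ^ 3) \<longlonglongrightarrow> 0"
proof (rule exp_moments)
  fix \<theta> C :: real
  assume \<theta>: "0 < \<theta>" and C: "0 < C" and E: "\<And>\<tau>. 0 \<le> \<tau> \<Longrightarrow> (\<integral>\<^sup>+w. ennreal (exp (\<theta> * dl w \<tau>)) \<partial>P) \<le> ennreal (C * (1 + \<tau>))"
  obtain c where c: "0 < c" "\<And>y. 0 \<le> y \<Longrightarrow> (1 + y) ^ 6 \<le> c * exp (\<theta> * y)" using exp_dominates_power[OF \<theta>, of 6] by metis
  show ?thesis
  proof (rule AE_tendsto_zero)
    show "(\<lambda>w. dl w (real (Suc n)) ^ 6 / real (Suc n) ^ 3) \<in> borel_measurable P" for n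
      using obs_at_time[OF cont_dl, of "real (Suc n)"] by (intro borel_measurable_divide borel_measurable_power) auto
    show "0 \<le> dl w (real (Suc n)) ^ 6 / real (Suc n) ^ 3" for n w
      by (rule divide_nonneg_nonneg, rule zero_le_even_power) auto
    show "summable (\<lambda>n. 2 * c * C / (real (Suc n))\<^sup>2)" by (rule summable_inverse_Suc_square)
    show "0 \<le> 2 * c * C / (real (Suc n))\<^sup>2" for n using c C by simp
    fix n
    let ?t = "real (Suc n)"
    have "(\<integral>\<^sup>+w. ennreal (dl w ?t ^ 6 / ?t ^ 3) \<partial>P) \<le> (\<integral>\<^sup>+w. ennreal (c / ?t ^ 3) * ennreal (exp (\<theta> * dl w ?t)) \<partial>P)"
    proof (rule nn_integral_mono_AE, use AE_good in eventually_elim)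
      fix w assume g: "good w"
      have d: "0 \<le> dl w ?t" using obs_range[OF g, of ?t] by simp
      then have "dl w ?t ^ 6 \<le> (1 + dl w ?t) ^ 6" by (intro power_mono) auto
      also have "\<dots> \<le> c * exp (\<theta> * dl w ?t)" by (rule c(2)[OF d])
      finally have "dl w ?t ^ 6 / ?t ^ 3 \<le> c * exp (\<theta> * dl w ?t) / ?t ^ 3" by (rule divide_right_mono) simp
      then have "ennreal (dl w ?t ^ 6 / ?t ^ 3) \<le> ennreal (c / ?t ^ 3 * exp (\<theta> * dl w ?t))" by (intro ennreal_leI) simp
      also have "\<dots> = ennreal (c / ?t ^ 3) * ennreal (exp (\<theta> * dl w ?t))" using c(1) by (intro ennreal_mult') simp
      finally show "ennreal (dl w ?t ^ 6 / ?t ^ 3) \<le> ennreal (c / ?t ^ 3) * ennreal (exp (\<theta> * dl w ?t))" .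
    qed
    also have "\<dots> = ennreal (c / ?t ^ 3) * (\<integral>\<^sup>+w. ennreal (exp (\<theta> * dl w ?t)) \<partial>P)"
    proof (rule nn_integral_cmult)
      have "(\<lambda>w. dl w ?t) \<in> borel_measurable P" by (rule obs_at_time[OF cont_dl])
      then show "(\<lambda>w. ennreal (exp (\<theta> * dl w ?t))) \<in> borel_measurable P" by measurable
    qed
    also have "\<dots> \<le> ennreal (c / ?t ^ 3) * ennreal (C * (1 + ?t))" by (intro mult_left_mono E) auto
    also have "\<dots> = ennreal (c / ?t ^ 3 * (C * (1 + ?t)))" using c(1) C by (intro ennreal_mult[symmetric]) auto
    also have "\<dots> \<le> ennreal (2 * c * C / ?t\<^sup>2)"
    proof (rule ennreal_leI)
      have "c / ?t ^ 3 * (C * (1 + ?t)) \<le> c / ?t ^ 3 * (C * (2 * ?t))" using c(1) C by (intro mult_left_mono) auto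
      also have "\<dots> = 2 * c * C / ?t\<^sup>2" by (simp add: power2_eq_square power3_eq_cube del: of_nat_Suc)
      finally show "c / ?t ^ 3 * (C * (1 + ?t)) \<le> 2 * c * C / ?t\<^sup>2" .
    qed
    finally show "(\<integral>\<^sup>+w. ennreal (dl w ?t ^ 6 / ?t ^ 3) \<partial>P) \<le> ennreal (2 * c * C / ?t\<^sup>2)" .
  qed
qed

text \<open>At the times n squared the second moment of the compensated process is of order n
  squared, hence summable after division by the fourth power of n. The boundary term is at most
  linear in the age, which is of smaller order than n there. Between the squares
  \<open>time_average_zero\<close> takes over.\<close>

theorem generator_average:
  assumes F: "smooth_pair F F'" and C: "0 \<le> C"
    and lin: "\<And>q \<delta> x. 0 \<le> x \<Longrightarrow> x \<le> \<delta> \<Longrightarrow> \<bar>F q \<delta> x\<bar> \<le> C * (1 + \<delta>) \<and> \<bar>F' q \<delta> x\<bar> \<le> C * (1 + \<delta>)"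
  shows "AE w in P. ((\<lambda>\<tau>. (LINT t:{0..\<tau>}|lborel. generator lam mu i F F' (Qw w t) (dl w t) (xl w t)) / \<tau>) \<longlongrightarrow> 0) at_top"
proof -
  have cF: "\<And>q. continuous_on UNIV (\<lambda>(\<delta>, x). F q \<delta> x)" using F by (auto simp: smooth_pair_def)
  have diff: "\<bar>F q \<delta>' x' - F q' \<delta> x\<bar> \<le> 2 * C * (1 + \<delta>)" if "0 \<le> x" "x \<le> \<delta>" "0 \<le> x'" "x' \<le> \<delta>'" "\<delta>' \<le> \<delta>" for q q' \<delta> x \<delta>' x'
  proof -
    have "C * (1 + \<delta>') \<le> C * (1 + \<delta>)" using that C by (intro mult_left_mono) auto
    then show ?thesis using lin[of x \<delta> q'] lin[of x' \<delta>' q] that by linarith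
  qed
  have jb: "\<bar>AJ F k w t\<bar> \<le> 2 * C * (1 + dl w t)" "\<bar>CJ F k w t\<bar> \<le> 2 * C * (1 + dl w t)" if g: "good w" and t: "0 \<le> t" for k w t
  proof -
    note o = obs_range[OF g t]
    show "\<bar>AJ F k w t\<bar> \<le> 2 * C * (1 + dl w t)" unfolding AJ_def arrival_jump_def using o C by (auto intro!: diff)
    show "\<bar>CJ F k w t\<bar> \<le> 2 * C * (1 + dl w t)" unfolding CJ_def completion_jump_def using o C by (auto intro!: diff)
  qed
  define C2 where "C2 = C + 2 * lam * real i * C + 2 * lam * C + 2 * mu * C"
  have C2: "0 \<le> C2" using C lam_pos mu_pos by (simp add: C2_def)
  have gb: "\<bar>generator lam mu i F F' q \<delta> x\<bar> \<le> C2 * (1 + \<delta>)" if x: "0 \<le> x" "x \<le> \<delta>" for q \<delta> x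
  proof -
    have 1: "\<bar>F' q \<delta> x\<bar> \<le> C * (1 + \<delta>)" using lin x by blast
    have 2: "\<bar>lam * (real (i - q) * (F (Suc q) \<delta> x - F q \<delta> x))\<bar> \<le> lam * (real i * (2 * C * (1 + \<delta>)))"
      unfolding abs_mult using lam_pos diff[OF x x order_refl] by (intro mult_mono) auto
    have 3: "\<bar>lam * (F q \<delta> 0 - F q \<delta> x)\<bar> \<le> lam * (2 * C * (1 + \<delta>))"
      unfolding abs_mult using lam_pos diff[OF x, of 0 \<delta> q q] x by (intro mult_mono) auto
    have 4: "\<bar>mu * (if q = 0 then F 0 x x - F 0 \<delta> x else F (q - 1) \<delta> x - F q \<delta> x)\<bar> \<le> mu * (2 * C * (1 + \<delta>))"
    proof -
      have "\<bar>if q = 0 then F 0 x x - F 0 \<delta> x else F (q - 1) \<delta> x - F q \<delta> x\<bar> \<le> 2 * C * (1 + \<delta>)"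
      proof (cases "q = 0")
        case True
        then show ?thesis unfolding if_P[OF True] by (intro diff[OF x x(1) order_refl x(2)])
      next
        case False
        show ?thesis unfolding if_not_P[OF False] by (rule diff[OF x x order_refl])
      qed
      then show ?thesis unfolding abs_mult abs_of_pos[OF mu_pos] by (rule mult_left_mono) (rule less_imp_le[OF mu_pos])
    qed
    have "\<bar>generator lam mu i F F' q \<delta> x\<bar> \<le> C * (1 + \<delta>) + lam * (real i * (2 * C * (1 + \<delta>))) + lam * (2 * C * (1 + \<delta>)) + mu * (2 * C * (1 + \<delta>))"
      unfolding generator_def
      by (rule order_trans[OF abs_triangle_ineq add_mono[OF order_trans[OF abs_triangle_ineq add_mono[OF order_trans[OF abs_triangle_ineq add_mono[OF 1 2]] 3]] 4]])
    also have "\<dots> = C2 * (1 + \<delta>)" by (simp add: C2_def algebra_simps)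
    finally show ?thesis .
  qed
  have M: "AE w in P. (\<lambda>n. (compensated F F' ((real (Suc n))\<^sup>2) w)\<^sup>2 / (real (Suc n)) ^ 4) \<longlonglongrightarrow> 0"
  proof (rule exp_moments)
    fix \<theta> C1 :: real
    assume \<theta>: "0 < \<theta>" and C1: "0 < C1" and E: "\<And>\<tau>. 0 \<le> \<tau> \<Longrightarrow> (\<integral>\<^sup>+w. (\<integral>\<^sup>+t. ennreal (exp (\<theta> * dl w t)) * indicator {0..\<tau>} t \<partial>lborel) \<partial>P) \<le> ennreal (C1 * (1 + \<tau>))"
    obtain c where c: "0 < c" "\<And>y. 0 \<le> y \<Longrightarrow> (1 + y) ^ 2 \<le> c * exp (\<theta> * y)" using exp_dominates_power[OF \<theta>, of 2] by metis
    define c4 where "c4 = (2 * C)\<^sup>2 * c"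
    have c4: "0 \<le> c4" using c by (simp add: c4_def)
    define K where "K = 2 * (real i + 1)\<^sup>2 * (lam + mu)"
    have K: "0 \<le> K" using lam_pos mu_pos by (simp add: K_def)
    have sq: "ennreal (y\<^sup>2) \<le> ennreal c4 * ennreal (exp (\<theta> * dl w t))" if g: "good w" and t: "0 \<le> t" and y: "\<bar>y\<bar> \<le> 2 * C * (1 + dl w t)" for y w t
    proof -
      have d: "0 \<le> dl w t" using obs_range[OF g t] by simp
      have "y\<^sup>2 \<le> (2 * C * (1 + dl w t))\<^sup>2" using power_mono[OF y, of 2] by simp
      also have "\<dots> = (2 * C)\<^sup>2 * (1 + dl w t)\<^sup>2" by (simp only: power_mult_distrib)
      also have "\<dots> \<le> (2 * C)\<^sup>2 * (c * exp (\<theta> * dl w t))" by (intro mult_left_mono c(2) d) simp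
      also have "\<dots> = c4 * exp (\<theta> * dl w t)" by (simp add: c4_def)
      finally have "ennreal (y\<^sup>2) \<le> ennreal (c4 * exp (\<theta> * dl w t))" by (rule ennreal_leI)
      then show ?thesis by (simp only: ennreal_mult'[OF c4])
    qed
    show ?thesis
    proof (rule AE_tendsto_zero)
      fix n
      let ?t = "(real (Suc n))\<^sup>2"
      have cm: "compensated F F' ?t \<in> borel_measurable P" using generator_martingale(1)[OF F, of ?t] by auto
      then show "(\<lambda>w. (compensated F F' ?t w)\<^sup>2 / (real (Suc n)) ^ 4) \<in> borel_measurable P" by measurable
      have em: "(\<lambda>w. \<integral>\<^sup>+t. ennreal (exp (\<theta> * dl w t)) * indicator {0..?t} t \<partial>lborel) \<in> borel_measurable P"
      proof (rule lborel.borel_measurable_nn_integral)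
        have "(\<lambda>x. dl (fst x) (snd x)) \<in> borel_measurable (P \<Otimes>\<^sub>M borel)" by (rule measurable_obs[OF cont_dl])
        then have "(\<lambda>x. ennreal (exp (\<theta> * dl (fst x) (snd x))) * indicator {0..?t} (snd x)) \<in> borel_measurable (P \<Otimes>\<^sub>M borel)" by measurable
        then show "(\<lambda>(w, t). ennreal (exp (\<theta> * dl w t)) * indicator {0..?t} t) \<in> borel_measurable (P \<Otimes>\<^sub>M lborel)"
          by (simp add: case_prod_beta' cong: measurable_cong_sets)
      qed
      have "(\<integral>\<^sup>+w. ennreal ((compensated F F' ?t w)\<^sup>2) \<partial>P) \<le> ennreal K *
          (\<integral>\<^sup>+w. (\<integral>\<^sup>+t. (ennreal c4 * ennreal (exp (\<theta> * dl w t))) * indicator {0..?t} t \<partial>lborel) \<partial>P)"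
        unfolding K_def by (rule generator_martingale(3)[OF F]) (auto intro!: sq jb)
      also have "(\<integral>\<^sup>+w. (\<integral>\<^sup>+t. (ennreal c4 * ennreal (exp (\<theta> * dl w t))) * indicator {0..?t} t \<partial>lborel) \<partial>P) =
         (\<integral>\<^sup>+w. ennreal c4 * (\<integral>\<^sup>+t. ennreal (exp (\<theta> * dl w t)) * indicator {0..?t} t \<partial>lborel) \<partial>P)"
      proof (rule nn_integral_cong)
        fix w
        have "(\<lambda>t. dl w t) \<in> borel_measurable borel" by (rule obs_section[OF cont_dl])
        then have "(\<lambda>t. dl w t) \<in> measurable lborel borel" by simp
        from measurable_compose[OF this, of "\<lambda>y. ennreal (exp (\<theta> * y))" borel]
        have "(\<lambda>t. ennreal (exp (\<theta> * dl w t))) \<in> borel_measurable lborel" by simp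
        then have "(\<lambda>t. ennreal (exp (\<theta> * dl w t)) * indicator {0..?t} t) \<in> borel_measurable lborel"
          by (rule borel_measurable_times_ennreal) (rule borel_measurable_indicator, simp)
        from nn_integral_cmult[OF this, of "ennreal c4"]
        show "(\<integral>\<^sup>+t. (ennreal c4 * ennreal (exp (\<theta> * dl w t))) * indicator {0..?t} t \<partial>lborel) = ennreal c4 * (\<integral>\<^sup>+t. ennreal (exp (\<theta> * dl w t)) * indicator {0..?t} t \<partial>lborel)"
          by (simp only: mult.assoc)
      qed
      also have "\<dots> = ennreal c4 * (\<integral>\<^sup>+w. (\<integral>\<^sup>+t. ennreal (exp (\<theta> * dl w t)) * indicator {0..?t} t \<partial>lborel) \<partial>P)"
        by (rule nn_integral_cmult[OF em])
      also have "ennreal K * \<dots> \<le> ennreal K * (ennreal c4 * ennreal (C1 * (1 + ?t)))" by (intro mult_left_mono E) auto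
      also have "\<dots> = ennreal (K * (c4 * (C1 * (1 + ?t))))"
        by (simp only: ennreal_mult'[OF K] ennreal_mult'[OF c4])
      finally have b: "(\<integral>\<^sup>+w. ennreal ((compensated F F' ?t w)\<^sup>2) \<partial>P) \<le> ennreal (K * (c4 * (C1 * (1 + ?t))))" .
      have "(\<integral>\<^sup>+w. ennreal ((compensated F F' ?t w)\<^sup>2 / (real (Suc n)) ^ 4) \<partial>P) = (\<integral>\<^sup>+w. ennreal (1 / (real (Suc n)) ^ 4) * ennreal ((compensated F F' ?t w)\<^sup>2) \<partial>P)"
        by (intro nn_integral_cong) (subst ennreal_mult[symmetric], auto)
      also have "\<dots> = ennreal (1 / (real (Suc n)) ^ 4) * (\<integral>\<^sup>+w. ennreal ((compensated F F' ?t w)\<^sup>2) \<partial>P)"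
        by (rule nn_integral_cmult) (use cm in measurable)
      also have "\<dots> \<le> ennreal (1 / (real (Suc n)) ^ 4) * ennreal (K * (c4 * (C1 * (1 + ?t))))" by (intro mult_left_mono b) auto
      also have "\<dots> = ennreal (1 / (real (Suc n)) ^ 4 * (K * (c4 * (C1 * (1 + ?t)))))" using K c4 C1 by (intro ennreal_mult[symmetric]) auto
      also have "\<dots> \<le> ennreal (2 * K * c4 * C1 / (real (Suc n))\<^sup>2)"
      proof (rule ennreal_leI)
        have p: "(real (Suc n)) ^ 4 = ?t * ?t" by (simp only: power2_eq_square power4_eq_xxxx mult.assoc)
        have t1: "1 \<le> ?t" by (rule one_le_power) simp
        have "1 / (real (Suc n)) ^ 4 * (K * (c4 * (C1 * (1 + ?t)))) \<le> 1 / (real (Suc n)) ^ 4 * (K * (c4 * (C1 * (2 * ?t))))"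
          using K c4 C1 t1 by (intro mult_left_mono) auto
        also have "\<dots> = 2 * K * c4 * C1 / ?t" unfolding p using t1 by (simp add: field_simps del: of_nat_Suc)
        finally show "1 / (real (Suc n)) ^ 4 * (K * (c4 * (C1 * (1 + ?t)))) \<le> 2 * K * c4 * C1 / ?t" .
      qed
      finally show "(\<integral>\<^sup>+w. ennreal ((compensated F F' ?t w)\<^sup>2 / (real (Suc n)) ^ 4) \<partial>P) \<le> ennreal (2 * K * c4 * C1 / (real (Suc n))\<^sup>2)" .
      show "0 \<le> 2 * K * c4 * C1 / (real (Suc n))\<^sup>2" using K c4 C1 by simp
    next
      show "summable (\<lambda>n. 2 * K * c4 * C1 / (real (Suc n))\<^sup>2)" by (rule summable_inverse_Suc_square)
    qed simp
  qed
  from AE_good AE_growth M show ?thesis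
  proof eventually_elim
    fix w assume g: "good w" and gr: "(\<lambda>m. dl w (real (Suc m)) ^ 6 / real (Suc m) ^ 3) \<longlonglongrightarrow> 0"
      and M: "(\<lambda>n. (compensated F F' ((real (Suc n))\<^sup>2) w)\<^sup>2 / (real (Suc n)) ^ 4) \<longlonglongrightarrow> 0"
    interpret path "T w" "X w" i by (rule good_path[OF g])
    let ?f = "\<lambda>t. generator lam mu i F F' (Qw w t) (dl w t) (xl w t)"
    \<comment> \<open>The growth statement is indexed by \<open>Suc m\<close>; the subsequence
      \<open>Suc n ^ 2 - 1\<close> lands on the squares.\<close>
    have sub: "filterlim (\<lambda>n. Suc n ^ 2 - 1) at_top sequentially"
      by (rule filterlim_at_top_mono[OF filterlim_ident]) (auto simp: power2_eq_square)
    have six: "(\<lambda>n. dl w ((real (Suc n))\<^sup>2) ^ 6 / ((real (Suc n))\<^sup>2) ^ 3) \<longlonglongrightarrow> 0"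
      using filterlim_compose[OF gr sub] by (simp add: Suc_diff_1 del: of_nat_Suc power_Suc)
    have "(\<lambda>n. (dl w ((real (Suc n))\<^sup>2) / real (Suc n)) ^ 6) \<longlonglongrightarrow> 0"
      using six by (simp only: power_divide power_mult[symmetric]) simp
    then have "(\<lambda>n. root 6 ((dl w ((real (Suc n))\<^sup>2) / real (Suc n)) ^ 6)) \<longlonglongrightarrow> root 6 0" by (rule tendsto_real_root)
    moreover have "root 6 ((dl w ((real (Suc n))\<^sup>2) / real (Suc n)) ^ 6) = dl w ((real (Suc n))\<^sup>2) / real (Suc n)" for n
      using obs_range[OF g, of "(real (Suc n))\<^sup>2"] by (intro real_root_power_cancel) auto
    ultimately have d1: "(\<lambda>n. dl w ((real (Suc n))\<^sup>2) / real (Suc n)) \<longlonglongrightarrow> 0" by simp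
    have inv: "(\<lambda>n. 1 / real (Suc n)) \<longlonglongrightarrow> 0" using LIMSEQ_inverse_real_of_nat by (simp add: inverse_eq_divide)
    have d2: "(\<lambda>n. C * (1 / real (Suc n) * (1 / real (Suc n)) + dl w ((real (Suc n))\<^sup>2) / real (Suc n) * (1 / real (Suc n)))) \<longlonglongrightarrow> C * (0 * 0 + 0 * 0)"
      by (intro tendsto_intros inv d1)
    have Fz: "(\<lambda>n. F (Qw w ((real (Suc n))\<^sup>2)) (dl w ((real (Suc n))\<^sup>2)) (xl w ((real (Suc n))\<^sup>2)) / (real (Suc n))\<^sup>2) \<longlonglongrightarrow> 0"
    proof (rule Lim_null_comparison)
      show "(\<lambda>n. C * (1 / real (Suc n) * (1 / real (Suc n)) + dl w ((real (Suc n))\<^sup>2) / real (Suc n) * (1 / real (Suc n)))) \<longlonglongrightarrow> 0"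
        using d2 by simp
      have "norm (F (Qw w ((real (Suc n))\<^sup>2)) (dl w ((real (Suc n))\<^sup>2)) (xl w ((real (Suc n))\<^sup>2)) / (real (Suc n))\<^sup>2) \<le>
        C * (1 / real (Suc n) * (1 / real (Suc n)) + dl w ((real (Suc n))\<^sup>2) / real (Suc n) * (1 / real (Suc n)))" for n
      proof -
        let ?t = "(real (Suc n))\<^sup>2"
        have "norm (F (Qw w ?t) (dl w ?t) (xl w ?t) / ?t) = \<bar>F (Qw w ?t) (dl w ?t) (xl w ?t)\<bar> / ?t" by (simp add: abs_divide)
        also have "\<dots> \<le> C * (1 + dl w ?t) / ?t" using lin obs_range[OF g, of ?t] by (intro divide_right_mono) auto
        also have "\<dots> = C * (1 / real (Suc n) * (1 / real (Suc n)) + dl w ?t / real (Suc n) * (1 / real (Suc n)))"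
          by (simp add: power2_eq_square add_divide_distrib ring_distribs)
        finally show ?thesis .
      qed
      then show "\<forall>\<^sub>F n in sequentially. norm (F (Qw w ((real (Suc n))\<^sup>2)) (dl w ((real (Suc n))\<^sup>2)) (xl w ((real (Suc n))\<^sup>2)) / (real (Suc n))\<^sup>2) \<le>
        C * (1 / real (Suc n) * (1 / real (Suc n)) + dl w ((real (Suc n))\<^sup>2) / real (Suc n) * (1 / real (Suc n)))" by (intro always_eventually allI)
    qed
    have "(\<lambda>n. sqrt ((compensated F F' ((real (Suc n))\<^sup>2) w)\<^sup>2 / (real (Suc n)) ^ 4)) \<longlonglongrightarrow> sqrt 0" by (rule tendsto_real_sqrt[OF M])
    moreover have "sqrt ((compensated F F' ((real (Suc n))\<^sup>2) w)\<^sup>2 / (real (Suc n)) ^ 4) = \<bar>compensated F F' ((real (Suc n))\<^sup>2) w / (real (Suc n))\<^sup>2\<bar>" for n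
    proof -
      have "(compensated F F' ((real (Suc n))\<^sup>2) w)\<^sup>2 / (real (Suc n)) ^ 4 = (compensated F F' ((real (Suc n))\<^sup>2) w / (real (Suc n))\<^sup>2)\<^sup>2"
        by (simp only: power_divide power_mult[symmetric]) simp
      then show ?thesis by (simp only: real_sqrt_abs)
    qed
    ultimately have "(\<lambda>n. \<bar>compensated F F' ((real (Suc n))\<^sup>2) w / (real (Suc n))\<^sup>2\<bar>) \<longlonglongrightarrow> 0" by simp
    then have Mz: "(\<lambda>n. compensated F F' ((real (Suc n))\<^sup>2) w / (real (Suc n))\<^sup>2) \<longlonglongrightarrow> 0" by (simp only: tendsto_rabs_zero_iff)
    have cz: "(\<lambda>n. F 0 0 0 * (1 / real (Suc n) * (1 / real (Suc n)))) \<longlonglongrightarrow> F 0 0 0 * (0 * 0)" by (intro tendsto_intros inv)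
    have sq: "(\<lambda>n. (LINT t:{0..(real (Suc n))\<^sup>2}|lborel. ?f t) / (real (Suc n))\<^sup>2) \<longlonglongrightarrow> 0"
    proof -
      have "(\<lambda>n. F (Qw w ((real (Suc n))\<^sup>2)) (dl w ((real (Suc n))\<^sup>2)) (xl w ((real (Suc n))\<^sup>2)) / (real (Suc n))\<^sup>2 - F 0 0 0 * (1 / real (Suc n) * (1 / real (Suc n)))
         - compensated F F' ((real (Suc n))\<^sup>2) w / (real (Suc n))\<^sup>2) \<longlonglongrightarrow> 0 - F 0 0 0 * (0 * 0) - 0"
        by (intro tendsto_diff Fz cz Mz)
      moreover have "F (Qw w ((real (Suc n))\<^sup>2)) (dl w ((real (Suc n))\<^sup>2)) (xl w ((real (Suc n))\<^sup>2)) / (real (Suc n))\<^sup>2 - F 0 0 0 * (1 / real (Suc n) * (1 / real (Suc n)))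
         - compensated F F' ((real (Suc n))\<^sup>2) w / (real (Suc n))\<^sup>2 = (LINT t:{0..(real (Suc n))\<^sup>2}|lborel. ?f t) / (real (Suc n))\<^sup>2" for n
        by (simp add: compensated_def power2_eq_square diff_divide_distrib)
      ultimately show ?thesis by simp
    qed
    show "((\<lambda>\<tau>. (LINT t:{0..\<tau>}|lborel. ?f t) / \<tau>) \<longlongrightarrow> 0) at_top"
    proof (rule time_average_zero[where d = "dl w" and C = C2])
      show "0 \<le> dl w t" if "0 \<le> t" for t using obs_range[OF g that] by simp
      show "dl w t \<le> dl w s + (t - s)" if "0 \<le> s" "s \<le> t" for s t using st_mono[OF that(2)] by (simp add: dl_def)
      show "set_integrable lborel {s..t} ?f" if "0 \<le> s" for s t
        by (rule set_integrable_obs[OF continuous_generator[OF F] g that])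
      show "\<bar>?f t\<bar> \<le> C2 * (1 + dl w t)" if "0 \<le> t" for t using obs_range[OF g that] by (intro gb) auto
    qed (use C2 gr sq in auto)
  qed
qed

end

section \<open>The stationary averages\<close>

lemma aux_a_ge:
  assumes "lam > 0" "mu > 0"
  shows "lam + mu \<le> aux_a lam mu d"
proof (induction d)
  case (Suc d)
  have pos: "0 < aux_a lam mu d" using Suc assms by linarith
  have "(real d + 1) * lam * mu \<le> (real d + 1) * lam * aux_a lam mu d"
    using Suc assms by (intro mult_left_mono) auto
  then have "(real d + 1) * lam * mu / aux_a lam mu d \<le> (real d + 1) * lam" using pos by (simp add: pos_divide_le_eq)
  then show ?case by (simp add: algebra_simps)
qed simp

lemma coef_a_pos:
  assumes "lam > 0" "mu > 0"
  shows "0 < coef_a lam mu i h"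
proof (cases "h = 0 \<and> i > 0")
  case True
  have a: "lam + mu \<le> aux_a lam mu (i - 1)" by (rule aux_a_ge[OF assms])
  then have pos: "0 < aux_a lam mu (i - 1)" using assms by linarith
  have "real i * lam * mu \<le> real i * lam * aux_a lam mu (i - 1)" using a assms by (intro mult_left_mono) auto
  then have "real i * lam * mu / aux_a lam mu (i - 1) \<le> real i * lam" using pos by (simp add: pos_divide_le_eq)
  then have "0 < (real i + 1) * lam - real i * lam * mu / aux_a lam mu (i - 1)" using assms by (simp add: algebra_simps)
  then show ?thesis using True by (simp add: coef_a_def)
next
  case False
  then show ?thesis using aux_a_ge[OF assms, of "i - h"] assms by (auto simp: coef_a_def)
qed

lemma coef_a_0: "coef_a lam mu i 0 = lam * (1 + real i * (1 - mu / coef_a lam mu i 1))"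
  by (simp add: coef_a_def algebra_simps)

text \<open>The recursion in the shape that makes the sum below telescope. At \<open>h = i\<close>
  the factor \<open>real (i - h)\<close> is zero and the formula reads
  \<open>coef_a lam mu i i = lam + mu\<close>.\<close>

lemma coef_a_rec:
  assumes "1 \<le> h" "h \<le> i"
  shows "coef_a lam mu i h - mu = lam * (1 + real (i - h) * (1 - mu / coef_a lam mu i (Suc h)))"
proof (cases "i - h")
  case 0
  then show ?thesis using assms by (simp add: coef_a_def)
next
  case (Suc d)
  moreover have "i - Suc h = d" using Suc by simp
  ultimately show ?thesis using assms by (simp add: coef_a_def algebra_simps)
qed

text \<open>The partial sum up to \<open>m\<close> misses 1 / lam by
  \<open>c m * (real (i - m) * (1 - mu / ?a (Suc m)))\<close>. The recursion rewrites this remainder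
  as \<open>c (Suc m) * (1 + y)\<close>, where \<open>y\<close> is the corresponding factor one
  index later: the next summand plus the next remainder. At \<open>m = i\<close> nothing
  remains.\<close>

lemma coef_a_sum:
  assumes "lam > 0" "mu > 0"
  shows "(\<Sum>j=0..i. lam ^ j * fact i / (fact (i - j) * (\<Prod>h=0..j. coef_a lam mu i h))) = 1 / lam"
proof -
  let ?a = "coef_a lam mu i"
  note a = coef_a_pos[OF assms, of i]
  define c where "c j = lam ^ j * fact i / (fact (i - j) * (\<Prod>h=0..j. ?a h))" for j
  have partial: "(\<Sum>j=0..m. c j) = 1 / lam - c m * (real (i - m) * (1 - mu / ?a (Suc m)))" if "m \<le> i" for m
    using that
  proof (induction m)
    case 0
    have nz: "?a 0 \<noteq> 0" using a[of 0] by simp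
    define y where "y = real i * (1 - mu / ?a 1)"
    have e: "?a 0 = lam * (1 + y)" unfolding y_def by (rule coef_a_0)
    have y: "1 + y \<noteq> 0" using nz unfolding e by auto
    define z where "z = 1 / ?a 0"
    have "z * (1 + y) = 1 / lam" unfolding z_def e using y by simp
    then have z: "z = 1 / lam - z * y" by (simp add: distrib_left)
    have c0: "c 0 = z" by (simp add: c_def z_def)
    have s: "(\<Sum>j=0..0. c j) = z" by (simp add: c0)
    have yy: "real (i - 0) * (1 - mu / ?a (Suc 0)) = y" by (simp add: y_def)
    show ?case unfolding s yy unfolding c0 by (rule z)
  next
    case (Suc m)
    then have m: "m < i" by simp
    define y where "y = real (i - Suc m) * (1 - mu / ?a (Suc (Suc m)))"
    have e: "?a (Suc m) - mu = lam * (1 + y)" unfolding y_def using m by (intro coef_a_rec) auto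
    have f: "fact (i - m) = real (i - m) * fact (i - Suc m)" using m by (simp add: fact_reduce)
    have pm: "(\<Prod>h=0..m. ?a h) > 0" using a by (intro prod_pos) auto
    have im: "real (i - m) \<noteq> 0" using m by simp
    have cs: "c (Suc m) = c m * (lam * real (i - m) / ?a (Suc m))"
    proof -
      have "lam ^ Suc m * u / (v * (x * z)) = lam ^ m * u / (d * v * x) * (lam * d / z)"
        if "d \<noteq> 0" "v \<noteq> 0" "x \<noteq> 0" "z \<noteq> 0" for u v x z d :: real
        using that by (simp add: field_simps)
      from this[of "real (i - m)" "fact (i - Suc m)" "\<Prod>h=0..m. ?a h" "?a (Suc m)" "fact i"]
      show ?thesis
        unfolding c_def prod.atLeast0_atMost_Suc f using pm a[of "Suc m"] im by (simp only: fact_nonzero less_imp_neq[THEN not_sym] not_False_eq_True simp_thms)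
    qed
    have h: "1 - mu / ?a (Suc m) = lam * (1 + y) / ?a (Suc m)"
      unfolding e[symmetric] using a[of "Suc m"] by (simp add: field_simps)
    have "c m * (real (i - m) * (1 - mu / ?a (Suc m))) = c (Suc m) * (1 + y)" unfolding h cs by (simp add: mult_ac)
    then show ?case using Suc.IH m by (simp add: y_def distrib_left)
  qed
  show ?thesis using partial[of i] by (simp add: c_def)
qed

text \<open>The second summand has a meaning: \<open>1 / S_const lam mu i\<close> is the long-run
  proportion of time with no busy higher stream, and \<open>1 / lam\<close> is the mean time since
  the last arrival.\<close>

lemma v_bar_0:
  assumes "lam > 0" "mu > 0"
  shows "v_bar lam mu i 0 = 1 / mu + 1 / S_const lam mu i / lam"
proof -
  have "(\<Sum>j=0..i. lam ^ j * fact i / (fact (i - j) * S_const lam mu i * (\<Prod>h=0..j. coef_a lam mu i h)))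
    = (\<Sum>j=0..i. lam ^ j * fact i / (fact (i - j) * (\<Prod>h=0..j. coef_a lam mu i h)) / S_const lam mu i)"
    by (intro sum.cong refl) (simp add: mult_ac)
  also have "\<dots> = 1 / lam / S_const lam mu i"
    unfolding sum_divide_distrib[symmetric] coef_a_sum[OF assms] ..
  finally show ?thesis by (simp add: mult.commute)
qed

lemma sum_tail:
  fixes g :: "nat \<Rightarrow> real"
  shows "(\<Sum>l\<le>i. of_bool (Suc j \<le> l) * g l) = (\<Sum>l=Suc j..i. g l)"
  by (rule sum.mono_neutral_cong_right) auto

lemma sum_tail_diff:
  fixes g :: "nat \<Rightarrow> real"
  assumes "j \<le> i"
  shows "(\<Sum>l\<le>i. of_bool (Suc j \<le> l) * g l) = (\<Sum>l\<le>i. g l) - (\<Sum>l\<le>j. g l)"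
proof -
  have "{..i} = {..j} \<union> {Suc j..i}" using assms by auto
  then have "(\<Sum>l\<le>i. g l) = (\<Sum>l\<le>j. g l) + (\<Sum>l=Suc j..i. g l)"
    by (simp add: sum.union_disjoint ivl_disj_int)
  then show ?thesis unfolding sum_tail by simp
qed

text \<open>Solving for the components one after the other makes each of them a nonnegative multiple of the first, up to a
  vanishing error; as the sum vanishes, so does the first.\<close>

lemma first_component_tendsto_zero:
  fixes e :: "nat \<Rightarrow> real \<Rightarrow> real"
  assumes pos: "lam > 0" "mu > 0" and a: "\<And>j. 0 \<le> a j"
    and H: "\<And>j. j < i \<Longrightarrow> ((\<lambda>\<tau>. a j * e j \<tau> - mu * e (Suc j) \<tau> - lam * (\<Sum>l\<le>i. of_bool (Suc j \<le> l) * e l \<tau>)) \<longlongrightarrow> 0) F"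
    and Z: "((\<lambda>\<tau>. \<Sum>l\<le>i. e l \<tau>) \<longlongrightarrow> 0) F"
  shows "(e 0 \<longlongrightarrow> 0) F"
proof -
  have step: "\<exists>c. 0 \<le> c \<and> (j = 0 \<longrightarrow> c = 1) \<and> ((\<lambda>\<tau>. e j \<tau> - c * e 0 \<tau>) \<longlongrightarrow> 0) F" if "j \<le> i" for j
    using that
  proof (induction j rule: less_induct)
    case (less j)
    show ?case
    proof (cases j)
      case 0
      then show ?thesis by (intro exI[of _ 1]) simp
    next
      case (Suc m)
      have "\<forall>l\<in>{..m}. \<exists>c. 0 \<le> c \<and> ((\<lambda>\<tau>. e l \<tau> - c * e 0 \<tau>) \<longlongrightarrow> 0) F"
        using less.IH less.prems Suc by (metis atMost_iff le_imp_less_Suc less_imp_le order_trans)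
      from bchoice[OF this] obtain c where c: "\<And>l. l \<le> m \<Longrightarrow> 0 \<le> c l"
        "\<And>l. l \<le> m \<Longrightarrow> ((\<lambda>\<tau>. e l \<tau> - c l * e 0 \<tau>) \<longlongrightarrow> 0) F" by auto
      \<comment> \<open>The relation at \<open>m\<close> solved for \<open>e (Suc m)\<close>, with
        the tail sum replaced by minus the sum of the components up to \<open>m\<close>, since the
        total vanishes in the limit.\<close>
      define C where "C = (a m * c m + lam * (\<Sum>l\<le>m. c l)) / mu"
      have m: "m < i" using less.prems Suc by simp
      have "0 \<le> (\<Sum>l\<le>m. c l)" using c(1) by (intro sum_nonneg) auto
      then have "0 \<le> C" unfolding C_def using pos c(1)[of m] a[of m] by (intro divide_nonneg_nonneg add_nonneg_nonneg mult_nonneg_nonneg) auto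
      moreover have "((\<lambda>\<tau>. e (Suc m) \<tau> - C * e 0 \<tau>) \<longlongrightarrow> 0) F"
      proof -
        let ?h = "\<lambda>\<tau>. a m * e m \<tau> - mu * e (Suc m) \<tau> - lam * (\<Sum>l\<le>i. of_bool (Suc m \<le> l) * e l \<tau>)"
        have "((\<lambda>\<tau>. (1 / mu) * (a m * (e m \<tau> - c m * e 0 \<tau>) + lam * (\<Sum>l\<le>m. e l \<tau> - c l * e 0 \<tau>) - ?h \<tau> - lam * (\<Sum>l\<le>i. e l \<tau>)))
          \<longlongrightarrow> (1 / mu) * (a m * 0 + lam * (\<Sum>l\<le>m. 0) - 0 - lam * 0)) F"
          by (rule tendsto_mult[OF tendsto_const] tendsto_diff tendsto_add tendsto_sum c(2) H[OF m] Z order_refl | simp)+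
        moreover have "(1 / mu) * (a m * (e m \<tau> - c m * e 0 \<tau>) + lam * (\<Sum>l\<le>m. e l \<tau> - c l * e 0 \<tau>) - ?h \<tau> - lam * (\<Sum>l\<le>i. e l \<tau>))
          = e (Suc m) \<tau> - C * e 0 \<tau>" for \<tau>
        proof -
          have s: "(\<Sum>l\<le>m. e l \<tau> - c l * e 0 \<tau>) = (\<Sum>l\<le>m. e l \<tau>) - (\<Sum>l\<le>m. c l) * e 0 \<tau>"
            by (simp add: sum_subtractf sum_distrib_right)
          show ?thesis unfolding s sum_tail_diff[OF less_imp_le[OF m]] C_def using pos by (simp add: field_simps)
        qed
        ultimately show ?thesis by simp
      qed
      ultimately show ?thesis using Suc by blast
    qed
  qed
  then have "\<forall>l\<in>{..i}. \<exists>c. 0 \<le> c \<and> (l = 0 \<longrightarrow> c = 1) \<and> ((\<lambda>\<tau>. e l \<tau> - c * e 0 \<tau>) \<longlongrightarrow> 0) F" by blast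
  from bchoice[OF this] obtain c where c: "\<And>l. l \<le> i \<Longrightarrow> 0 \<le> c l" "c 0 = 1"
    "\<And>l. l \<le> i \<Longrightarrow> ((\<lambda>\<tau>. e l \<tau> - c l * e 0 \<tau>) \<longlongrightarrow> 0) F" by (metis atMost_iff bot_nat_0.extremum)
  have "c 0 \<le> (\<Sum>l\<le>i. c l)" using c(1) by (intro member_le_sum) auto
  then have cp: "0 < (\<Sum>l\<le>i. c l)" using c(2) by linarith
  have "((\<lambda>\<tau>. ((\<Sum>l\<le>i. e l \<tau>) - (\<Sum>l\<le>i. e l \<tau> - c l * e 0 \<tau>)) / (\<Sum>l\<le>i. c l)) \<longlongrightarrow> (0 - (\<Sum>l\<le>i. 0)) / (\<Sum>l\<le>i. c l)) F"
    by (intro tendsto_divide tendsto_diff tendsto_sum Z tendsto_const c(3)) (use cp in auto)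
  moreover have "((\<Sum>l\<le>i. e l \<tau>) - (\<Sum>l\<le>i. e l \<tau> - c l * e 0 \<tau>)) / (\<Sum>l\<le>i. c l) = e 0 \<tau>" for \<tau>
    using cp by (simp add: sum_subtractf sum_distrib_right[symmetric])
  ultimately show ?thesis by simp
qed

lemma S_const_pos: "lam > 0 \<Longrightarrow> mu > 0 \<Longrightarrow> 0 < S_const lam mu i"
  unfolding S_const_def by (intro sum_pos) auto

text \<open>The hypotheses are the cut equations of a birth-death chain. They make each
  \<open>p l\<close> asymptotically the multiple \<open>\<kappa> l\<close> of \<open>p 0\<close>,
  and \<open>S_const\<close> is the normalizing sum of these multiples.\<close>

lemma occupation_limit:
  fixes p :: "nat \<Rightarrow> real \<Rightarrow> real"
  assumes pos: "lam > 0" "mu > 0"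
    and H: "\<And>j. j < i \<Longrightarrow> ((\<lambda>\<tau>. lam * real (i - j) * p j \<tau> - mu * p (Suc j) \<tau>) \<longlongrightarrow> 0) F"
    and total: "((\<lambda>\<tau>. \<Sum>l\<le>i. p l \<tau>) \<longlongrightarrow> 1) F"
    and l: "l \<le> i"
  shows "(p l \<longlongrightarrow> lam ^ l * fact i / (mu ^ l * fact (i - l)) / S_const lam mu i) F"
proof -
  define \<kappa> where "\<kappa> l = lam ^ l * fact i / (mu ^ l * fact (i - l))" for l
  have d: "((\<lambda>\<tau>. p j \<tau> - \<kappa> j * p 0 \<tau>) \<longlongrightarrow> 0) F" if "j \<le> i" for j
    using that
  proof (induction j)
    case (Suc j)
    then have j: "j < i" by simp
    have f: "fact (i - j) = real (i - j) * fact (i - Suc j)" using j by (simp add: fact_reduce)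
    have k: "\<kappa> (Suc j) = lam * real (i - j) * \<kappa> j / mu"
      unfolding \<kappa>_def f using j pos by (simp add: field_simps)
    have "((\<lambda>\<tau>. (1 / mu) * (lam * real (i - j) * (p j \<tau> - \<kappa> j * p 0 \<tau>) - (lam * real (i - j) * p j \<tau> - mu * p (Suc j) \<tau>)))
      \<longlongrightarrow> (1 / mu) * (lam * real (i - j) * 0 - 0)) F"
      using Suc.IH j by (intro tendsto_mult[OF tendsto_const] tendsto_diff H) auto
    moreover have "(1 / mu) * (lam * real (i - j) * (p j \<tau> - \<kappa> j * p 0 \<tau>) - (lam * real (i - j) * p j \<tau> - mu * p (Suc j) \<tau>))
      = p (Suc j) \<tau> - \<kappa> (Suc j) * p 0 \<tau>" for \<tau>
      unfolding k using pos by (simp add: field_simps)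
    ultimately show ?case by simp
  qed (simp add: \<kappa>_def)
  have S: "(\<Sum>l\<le>i. \<kappa> l) = S_const lam mu i" by (simp add: S_const_def \<kappa>_def atMost_atLeast0)
  note Sp = S_const_pos[OF pos, of i]
  have "((\<lambda>\<tau>. ((\<Sum>l\<le>i. p l \<tau>) - (\<Sum>l\<le>i. p l \<tau> - \<kappa> l * p 0 \<tau>)) / S_const lam mu i) \<longlongrightarrow> (1 - (\<Sum>l\<le>i. 0)) / S_const lam mu i) F"
    by (intro tendsto_divide tendsto_diff tendsto_sum total tendsto_const d) (use Sp in auto)
  moreover have "((\<Sum>l\<le>i. p l \<tau>) - (\<Sum>l\<le>i. p l \<tau> - \<kappa> l * p 0 \<tau>)) / S_const lam mu i = p 0 \<tau>" for \<tau>
    using Sp by (simp add: sum_subtractf sum_distrib_right[symmetric] S)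
  ultimately have p0: "(p 0 \<longlongrightarrow> 1 / S_const lam mu i) F" by simp
  have "((\<lambda>\<tau>. (p l \<tau> - \<kappa> l * p 0 \<tau>) + \<kappa> l * p 0 \<tau>) \<longlongrightarrow> 0 + \<kappa> l * (1 / S_const lam mu i)) F"
    by (intro tendsto_add d l tendsto_mult tendsto_const p0)
  then show ?thesis by (simp add: \<kappa>_def)
qed

text \<open>\<open>p l\<close> stands for the proportion of time at level \<open>l\<close>, and
  \<open>U l\<close>, \<open>V l\<close> for the time averages of \<open>x\<close> and of the age
  restricted to that level. The combination \<open>lam * U l - p l\<close> measures the failure of
  \<open>x\<close> to have conditional mean \<open>1 / lam\<close> at the level; it must vanish at
  level 0, which ties \<open>V 0\<close> to \<open>p 0\<close>. The cut equations then produce the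
  recursion of \<open>v_bar\<close>.\<close>

lemma age_limit:
  fixes p U V :: "nat \<Rightarrow> real \<Rightarrow> real"
  assumes pos: "lam > 0" "mu > 0"
    and p: "\<And>j. j < i \<Longrightarrow> ((\<lambda>\<tau>. lam * real (i - j) * p j \<tau> - mu * p (Suc j) \<tau>) \<longlongrightarrow> 0) F"
      "((\<lambda>\<tau>. \<Sum>l\<le>i. p l \<tau>) \<longlongrightarrow> 1) F"
    and e: "\<And>j. j < i \<Longrightarrow> ((\<lambda>\<tau>. lam * real (i - j) * (lam * U j \<tau> - p j \<tau>) - mu * (lam * U (Suc j) \<tau> - p (Suc j) \<tau>)
        - lam * (\<Sum>l\<le>i. of_bool (Suc j \<le> l) * (lam * U l \<tau> - p l \<tau>))) \<longlongrightarrow> 0) F"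
      "((\<lambda>\<tau>. \<Sum>l\<le>i. lam * U l \<tau> - p l \<tau>) \<longlongrightarrow> 0) F"
    and V: "((\<lambda>\<tau>. mu * (V 0 \<tau> - U 0 \<tau>)) \<longlongrightarrow> 1) F"
      "\<And>j. j < i \<Longrightarrow> ((\<lambda>\<tau>. lam * real (i - j) * V j \<tau> - mu * V (Suc j) \<tau> + (\<Sum>l\<le>i. of_bool (Suc j \<le> l) * p l \<tau>)) \<longlongrightarrow> 0) F"
  shows "((\<lambda>\<tau>. \<Sum>l\<le>i. V l \<tau>) \<longlongrightarrow> avg_age_WQ lam mu i) F"
proof -
  let ?S = "S_const lam mu i"
  note pl = occupation_limit[OF pos p]
  have e0: "((\<lambda>\<tau>. lam * U 0 \<tau> - p 0 \<tau>) \<longlongrightarrow> 0) F"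
    by (rule first_component_tendsto_zero[OF pos, where a = "\<lambda>j. lam * real (i - j)" and e = "\<lambda>l \<tau>. lam * U l \<tau> - p l \<tau>" and i = i])
       (use pos e in auto)
  have "((\<lambda>\<tau>. mu * (V 0 \<tau> - U 0 \<tau>) / mu + ((lam * U 0 \<tau> - p 0 \<tau>) + p 0 \<tau>) / lam) \<longlongrightarrow> 1 / mu + (0 + lam ^ 0 * fact i / (mu ^ 0 * fact (i - 0)) / ?S) / lam) F"
    by (intro tendsto_add tendsto_divide V(1) e0 pl tendsto_const) (use pos in auto)
  moreover have "mu * (V 0 \<tau> - U 0 \<tau>) / mu + ((lam * U 0 \<tau> - p 0 \<tau>) + p 0 \<tau>) / lam = V 0 \<tau>" for \<tau> using pos by simp
  ultimately have V0: "(V 0 \<longlongrightarrow> v_bar lam mu i 0) F" unfolding v_bar_0[OF pos] by simp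
  have Vl: "(V l \<longlongrightarrow> v_bar lam mu i l) F" if "l \<le> i" for l
    using that
  proof (induction l)
    case 0
    show ?case by (rule V0)
  next
    case (Suc j)
    then have j: "j < i" by simp
    let ?\<pi> = "\<lambda>l. lam ^ l * fact i / (mu ^ l * fact (i - l)) / ?S"
    have "((\<lambda>\<tau>. (lam * real (i - j) * V j \<tau> + (\<Sum>l\<le>i. of_bool (Suc j \<le> l) * p l \<tau>)
        - (lam * real (i - j) * V j \<tau> - mu * V (Suc j) \<tau> + (\<Sum>l\<le>i. of_bool (Suc j \<le> l) * p l \<tau>))) / mu)
      \<longlongrightarrow> (lam * real (i - j) * v_bar lam mu i j + (\<Sum>l\<le>i. of_bool (Suc j \<le> l) * ?\<pi> l) - 0) / mu) F"
      by (intro tendsto_divide tendsto_diff tendsto_add tendsto_mult tendsto_sum V(2)[OF j] pl tendsto_const) (use pos j Suc.IH in auto)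
    moreover have "(lam * real (i - j) * v_bar lam mu i j + (\<Sum>l\<le>i. of_bool (Suc j \<le> l) * ?\<pi> l) - 0) / mu = v_bar lam mu i (Suc j)"
      unfolding sum_tail v_bar.simps diff_zero add_divide_distrib sum_divide_distrib
      by (intro arg_cong2[of _ _ _ _ "(+)"] sum.cong refl) (simp_all add: mult_ac)
    ultimately show ?case using pos by simp
  qed
  have "((\<lambda>\<tau>. \<Sum>l\<le>i. V l \<tau>) \<longlongrightarrow> (\<Sum>l\<le>i. v_bar lam mu i l)) F" by (intro tendsto_sum Vl) simp
  moreover have "(\<Sum>l\<le>i. v_bar lam mu i l) = avg_age_WQ lam mu i"
    unfolding avg_age_WQ_def atMost_atLeast0 by (subst sum.atLeast_Suc_atMost) simp_all
  ultimately show ?thesis by simp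
qed

section \<open>Time averages along a sample path\<close>

context path
begin

lemma delivered_by_iff:
  assumes A: "arrival_time A = T"
  shows "delivered_by A X i n t \<longleftrightarrow> completes i n \<and> ctime i n \<le> t"
proof
  assume "delivered_by A X i n t"
  then obtain t' where t': "t' \<le> t" "t' < T i (Suc n)" "X i n \<le> srv i n t'"
    unfolding delivered_by_def done_by_def A by blast
  have c: "completes i n"
  proof (rule ccontr)
    assume "\<not> completes i n"
    from srv_less_X[OF order_refl this less_imp_le[OF t'(2)]] t'(3) show False by linarith
  qed
  with t' ctime_iff[OF order_refl c, of t'] show "completes i n \<and> ctime i n \<le> t" by linarith
next
  assume a: "completes i n \<and> ctime i n \<le> t"
  then have c: "completes i n" ..
  show "delivered_by A X i n t"
    unfolding delivered_by_def done_by_def A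
    using a ctime_gt[OF order_refl c] ctime_less[OF order_refl c] srv_ctime[OF order_refl c]
    by (intro exI[of _ "ctime i n"]) linarith
qed

text \<open>By time \<open>t\<close> only finitely many packets have been delivered, so both suprema
  are attained at the last of them; without a delivery both stamps are 0. This links the measurable
  version to the model.\<close>

lemma latest_stamp_eq_stamp:
  assumes A: "arrival_time A = T"
  shows "latest_stamp A X i t = st t"
proof (cases "\<exists>n. completes i n \<and> ctime i n \<le> t")
  case False
  then have "{T i n |n. completes i n \<and> ctime i n \<le> t} = {}" by blast
  then show ?thesis
    unfolding latest_stamp_def delivered_by_iff[OF A] A st_alt Let_def
    using enn2real_SUP_none[of "\<lambda>n. completes i n \<and> ctime i n \<le> t" "T i"] False by (metis (mono_tags, lifting))
next
  case True
  let ?J = "{n. completes i n \<and> ctime i n \<le> t}"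
  obtain n0 where n0: "\<And>n. n0 \<le> n \<Longrightarrow> t < T i n" using eventually_T_gt[OF order_refl] by blast
  have "n < n0" if "n \<in> ?J" for n
    using that n0[of n] ctime_gt[OF order_refl, of n] by (cases "n < n0") auto
  then have fin: "finite ?J" by (intro finite_subset[of ?J "{..<n0}"]) auto
  define m where "m = Max ?J"
  have m: "m \<in> ?J" unfolding m_def using fin True by (intro Max_in) auto
  have le: "T i n \<le> T i m" if "n \<in> ?J" for n
    unfolding T_le_iff[OF order_refl] m_def using fin that by (rule Max_ge)
  have ne: "{T i n |n. completes i n \<and> ctime i n \<le> t} \<noteq> {}" using True by blast
  have "Sup {T i n |n. completes i n \<and> ctime i n \<le> t} = T i m"
    by (rule cSup_eq_maximum) (use m le in blast)+
  then have "latest_stamp A X i t = T i m"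
    unfolding latest_stamp_def delivered_by_iff[OF A] A Let_def if_not_P[OF ne] .
  moreover have "st t = T i m"
    unfolding st_alt by (rule enn2real_SUP_attained) (use m le T_pos[OF order_refl, of m] in \<open>auto intro: less_imp_le\<close>)
  ultimately show ?thesis by simp
qed

end

section \<open>Affine test functions and the balance equations for time averages\<close>

definition affine :: "real \<Rightarrow> real \<Rightarrow> real \<Rightarrow> (nat \<Rightarrow> real) \<Rightarrow> nat \<Rightarrow> real \<Rightarrow> real \<Rightarrow> real" where
  "affine a b c r q \<delta> x = (a + b * \<delta> + c * x) * r q"

abbreviation point :: "nat \<Rightarrow> nat \<Rightarrow> real" where "point l \<equiv> \<lambda>q. of_bool (q = l)"

lemma sum_point: "finite L \<Longrightarrow> q \<in> L \<Longrightarrow> (\<Sum>l\<in>L. r l * (y * point l q)) = r q * y"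
  for r :: "nat \<Rightarrow> real"
  by (simp add: of_bool_def if_distrib[of "\<lambda>z. _ * z"] sum.delta cong: if_cong)

lemma continuous_affine: "continuous_on UNIV (\<lambda>(\<delta>, x). affine a b c r q \<delta> x)"
  unfolding affine_def case_prod_beta' by (intro continuous_intros)

lemma smooth_pair_affine: "smooth_pair (affine a b c r) (affine (b + c) 0 0 r)"
  unfolding smooth_pair_def
proof (intro conjI allI continuous_affine)
  fix q \<delta> x
  show "((\<lambda>s. affine a b c r q (\<delta> + s) (x + s)) has_real_derivative affine (b + c) 0 0 r q \<delta> x) (at 0)"
    unfolding affine_def by (auto intro!: derivative_eq_intros)
qed

context queue
begin

definition average :: "(event \<Rightarrow> real) \<Rightarrow> (nat \<Rightarrow> real \<Rightarrow> real \<Rightarrow> real) \<Rightarrow> real \<Rightarrow> real" where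
  "average w F \<tau> = (LINT t:{0..\<tau>}|lborel. F (Qw w t) (dl w t) (xl w t)) / \<tau>"

lemma average_linear:
  assumes "good w" and F: "\<And>q. continuous_on UNIV (\<lambda>(\<delta>, x). F q \<delta> x)" and G: "\<And>q. continuous_on UNIV (\<lambda>(\<delta>, x). G q \<delta> x)"
  shows "average w (\<lambda>q \<delta> x. a * F q \<delta> x + b * G q \<delta> x) \<tau> = a * average w F \<tau> + b * average w G \<tau>"
proof -
  have f: "set_integrable lborel {0..\<tau>} (\<lambda>t. a * F (Qw w t) (dl w t) (xl w t))"
    by (rule set_integrable_mult_right) (rule set_integrable_obs[where F = F, OF F assms(1) order_refl])
  have g: "set_integrable lborel {0..\<tau>} (\<lambda>t. b * G (Qw w t) (dl w t) (xl w t))"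
    by (rule set_integrable_mult_right) (rule set_integrable_obs[where F = G, OF G assms(1) order_refl])
  show ?thesis
    unfolding average_def set_integral_add(2)[OF f g] set_integral_mult_right by (simp add: add_divide_distrib)
qed

lemma average_sum:
  assumes "good w" and F: "\<And>l q. continuous_on UNIV (\<lambda>(\<delta>, x). F l q \<delta> x)" and "finite L"
  shows "average w (\<lambda>q \<delta> x. \<Sum>l\<in>L. F l q \<delta> x) \<tau> = (\<Sum>l\<in>L. average w (F l) \<tau>)"
  using \<open>finite L\<close>
proof (induction L rule: finite_induct)
  case empty
  then show ?case by (simp add: average_def set_lebesgue_integral_def)
next
  case (insert l L)
  have "continuous_on UNIV (\<lambda>(\<delta>, x). \<Sum>l\<in>L. F l q \<delta> x)" for q
    using F[of _ q] unfolding case_prod_beta' by (intro continuous_on_sum)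
  from average_linear[where F = "F l" and G = "\<lambda>q \<delta> x. \<Sum>l\<in>L. F l q \<delta> x" and a = 1 and b = 1, OF assms(1) F this]
  show ?case using insert by simp
qed

lemma average_cong:
  assumes g: "good w" and FG: "\<And>q \<delta> x. q \<le> i \<Longrightarrow> 0 \<le> x \<Longrightarrow> x \<le> \<delta> \<Longrightarrow> F q \<delta> x = G q \<delta> x"
  shows "average w F \<tau> = average w G \<tau>"
proof -
  have "(LINT t:{0..\<tau>}|lborel. F (Qw w t) (dl w t) (xl w t)) = (LINT t:{0..\<tau>}|lborel. G (Qw w t) (dl w t) (xl w t))"
    by (rule set_lebesgue_integral_cong) (use obs_range[OF g] FG in auto)
  then show ?thesis by (simp add: average_def)
qed

lemma average_affine:
  assumes "good w"
  shows "average w (affine a b c r) \<tau> = a * average w (affine 1 0 0 r) \<tau> + b * average w (affine 0 1 0 r) \<tau> + c * average w (affine 0 0 1 r) \<tau>"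
proof -
  have ab: "average w (affine a b 0 r) \<tau> = a * average w (affine 1 0 0 r) \<tau> + b * average w (affine 0 1 0 r) \<tau>"
    unfolding average_linear[where F = "affine 1 0 0 r" and G = "affine 0 1 0 r", OF assms continuous_affine continuous_affine, symmetric]
    by (rule average_cong[OF assms]) (simp add: affine_def algebra_simps)
  have "average w (affine a b c r) \<tau> = 1 * average w (affine a b 0 r) \<tau> + c * average w (affine 0 0 1 r) \<tau>"
    unfolding average_linear[where F = "affine a b 0 r" and G = "affine 0 0 1 r", OF assms continuous_affine continuous_affine, symmetric]
    by (rule average_cong[OF assms]) (simp add: affine_def algebra_simps)
  then show ?thesis using ab by simp
qed

lemma average_affine_split:
  assumes "good w"
  shows "average w (affine a b c r) \<tau> = (\<Sum>l\<le>i. r l * average w (affine a b c (point l)) \<tau>)"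
proof -
  have "average w (affine a b c r) \<tau> = average w (\<lambda>q \<delta> x. \<Sum>l\<le>i. affine (r l * a) (r l * b) (r l * c) (point l) q \<delta> x) \<tau>"
  proof (rule average_cong[OF assms])
    fix q \<delta> x assume "q \<le> i"
    then have "(\<Sum>l\<le>i. r l * ((a + b * \<delta> + c * x) * point l q)) = r q * (a + b * \<delta> + c * x)"
      by (intro sum_point) auto
    then show "affine a b c r q \<delta> x = (\<Sum>l\<le>i. affine (r l * a) (r l * b) (r l * c) (point l) q \<delta> x)"
      by (simp add: affine_def algebra_simps)
  qed
  also have "\<dots> = (\<Sum>l\<le>i. average w (affine (r l * a) (r l * b) (r l * c) (point l)) \<tau>)"
    by (rule average_sum[OF assms continuous_affine]) simp
  also have "\<dots> = (\<Sum>l\<le>i. r l * average w (affine a b c (point l)) \<tau>)"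
    unfolding average_affine[OF assms, of "r _ * a"] average_affine[OF assms, of a] by (simp add: algebra_simps)
  finally show ?thesis .
qed

text \<open>The generator of the birth-death chain Q acting on a function of the level.\<close>

definition drift :: "(nat \<Rightarrow> real) \<Rightarrow> nat \<Rightarrow> real" where
  "drift r q = lam * (real (i - q) * (r (Suc q) - r q)) + mu * (if q = 0 then 0 else r (q - 1) - r q)"

text \<open>The three terms have separate origins: changes of the level; the unit growth of age and
  \<open>x\<close> together with the reset of \<open>x\<close> at rate \<open>lam\<close>; and the
  replacement of the age by \<open>x\<close> at level 0.\<close>

lemma average_generator_affine:
  assumes "good w"
  shows "average w (generator lam mu i (affine a b c r) (affine (b + c) 0 0 r)) \<tau> =
    (\<Sum>l\<le>i. drift r l * average w (affine a b c (point l)) \<tau>) + (\<Sum>l\<le>i. r l * average w (affine (b + c) 0 (- lam * c) (point l)) \<tau>)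
    + mu * b * r 0 * average w (affine 0 (-1) 1 (point 0)) \<tau>"
proof -
  let ?G = "\<lambda>q \<delta> x. 1 * affine a b c (drift r) q \<delta> x + 1 * affine (b + c) 0 (- lam * c) r q \<delta> x"
  have cont: "continuous_on UNIV (\<lambda>(\<delta>, x). ?G q \<delta> x)" for q
    using continuous_affine[of a b c "drift r" q] continuous_affine[of "b + c" 0 "- lam * c" r q]
    unfolding case_prod_beta' by (intro continuous_on_add continuous_on_mult continuous_on_const)
  have "average w (generator lam mu i (affine a b c r) (affine (b + c) 0 0 r)) \<tau> =
    average w (\<lambda>q \<delta> x. 1 * ?G q \<delta> x + (mu * b * r 0) * affine 0 (-1) 1 (point 0) q \<delta> x) \<tau>"
    by (rule average_cong[OF assms]) (simp add: generator_def affine_def drift_def algebra_simps)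
  also have "\<dots> = 1 * average w ?G \<tau> + (mu * b * r 0) * average w (affine 0 (-1) 1 (point 0)) \<tau>"
    by (rule average_linear[OF assms cont continuous_affine])
  also have "average w ?G \<tau> = 1 * average w (affine a b c (drift r)) \<tau> + 1 * average w (affine (b + c) 0 (- lam * c) r) \<tau>"
    by (rule average_linear[OF assms continuous_affine continuous_affine])
  finally show ?thesis
    unfolding average_affine_split[OF assms, of a b c "drift r"] average_affine_split[OF assms, of "b + c" 0 "- lam * c" r] by simp
qed

lemma affine_balance:
  assumes r: "\<And>q. \<bar>r q\<bar> \<le> 1"
  shows "AE w in P. ((\<lambda>\<tau>. (\<Sum>l\<le>i. drift r l * average w (affine a b c (point l)) \<tau>) + (\<Sum>l\<le>i. r l * average w (affine (b + c) 0 (- lam * c) (point l)) \<tau>)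
    + mu * b * r 0 * average w (affine 0 (-1) 1 (point 0)) \<tau>) \<longlongrightarrow> 0) at_top"
proof -
  define C where "C = \<bar>a\<bar> + \<bar>b\<bar> + \<bar>c\<bar>"
  have bound: "\<bar>y * r q\<bar> \<le> C * (1 + \<delta>)" if "\<bar>y\<bar> \<le> C * (1 + \<delta>)" for y q and \<delta> :: real
  proof -
    have "\<bar>y\<bar> * \<bar>r q\<bar> \<le> \<bar>y\<bar> * 1" by (rule mult_left_mono[OF r]) simp
    then show ?thesis unfolding abs_mult using that by linarith
  qed
  have "AE w in P. ((\<lambda>\<tau>. (LINT t:{0..\<tau>}|lborel. generator lam mu i (affine a b c r) (affine (b + c) 0 0 r) (Qw w t) (dl w t) (xl w t)) / \<tau>) \<longlongrightarrow> 0) at_top"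
  proof (rule generator_average[OF smooth_pair_affine, where C = C])
    show "0 \<le> C" by (simp add: C_def)
    fix q :: nat and \<delta> x :: real assume x: "0 \<le> x" "x \<le> \<delta>"
    have 1: "\<bar>a\<bar> \<le> \<bar>a\<bar> * (1 + \<delta>)" "\<bar>b\<bar> * \<delta> \<le> \<bar>b\<bar> * (1 + \<delta>)" "\<bar>c\<bar> * x \<le> \<bar>c\<bar> * (1 + \<delta>)" "\<bar>b\<bar> \<le> \<bar>b\<bar> * (1 + \<delta>)" "\<bar>c\<bar> \<le> \<bar>c\<bar> * (1 + \<delta>)" "0 \<le> \<bar>a\<bar> * (1 + \<delta>)"
      using x by (auto simp: mult_left_mono mult_le_cancel_left1)
    have 2: "\<bar>b * \<delta>\<bar> = \<bar>b\<bar> * \<delta>" "\<bar>c * x\<bar> = \<bar>c\<bar> * x" using x by (auto simp: abs_mult)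
    have D: "C * (1 + \<delta>) = \<bar>a\<bar> * (1 + \<delta>) + \<bar>b\<bar> * (1 + \<delta>) + \<bar>c\<bar> * (1 + \<delta>)" by (simp add: C_def distrib_right)
    have "\<bar>a + b * \<delta> + c * x\<bar> \<le> C * (1 + \<delta>)" "\<bar>b + c + 0 * \<delta> + 0 * x\<bar> \<le> C * (1 + \<delta>)"
      unfolding D using 1 2 by linarith+
    then show "\<bar>affine a b c r q \<delta> x\<bar> \<le> C * (1 + \<delta>) \<and> \<bar>affine (b + c) 0 0 r q \<delta> x\<bar> \<le> C * (1 + \<delta>)"
      unfolding affine_def by (intro conjI bound)
  qed
  from this AE_good show ?thesis
  proof eventually_elim
    case (elim w)
    show ?case using elim(1) unfolding average_generator_affine[OF elim(2), symmetric] by (simp add: average_def)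
  qed
qed

lemma drift_const: "drift (\<lambda>_. 1) q = 0"
  by (simp add: drift_def)

text \<open>The indicator of the levels above \<open>j\<close> changes only across the cut between
  \<open>j\<close> and \<open>Suc j\<close>, so just the two opposite flows through that cut
  survive.\<close>

lemma sum_drift_threshold:
  assumes "j < i"
  shows "(\<Sum>l\<le>i. drift (\<lambda>q. of_bool (Suc j \<le> q)) l * f l) = lam * real (i - j) * f j - mu * f (Suc j)"
proof -
  have d: "drift (\<lambda>q. of_bool (Suc j \<le> q)) l = lam * real (i - j) * point j l - mu * point (Suc j) l" for l
    by (cases "l = j"; cases "l = Suc j"; cases "l < j") (auto simp: drift_def of_bool_def)
  have "(\<Sum>l\<le>i. drift (\<lambda>q. of_bool (Suc j \<le> q)) l * f l) = (\<Sum>l\<le>i. (lam * real (i - j) * f l) * point j l) - (\<Sum>l\<le>i. (mu * f l) * point (Suc j) l)"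
    unfolding sum_subtractf[symmetric] d by (intro sum.cong refl) (simp add: left_diff_distrib mult_ac)
  also have "\<dots> = lam * real (i - j) * f j - mu * f (Suc j)"
    using assms by (simp add: of_bool_def if_distrib[of "\<lambda>z. _ * z"] sum.delta' cong: if_cong)
  finally show ?thesis .
qed

lemma average_age:
  "AE w in P. ((\<lambda>\<tau>. (LINT t:{0..\<tau>}|lborel. dl w t) / \<tau>) \<longlongrightarrow> avg_age_WQ lam mu i) at_top"
proof -
  let ?r = "\<lambda>j q. of_bool (Suc j \<le> q) :: real"
  have "AE w in P. \<forall>j. ((\<lambda>\<tau>. (\<Sum>l\<le>i. drift (?r j) l * average w (affine a b c (point l)) \<tau>) + (\<Sum>l\<le>i. ?r j l * average w (affine (b + c) 0 (- lam * c) (point l)) \<tau>)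
    + mu * b * ?r j 0 * average w (affine 0 (-1) 1 (point 0)) \<tau>) \<longlongrightarrow> 0) at_top" for a b c
    unfolding AE_all_countable by (intro allI affine_balance) simp
  note thr = this
  have one: "AE w in P. ((\<lambda>\<tau>. (\<Sum>l\<le>i. drift (\<lambda>_. 1) l * average w (affine a b c (point l)) \<tau>) + (\<Sum>l\<le>i. 1 * average w (affine (b + c) 0 (- lam * c) (point l)) \<tau>)
    + mu * b * 1 * average w (affine 0 (-1) 1 (point 0)) \<tau>) \<longlongrightarrow> 0) at_top" for a b c
    by (rule affine_balance) simp
  \<comment> \<open>The test functions: on the levels above \<open>j\<close>, the constant 1 yields
    the cut equations for \<open>p\<close>, \<open>lam * x - 1\<close> those for
    \<open>lam * U - p\<close>, and the age those for \<open>V\<close>. On all levels,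
    \<open>x\<close> shows that the total of \<open>lam * U - p\<close> vanishes, and the age shows
    that \<open>mu * (V 0 - U 0)\<close> tends to 1.\<close>
  from AE_good thr[of 1 0 0] thr[of "-1" 0 lam] thr[of 0 1 0] one[of 0 0 1] one[of 0 1 0]
  show ?thesis
  proof eventually_elim
    case (elim w)
    note g = elim(1)
    define p where "p l = average w (affine 1 0 0 (point l))" for l
    define U where "U l = average w (affine 0 0 1 (point l))" for l
    define V where "V l = average w (affine 0 1 0 (point l))" for l
    have ex: "average w (affine a b c (point l)) \<tau> = a * p l \<tau> + b * V l \<tau> + c * U l \<tau>" for a b c l \<tau>
      unfolding p_def U_def V_def by (rule average_affine[OF g])
    have total: "((\<lambda>\<tau>. \<Sum>l\<le>i. p l \<tau>) \<longlongrightarrow> 1) at_top"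
    proof (rule tendsto_eventually)
      show "\<forall>\<^sub>F \<tau> in at_top. (\<Sum>l\<le>i. p l \<tau>) = 1"
        using eventually_gt_at_top[of 0]
      proof eventually_elim
        fix \<tau> :: real assume \<tau>: "0 < \<tau>"
        have "average w (affine 1 0 0 (\<lambda>_. 1)) \<tau> = 1"
          unfolding average_def affine_def using \<tau> by (simp add: set_integral_const)
        then show "(\<Sum>l\<le>i. p l \<tau>) = 1" unfolding average_affine_split[OF g, of 1 0 0 "\<lambda>_. 1"] p_def by simp
      qed
    qed
    have "((\<lambda>\<tau>. \<Sum>l\<le>i. V l \<tau>) \<longlongrightarrow> avg_age_WQ lam mu i) at_top"
    proof (rule age_limit[OF lam_pos mu_pos _ total])
      fix j assume j: "j < i"
      show "((\<lambda>\<tau>. lam * real (i - j) * p j \<tau> - mu * p (Suc j) \<tau>) \<longlongrightarrow> 0) at_top"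
        using elim(2)[rule_format, of j] unfolding sum_drift_threshold[OF j] ex by simp
      have "lam * (\<Sum>l\<le>i. of_bool (Suc j \<le> l) * (lam * U l \<tau> - p l \<tau>)) = - (\<Sum>l\<le>i. ?r j l * ((0 + lam) * p l \<tau> + 0 * V l \<tau> + - lam * lam * U l \<tau>))" for \<tau>
        unfolding sum_distrib_left sum_negf[symmetric] by (intro sum.cong refl) (simp add: algebra_simps)
      then show "((\<lambda>\<tau>. lam * real (i - j) * (lam * U j \<tau> - p j \<tau>) - mu * (lam * U (Suc j) \<tau> - p (Suc j) \<tau>)
        - lam * (\<Sum>l\<le>i. of_bool (Suc j \<le> l) * (lam * U l \<tau> - p l \<tau>))) \<longlongrightarrow> 0) at_top"
        using elim(3)[rule_format, of j] unfolding sum_drift_threshold[OF j] ex by simp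
      show "((\<lambda>\<tau>. lam * real (i - j) * V j \<tau> - mu * V (Suc j) \<tau> + (\<Sum>l\<le>i. of_bool (Suc j \<le> l) * p l \<tau>)) \<longlongrightarrow> 0) at_top"
        using elim(4)[rule_format, of j] unfolding sum_drift_threshold[OF j] ex by simp
    next
      have "((\<lambda>\<tau>. \<Sum>l\<le>i. p l \<tau> - lam * U l \<tau>) \<longlongrightarrow> 0) at_top"
        using elim(5) unfolding drift_const ex by simp
      from tendsto_minus[OF this] show "((\<lambda>\<tau>. \<Sum>l\<le>i. lam * U l \<tau> - p l \<tau>) \<longlongrightarrow> 0) at_top"
        unfolding sum_negf[symmetric] by simp
      have "((\<lambda>\<tau>. (\<Sum>l\<le>i. p l \<tau>) + mu * (U 0 \<tau> - V 0 \<tau>)) \<longlongrightarrow> 0) at_top"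
        using elim(6) unfolding drift_const ex by simp
      from tendsto_diff[OF total this] show "((\<lambda>\<tau>. mu * (V 0 \<tau> - U 0 \<tau>)) \<longlongrightarrow> 1) at_top"
        by (simp add: algebra_simps)
    qed
    moreover have "(\<Sum>l\<le>i. V l \<tau>) = (LINT t:{0..\<tau>}|lborel. dl w t) / \<tau>" for \<tau>
      using average_affine_split[OF g, of 0 1 0 "\<lambda>_. 1" \<tau>] by (simp add: V_def average_def affine_def)
    ultimately show ?case by simp
  qed
qed

lemma average_latest_age:
  "AE w in P. ((\<lambda>\<tau>. (LINT t:{0..\<tau>}|lborel. age (\<lambda>k n. w (Inl (k, n))) (\<lambda>k n. w (Inr (k, n))) i t) / \<tau>) \<longlongrightarrow> avg_age_WQ lam mu i) at_top"
  using AE_good average_age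
proof eventually_elim
  case (elim w)
  have "age (\<lambda>k n. w (Inl (k, n))) (\<lambda>k n. w (Inr (k, n))) i t = dl w t" for t
    using path.latest_stamp_eq_stamp[OF good_path[OF elim(1)], of "\<lambda>k n. w (Inl (k, n))" t]
    by (simp add: age_def dl_def T_def X_def)
  then show ?case using elim(2) by simp
qed

end

section \<open>Transfer to the given probability space\<close>

lemma higher_busy_cong:
  assumes "\<And>l n. l < k \<Longrightarrow> T l n = T' l n" "\<And>l n. l < k \<Longrightarrow> X l n = X' l n"
  shows "higher_busy T X k = higher_busy T' X' k"
  using assms
proof (induction k)
  case (Suc k)
  then have "higher_busy T X k = higher_busy T' X' k" by simp
  then show ?case using Suc.prems by (auto simp: holds_packet_def done_by_def served_def fun_eq_iff)
qed simp

text \<open>The age of stream \<open>i\<close> reads only the variables of streams up to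
  \<open>i\<close>; this hides the coordinates that are added artificially.\<close>

lemma age_cong:
  assumes A: "\<And>k n. k \<le> i \<Longrightarrow> A k n = A' k n" and X: "\<And>k n. k \<le> i \<Longrightarrow> X k n = X' k n"
  shows "age A X i t = age A' X' i t"
proof -
  have T: "arrival_time A k n = arrival_time A' k n" if "k \<le> i" for k n using A[OF that] by (simp add: arrival_time_def)
  have "higher_busy (arrival_time A) X i = higher_busy (arrival_time A') X' i"
    by (rule higher_busy_cong) (simp_all add: T X)
  then have "delivered_by A X i n t = delivered_by A' X' i n t" for n
    by (simp add: delivered_by_def done_by_def served_def T X)
  then show ?thesis by (simp add: age_def latest_stamp_def T)
qed

text \<open>Cylinder probabilities split into the coordinates in \<open>I\<close>, independent under
  \<open>M\<close> with the right exponential laws, and the others, taken from an independent copy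
  of \<open>P\<close>. The product is the cylinder probability under \<open>P\<close>.\<close>

lemma (in exponential_family) distr_completion:
  assumes M: "prob_space M" and I: "\<And>c. c \<in> I \<Longrightarrow> distributed M lborel (Y c) (exponential_density (rate c))"
    and indep: "prob_space.indep_vars M (\<lambda>_. borel) Y I"
  shows "distr (M \<Otimes>\<^sub>M P) P (\<lambda>(x, w) c. if c \<in> I then Y c x else w c) = P" (is "distr _ _ ?\<Phi> = _")
    and "(\<lambda>(x, w) c. if c \<in> I then Y c x else w c) \<in> measurable (M \<Otimes>\<^sub>M P) P"
proof -
  interpret M: prob_space M by (rule M)
  have Ym: "Y c \<in> borel_measurable M" if "c \<in> I" for c
    using distributed_measurable[OF I[OF that]] by simp
  show m: "?\<Phi> \<in> measurable (M \<Otimes>\<^sub>M P) P"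
  proof (rule measurable_into_P)
    fix c
    show "(\<lambda>x. ?\<Phi> x c) \<in> borel_measurable (M \<Otimes>\<^sub>M P)"
    proof (cases "c \<in> I")
      case True
      then show ?thesis using measurable_compose[OF measurable_fst Ym[OF True]] by (simp add: case_prod_beta')
    next
      case False
      then show ?thesis using measurable_compose[OF measurable_snd measurable_coordinate[of c]] by (simp add: case_prod_beta')
    qed
  qed
  show "distr (M \<Otimes>\<^sub>M P) P ?\<Phi> = P"
  proof (rule P_eqI)
    show "sets (distr (M \<Otimes>\<^sub>M P) P ?\<Phi>) = sets P" by simp
    fix J and E :: "'c \<Rightarrow> real set" assume J: "finite J" and E: "\<And>j. j \<in> J \<Longrightarrow> E j \<in> sets borel"
    let ?A = "{x \<in> space M. \<forall>j\<in>J \<inter> I. Y j x \<in> E j}" and ?B = "{w. \<forall>j\<in>J - I. w j \<in> E j}"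
    have law: "emeasure M (Y j -` E j \<inter> space M) = emeasure (expm (rate j)) (E j)" if "j \<in> J \<inter> I" for j
    proof -
      have "emeasure (distr M lborel (Y j)) (E j) = emeasure (expm (rate j)) (E j)"
        using distributed_distr_eq_density[OF I[of j]] that by (simp add: comp_def)
      then show ?thesis using that Ym[of j] E[of j] by (simp add: emeasure_distr)
    qed
    have A: "emeasure M ?A = (\<Prod>j\<in>J \<inter> I. emeasure (expm (rate j)) (E j))"
    proof (cases "J \<inter> I = {}")
      case True
      then have "?A = space M" by blast
      then show ?thesis unfolding True using M.emeasure_space_1 by simp
    next
      case False
      have Aeq: "?A = (\<Inter>j\<in>J \<inter> I. Y j -` E j \<inter> space M)" using False by blast
      have "M.prob ?A = (\<Prod>j\<in>J \<inter> I. M.prob (Y j -` E j \<inter> space M))"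
        unfolding Aeq by (rule M.indep_varsD[OF indep False]) (use J E in auto)
      then have "emeasure M ?A = ennreal (\<Prod>j\<in>J \<inter> I. M.prob (Y j -` E j \<inter> space M))"
        by (simp only: M.emeasure_eq_measure)
      also have "\<dots> = (\<Prod>j\<in>J \<inter> I. ennreal (M.prob (Y j -` E j \<inter> space M)))" by (rule prod_ennreal[symmetric]) simp
      also have "\<dots> = (\<Prod>j\<in>J \<inter> I. emeasure (expm (rate j)) (E j))"
        by (intro prod.cong refl) (simp only: M.emeasure_eq_measure[symmetric] law)
      finally show ?thesis .
    qed
    have Am: "?A \<in> sets M"
    proof -
      have "?A = space M \<inter> (\<Inter>j\<in>J \<inter> I. Y j -` E j \<inter> space M) \<or> ?A = space M" by blast
      moreover have "(\<Inter>j\<in>J \<inter> I. Y j -` E j \<inter> space M) \<in> sets M" if "J \<inter> I \<noteq> {}"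
        using J that E Ym by (intro sets.finite_INT) auto
      moreover have "?A = (\<Inter>j\<in>J \<inter> I. Y j -` E j \<inter> space M)" if "J \<inter> I \<noteq> {}" using that by blast
      moreover have "?A = space M" if "J \<inter> I = {}" using that by blast
      ultimately show ?thesis by (cases "J \<inter> I = {}") simp_all
    qed
    have Bm: "?B \<in> sets P" using J E by (intro sets_P_cylinder) auto
    have B: "emeasure P ?B = (\<Prod>j\<in>J - I. emeasure (expm (rate j)) (E j))" using J E by (intro emeasure_P_cylinder) auto
    have "emeasure (distr (M \<Otimes>\<^sub>M P) P ?\<Phi>) {w. \<forall>j\<in>J. w j \<in> E j} = emeasure (M \<Otimes>\<^sub>M P) (?\<Phi> -` {w. \<forall>j\<in>J. w j \<in> E j} \<inter> space (M \<Otimes>\<^sub>M P))"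
      by (rule emeasure_distr[OF m sets_P_cylinder[OF J E]])
    also have "?\<Phi> -` {w. \<forall>j\<in>J. w j \<in> E j} \<inter> space (M \<Otimes>\<^sub>M P) = ?A \<times> ?B"
      by (auto simp: space_pair_measure split: if_splits)
    also have "emeasure (M \<Otimes>\<^sub>M P) (?A \<times> ?B) = emeasure M ?A * emeasure P ?B"
      by (rule P.emeasure_pair_measure_Times[OF Am Bm])
    also have "\<dots> = (\<Prod>j\<in>J. emeasure (expm (rate j)) (E j))"
      unfolding A B by (rule prod.Int_Diff[OF J, symmetric])
    finally show "emeasure (distr (M \<Otimes>\<^sub>M P) P ?\<Phi>) {w. \<forall>j\<in>J. w j \<in> E j} = (\<Prod>j\<in>J. emeasure (expm (rate j)) (E j))" .
  qed
qed

text \<open>The given variables are completed by independent ones to a family with law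
  \<open>P\<close>, for which the limit is known. Since \<open>i < N\<close>, the age never reads
  the added variables.\<close>

theorem theorem2:
  fixes M :: "'w measure" and N i :: nat and lam mu :: real
    and A X :: "nat \<Rightarrow> nat \<Rightarrow> 'w \<Rightarrow> real"
  assumes "prob_space M"
    and "N \<ge> 1" and "i < N" and "lam > 0" and "mu > 0"
    and "\<And>k n. k < N \<Longrightarrow> distributed M lborel (A k n) (exponential_density lam)"
    and "\<And>k n. k < N \<Longrightarrow> distributed M lborel (X k n) (exponential_density mu)"
    and "prob_space.indep_vars M (\<lambda>_. borel)
           (\<lambda>x. case x of Inl (k, n) \<Rightarrow> A k n | Inr (k, n) \<Rightarrow> X k n)
           (({..<N} \<times> UNIV) <+> ({..<N} \<times> UNIV))"
  shows "AE w in M.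
           ((\<lambda>\<tau>::real. (1 / \<tau>) * (LINT t:{0..\<tau>}|lborel. age (\<lambda>k n. A k n w) (\<lambda>k n. X k n w) i t))
              \<longlongrightarrow> avg_age_WQ lam mu i) at_top"
proof -
  interpret M: prob_space M by (rule assms(1))
  interpret queue lam mu i by unfold_locales fact+
  interpret M_P: pair_sigma_finite M P ..
  define I :: "event set" where "I = ({..<N} \<times> UNIV) <+> ({..<N} \<times> UNIV)"
  define Y where "Y = (\<lambda>x. case x of Inl (k, n) \<Rightarrow> A k n | Inr (k, n) \<Rightarrow> X k n)"
  have dist: "distributed M lborel (Y c) (exponential_density (clock_rate lam mu c))" if "c \<in> I" for c
    using that assms(6,7) by (auto simp: I_def Y_def clock_rate_def)
  have indep: "prob_space.indep_vars M (\<lambda>_. borel) Y I" unfolding I_def Y_def by (rule assms(8))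
  let ?\<Phi> = "\<lambda>(x, w) c. if c \<in> I then Y c x else w c"
  define lim where "lim w \<longleftrightarrow> ((\<lambda>\<tau>. (LINT t:{0..\<tau>}|lborel. age (\<lambda>k n. w (Inl (k, n))) (\<lambda>k n. w (Inr (k, n))) i t) / \<tau>) \<longlongrightarrow> avg_age_WQ lam mu i) at_top"
    for w :: "event \<Rightarrow> real"
  have "AE w in P. lim w" unfolding lim_def by (rule average_latest_age)
  then have "AE w in distr (M \<Otimes>\<^sub>M P) P ?\<Phi>. lim w"
    using distr_completion(1)[OF assms(1) dist indep] by (simp only:)
  from AE_distrD[OF distr_completion(2)[OF assms(1) dist indep] this]
  have "AE x in M \<Otimes>\<^sub>M P. lim (?\<Phi> x)" .
  \<comment> \<open>For almost every outcome of \<open>M\<close> the limit holds for almost every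
    completion. As it does not depend on the completion and \<open>P\<close> has mass one, it holds
    for the outcome itself.\<close>
  from M_P.AE_pair[OF this] have "AE x in M. AE w in P. lim (?\<Phi> (x, w))" .
  then show ?thesis
  proof eventually_elim
    fix x assume "AE w in P. lim (?\<Phi> (x, w))"
    moreover have "lim (?\<Phi> (x, w)) \<longleftrightarrow> ((\<lambda>\<tau>. (1 / \<tau>) * (LINT t:{0..\<tau>}|lborel. age (\<lambda>k n. A k n x) (\<lambda>k n. X k n x) i t)) \<longlongrightarrow> avg_age_WQ lam mu i) at_top" for w
    proof -
      have "age (\<lambda>k n. ?\<Phi> (x, w) (Inl (k, n))) (\<lambda>k n. ?\<Phi> (x, w) (Inr (k, n))) i t = age (\<lambda>k n. A k n x) (\<lambda>k n. X k n x) i t" for t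
        by (rule age_cong) (use assms(3) in \<open>auto simp: I_def Y_def\<close>)
      then show ?thesis by (simp add: lim_def)
    qed
    ultimately show "((\<lambda>\<tau>. (1 / \<tau>) * (LINT t:{0..\<tau>}|lborel. age (\<lambda>k n. A k n x) (\<lambda>k n. X k n x) i t)) \<longlongrightarrow> avg_age_WQ lam mu i) at_top"
      by (simp add: P.AE_const)
  qed
qed

end
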